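(* Let $r\ge 2$ and let $\mathbb{R}^N$ (with $N\geq 1$ and a positive definite inner product) be a real representation of the even Clifford algebra $Cl_r^0$ without trivial summands, on which each $e_ie_j$, $1\le i<j\le r$, acts by a skew-symmetric endomorphism. Write $\mathbb{R}^N=\mathbb{R}^m\otimes\tilde\Delta_r$ if $r\not\equiv 0 \pmod 4$, and $\mathbb{R}^N=\mathbb{R}^{m_1}\otimes\tilde\Delta_r^+\oplus\mathbb{R}^{m_2}\otimes\tilde\Delta_r^-$ if $r\equiv 0\pmod 4$. Let $\mathfrak{c}\subset\mathfrak{so}(N)$ be the centralizer of the image of $\mathfrak{spin}(r)$ in $\mathfrak{so}(N)$. Then, as a complex representation of $\mathfrak{c}\oplus\mathfrak{spin}(r)$, the complexification $\mathbb{R}^N\otimes_{\mathbb{R}}\mathbb{C}$ decomposes as follows: - $r\equiv 0\pmod 8$: $\ \mathbb{C}^{m_1}\otimes\Delta_r^+\oplus\mathbb{C}^{m_2}\otimes\Delta_r^-$; - $r\equiv 1,7\pmod 8$: $\ \mathbb{C}^{m}\otimes\Delta_r$; - $r\equiv 2\pmod 8$: $\ \mathbb{C}^{m}\otimes\Delta_r^+\oplus\overline{\mathbb{C}^{m}}\otimes\Delta_r^-$; - $r\equiv 6\pmod 8$: $\ \overline{\mathbb{C}^{m}}\otimes\Delta_r^+\oplus\mathbb{C}^{m}\otimes\Delta_r^-$; - $r\equiv 3,5\pmod 8$: $\ \mathbb{C}^{2m}\otimes\Delta_r$; - $r\equiv 4\pmod 8$: $\ \mathbb{C}^{2m_2}\otimes\Delta_r^+\oplus\mathbb{C}^{2m_1}\otimes\Delta_r^-$.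 Here $\mathbb{C}^s$ denotes the standard complex representation of the corresponding classical Lie algebra $\mathfrak{so}(s)$ (for $r\equiv 0,1,7$), $\mathfrak{u}(s)$ (for $r\equiv 2,6$) or $\mathfrak{sp}(s/2)$ (for $r\equiv 3,4,5$), which is $\mathfrak{c}$ or the corresponding summand of $\mathfrak{c}$, and $\overline{\mathbb{C}^s}$ denotes its conjugate.
   Context: Clifford algebras. $Cl_r$ is the real Clifford algebra generated by an orthonormal basis $e_1,\dots,e_r$ of $\mathbb{R}^r$ with $e_ie_j+e_je_i=-2\delta_{ij}$; $Cl_r^0$ is its even subalgebra; $\mathfrak{spin}(r)=\mathrm{span}\{e_ie_j: i<j\}\subset Cl_r^0$; $\mathrm{vol}_r=e_1\cdots e_r$. Complex spinors. $\Delta_r=\mathbb{C}^{2^{\lfloor r/2\rfloor}}$ is the complex spin representation (for $r$ even, the irreducible module of $Cl_r\otimes\mathbb{C}$; for $r$ odd, the irreducible complex module of $Cl_r^0$). For $r$ even, $\Delta_r^{\pm}$ is the $\pm1$-eigenspace of $(-i)^{r/2}\,\mathrm{vol}_r$ on $\Delta_r$. Real irreducible representations of $Cl_r^0$. For $r\not\equiv 0\pmod 4$, $\tilde\Delta_r$ is the unique irreducible real representation of $Cl_r^0$. For $r\equiv 0\pmod 4$ there are two, $\tilde\Delta_r^+$ and $\tilde\Delta_r^-$, on which $\mathrm{vol}_r$ acts as $+\mathrm{Id}$ and $-\mathrm{Id}$ respectively. A representation without trivial summands is one in which $(e_ie_j)^2$ acts as $-\mathrm{Id}$ for all $i<j$.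 It is isomorphic to $\mathbb{R}^m\otimes\tilde\Delta_r$ (if $r\not\equiv0$ mod 4) or $\mathbb{R}^{m_1}\otimes\tilde\Delta_r^+\oplus\mathbb{R}^{m_2}\otimes\tilde\Delta_r^-$ (if $r\equiv 0$ mod 4; $m_1,m_2\ge0$, not both zero), with $Cl_r^0$ acting on the second tensor factors. Centralizers (known facts). The centralizer $\mathfrak{c}$ of the image of $\mathfrak{spin}(r)$ in $\mathfrak{so}(N)$ is: - $r\equiv 1,7\pmod 8$: $\mathfrak{so}(m)\otimes\mathrm{Id}_{\tilde\Delta_r}\cong\mathfrak{so}(m)$. - $r\equiv 0\pmod 8$: $\mathfrak{so}(m_1)\otimes\mathrm{Id}_{\tilde\Delta_r^+}\oplus\mathfrak{so}(m_2)\otimes\mathrm{Id}_{\tilde\Delta_r^-}\cong\mathfrak{so}(m_1)\oplus\mathfrak{so}(m_2)$. - $r\equiv 2,6\pmod 8$: $\mathfrak{so}(m)\otimes\mathrm{Id}_{\tilde\Delta_r}\oplus S^2\mathbb{R}^m\otimes J\cong\mathfrak{u}(m)$, where $J$ is the complex structure on $\tilde\Delta_r$ given by the action of $\mathrm{vol}_r$, $S^2\mathbb{R}^m$ is the space of symmetric endomorphisms of $\mathbb{R}^m$, and the identification with $\mathfrak{u}(m)$ is $A\otimes\mathrm{Id}+B\otimes J\mapsto A+iB$. - $r\equiv 3,5\pmod 8$: $\mathfrak{so}(m)\otimes\mathrm{Id}_{\tilde\Delta_r}\oplus S^2\mathbb{R}^m\otimes\mathrm{span}(I,J,K)\cong\mathfrak{sp}(m)$,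 where $I,J,K$ are complex structures on $\tilde\Delta_r$ that commute with $\mathfrak{spin}(r)$ and satisfy the quaternion relations. - $r\equiv 4\pmod 8$: the analogous $\mathfrak{sp}(m_1)\oplus\mathfrak{sp}(m_2)$, with $\mathfrak{sp}(m_1)$ acting on $\mathbb{R}^{m_1}\otimes\tilde\Delta_r^+$ and $\mathfrak{sp}(m_2)$ on $\mathbb{R}^{m_2}\otimes\tilde\Delta_r^-$. Here $\mathfrak{sp}(m)$ is the compact symplectic Lie algebra of $Sp(m)$, whose standard complex representation is $\mathbb{C}^{2m}$. *)

theory Defs
  imports
    "HOL-Analysis.Analysis"
    "HOL-Library.Function_Algebras"
    "Jordan_Normal_Form.Matrix"
begin

section \<open>Real Clifford algebras\<close>

text \<open>
  The Clifford algebra on countably many generators \<open>e\<^sub>0, e\<^sub>1, \<dots>\<close>: real combinations of the ordered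
  monomials \<open>e\<^sub>S\<close> (\<open>S\<close> a finite set of indices).  Multiplication is given by
  \<open>e\<^sub>S e\<^sub>T = (-1)^k e\<^bsub>S \<triangle> T\<^esub>\<close>, where \<open>k\<close> counts the pairs \<open>i \<in> S\<close>, \<open>j \<in> T\<close> with \<open>j < i\<close>
  (transpositions) or \<open>j = i\<close> (each cancellation contributes \<open>e\<^sub>i\<^sup>2 = -1\<close>).  \<open>Cl\<^sub>r\<close> is the subalgebra
  generated by \<open>e\<^sub>1, \<dots>, e\<^sub>r\<close>; see \<open>Cl_eq\<close> for its monomial basis.
\<close>

typedef clifford = "{f :: nat set \<Rightarrow> real. finite {S. f S \<noteq> 0} \<and> (\<forall>S. f S \<noteq> 0 \<longrightarrow> finite S)}"
  morphisms cl_coeff Abs_clifford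
  by (rule exI[of _ "\<lambda>_. 0"]) auto

setup_lifting type_definition_clifford

definition cl_sign :: "nat set \<Rightarrow> nat set \<Rightarrow> real" where
  "cl_sign S T = (-1) ^ card {(i, j). i \<in> S \<and> j \<in> T \<and> j \<le> i}"

lemma minus_one_card_sym_diff:
  assumes "finite A" "finite B"
  shows "(-1::real) ^ card (sym_diff A B) = (-1) ^ card A * (-1) ^ card B"
proof -
  have A: "card A = card (A - B) + card (A \<inter> B)"
    using assms card_Int_Diff[of A B] by (simp add: Int_commute)
  have B: "card B = card (B - A) + card (A \<inter> B)"
    using assms card_Int_Diff[of B A] by (simp add: Int_commute)
  have C: "card (sym_diff A B) = card (A - B) + card (B - A)"
    using assms by (intro card_Un_disjoint) auto
  show ?thesis unfolding A B C by (simp add: power_add flip: power_mult_distrib)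
qed

lemma finite_sign_pairs:
  assumes "finite S" "finite T"
  shows "finite {(i, j). i \<in> S \<and> j \<in> T \<and> (j::nat) \<le> i}"
  by (rule finite_subset[of _ "S \<times> T"]) (use assms in auto)

lemma cl_sign_sym_diff_left:
  assumes "finite S" "finite T" "finite U"
  shows "cl_sign (sym_diff S T) U = cl_sign S U * cl_sign T U"
proof -
  have eq: "{(i, j). i \<in> sym_diff S T \<and> j \<in> U \<and> j \<le> i} =
      sym_diff {(i, j). i \<in> S \<and> j \<in> U \<and> j \<le> i} {(i, j). i \<in> T \<and> j \<in> U \<and> j \<le> i}"
    by auto
  show ?thesis
    unfolding cl_sign_def eq
    by (rule minus_one_card_sym_diff) (intro finite_sign_pairs assms)+
qed

lemma cl_sign_sym_diff_right:
  assumes "finite S" "finite T" "finite U"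
  shows "cl_sign S (sym_diff T U) = cl_sign S T * cl_sign S U"
proof -
  have eq: "{(i, j). i \<in> S \<and> j \<in> sym_diff T U \<and> j \<le> i} =
      sym_diff {(i, j). i \<in> S \<and> j \<in> T \<and> j \<le> i} {(i, j). i \<in> S \<and> j \<in> U \<and> j \<le> i}"
    by auto
  show ?thesis
    unfolding cl_sign_def eq
    by (rule minus_one_card_sym_diff) (intro finite_sign_pairs assms)+
qed

lemma cl_sign_empty [simp]: "cl_sign {} S = 1" "cl_sign S {} = 1"
  by (simp_all add: cl_sign_def)

instantiation clifford :: real_vector
begin

lift_definition zero_clifford :: clifford is "\<lambda>_. 0" by simp

lift_definition plus_clifford :: "clifford \<Rightarrow> clifford \<Rightarrow> clifford" is "\<lambda>f g S. f S + g S"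
proof -
  fix f g :: "nat set \<Rightarrow> real"
  assume a: "finite {S. f S \<noteq> 0} \<and> (\<forall>S. f S \<noteq> 0 \<longrightarrow> finite S)" "finite {S. g S \<noteq> 0} \<and> (\<forall>S. g S \<noteq> 0 \<longrightarrow> finite S)"
  have "{S. f S + g S \<noteq> 0} \<subseteq> {S. f S \<noteq> 0} \<union> {S. g S \<noteq> 0}" by auto
  hence "finite {S. f S + g S \<noteq> 0}" by (rule finite_subset) (use a in simp)
  moreover have "finite S" if "f S + g S \<noteq> 0" for S
    using that a by (cases "f S = 0") auto
  ultimately show "finite {S. f S + g S \<noteq> 0} \<and> (\<forall>S. f S + g S \<noteq> 0 \<longrightarrow> finite S)" by blast
qed

lift_definition uminus_clifford :: "clifford \<Rightarrow> clifford" is "\<lambda>f S. - f S" by simp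

lift_definition scaleR_clifford :: "real \<Rightarrow> clifford \<Rightarrow> clifford" is "\<lambda>c f S. c * f S"
  by (auto elim: rev_finite_subset)

definition minus_clifford :: "clifford \<Rightarrow> clifford \<Rightarrow> clifford" where
  "minus_clifford a b = a + - b"

instance
proof
  fix a b c :: clifford and x y :: real
  show "a + b + c = a + (b + c)" by transfer (simp add: add.assoc)
  show "a + b = b + a" by transfer (simp add: add.commute)
  show "0 + a = a" by transfer simp
  show "- a + a = 0" by transfer simp
  show "a - b = a + - b" by (rule minus_clifford_def)
  show "x *\<^sub>R (a + b) = x *\<^sub>R a + x *\<^sub>R b" by transfer (simp add: distrib_left)
  show "(x + y) *\<^sub>R a = x *\<^sub>R a + y *\<^sub>R a" by transfer (simp add: distrib_right)
  show "x *\<^sub>R y *\<^sub>R a = (x * y) *\<^sub>R a" by transfer (simp add: mult.assoc)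
  show "1 *\<^sub>R a = a" by transfer simp
qed

end

lemma finite_cl_coeff: "finite {S. cl_coeff a S \<noteq> 0}"
  and finite_cl_index: "cl_coeff a S \<noteq> 0 \<Longrightarrow> finite S"
  by (transfer; simp)+

lemma cl_eqI: "(\<And>S. finite S \<Longrightarrow> cl_coeff a S = cl_coeff b S) \<Longrightarrow> a = b"
  by (rule cl_coeff_inject[THEN iffD1], rule ext) (metis finite_cl_index)

instantiation clifford :: "{times, one}"
begin

lift_definition one_clifford :: clifford is "\<lambda>S. if S = {} then 1 else 0" by simp

lift_definition times_clifford :: "clifford \<Rightarrow> clifford \<Rightarrow> clifford" is
  "\<lambda>f g U. \<Sum>S | f S \<noteq> 0. cl_sign S (sym_diff S U) * f S * g (sym_diff S U)"
proof -
  fix f g :: "nat set \<Rightarrow> real"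
  assume a: "finite {S. f S \<noteq> 0} \<and> (\<forall>S. f S \<noteq> 0 \<longrightarrow> finite S)" "finite {S. g S \<noteq> 0} \<and> (\<forall>S. g S \<noteq> 0 \<longrightarrow> finite S)"
  let ?h = "\<lambda>U. \<Sum>S | f S \<noteq> 0. cl_sign S (sym_diff S U) * f S * g (sym_diff S U)"
  have *: "\<exists>S T. f S \<noteq> 0 \<and> g T \<noteq> 0 \<and> U = sym_diff S T" if "?h U \<noteq> 0" for U
  proof -
    from that obtain S where "f S \<noteq> 0" "g (sym_diff S U) \<noteq> 0"
      by (rule sum.not_neutral_contains_not_neutral) simp
    moreover have "U = sym_diff S (sym_diff S U)" by auto
    ultimately show ?thesis by (intro exI conjI)
  qed
  have "{U. ?h U \<noteq> 0} \<subseteq> (\<lambda>(S, T). sym_diff S T) ` ({S. f S \<noteq> 0} \<times> {S. g S \<noteq> 0})"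
  proof
    fix U assume "U \<in> {U. ?h U \<noteq> 0}"
    hence "?h U \<noteq> 0" by (rule CollectD)
    from *[OF this] obtain S T where "f S \<noteq> 0" "g T \<noteq> 0" "U = sym_diff S T" by (elim exE conjE)
    thus "U \<in> (\<lambda>(S, T). sym_diff S T) ` ({S. f S \<noteq> 0} \<times> {S. g S \<noteq> 0})"
      by (intro image_eqI[of _ _ "(S, T)"]) simp_all
  qed
  hence "finite {U. ?h U \<noteq> 0}" by (rule finite_subset) (use a in auto)
  moreover have "finite U" if U: "?h U \<noteq> 0" for U
  proof -
    from *[OF U] obtain S T where ST: "f S \<noteq> 0" "g T \<noteq> 0" "U = sym_diff S T" by (elim exE conjE)
    have "finite S" "finite T" using ST(1,2) a by blast+
    thus ?thesis unfolding ST(3) by simp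
  qed
  ultimately show "finite {U. ?h U \<noteq> 0} \<and> (\<forall>U. ?h U \<noteq> 0 \<longrightarrow> finite U)"
    by (intro conjI allI impI)
qed

instance ..

end

lemma cl_coeff_simps [simp]:
  "cl_coeff 0 S = 0" "cl_coeff (a + b) S = cl_coeff a S + cl_coeff b S"
  "cl_coeff (- a) S = - cl_coeff a S" "cl_coeff (a - b) S = cl_coeff a S - cl_coeff b S"
  "cl_coeff (c *\<^sub>R a) S = c * cl_coeff a S" "cl_coeff 1 S = (if S = {} then 1 else 0)"
  by (simp_all add: zero_clifford.rep_eq plus_clifford.rep_eq uminus_clifford.rep_eq
        minus_clifford_def scaleR_clifford.rep_eq one_clifford.rep_eq del: add_uminus_conv_diff)

lemma cl_coeff_times:
  assumes "finite F" "{S. cl_coeff a S \<noteq> 0} \<subseteq> F"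
  shows "cl_coeff (a * b) U =
    (\<Sum>S\<in>F. cl_sign S (sym_diff S U) * cl_coeff a S * cl_coeff b (sym_diff S U))"
  unfolding times_clifford.rep_eq
proof (rule sum.mono_neutral_left[OF assms])
  show "\<forall>S\<in>F - {S. cl_coeff a S \<noteq> 0}.
      cl_sign S (sym_diff S U) * cl_coeff a S * cl_coeff b (sym_diff S U) = 0"
    by simp
qed

lemma clifford_mult_assoc: "(a * b) * c = a * (b * (c :: clifford))"
proof (rule cl_eqI)
  fix U :: "nat set" assume U: "finite U"
  define A where "A = {S. cl_coeff a S \<noteq> 0}"
  define B where "B = {S. cl_coeff b S \<noteq> 0}"
  define P where "P = (\<lambda>(S, T). sym_diff S T) ` (A \<times> B) \<union> {S. cl_coeff (a * b) S \<noteq> 0}"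
  have fin: "finite A" "finite B" "finite P"
    unfolding A_def B_def P_def by (auto intro!: finite_cl_coeff)
  have finA: "finite S" if "S \<in> A" for S using that finite_cl_index unfolding A_def by blast
  have finB: "finite S" if "S \<in> B" for S using that finite_cl_index unfolding B_def by blast
  let ?t = "\<lambda>S T. cl_sign S T * cl_sign (sym_diff S T) (sym_diff (sym_diff S T) U) *
    cl_coeff a S * cl_coeff b T * cl_coeff c (sym_diff (sym_diff S T) U)"
  have "cl_coeff ((a * b) * c) U = (\<Sum>R\<in>P. cl_sign R (sym_diff R U) *
      (\<Sum>S\<in>A. cl_sign S (sym_diff S R) * cl_coeff a S * cl_coeff b (sym_diff S R)) *
      cl_coeff c (sym_diff R U))"
    by (subst cl_coeff_times[of P], (use fin in \<open>auto simp: P_def\<close>)[2])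
       (subst cl_coeff_times[of A], use fin in \<open>auto simp: A_def\<close>)
  also have "\<dots> = (\<Sum>S\<in>A. \<Sum>R\<in>P. cl_sign R (sym_diff R U) *
      (cl_sign S (sym_diff S R) * cl_coeff a S * cl_coeff b (sym_diff S R)) *
      cl_coeff c (sym_diff R U))"
    by (subst sum.swap) (simp add: sum_distrib_left sum_distrib_right)
  also have "\<dots> = (\<Sum>S\<in>A. \<Sum>T\<in>B. ?t S T)"
  proof (rule sum.cong[OF refl])
    fix S assume S: "S \<in> A"
    let ?f = "\<lambda>R. cl_sign R (sym_diff R U) *
      (cl_sign S (sym_diff S R) * cl_coeff a S * cl_coeff b (sym_diff S R)) *
      cl_coeff c (sym_diff R U)"
    have inv: "sym_diff S (sym_diff S T) = T" for T by auto
    have "(\<Sum>R\<in>P. ?f R) = (\<Sum>R\<in>sym_diff S ` B. ?f R)"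
    proof (rule sum.mono_neutral_right[OF fin(3)])
      show "sym_diff S ` B \<subseteq> P" unfolding P_def using S by auto
      show "\<forall>R\<in>P - sym_diff S ` B. ?f R = 0"
      proof
        fix R assume R: "R \<in> P - sym_diff S ` B"
        have "R = sym_diff S (sym_diff S R)" by auto
        hence "sym_diff S R \<in> B \<Longrightarrow> R \<in> sym_diff S ` B" by (rule image_eqI)
        with R have "sym_diff S R \<notin> B" by (meson DiffD2)
        thus "?f R = 0" by (simp add: B_def)
      qed
    qed
    also have "\<dots> = (\<Sum>T\<in>B. ?f (sym_diff S T))"
      by (rule sum.reindex[unfolded o_def]) (rule inj_on_inverseI[of _ "sym_diff S"], rule inv)
    also have "\<dots> = (\<Sum>T\<in>B. ?t S T)"
      unfolding inv by (rule sum.cong[OF refl]) (simp only: ac_simps)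
    finally show "(\<Sum>R\<in>P. ?f R) = (\<Sum>T\<in>B. ?t S T)" .
  qed
  also have "\<dots> = (\<Sum>S\<in>A. cl_sign S (sym_diff S U) * cl_coeff a S *
      (\<Sum>T\<in>B. cl_sign T (sym_diff T (sym_diff S U)) * cl_coeff b T *
        cl_coeff c (sym_diff T (sym_diff S U))))"
    unfolding sum_distrib_left
  proof (intro sum.cong refl)
    fix S T assume S: "S \<in> A" and T: "T \<in> B"
    define Z where "Z = sym_diff (sym_diff S T) U"
    have f: "finite S" "finite T" "finite Z" using S T U finA finB by (auto simp: Z_def)
    have 1: "sym_diff T (sym_diff S U) = Z" "sym_diff S U = sym_diff T Z" unfolding Z_def by auto
    show "?t S T = cl_sign S (sym_diff S U) * cl_coeff a S *
      (cl_sign T (sym_diff T (sym_diff S U)) * cl_coeff b T *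
        cl_coeff c (sym_diff T (sym_diff S U)))"
      unfolding 1(1) unfolding 1(2) Z_def[symmetric]
      using f by (simp add: cl_sign_sym_diff_left cl_sign_sym_diff_right)
  qed
  also have "\<dots> = cl_coeff (a * (b * c)) U"
    by (subst cl_coeff_times[of A], (use fin in \<open>auto simp: A_def\<close>)[2])
       (subst cl_coeff_times[of B], use fin in \<open>auto simp: B_def\<close>)
  finally show "cl_coeff ((a * b) * c) U = cl_coeff (a * (b * c)) U" .
qed

instance clifford :: real_algebra_1
proof
  fix a b c :: clifford and x :: real
  show "a * b * c = a * (b * c)" by (rule clifford_mult_assoc)
  show "(1 :: clifford) * a = a"
    by (rule cl_eqI, subst cl_coeff_times[of "{{}}"]) auto
  show "a * 1 = a"
  proof (rule cl_eqI)
    fix U :: "nat set" assume "finite U"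
    let ?F = "insert U {S. cl_coeff a S \<noteq> 0}"
    have "cl_coeff (a * 1) U =
        (\<Sum>S\<in>?F. cl_sign S (sym_diff S U) * cl_coeff a S * cl_coeff 1 (sym_diff S U))"
      by (rule cl_coeff_times) (auto simp: finite_cl_coeff)
    also have "\<dots> = (\<Sum>S\<in>?F. if S = U then cl_coeff a U else 0)"
    proof (rule sum.cong[OF refl])
      fix S
      have "sym_diff S U = {} \<longleftrightarrow> S = U" by auto
      thus "cl_sign S (sym_diff S U) * cl_coeff a S * cl_coeff 1 (sym_diff S U) =
          (if S = U then cl_coeff a U else 0)"
        unfolding cl_coeff_simps by simp
    qed
    also have "\<dots> = cl_coeff a U"
      by (subst sum.delta) (simp_all add: finite_cl_coeff)
    finally show "cl_coeff (a * 1) U = cl_coeff a U" .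
  qed
  show "(a + b) * c = a * c + b * c"
  proof (rule cl_eqI)
    fix U :: "nat set"
    let ?F = "{S. cl_coeff a S \<noteq> 0} \<union> {S. cl_coeff b S \<noteq> 0}"
    have F: "finite ?F" by (simp add: finite_cl_coeff)
    have sub: "{S. cl_coeff a S + cl_coeff b S \<noteq> 0} \<subseteq> ?F" by auto
    show "cl_coeff ((a + b) * c) U = cl_coeff (a * c + b * c) U"
      unfolding cl_coeff_simps(2)
      using sub cl_coeff_times[OF F, of "a + b" c U] cl_coeff_times[OF F, of a c U]
        cl_coeff_times[OF F, of b c U]
      by (auto simp: distrib_left distrib_right simp flip: sum.distrib)
  qed
  show "a * (b + c) = a * b + a * c"
    by (rule cl_eqI) (simp add: times_clifford.rep_eq algebra_simps sum.distrib)
  show "(x *\<^sub>R a) * b = x *\<^sub>R (a * b)"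
    by (rule cl_eqI, cases "x = 0")
       (simp_all add: times_clifford.rep_eq sum_distrib_left ac_simps)
  show "a * (x *\<^sub>R b) = x *\<^sub>R (a * b)"
    by (rule cl_eqI) (simp_all add: times_clifford.rep_eq sum_distrib_left ac_simps)
  show "(0 :: clifford) \<noteq> 1"
    by (metis cl_coeff_simps(1,6) zero_neq_one)
qed

lift_definition cl_basis :: "nat set \<Rightarrow> clifford" is
  "\<lambda>S T. if finite S \<and> T = S then 1 else 0" by auto

definition cl_gen :: "nat \<Rightarrow> clifford" where
  "cl_gen i = cl_basis {i}"

lemma cl_basis_times:
  assumes "finite S" "finite T"
  shows "cl_basis S * cl_basis T = cl_sign S T *\<^sub>R cl_basis (sym_diff S T)"
proof (rule cl_eqI)
  fix U :: "nat set"
  have eq: "sym_diff S U = T \<longleftrightarrow> U = sym_diff S T" by auto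
  have "cl_coeff (cl_basis S * cl_basis T) U =
      (\<Sum>R\<in>{S}. cl_sign R (sym_diff R U) * cl_coeff (cl_basis S) R * cl_coeff (cl_basis T) (sym_diff R U))"
    by (rule cl_coeff_times) (auto simp: cl_basis.rep_eq)
  also have "\<dots> = cl_sign S (sym_diff S U) * (if sym_diff S U = T then 1 else 0)"
    using assms by (simp add: cl_basis.rep_eq)
  also have "\<dots> = cl_sign S T * (if U = sym_diff S T then 1 else 0)"
    using eq by (cases "sym_diff S U = T") simp_all
  also have "\<dots> = cl_coeff (cl_sign S T *\<^sub>R cl_basis (sym_diff S T)) U"
    using assms by (simp add: cl_basis.rep_eq)
  finally show "cl_coeff (cl_basis S * cl_basis T) U = cl_coeff (cl_sign S T *\<^sub>R cl_basis (sym_diff S T)) U" .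
qed

theorem clifford_relation:
  "cl_gen i * cl_gen j + cl_gen j * cl_gen i = (if i = j then -2 else 0)"
proof -
  have s: "{(a, b). a = i \<and> b = j \<and> b \<le> a} = (if j \<le> i then {(i, j)} else {})" for i j :: nat by auto
  have 1: "cl_basis {} = 1" by (rule cl_eqI) (auto simp: cl_basis.rep_eq)
  have h: "cl_gen i * cl_gen j = (if j \<le> i then -1 else 1) *\<^sub>R cl_basis (sym_diff {i} {j})" for i j
    unfolding cl_gen_def by (subst cl_basis_times) (simp_all add: cl_sign_def s)
  show ?thesis
  proof (cases "i = j")
    case True
    have "cl_gen j * cl_gen j = - 1" unfolding h by (simp add: 1)
    thus ?thesis using True by simp
  next
    case False
    have 2: "sym_diff {j} {i} = sym_diff {i} {j}" by auto
    have "cl_gen i * cl_gen j + cl_gen j * cl_gen i =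
        ((if j \<le> i then -1 else 1) + (if i \<le> j then -1 else 1)) *\<^sub>R cl_basis (sym_diff {i} {j})"
      unfolding h[of i j] h[of j i] 2 by (simp only: scaleR_add_left)
    also have "\<dots> = 0" using False by (cases "j \<le> i") simp_all
    finally show ?thesis using False by simp
  qed
qed

definition Cl :: "nat \<Rightarrow> clifford set" where
  "Cl r = span {prod_list (map cl_gen is) | is. set is \<subseteq> {1..r}}"

definition Cl0 :: "nat \<Rightarrow> clifford set" where
  "Cl0 r = span {prod_list (map cl_gen is) | is. set is \<subseteq> {1..r} \<and> even (length is)}"

lemma prod_list_cl_gen_sorted:
  "sorted_wrt (<) is \<Longrightarrow> prod_list (map cl_gen is) = cl_basis (set is)"
proof (induction "is")
  case Nil
  show ?case by (rule cl_eqI) (auto simp: cl_basis.rep_eq)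
next
  case (Cons i "is")
  have 1: "{(a, b). a \<in> {i} \<and> b \<in> set is \<and> b \<le> a} = {}"
    and 2: "sym_diff {i} (set is) = insert i (set is)"
    using Cons.prems by auto
  have "cl_sign {i} (set is) = 1" unfolding cl_sign_def 1 by simp
  with 2 show ?case using Cons by (simp add: cl_gen_def cl_basis_times)
qed

lemma prod_list_cl_gen_support:
  assumes "cl_coeff (prod_list (map cl_gen is)) S \<noteq> 0"
  shows "S \<subseteq> set is" "even (card S) = even (length is)"
proof -
  have "\<exists>c T. finite T \<and> T \<subseteq> set is \<and> even (card T) = even (length is) \<and>
    prod_list (map cl_gen is) = c *\<^sub>R cl_basis T" for "is"
  proof (induction "is")
    case Nil
    have "prod_list (map cl_gen []) = 1 *\<^sub>R cl_basis {}"
      by (rule cl_eqI) (auto simp: cl_basis.rep_eq)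
    thus ?case by (intro exI[of _ 1] exI[of _ "{}"]) simp
  next
    case (Cons i "is")
    then obtain c T where *: "finite T" "T \<subseteq> set is" "even (card T) = even (length is)"
      "prod_list (map cl_gen is) = c *\<^sub>R cl_basis T" by (elim exE conjE)
    have "prod_list (map cl_gen (i # is)) = (c * cl_sign {i} T) *\<^sub>R cl_basis (sym_diff {i} T)"
      using * by (simp add: cl_gen_def cl_basis_times)
    moreover have "even (card (sym_diff {i} T)) \<longleftrightarrow> even (length (i # is))"
    proof (cases "i \<in> T")
      case True
      hence eq: "sym_diff {i} T = T - {i}" by auto
      have "card T = Suc (card (sym_diff {i} T))"
        unfolding eq using *(1) True by (rule card.remove)
      thus ?thesis using *(3) by (metis even_Suc length_Cons)
    next
      case False
      hence eq: "sym_diff {i} T = insert i T" by auto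
      show ?thesis unfolding eq using *(1,3) False by simp
    qed
    moreover have "finite (sym_diff {i} T)" "sym_diff {i} T \<subseteq> set (i # is)"
      using *(1,2) by auto
    ultimately show ?case by (intro exI conjI)
  qed
  then obtain c T where *: "finite T" "T \<subseteq> set is" "even (card T) = even (length is)"
    "prod_list (map cl_gen is) = c *\<^sub>R cl_basis T" by blast
  have "S = T" using assms unfolding *(4) by (simp add: cl_basis.rep_eq split: if_splits)
  with *(2,3) show "S \<subseteq> set is" "even (card S) = even (length is)" by simp_all
qed

lemma cl_expansion: "a = (\<Sum>S | cl_coeff a S \<noteq> 0. cl_coeff a S *\<^sub>R cl_basis S)"
proof (rule cl_eqI)
  fix U :: "nat set" assume U: "finite U"
  have sum: "cl_coeff (sum f F) U = (\<Sum>S\<in>F. cl_coeff (f S) U)" if "finite F" for f :: "nat set \<Rightarrow> clifford" and F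
    using that by induction auto
  have "cl_coeff (\<Sum>S | cl_coeff a S \<noteq> 0. cl_coeff a S *\<^sub>R cl_basis S) U =
      (\<Sum>S | cl_coeff a S \<noteq> 0. if S = U then cl_coeff a U else 0)"
    unfolding sum[OF finite_cl_coeff]
    by (rule sum.cong) (use U in \<open>auto simp: cl_basis.rep_eq\<close>)
  also have "\<dots> = cl_coeff a U"
    by (subst sum.delta) (auto simp: finite_cl_coeff)
  finally show "cl_coeff a U = cl_coeff (\<Sum>S | cl_coeff a S \<noteq> 0. cl_coeff a S *\<^sub>R cl_basis S) U" ..
qed

lemma span_words_eq:
  assumes gen: "X = {prod_list (map cl_gen is) | is. set is \<subseteq> A \<and> (E \<longrightarrow> even (length is))}"
  shows "span X = {a. \<forall>S. cl_coeff a S \<noteq> 0 \<longrightarrow> S \<subseteq> A \<and> (E \<longrightarrow> even (card S))}" (is "_ = ?R")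
proof
  have sub: "subspace ?R"
    unfolding subspace_def
  proof (intro conjI ballI allI)
    fix a b :: clifford and c :: real
    show "0 \<in> ?R" by simp
    assume a: "a \<in> ?R"
    show "c *\<^sub>R a \<in> ?R" using a by simp
    assume b: "b \<in> ?R"
    show "a + b \<in> ?R"
    proof (rule CollectI, rule allI, rule impI)
      fix S assume "cl_coeff (a + b) S \<noteq> 0"
      hence "cl_coeff a S \<noteq> 0 \<or> cl_coeff b S \<noteq> 0" by auto
      thus "S \<subseteq> A \<and> (E \<longrightarrow> even (card S))" using a b by (elim disjE) simp_all
    qed
  qed
  show "span X \<subseteq> ?R"
  proof (rule span_minimal[OF _ sub], rule subsetI)
    fix x assume "x \<in> X"
    then obtain "is" where "is": "x = prod_list (map cl_gen is)" "set is \<subseteq> A" "E \<longrightarrow> even (length is)"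
      unfolding gen by (elim CollectE exE conjE)
    show "x \<in> ?R" unfolding "is"(1)
    proof (intro CollectI allI impI conjI)
      fix S assume S: "cl_coeff (prod_list (map cl_gen is)) S \<noteq> 0"
      show "S \<subseteq> A" using prod_list_cl_gen_support(1)[OF S] "is"(2) by (rule subset_trans)
      show "even (card S)" if E using prod_list_cl_gen_support(2)[OF S] "is"(3) that by simp
    qed
  qed
  show "?R \<subseteq> span X"
  proof
    fix a assume a: "a \<in> ?R"
    have "cl_coeff a S *\<^sub>R cl_basis S \<in> span X" if "cl_coeff a S \<noteq> 0" for S
    proof -
      let ?is = "sorted_list_of_set S"
      have fin: "finite S" using that by (rule finite_cl_index)
      have "cl_basis S = prod_list (map cl_gen ?is)"
        by (subst prod_list_cl_gen_sorted) (simp_all add: fin)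
      moreover have "set ?is \<subseteq> A" using a that fin by simp
      moreover have "E \<longrightarrow> even (length ?is)" using a that fin by simp
      ultimately have "\<exists>is. cl_basis S = prod_list (map cl_gen is) \<and> set is \<subseteq> A \<and>
          (E \<longrightarrow> even (length is))"
        by (intro exI conjI)
      hence "cl_basis S \<in> X" unfolding gen by (rule CollectI)
      thus ?thesis by (intro span_scale span_base)
    qed
    hence "(\<Sum>S | cl_coeff a S \<noteq> 0. cl_coeff a S *\<^sub>R cl_basis S) \<in> span X" by (intro span_sum) simp
    thus "a \<in> span X" unfolding cl_expansion[of a, symmetric] .
  qed
qed

theorem Cl_eq: "Cl r = {a. \<forall>S. cl_coeff a S \<noteq> 0 \<longrightarrow> S \<subseteq> {1..r}}"
  unfolding Cl_def by (subst span_words_eq[where A = "{1..r}" and E = False]) simp_all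

theorem Cl0_eq: "Cl0 r = {a. \<forall>S. cl_coeff a S \<noteq> 0 \<longrightarrow> S \<subseteq> {1..r} \<and> even (card S)}"
  unfolding Cl0_def by (subst span_words_eq[where A = "{1..r}" and E = True]) simp_all

definition vol :: "nat \<Rightarrow> clifford" where
  "vol r = prod_list (map cl_gen [1..<Suc r])"


section \<open>Real Lie algebras\<close>

record 'a lie_algebra =
  lcarrier :: "'a set"
  ladd :: "'a \<Rightarrow> 'a \<Rightarrow> 'a"
  lscale :: "real \<Rightarrow> 'a \<Rightarrow> 'a"
  lbracket :: "'a \<Rightarrow> 'a \<Rightarrow> 'a"

definition lie_sum :: "'a lie_algebra \<Rightarrow> 'b lie_algebra \<Rightarrow> ('a \<times> 'b) lie_algebra" where
  "lie_sum L M = \<lparr>lcarrier = lcarrier L \<times> lcarrier M,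
     ladd = (\<lambda>(a, b) (a', b'). (ladd L a a', ladd M b b')),
     lscale = (\<lambda>t (a, b). (lscale L t a, lscale M t b)),
     lbracket = (\<lambda>(a, b) (a', b'). (lbracket L a a', lbracket M b b'))\<rparr>"

definition lie_iso :: "'a lie_algebra \<Rightarrow> 'b lie_algebra \<Rightarrow> ('a \<Rightarrow> 'b) \<Rightarrow> bool" where
  "lie_iso L M f \<longleftrightarrow> bij_betw f (lcarrier L) (lcarrier M) \<and>
     (\<forall>a\<in>lcarrier L. \<forall>b\<in>lcarrier L. f (ladd L a b) = ladd M (f a) (f b)) \<and>
     (\<forall>t. \<forall>a\<in>lcarrier L. f (lscale L t a) = lscale M t (f a)) \<and>
     (\<forall>a\<in>lcarrier L. \<forall>b\<in>lcarrier L. f (lbracket L a b) = lbracket M (f a) (f b))"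

definition spin_lie :: "nat \<Rightarrow> clifford lie_algebra" where
  "spin_lie r = \<lparr>lcarrier = span {cl_gen i * cl_gen j | i j. 1 \<le> i \<and> i < j \<and> j \<le> r},
     ladd = (+), lscale = (*\<^sub>R), lbracket = (\<lambda>a b. a * b - b * a)\<rparr>"

definition end_lie :: "('v::real_vector \<Rightarrow> 'v) set \<Rightarrow> ('v \<Rightarrow> 'v) lie_algebra" where
  "end_lie E = \<lparr>lcarrier = E, ladd = (\<lambda>X Y v. X v + Y v), lscale = (\<lambda>t X v. t *\<^sub>R X v),
     lbracket = (\<lambda>X Y v. X (Y v) - Y (X v))\<rparr>"

definition mat_lie :: "'k::real_field mat set \<Rightarrow> 'k mat lie_algebra" where
  "mat_lie E = \<lparr>lcarrier = E, ladd = (+), lscale = (\<lambda>t A. of_real t \<cdot>\<^sub>m A),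
     lbracket = (\<lambda>A B. A * B - B * A)\<rparr>"

definition so_lie :: "nat \<Rightarrow> real mat lie_algebra" where
  "so_lie m = mat_lie {A \<in> carrier_mat m m. transpose_mat A = - A}"

definition u_lie :: "nat \<Rightarrow> complex mat lie_algebra" where
  "u_lie m = mat_lie {A \<in> carrier_mat m m. transpose_mat (map_mat cnj A) = - A}"

definition symplectic_form :: "nat \<Rightarrow> complex mat" where
  "symplectic_form m = four_block_mat (0\<^sub>m m m) (1\<^sub>m m) (- 1\<^sub>m m) (0\<^sub>m m m)"

text \<open>
  \<open>sp(m) = u(2m) \<inter> sp(2m, \<complex>)\<close>, so that its standard representation \<open>\<complex>\<^bsup>2m\<^esup>\<close> is the tautological
  one.  Equivalently, it consists of the matrices \<open>(P, Q; -\<bar>Q, \<bar>P)\<close> with \<open>P\<close> skew-Hermitian and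
  \<open>Q\<close> symmetric.
\<close>

definition sp_lie :: "nat \<Rightarrow> complex mat lie_algebra" where
  "sp_lie m = mat_lie {X \<in> carrier_mat (2 * m) (2 * m). transpose_mat (map_mat cnj X) = - X \<and>
     transpose_mat X * symplectic_form m + symplectic_form m * X = 0\<^sub>m (2 * m) (2 * m)}"


section \<open>Representations of Clifford algebras\<close>

text \<open>
  Unitality is not required here: a trivial summand is one on which the algebra acts by \<open>0\<close>.  Only
  the values of \<open>\<rho>\<close> on the subalgebra \<open>A\<close> matter.
\<close>

definition algebra_rep :: "clifford set \<Rightarrow> (clifford \<Rightarrow> 'v::real_vector \<Rightarrow> 'v) \<Rightarrow> bool" where
  "algebra_rep A \<rho> \<longleftrightarrow> (\<forall>a\<in>A. linear (\<rho> a)) \<and>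
     (\<forall>a\<in>A. \<forall>b\<in>A. \<forall>v. \<rho> (a + b) v = \<rho> a v + \<rho> b v) \<and>
     (\<forall>t. \<forall>a\<in>A. \<forall>v. \<rho> (t *\<^sub>R a) v = t *\<^sub>R \<rho> a v) \<and>
     (\<forall>a\<in>A. \<forall>b\<in>A. \<forall>v. \<rho> (a * b) v = \<rho> a (\<rho> b v))"

definition no_trivial_summands :: "nat \<Rightarrow> (clifford \<Rightarrow> 'v::real_vector \<Rightarrow> 'v) \<Rightarrow> bool" where
  "no_trivial_summands r \<rho> \<longleftrightarrow> (\<forall>i j. 1 \<le> i \<and> i < j \<and> j \<le> r \<longrightarrow>
     (\<forall>v. \<rho> (cl_gen i * cl_gen j) (\<rho> (cl_gen i * cl_gen j) v) = - v))"

definition skew :: "('v::real_inner \<Rightarrow> 'v) \<Rightarrow> bool" where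
  "skew X \<longleftrightarrow> (\<forall>u v. X u \<bullet> v = - (u \<bullet> X v))"

definition spin_skew :: "nat \<Rightarrow> (clifford \<Rightarrow> 'v::real_inner \<Rightarrow> 'v) \<Rightarrow> bool" where
  "spin_skew r \<rho> \<longleftrightarrow> (\<forall>i j. 1 \<le> i \<and> i < j \<and> j \<le> r \<longrightarrow> skew (\<rho> (cl_gen i * cl_gen j)))"

text \<open>
  A model of \<open>\<Delta>\<^sub>r\<close> over the reals (with tilde): an irreducible module of \<open>Cl\<^sub>r\<^sup>0\<close>, on a Euclidean space
  whose inner product is invariant.
\<close>

definition real_spinor_rep :: "nat \<Rightarrow> (clifford \<Rightarrow> 'w::euclidean_space \<Rightarrow> 'w) \<Rightarrow> bool" where
  "real_spinor_rep r \<tau> \<longleftrightarrow> algebra_rep (Cl0 r) \<tau> \<and> (\<forall>w. \<tau> 1 w = w) \<and> spin_skew r \<tau> \<and>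
     (\<forall>U. subspace U \<and> (\<forall>a\<in>Cl0 r. \<tau> a ` U \<subseteq> U) \<longrightarrow> U = {0} \<or> U = UNIV)"

text \<open>
  A model of \<open>\<Delta>\<^sub>r\<close>: a complex representation of the real algebra \<open>Cl\<^sub>r\<close> (equivalently, a
  representation of \<open>Cl\<^sub>r \<otimes> \<complex>\<close>) for even \<open>r\<close>, and of \<open>Cl\<^sub>r\<^sup>0\<close> for odd \<open>r\<close>.
\<close>

definition complex_spinor_rep :: "nat \<Rightarrow> (clifford \<Rightarrow> complex^'s \<Rightarrow> complex^'s) \<Rightarrow> bool" where
  "complex_spinor_rep r \<kappa> \<longleftrightarrow> CARD('s) = 2 ^ (r div 2) \<and>
     (let A = (if even r then Cl r else Cl0 r) in
       algebra_rep A \<kappa> \<and> (\<forall>a\<in>A. Vector_Spaces.linear (*s) (*s) (\<kappa> a)) \<and> (\<forall>x. \<kappa> 1 x = x) \<and>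
       (\<forall>U. vec.subspace U \<and> (\<forall>a\<in>A. \<kappa> a ` U \<subseteq> U) \<longrightarrow> U = {0} \<or> U = UNIV))"

definition centralizer :: "nat \<Rightarrow> (clifford \<Rightarrow> 'v::euclidean_space \<Rightarrow> 'v) \<Rightarrow> ('v \<Rightarrow> 'v) lie_algebra" where
  "centralizer r \<rho> = end_lie {X. linear X \<and> skew X \<and>
     (\<forall>\<xi>\<in>lcarrier (spin_lie r). \<forall>v. X (\<rho> \<xi> v) = \<rho> \<xi> (X v))}"


section \<open>Tensor products and the identifications of the centralizer\<close>

text \<open>
  For \<open>k = \<real>, \<complex>\<close> the tensor product \<open>k\<^sup>s \<otimes> W\<close> is realised as \<open>W\<^sup>s\<close>, by expanding in the standard
  basis of \<open>k\<^sup>s\<close>: elements are sequences in \<open>W\<close> vanishing from index \<open>s\<close> on, \<open>mat_tensor\<close> is the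
  operator \<open>A \<otimes> T\<close>, and (for an inner product space \<open>W\<close>) the inner product is the sum of those of
  the components.
\<close>

definition tensor_space :: "nat \<Rightarrow> 'w::zero set \<Rightarrow> (nat \<Rightarrow> 'w) set" where
  "tensor_space s W = {x. (\<forall>i<s. x i \<in> W) \<and> (\<forall>i\<ge>s. x i = 0)}"

definition mat_tensor ::
  "('k \<Rightarrow> 'w \<Rightarrow> 'w) \<Rightarrow> 'k mat \<Rightarrow> ('w \<Rightarrow> 'w) \<Rightarrow> (nat \<Rightarrow> 'w) \<Rightarrow> nat \<Rightarrow> 'w::comm_monoid_add" where
  "mat_tensor sc A T x = (\<lambda>i. if i < dim_row A then \<Sum>j<dim_col A. sc (A $$ (i, j)) (T (x j)) else 0)"

text \<open>\<open>\<phi>\<close> is an isometric isomorphism \<open>\<real>\<^sup>m \<otimes> W \<rightarrow> V\<close> of representations of \<open>Cl\<^sub>r\<^sup>0\<close>.\<close>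

definition decomposition ::
  "nat \<Rightarrow> (clifford \<Rightarrow> 'w \<Rightarrow> 'w) \<Rightarrow> (clifford \<Rightarrow> 'v \<Rightarrow> 'v) \<Rightarrow> nat \<Rightarrow>
     ((nat \<Rightarrow> 'w::euclidean_space) \<Rightarrow> 'v::euclidean_space) \<Rightarrow> bool" where
  "decomposition r \<tau> \<rho> m \<phi> \<longleftrightarrow> (let D = tensor_space m UNIV in
     bij_betw \<phi> D UNIV \<and>
     (\<forall>x\<in>D. \<forall>y\<in>D. \<phi> (x + y) = \<phi> x + \<phi> y) \<and>
     (\<forall>t. \<forall>x\<in>D. \<phi> (\<lambda>i. t *\<^sub>R x i) = t *\<^sub>R \<phi> x) \<and>
     (\<forall>x\<in>D. \<forall>y\<in>D. \<phi> x \<bullet> \<phi> y = (\<Sum>i<m. x i \<bullet> y i)) \<and>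
     (\<forall>a\<in>Cl0 r. \<forall>x\<in>D. \<phi> (\<lambda>i. \<tau> a (x i)) = \<rho> a (\<phi> x)))"

text \<open>Likewise for \<open>\<real>\<^bsup>m\<^sub>1\<^esup> \<otimes> W\<^sub>1 \<oplus> \<real>\<^bsup>m\<^sub>2\<^esup> \<otimes> W\<^sub>2 \<rightarrow> V\<close>.\<close>

definition decomposition2 ::
  "nat \<Rightarrow> (clifford \<Rightarrow> 'p \<Rightarrow> 'p) \<Rightarrow> (clifford \<Rightarrow> 'q \<Rightarrow> 'q) \<Rightarrow> (clifford \<Rightarrow> 'v \<Rightarrow> 'v) \<Rightarrow> nat \<Rightarrow> nat \<Rightarrow>
     ((nat \<Rightarrow> 'p::euclidean_space) \<times> (nat \<Rightarrow> 'q::euclidean_space) \<Rightarrow> 'v::euclidean_space) \<Rightarrow> bool" where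
  "decomposition2 r \<tau>1 \<tau>2 \<rho> m1 m2 \<phi> \<longleftrightarrow>
     (let D1 = tensor_space m1 UNIV; D2 = tensor_space m2 UNIV in
     bij_betw \<phi> (D1 \<times> D2) UNIV \<and>
     (\<forall>x\<in>D1 \<times> D2. \<forall>y\<in>D1 \<times> D2. \<phi> (x + y) = \<phi> x + \<phi> y) \<and>
     (\<forall>t. \<forall>x\<in>D1. \<forall>y\<in>D2. \<phi> (\<lambda>i. t *\<^sub>R x i, \<lambda>i. t *\<^sub>R y i) = t *\<^sub>R \<phi> (x, y)) \<and>
     (\<forall>x\<in>D1. \<forall>y\<in>D2. \<forall>x'\<in>D1. \<forall>y'\<in>D2.
        \<phi> (x, y) \<bullet> \<phi> (x', y') = (\<Sum>i<m1. x i \<bullet> x' i) + (\<Sum>i<m2. y i \<bullet> y' i)) \<and>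
     (\<forall>a\<in>Cl0 r. \<forall>x\<in>D1. \<forall>y\<in>D2. \<phi> (\<lambda>i. \<tau>1 a (x i), \<lambda>i. \<tau>2 a (y i)) = \<rho> a (\<phi> (x, y))))"

text \<open>The inverses of the identifications \<open>A \<otimes> Id \<mapsto> A\<close> and \<open>A \<otimes> Id + B \<otimes> J \<mapsto> A + iB\<close>.\<close>

definition so_op :: "real mat \<Rightarrow> (nat \<Rightarrow> 'w::real_vector) \<Rightarrow> nat \<Rightarrow> 'w" where
  "so_op A = mat_tensor (*\<^sub>R) A id"

definition u_op :: "('w \<Rightarrow> 'w) \<Rightarrow> complex mat \<Rightarrow> (nat \<Rightarrow> 'w::real_vector) \<Rightarrow> nat \<Rightarrow> 'w" where
  "u_op J Z x = mat_tensor (*\<^sub>R) (map_mat Re Z) id x + mat_tensor (*\<^sub>R) (map_mat Im Z) J x"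

text \<open>
  The inverse of \<open>A \<otimes> Id + B \<otimes> I + C \<otimes> J + D \<otimes> K \<mapsto> A + iB + jC + kD\<close>, where quaternionic matrices
  are complex ones through \<open>A + iB + jC + kD = (P, Q; -\<bar>Q, \<bar>P)\<close>, \<open>P = A + iB\<close>, \<open>Q = C + iD\<close>
  (that is, \<open>i = diag(i, -i)\<close>, \<open>j = (0, 1; -1, 0)\<close>, \<open>k = ij\<close>).
\<close>

definition sp_op ::
  "('w \<Rightarrow> 'w) \<Rightarrow> ('w \<Rightarrow> 'w) \<Rightarrow> ('w \<Rightarrow> 'w) \<Rightarrow> nat \<Rightarrow> complex mat \<Rightarrow> (nat \<Rightarrow> 'w::real_vector) \<Rightarrow> nat \<Rightarrow> 'w" where
  "sp_op I J K m X x =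
     (let P = mat m m (\<lambda>(i, j). X $$ (i, j)); Q = mat m m (\<lambda>(i, j). X $$ (i, j + m)) in
       mat_tensor (*\<^sub>R) (map_mat Re P) id x + mat_tensor (*\<^sub>R) (map_mat Im P) I x +
       mat_tensor (*\<^sub>R) (map_mat Re Q) J x + mat_tensor (*\<^sub>R) (map_mat Im Q) K x)"

definition quaternionic_structure ::
  "nat \<Rightarrow> (clifford \<Rightarrow> 'w::real_vector \<Rightarrow> 'w) \<Rightarrow> ('w \<Rightarrow> 'w) \<Rightarrow> ('w \<Rightarrow> 'w) \<Rightarrow> ('w \<Rightarrow> 'w) \<Rightarrow> bool" where
  "quaternionic_structure r \<tau> I J K \<longleftrightarrow>
     (\<forall>T\<in>{I, J, K}. linear T \<and> (\<forall>w. T (T w) = - w) \<and>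
        (\<forall>\<xi>\<in>lcarrier (spin_lie r). \<forall>w. T (\<tau> \<xi> w) = \<tau> \<xi> (T w))) \<and>
     (\<forall>w. I (J w) = K w \<and> J (K w) = I w \<and> K (I w) = J w)"

definition transport :: "('x \<Rightarrow> 'v) \<Rightarrow> 'x set \<Rightarrow> ('x \<Rightarrow> 'x) \<Rightarrow> 'v \<Rightarrow> 'v" where
  "transport \<phi> D L v = \<phi> (L (inv_into D \<phi> v))"


section \<open>Complex representations of Lie algebras\<close>

record ('l, 'x) crep =
  rspace :: "'x set"
  rscale :: "complex \<Rightarrow> 'x \<Rightarrow> 'x"
  ract :: "'l \<Rightarrow> 'x \<Rightarrow> 'x"

definition crep_iso :: "'l lie_algebra \<Rightarrow> ('l, 'x::plus) crep \<Rightarrow> ('l, 'y::plus) crep \<Rightarrow> bool" where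
  "crep_iso L R S \<longleftrightarrow> (\<exists>\<Psi>. bij_betw \<Psi> (rspace R) (rspace S) \<and>
     (\<forall>x\<in>rspace R. \<forall>y\<in>rspace R. \<Psi> (x + y) = \<Psi> x + \<Psi> y) \<and>
     (\<forall>z. \<forall>x\<in>rspace R. \<Psi> (rscale R z x) = rscale S z (\<Psi> x)) \<and>
     (\<forall>l\<in>lcarrier L. \<forall>x\<in>rspace R. \<Psi> (ract R l x) = ract S l (\<Psi> x)))"

definition crep_sum :: "('l, 'x) crep \<Rightarrow> ('l, 'y) crep \<Rightarrow> ('l, 'x \<times> 'y) crep" where
  "crep_sum R S = \<lparr>rspace = rspace R \<times> rspace S,
     rscale = (\<lambda>z (x, y). (rscale R z x, rscale S z y)),
     ract = (\<lambda>l (x, y). (ract R l x, ract S l y))\<rparr>"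

text \<open>
  The representation of \<open>\<gg> \<oplus> \<hh>\<close> on \<open>\<complex>\<^sup>s \<otimes> S\<close>, where \<open>\<gg>\<close> acts on \<open>\<complex>\<^sup>s\<close> through the matrices \<open>\<pi> a\<close>
  and \<open>\<hh>\<close> acts on \<open>S\<close>.  The conjugate of \<open>\<complex>\<^sup>s\<close> is obtained by conjugating the entries of \<open>\<pi> a\<close>.
\<close>

definition std_tensor ::
  "nat \<Rightarrow> ('g \<Rightarrow> complex mat) \<Rightarrow> ('h, 'x::comm_monoid_add) crep \<Rightarrow> ('g \<times> 'h, nat \<Rightarrow> 'x) crep" where
  "std_tensor s \<pi> S = \<lparr>rspace = tensor_space s (rspace S),
     rscale = (\<lambda>z x i. rscale S z (x i)),
     ract = (\<lambda>(a, b) x. mat_tensor (rscale S) (\<pi> a) id x + (\<lambda>i. ract S b (x i)))\<rparr>"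

definition spinor :: "(clifford \<Rightarrow> complex^'s \<Rightarrow> complex^'s) \<Rightarrow> (clifford, complex^'s) crep" where
  "spinor \<kappa> = \<lparr>rspace = UNIV, rscale = (*s), ract = \<kappa>\<rparr>"

text \<open>\<open>\<Delta>\<^sub>r\<^sup>+\<close> and \<open>\<Delta>\<^sub>r\<^sup>-\<close> are obtained for \<open>\<epsilon> = 1\<close> and \<open>\<epsilon> = -1\<close>.\<close>

definition half_spinor ::
  "nat \<Rightarrow> (clifford \<Rightarrow> complex^'s \<Rightarrow> complex^'s) \<Rightarrow> complex \<Rightarrow> (clifford, complex^'s) crep" where
  "half_spinor r \<kappa> \<epsilon> =
     (spinor \<kappa>)\<lparr>rspace := {x. (- \<i>) ^ (r div 2) *s \<kappa> (vol r) x = \<epsilon> *s x}\<rparr>"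

text \<open>
  \<open>V \<otimes> \<complex>\<close>, with \<open>(u, v)\<close> standing for \<open>u + iv\<close>, as a representation of the direct sum of a Lie
  algebra of endomorphisms of \<open>V\<close> and \<open>spin(r)\<close>.
\<close>

definition complexified ::
  "(clifford \<Rightarrow> 'v::real_vector \<Rightarrow> 'v) \<Rightarrow> (('v \<Rightarrow> 'v) \<times> clifford, 'v \<times> 'v) crep" where
  "complexified \<rho> = \<lparr>rspace = UNIV,
     rscale = (\<lambda>z (u, v). (Re z *\<^sub>R u - Im z *\<^sub>R v, Re z *\<^sub>R v + Im z *\<^sub>R u)),
     ract = (\<lambda>(X, \<xi>) (u, v). (X u + \<rho> \<xi> u, X v + \<rho> \<xi> v))\<rparr>"

end

theory Submission
  imports Defs
begin

text \<open>
  The monomials \<open>\<plusminus>e\<^sub>S\<close> with \<open>S\<close> an even subset of \<open>{1..r}\<close> form a finite group which acts orthogonally on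
  the real modules in question, and the theorem is obtained from the character theory of this group.

  A monomial other than \<open>1\<close> and \<open>vol\<close> anticommutes with an even monomial and hence has trace \<open>0\<close>.
  Averaging rank one operators over the group therefore produces a nonzero equivariant map from an
  irreducible module \<open>W\<close> into every nonzero module on which, for \<open>r\<close> divisible by \<open>4\<close>, the volume element
  acts as it does on \<open>W\<close> (\<open>exists_intertwiner\<close>).  Applied to orthogonal complements this splits off
  isometric copies of \<open>W\<close> one after the other (\<open>frame_exists\<close>).

  The period \<open>8\<close> comes from the Frobenius-Schur indicator.  By Schur's lemma the symmetric elements of
  the commutant of \<open>W\<close> are scalars, and the argument of Frobenius shows that its skew elements form a
  space of dimension \<open>s = 0, 1\<close> or \<open>3\<close> (\<open>commutant_trichotomy\<close>).  The indicator equates \<open>1 - s\<close>, up to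
  a positive factor, with the sum of the squares \<open>e\<^sub>S\<^sup>2 = (-1)\<^bsup>|S|/2\<^esup>\<close>, which is the real part of
  \<open>(1 + \<i>)\<^sup>r\<close>; its sign depends on \<open>r\<close> modulo \<open>8\<close> only (\<open>frobenius_schur\<close>, \<open>sum_cl_sign\<close>).

  A decomposition of \<open>V\<close> into copies of \<open>W\<close> turns an element of the centralizer into a matrix with
  entries in the commutant, and skewness into anti-selfadjointness of that matrix
  (\<open>lie_iso_single\<close>, \<open>lie_iso_double\<close>).  According to the commutant this gives \<open>so(m)\<close>, \<open>u(m)\<close> or \<open>sp(m)\<close>.

  Since \<open>\<cc> \<oplus> spin(r)\<close> acts on \<open>V \<otimes> \<complex>\<close> by real operators, an isomorphism onto a complex module is the same as
  a real linear equivariant map \<open>h\<close> on \<open>V\<close> for which \<open>u + \<i> v \<mapsto> h u + \<i> h v\<close> is bijective.  Such an \<open>h\<close> is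
  assembled from a nonzero equivariant map \<open>g\<close> from \<open>W\<close> to \<open>\<Delta>\<^sub>r\<close> or to a half spinor space:
  \<^item> If the commutant is \<open>\<real>\<close>, then \<open>g u + \<i> g v\<close> vanishes for \<open>u = v = 0\<close> only, because otherwise
    \<open>W\<close> would carry a complex structure.
  \<^item> If the commutant is \<open>\<complex>\<close>, generated by \<open>J = vol\<close>, then \<open>vol\<close> acts on \<open>\<Delta>\<^sub>r\<^sup>\<plusminus>\<close> as \<open>\<plusminus>\<i>\<^bsup>r/2\<^esup>\<close>.
    So one of the two maps from \<open>W\<close> to \<open>\<Delta>\<^sub>r\<^sup>\<plusminus>\<close> is linear and the other one conjugate linear with respect
    to \<open>J\<close>; this is how \<open>\<complex>\<^sup>m\<close> and its conjugate are distributed for \<open>r \<equiv> 2, 6\<close>.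
  \<^item> If the commutant is quaternionic, then \<open>g\<close> can be chosen with \<open>g I = \<i> g\<close>, and \<open>w \<mapsto> (g w, g (J w))\<close>
    turns the quaternionic matrix \<open>P + Q J\<close> into the complex matrix \<open>(P, Q; -\<bar>Q, \<bar>P)\<close>.  For \<open>r \<equiv> 4\<close> the
    half spinor space \<open>\<Delta>\<^sub>r\<^sup>+\<close> is the one on which \<open>vol\<close> acts as \<open>-1\<close>, since \<open>(-\<i>)\<^bsup>r/2\<^esup> = -1\<close>; hence the
    exchange of \<open>m\<^sub>1\<close> and \<open>m\<^sub>2\<close>.
\<close>

(* The dot is to denote the inner product of Euclidean spaces. *)
no_notation scalar_prod (infix "\<bullet>" 70)

section \<open>Even monomials\<close>

definition even_sets :: "nat \<Rightarrow> nat set set" where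
  "even_sets r = {S. S \<subseteq> {1..r} \<and> even (card S)}"

lemma finite_even_sets [simp]: "finite (even_sets r)"
  unfolding even_sets_def by (rule finite_subset[of _ "Pow {1..r}"]) auto

lemma even_sets_finite: "S \<in> even_sets r \<Longrightarrow> finite S"
  unfolding even_sets_def using finite_subset by auto

lemma even_sets_empty [simp]: "{} \<in> even_sets r"
  unfolding even_sets_def by simp

text \<open>Compare signs: \<open>(-1)\<^bsup>|S|\<^esup>\<close> is multiplicative for symmetric differences.\<close>

lemma even_card_sym_diff:
  assumes "finite S" "finite T"
  shows "even (card (sym_diff S T)) \<longleftrightarrow> (even (card S) \<longleftrightarrow> even (card T))"
proof -
  have "(-1::real) ^ card (sym_diff S T) = (-1) ^ card S * (-1) ^ card T"
    using assms by (rule minus_one_card_sym_diff)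
  then show ?thesis
    by (auto simp: uminus_power_if split: if_splits)
qed

lemma even_sets_sym_diff:
  assumes "S \<in> even_sets r" "T \<in> even_sets r" shows "sym_diff S T \<in> even_sets r"
  using assms even_card_sym_diff[of S T] even_sets_finite[OF assms(1)] even_sets_finite[OF assms(2)]
  unfolding even_sets_def by auto

lemma cl_coeff_basis: "finite S \<Longrightarrow> cl_coeff (cl_basis S) T = (if T = S then 1 else 0)"
  by (simp add: cl_basis.rep_eq)

lemma cl_basis_in_Cl0: "S \<in> even_sets r \<Longrightarrow> cl_basis S \<in> Cl0 r"
  unfolding Cl0_eq using even_sets_finite[of S r]
  by (auto simp: cl_coeff_basis even_sets_def split: if_splits)

lemma cl_basis_empty: "cl_basis {} = 1"
  by (rule cl_eqI) (simp add: cl_coeff_basis)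

lemma one_in_Cl0: "1 \<in> Cl0 r"
  using cl_basis_in_Cl0[OF even_sets_empty] by (simp add: cl_basis_empty)

lemma subspace_Cl0: "subspace (Cl0 r)"
  unfolding Cl0_def by (rule subspace_span)

lemma Cl0_eq_span: "Cl0 r = span (cl_basis ` even_sets r)"
proof
  show "span (cl_basis ` even_sets r) \<subseteq> Cl0 r"
    by (rule span_minimal[OF _ subspace_Cl0]) (auto intro: cl_basis_in_Cl0)
  show "Cl0 r \<subseteq> span (cl_basis ` even_sets r)"
  proof
    fix a assume a: "a \<in> Cl0 r"
    have "(\<Sum>S | cl_coeff a S \<noteq> 0. cl_coeff a S *\<^sub>R cl_basis S) \<in> span (cl_basis ` even_sets r)"
      using a unfolding Cl0_eq even_sets_def by (intro span_sum span_scale span_base) blast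
    then show "a \<in> span (cl_basis ` even_sets r)" unfolding cl_expansion[of a, symmetric] .
  qed
qed

lemma cl_sign_pm: "cl_sign S T = 1 \<or> cl_sign S T = -1"
  unfolding cl_sign_def by (simp add: uminus_power_if)

lemma cl_sign_square [simp]: "cl_sign S T * cl_sign S T = 1"
  using cl_sign_pm[of S T] by auto

lemma cl_sign_square2 [simp]: "cl_sign S T * (cl_sign S T * x) = x"
  using cl_sign_pm[of S T] by auto

text \<open>Every pair in \<open>S \<times> T\<close> is counted by exactly one of the two signs, except that the diagonal pairs
  are counted by both.  Hence \<open>e\<^sub>S\<close> and \<open>e\<^sub>T\<close> commute or anticommute according to the parity of
  \<open>|S| |T| + |S \<inter> T|\<close>.\<close>

lemma cl_sign_commute:
  assumes "finite S" "finite T"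
  shows "cl_sign S T * cl_sign T S = (-1) ^ (card S * card T + card (S \<inter> T))"
proof -
  let ?A = "{(i, j). i \<in> S \<and> j \<in> T \<and> j \<le> i}"
  let ?B = "{(i, j). i \<in> S \<and> j \<in> T \<and> i \<le> j}"
  let ?C = "{(i, j). i \<in> T \<and> j \<in> S \<and> j \<le> i}"
  have "finite ?A" "finite ?B"
    by (rule finite_subset[of _ "S \<times> T"]; use assms in auto)+
  then have "card ?A + card ?B = card (?A \<union> ?B) + card (?A \<inter> ?B)"
    by (rule card_Un_Int)
  also have "?A \<union> ?B = S \<times> T" by auto
  also have "?A \<inter> ?B = (\<lambda>i. (i, i)) ` (S \<inter> T)" by auto
  also have "card \<dots> = card (S \<inter> T)" by (rule card_image) (auto simp: inj_on_def)
  finally have 1: "card ?A + card ?B = card S * card T + card (S \<inter> T)"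
    by (simp add: card_cartesian_product)
  have "?C = prod.swap ` ?B" by auto
  then have 2: "card ?C = card ?B" using card_image[of prod.swap ?B] by (simp add: inj_on_def)
  show ?thesis unfolding cl_sign_def 2 power_add[symmetric] 1 ..
qed

lemma cl_sign_commute_even:
  assumes "finite S" "finite T" "even (card S * card T)"
  shows "cl_sign S T = (-1) ^ card (S \<inter> T) * cl_sign T S"
proof -
  have "cl_sign S T * cl_sign T S = (-1) ^ card (S \<inter> T)"
    using cl_sign_commute[OF assms(1,2)] assms(3) by (simp add: power_add)
  then have "cl_sign S T * cl_sign T S * cl_sign T S = (-1) ^ card (S \<inter> T) * cl_sign T S" by simp
  then show ?thesis by (simp add: mult.assoc)
qed

lemma cl_sign_insert_self:
  assumes "finite S" "x \<notin> S"
  shows "cl_sign (insert x S) (insert x S) = (-1) ^ Suc (card S) * cl_sign S S"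
proof -
  have eq: "insert x S = sym_diff {x} S" using assms by auto
  have "cl_sign (sym_diff {x} S) (sym_diff {x} S) =
      cl_sign {x} {x} * (cl_sign {x} S * cl_sign S {x}) * cl_sign S S"
    using assms(1) by (simp only: cl_sign_sym_diff_left cl_sign_sym_diff_right finite_Un finite_Diff
        finite.emptyI finite.insertI simp_thms ac_simps)
  also have "cl_sign {x} S * cl_sign S {x} = (-1) ^ card S"
    using cl_sign_commute[of "{x}" S] assms by simp
  also have "cl_sign {x} {x} = -1"
  proof -
    have "{(i, j). i \<in> {x} \<and> j \<in> {x} \<and> j \<le> i} = {(x, x)}" by auto
    then show ?thesis unfolding cl_sign_def by simp
  qed
  finally show ?thesis unfolding eq by simp
qed

text \<open>The pair meets \<open>S\<close> in a single index, so \<open>e\<^sub>S\<close> anticommutes with \<open>e\<^sub>i e\<^sub>j\<close>.\<close>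

lemma even_set_commutes_pair:
  assumes "i \<in> S" "j \<notin> S" "finite S"
  shows "cl_sign S {i, j} = - cl_sign {i, j} S"
proof -
  have "i \<noteq> j" using assms by auto
  then have "even (card S * card {i, j})" by simp
  moreover have "S \<inter> {i, j} = {i}" using assms by auto
  ultimately show ?thesis using cl_sign_commute_even[of S "{i, j}"] assms(3) by simp
qed

lemma cl_basis_pair: "i < j \<Longrightarrow> cl_gen i * cl_gen j = cl_basis {i, j}"
  using prod_list_cl_gen_sorted[of "[i, j]"] by simp

lemma vol_eq: "vol r = cl_basis {1..r}"
proof -
  have "set [1..<Suc r] = {1..r}" by auto
  moreover have "sorted_wrt (<) [1..<Suc r]" by (rule sorted_wrt_upt)
  ultimately show ?thesis
    unfolding vol_def using prod_list_cl_gen_sorted[of "[1..<Suc r]"] by metis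
qed

lemma full_even_set: "even r \<Longrightarrow> {1..r} \<in> even_sets r"
  unfolding even_sets_def by simp

lemma vol_in_Cl0: "even r \<Longrightarrow> vol r \<in> Cl0 r"
  unfolding vol_eq by (rule cl_basis_in_Cl0[OF full_even_set])

lemma cl_sign_self_atLeastAtMost: "cl_sign {1..r} {1..r} = (-1) ^ (r * (r + 1) div 2)"
proof (induction r)
  case (Suc r)
  have 1: "{1..Suc r} = insert (Suc r) {1..r}" by auto
  have "Suc r * (Suc r + 1) = r * (r + 1) + 2 * Suc r" by simp
  then have 2: "Suc r * (Suc r + 1) div 2 = r * (r + 1) div 2 + Suc r" by (metis div_mult_self2 numeral_neq_zero zero_neq_numeral mult.commute add.commute)
  show ?case unfolding 1 2 using Suc by (subst cl_sign_insert_self) (simp_all add: power_add)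
qed simp

lemma cl_sign_vol_0: "r mod 4 = 0 \<Longrightarrow> cl_sign {1..r} {1..r} = 1"
proof -
  assume "r mod 4 = 0"
  then obtain k where k: "r = 4 * k" by auto
  have "r * (r + 1) div 2 = 2 * (k * (r + 1))" unfolding k by simp
  then show ?thesis unfolding cl_sign_self_atLeastAtMost by simp
qed

lemma cl_sign_vol_2: "r mod 4 = 2 \<Longrightarrow> cl_sign {1..r} {1..r} = -1"
proof -
  assume "r mod 4 = 2"
  then obtain k where k: "r = 4 * k + 2" by (metis div_mult_mod_eq mult.commute)
  have "r * (r + 1) div 2 = (2 * k + 1) * (4 * k + 3)" unfolding k by (simp add: algebra_simps)
  then show ?thesis unfolding cl_sign_self_atLeastAtMost by simp
qed

text \<open>
  An even monomial is, up to sign, a product of pairs.  This transfers properties of the generators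
  \<open>e\<^sub>i e\<^sub>j\<close> of \<open>spin(r)\<close> to all of the even Clifford algebra.
\<close>

lemma even_set_induct [consumes 1, case_names empty pair]:
  assumes "S \<in> even_sets r" and "P {}"
    and "\<And>S i j. S \<in> even_sets r \<Longrightarrow> P S \<Longrightarrow> 1 \<le> i \<Longrightarrow> i < j \<Longrightarrow> j \<le> r \<Longrightarrow> i \<notin> S \<Longrightarrow> j \<notin> S \<Longrightarrow>
      {i, j} \<in> even_sets r \<Longrightarrow>
      cl_basis (insert i (insert j S)) = cl_sign S {i, j} *\<^sub>R (cl_basis S * cl_basis {i, j}) \<Longrightarrow>
      P (insert i (insert j S))"
  shows "P S"
  using assms(1)
proof (induction "card S" arbitrary: S rule: less_induct)
  case less
  have fin: "finite S" using less.prems by (rule even_sets_finite)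
  show ?case
  proof (cases "S = {}")
    case False
    then obtain i where i: "i \<in> S" by auto
    have "S - {i} \<noteq> {}"
    proof
      assume "S - {i} = {}"
      with i have "S = {i}" by auto
      with less.prems show False unfolding even_sets_def by simp
    qed
    then obtain j where j: "j \<in> S" "j \<noteq> i" by auto
    define a b where "a = min i j" and "b = max i j"
    have ab: "a \<in> S" "b \<in> S" "a < b" using i j unfolding a_def b_def by (auto simp: min_def max_def)
    define S' where "S' = S - {a, b}"
    have S: "S = insert a (insert b S')" using ab unfolding S'_def by auto
    have notin: "a \<notin> S'" "b \<notin> S'" "finite S'" unfolding S'_def using fin by auto
    have c: "card S = card S' + 2" unfolding S using notin ab by simp
    have S': "S' \<in> even_sets r" using less.prems c unfolding even_sets_def S'_def by auto
    have r: "1 \<le> a" "b \<le> r" "{a, b} \<in> even_sets r"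
      using ab less.prems unfolding even_sets_def by auto
    have sd: "sym_diff S' {a, b} = S" using notin unfolding S by auto
    have "cl_basis S' * cl_basis {a, b} = cl_sign S' {a, b} *\<^sub>R cl_basis S"
      using cl_basis_times[of S' "{a, b}"] notin unfolding sd by simp
    then have "cl_basis S = cl_sign S' {a, b} *\<^sub>R (cl_basis S' * cl_basis {a, b})"
      by simp
    then show ?thesis unfolding S
      using assms(3)[OF S' _ r(1) ab(3) r(2) notin(1,2) r(3)] less.hyps[OF _ S'] c by simp
  qed (use assms(2) in simp)
qed

section \<open>Traces\<close>

definition op_trace :: "('v::euclidean_space \<Rightarrow> 'v) \<Rightarrow> real" where
  "op_trace f = (\<Sum>b\<in>Basis. f b \<bullet> b)"

lemma inner_expand: "(x::'a::euclidean_space) \<bullet> y = (\<Sum>b\<in>Basis. (x \<bullet> b) * (b \<bullet> y))"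
  by (subst euclidean_inner) (simp add: inner_commute)

lemma linear_inner_expand:
  fixes f :: "'a::euclidean_space \<Rightarrow> 'b::real_inner"
  assumes "linear f" shows "f x \<bullet> y = (\<Sum>b\<in>Basis. (x \<bullet> b) * (f b \<bullet> y))"
proof -
  have "f x = f (\<Sum>b\<in>Basis. (x \<bullet> b) *\<^sub>R b)" by (simp add: euclidean_representation)
  also have "\<dots> = (\<Sum>b\<in>Basis. (x \<bullet> b) *\<^sub>R f b)"
    using assms by (simp add: linear_sum linear_cmul)
  finally show ?thesis by (simp add: inner_sum_left)
qed

lemma op_trace_commute:
  fixes f :: "'a::euclidean_space \<Rightarrow> 'b::euclidean_space" and g :: "'b \<Rightarrow> 'a"
  assumes f: "linear f" and g: "linear g"
  shows "op_trace (\<lambda>x. f (g x)) = op_trace (\<lambda>x. g (f x))"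
proof -
  have "op_trace (\<lambda>x. f (g x)) = (\<Sum>b\<in>Basis. \<Sum>c\<in>Basis. (g b \<bullet> c) * (f c \<bullet> b))"
    unfolding op_trace_def by (intro sum.cong refl linear_inner_expand[OF f])
  also have "\<dots> = (\<Sum>c\<in>Basis. \<Sum>b\<in>Basis. (f c \<bullet> b) * (g b \<bullet> c))"
    by (subst sum.swap) (simp add: mult.commute)
  also have "\<dots> = op_trace (\<lambda>x. g (f x))"
    unfolding op_trace_def by (intro sum.cong refl linear_inner_expand[OF g, symmetric])
  finally show ?thesis .
qed

lemma op_trace_scaleR: "op_trace (\<lambda>x. c *\<^sub>R f x) = c * op_trace f"
  unfolding op_trace_def by (simp add: sum_distrib_left)

lemma op_trace_id: "op_trace (\<lambda>x::'v::euclidean_space. x) = DIM('v)"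
  unfolding op_trace_def by (simp add: inner_Basis)

lemma op_trace_add: "op_trace (\<lambda>x. f x + g x) = op_trace f + op_trace g"
  unfolding op_trace_def by (simp add: inner_add_left sum.distrib)

text \<open>Conjugation by \<open>B\<close> changes the sign of \<open>A\<close> but not its trace.\<close>

lemma op_trace_anticommute:
  assumes "linear A" "linear B" "\<And>v. B (B v) = c *\<^sub>R v" "c \<noteq> 0" "\<And>v. A (B v) = - B (A v)"
  shows "op_trace A = 0"
proof -
  have "c * op_trace A = op_trace (\<lambda>v. c *\<^sub>R A v)" by (simp add: op_trace_scaleR)
  also have "\<dots> = op_trace (\<lambda>v. B (B (A v)))" by (simp add: assms(3))
  also have "\<dots> = op_trace (\<lambda>v. B (A (B v)))"
    using op_trace_commute[OF assms(2), of "\<lambda>v. B (A v)"] linear_compose[OF assms(1,2)]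
    by (simp add: o_def)
  also have "\<dots> = op_trace (\<lambda>v. (- 1) *\<^sub>R B (B (A v)))"
    by (simp add: assms(5) linear_neg[OF assms(2)])
  also have "\<dots> = - op_trace (\<lambda>v. c *\<^sub>R A v)" by (subst op_trace_scaleR) (simp add: assms(3))
  also have "\<dots> = - (c * op_trace A)" by (simp add: op_trace_scaleR)
  finally show ?thesis using assms(4) by simp
qed

lemma op_trace_skew: "(\<And>u v. A u \<bullet> v = - (u \<bullet> A v)) \<Longrightarrow> op_trace A = 0"
proof -
  assume "\<And>u v. A u \<bullet> v = - (u \<bullet> A v)"
  then have "A b \<bullet> b = 0" for b by (metis inner_commute equal_neg_zero)
  then show ?thesis unfolding op_trace_def by simp
qed

section \<open>Representations of the even Clifford algebra\<close>

locale cl0_rep =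
  fixes r :: nat and \<rho> :: "clifford \<Rightarrow> 'v::euclidean_space \<Rightarrow> 'v"
  assumes rep: "algebra_rep (Cl0 r) \<rho>" and rep_one [simp]: "\<rho> 1 v = v"
begin

lemma rep_linear: "a \<in> Cl0 r \<Longrightarrow> linear (\<rho> a)"
  and rep_add: "a \<in> Cl0 r \<Longrightarrow> b \<in> Cl0 r \<Longrightarrow> \<rho> (a + b) v = \<rho> a v + \<rho> b v"
  and rep_scale: "a \<in> Cl0 r \<Longrightarrow> \<rho> (t *\<^sub>R a) v = t *\<^sub>R \<rho> a v"
  and rep_mult: "a \<in> Cl0 r \<Longrightarrow> b \<in> Cl0 r \<Longrightarrow> \<rho> (a * b) v = \<rho> a (\<rho> b v)"
  using rep unfolding algebra_rep_def by blast+

lemma basis_linear: "S \<in> even_sets r \<Longrightarrow> linear (\<rho> (cl_basis S))"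
  by (intro rep_linear cl_basis_in_Cl0)

lemma basis_mult:
  assumes "S \<in> even_sets r" "T \<in> even_sets r"
  shows "\<rho> (cl_basis S) (\<rho> (cl_basis T) v) = cl_sign S T *\<^sub>R \<rho> (cl_basis (sym_diff S T)) v"
proof -
  have "\<rho> (cl_basis S) (\<rho> (cl_basis T) v) = \<rho> (cl_basis S * cl_basis T) v"
    by (simp add: rep_mult cl_basis_in_Cl0 assms)
  also have "\<dots> = cl_sign S T *\<^sub>R \<rho> (cl_basis (sym_diff S T)) v"
    using assms by (subst cl_basis_times)
      (auto simp: even_sets_finite rep_scale cl_basis_in_Cl0 even_sets_sym_diff)
  finally show ?thesis .
qed

lemma basis_square:
  assumes "S \<in> even_sets r"
  shows "\<rho> (cl_basis S) (\<rho> (cl_basis S) v) = cl_sign S S *\<^sub>R v"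
  using basis_mult[OF assms assms, of v] by (simp add: cl_basis_empty)

lemma basis_step:
  assumes "S \<in> even_sets r" "{i, j} \<in> even_sets r"
    and "cl_basis (insert i (insert j S)) = c *\<^sub>R (cl_basis S * cl_basis {i, j})"
  shows "\<rho> (cl_basis (insert i (insert j S))) v = c *\<^sub>R \<rho> (cl_basis S) (\<rho> (cl_basis {i, j}) v)"
proof -
  have "cl_basis S * cl_basis {i, j} \<in> Cl0 r"
    using assms(1,2) by (auto simp: cl_basis_times even_sets_finite
        intro!: subspace_scale[OF subspace_Cl0] cl_basis_in_Cl0 even_sets_sym_diff)
  then show ?thesis unfolding assms(3) by (simp add: rep_scale rep_mult cl_basis_in_Cl0 assms(1,2))
qed

text \<open>Choose \<open>i \<in> S\<close> and \<open>j \<notin> S\<close>: then \<open>e\<^sub>i e\<^sub>j\<close> anticommutes with \<open>e\<^sub>S\<close>.\<close>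

lemma trace_basis_eq_0:
  assumes S: "S \<in> even_sets r" "S \<noteq> {}" "S \<noteq> {1..r}"
  shows "op_trace (\<rho> (cl_basis S)) = 0"
proof -
  have fin: "finite S" using S(1) by (rule even_sets_finite)
  obtain i where i: "i \<in> S" using S(2) by auto
  have sub: "S \<subseteq> {1..r}" using S(1) unfolding even_sets_def by auto
  then obtain j where j: "j \<in> {1..r}" "j \<notin> S" using S(3) by blast
  have "i \<noteq> j" using i j by auto
  then have T: "{i, j} \<in> even_sets r" using i j sub unfolding even_sets_def by auto
  have com: "sym_diff {i, j} S = sym_diff S {i, j}" by auto
  show ?thesis
  proof (rule op_trace_anticommute[OF basis_linear[OF S(1)] basis_linear[OF T] basis_square[OF T]])
    show "cl_sign {i, j} {i, j} \<noteq> 0" using cl_sign_pm[of "{i, j}" "{i, j}"] by auto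
    fix v
    show "\<rho> (cl_basis S) (\<rho> (cl_basis {i, j}) v) = - \<rho> (cl_basis {i, j}) (\<rho> (cl_basis S) v)"
      using basis_mult[OF S(1) T, of v] basis_mult[OF T S(1), of v]
        even_set_commutes_pair[OF i j(2) fin] by (simp add: com)
  qed
qed

lemma vol_commutes:
  assumes r: "even r" and S: "S \<in> even_sets r"
  shows "\<rho> (cl_basis S) (\<rho> (vol r) v) = \<rho> (vol r) (\<rho> (cl_basis S) v)"
proof -
  have V: "{1..r} \<in> even_sets r" using r by (rule full_even_set)
  have "S \<inter> {1..r} = S" "even (card S)" using S unfolding even_sets_def by auto
  then have "cl_sign S {1..r} = cl_sign {1..r} S"
    using cl_sign_commute_even[of S "{1..r}"] even_sets_finite[OF S] r by simp
  moreover have "sym_diff S {1..r} = sym_diff {1..r} S" by auto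
  ultimately show ?thesis unfolding vol_eq basis_mult[OF S V] basis_mult[OF V S] by simp
qed

end

definition intertwines ::
  "nat \<Rightarrow> (clifford \<Rightarrow> 'w::real_vector \<Rightarrow> 'w) \<Rightarrow> (clifford \<Rightarrow> 'v::real_vector \<Rightarrow> 'v) \<Rightarrow> ('w \<Rightarrow> 'v) \<Rightarrow> bool" where
  "intertwines r \<tau> \<rho> f \<longleftrightarrow> linear f \<and> (\<forall>a\<in>Cl0 r. \<forall>w. f (\<tau> a w) = \<rho> a (f w))"

lemma intertwinesD:
  assumes "intertwines r \<tau> \<rho> f"
  shows "linear f" "a \<in> Cl0 r \<Longrightarrow> f (\<tau> a w) = \<rho> a (f w)"
  using assms unfolding intertwines_def by auto

lemma intertwines_comp:
  "intertwines r \<tau> \<rho> f \<Longrightarrow> intertwines r \<rho> \<sigma> g \<Longrightarrow> intertwines r \<tau> \<sigma> (\<lambda>w. g (f w))"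
  unfolding intertwines_def using linear_compose[of f g] by (auto simp: o_def)

context cl0_rep
begin

lemma intertwines_scale: "intertwines r \<tau> \<rho> T \<Longrightarrow> intertwines r \<tau> \<rho> (\<lambda>w. c *\<^sub>R T w)"
  unfolding intertwines_def
  using linear_compose_scale_right[of T c] by (auto simp: linear_cmul[OF rep_linear])

lemma intertwines_add:
  "intertwines r \<tau> \<rho> S \<Longrightarrow> intertwines r \<tau> \<rho> T \<Longrightarrow> intertwines r \<tau> \<rho> (\<lambda>w. S w + T w)"
  unfolding intertwines_def
  using linear_compose_add[of S T] by (auto simp: linear_add[OF rep_linear])

lemma intertwines_diff:
  "intertwines r \<tau> \<rho> S \<Longrightarrow> intertwines r \<tau> \<rho> T \<Longrightarrow> intertwines r \<tau> \<rho> (\<lambda>w. S w - T w)"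
  using intertwines_add[of \<tau> S "\<lambda>w. (- 1) *\<^sub>R T w"] intertwines_scale[of \<tau> T "- 1"] by simp

lemma intertwines_sum:
  "(\<And>i. i \<in> A \<Longrightarrow> intertwines r \<tau> \<rho> (T i)) \<Longrightarrow> intertwines r \<tau> \<rho> (\<lambda>w. \<Sum>i\<in>A. T i w)"
  unfolding intertwines_def
  using linear_compose_sum[of A T] by (auto simp: linear_sum[OF rep_linear] intro!: sum.cong)

lemma intertwines_id: "intertwines r \<rho> \<rho> (\<lambda>w. w)"
  unfolding intertwines_def by (simp add: linear_id[unfolded id_def])

end

locale cl0_rep_pair = W: cl0_rep r \<tau> + V: cl0_rep r \<rho>
  for r and \<tau> :: "clifford \<Rightarrow> 'w::euclidean_space \<Rightarrow> 'w" and \<rho> :: "clifford \<Rightarrow> 'v::euclidean_space \<Rightarrow> 'v"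
begin

text \<open>The even monomials span the even Clifford algebra.\<close>

lemma intertwines_basisI:
  assumes "linear f" and S: "\<And>S w. S \<in> even_sets r \<Longrightarrow> f (\<tau> (cl_basis S) w) = \<rho> (cl_basis S) (f w)"
  shows "intertwines r \<tau> \<rho> f"
  unfolding intertwines_def
proof (intro conjI ballI allI assms(1))
  fix a w assume "a \<in> Cl0 r"
  then have "a \<in> span (cl_basis ` even_sets r)" unfolding Cl0_eq_span .
  then have "a \<in> Cl0 r \<and> f (\<tau> a w) = \<rho> a (f w)"
  proof (induction rule: span_induct_alt)
    case base
    have "\<tau> 0 w = 0" "\<rho> 0 (f w) = 0"
      using W.rep_scale[of 1 0 w] V.rep_scale[of 1 0 "f w"] one_in_Cl0 by simp_all
    then show ?case by (simp add: linear_0[OF assms(1)] subspace_0[OF subspace_Cl0])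
  next
    case (step c x y)
    then obtain S where x: "x = cl_basis S" "S \<in> even_sets r" by auto
    then have "x \<in> Cl0 r" by (simp add: cl_basis_in_Cl0)
    with step x show ?case
      by (auto simp: W.rep_add V.rep_add W.rep_scale V.rep_scale linear_add[OF assms(1)]
          linear_cmul[OF assms(1)] S subspace_scale[OF subspace_Cl0] intro!: subspace_add[OF subspace_Cl0])
  qed
  then show "f (\<tau> a w) = \<rho> a (f w)" ..
qed

text \<open>The products \<open>e\<^sub>i e\<^sub>j\<close> generate the even Clifford algebra, so commuting with \<open>spin(r)\<close> suffices.\<close>

lemma intertwines_pairI:
  assumes f: "linear f"
    and p: "\<And>i j w. 1 \<le> i \<Longrightarrow> i < j \<Longrightarrow> j \<le> r \<Longrightarrow> f (\<tau> (cl_gen i * cl_gen j) w) = \<rho> (cl_gen i * cl_gen j) (f w)"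
  shows "intertwines r \<tau> \<rho> f"
proof (rule intertwines_basisI[OF f])
  fix S w assume "S \<in> even_sets r"
  then show "f (\<tau> (cl_basis S) w) = \<rho> (cl_basis S) (f w)"
  proof (induction arbitrary: w rule: even_set_induct)
    case empty
    show ?case by (simp add: cl_basis_empty)
  next
    case (pair S i j)
    have "f (\<tau> (cl_basis {i, j}) w) = \<rho> (cl_basis {i, j}) (f w)" for w
      using p[of i j w] pair.hyps by (simp add: cl_basis_pair)
    then show ?case
      using pair.IH by (simp add: W.basis_step[OF pair.hyps(1,7,8)] V.basis_step[OF pair.hyps(1,7,8)]
          linear_cmul[OF f])
  qed
qed

text \<open>
  The sum of \<open>g T g\<^sup>-\<^sup>1\<close> over the group \<open>{\<plusminus>e\<^sub>S}\<close>, up to a factor \<open>2\<close>: opposite elements contribute equally,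
  and the factor \<open>cl_sign S S\<close> accounts for \<open>e\<^sub>S\<^sup>-\<^sup>1 = e\<^sub>S\<^sup>2 e\<^sub>S\<close> with \<open>e\<^sub>S\<^sup>2 = \<plusminus>1\<close>.
\<close>

definition average :: "('w \<Rightarrow> 'v) \<Rightarrow> 'w \<Rightarrow> 'v" where
  "average T w = (\<Sum>S\<in>even_sets r. cl_sign S S *\<^sub>R \<rho> (cl_basis S) (T (\<tau> (cl_basis S) w)))"

text \<open>Left multiplication by a group element permutes the summands; the cocycle property of the signs makes
  the coefficients agree.\<close>

lemma average_intertwines:
  assumes T: "linear T"
  shows "intertwines r \<tau> \<rho> (average T)"
proof (rule intertwines_basisI)
  show "linear (average T)" unfolding average_def
  proof (rule linear_compose_sum, rule ballI)
    fix S assume S: "S \<in> even_sets r"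
    have "linear (\<lambda>w. \<rho> (cl_basis S) (T (\<tau> (cl_basis S) w)))"
      using linear_compose[OF linear_compose[OF W.basis_linear[OF S] T] V.basis_linear[OF S]]
      by (simp add: o_def)
    then show "linear (\<lambda>w. cl_sign S S *\<^sub>R \<rho> (cl_basis S) (T (\<tau> (cl_basis S) w)))"
      by (rule linear_compose_scale_right)
  qed
next
  fix R w assume R: "R \<in> even_sets r"
  have inv: "sym_diff R (sym_diff R S) = S" for S by auto
  have bij: "bij_betw (sym_diff R) (even_sets r) (even_sets r)"
    by (rule bij_betwI[of _ _ _ "sym_diff R"]) (use R inv even_sets_sym_diff in auto)
  \<comment> \<open>The substitution of \<open>sym_diff R S\<close> for \<open>S\<close> turns the right factor \<open>e\<^sub>R\<close> into a left factor.\<close>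
  have "average T (\<tau> (cl_basis R) w) =
      (\<Sum>S\<in>even_sets r. (cl_sign S S * cl_sign S R) *\<^sub>R \<rho> (cl_basis S) (T (\<tau> (cl_basis (sym_diff S R)) w)))"
    unfolding average_def
    by (intro sum.cong refl)
      (simp add: W.basis_mult[OF _ R] linear_cmul[OF T] linear_cmul[OF V.basis_linear])
  also have "\<dots> = (\<Sum>S\<in>even_sets r.
      (cl_sign (sym_diff R S) (sym_diff R S) * cl_sign R (sym_diff R S)) *\<^sub>R
        \<rho> (cl_basis S) (T (\<tau> (cl_basis (sym_diff R S)) w)))"
  proof (rule sum.cong[OF refl])
    fix S assume S: "S \<in> even_sets r"
    have "cl_sign (sym_diff R S) (sym_diff R S) * cl_sign R (sym_diff R S) =
       cl_sign R R * cl_sign R S * (cl_sign S R * cl_sign S S) * (cl_sign R R * cl_sign R S)"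
      using even_sets_finite[OF S] even_sets_finite[OF R]
      by (simp only: cl_sign_sym_diff_left cl_sign_sym_diff_right finite_Un finite_Diff ac_simps)
    also have "\<dots> = cl_sign S S * cl_sign S R" by (simp add: ac_simps)
    finally have 1: "cl_sign (sym_diff R S) (sym_diff R S) * cl_sign R (sym_diff R S) =
      cl_sign S S * cl_sign S R" .
    have "sym_diff S R = sym_diff R S" by auto
    then show "(cl_sign S S * cl_sign S R) *\<^sub>R \<rho> (cl_basis S) (T (\<tau> (cl_basis (sym_diff S R)) w)) =
      (cl_sign (sym_diff R S) (sym_diff R S) * cl_sign R (sym_diff R S)) *\<^sub>R
        \<rho> (cl_basis S) (T (\<tau> (cl_basis (sym_diff R S)) w))" unfolding 1 by simp
  qed
  also have "\<dots> = (\<Sum>S\<in>even_sets r.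
      (cl_sign S S * cl_sign R S) *\<^sub>R \<rho> (cl_basis (sym_diff R S)) (T (\<tau> (cl_basis S) w)))"
    by (subst sum.reindex_bij_betw[OF bij, symmetric]) (simp only: inv)
  also have "\<dots> = \<rho> (cl_basis R) (average T w)"
    unfolding average_def linear_sum[OF V.basis_linear[OF R]]
    by (intro sum.cong refl) (simp add: linear_cmul[OF V.basis_linear[OF R]] V.basis_mult[OF R])
  finally show "average T (\<tau> (cl_basis R) w) = \<rho> (cl_basis R) (average T w)" .
qed

text \<open>If all averages of rank one operators were killed by \<open>C\<close>, then so would be their matrix
  coefficients, which add up to the pairing of the two characters.\<close>

lemma exists_intertwiner_trace:
  assumes C: "linear C"
    and nz: "(\<Sum>S\<in>even_sets r. cl_sign S S * op_trace (\<tau> (cl_basis S)) *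
      op_trace (\<lambda>v. C (\<rho> (cl_basis S) v))) \<noteq> 0"
  obtains f w where "intertwines r \<tau> \<rho> f" "C (f w) \<noteq> 0"
proof -
  have "\<exists>f w. intertwines r \<tau> \<rho> f \<and> C (f w) \<noteq> 0"
  proof (rule ccontr)
    assume no: "\<not> ?thesis"
    have z: "(\<Sum>S\<in>even_sets r. cl_sign S S * (\<tau> (cl_basis S) b \<bullet> b) * (C (\<rho> (cl_basis S) c) \<bullet> c)) = 0"
      for b c
    proof -
      let ?T = "\<lambda>w. (w \<bullet> b) *\<^sub>R c"
      have lin: "linear ?T" by (intro linearI) (simp_all add: inner_add_left scaleR_add_left)
      have "C (average ?T b) = 0" using no average_intertwines[OF lin] by blast
      then have "0 = C (average ?T b) \<bullet> c" by simp
      also have "\<dots> = (\<Sum>S\<in>even_sets r. cl_sign S S * (\<tau> (cl_basis S) b \<bullet> b) * (C (\<rho> (cl_basis S) c) \<bullet> c))"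
        unfolding average_def linear_sum[OF C] inner_sum_left
        by (intro sum.cong refl) (simp add: linear_cmul[OF C] linear_cmul[OF V.basis_linear])
      finally show ?thesis by simp
    qed
    have "(\<Sum>S\<in>even_sets r. cl_sign S S * op_trace (\<tau> (cl_basis S)) *
        op_trace (\<lambda>v. C (\<rho> (cl_basis S) v))) =
      (\<Sum>S\<in>even_sets r. \<Sum>b\<in>Basis. \<Sum>c\<in>Basis.
        cl_sign S S * (\<tau> (cl_basis S) b \<bullet> b) * (C (\<rho> (cl_basis S) c) \<bullet> c))"
      unfolding op_trace_def by (simp only: mult.assoc sum_product) (simp only: sum_distrib_left)
    also have "\<dots> = (\<Sum>b\<in>Basis. \<Sum>S\<in>even_sets r. \<Sum>c\<in>Basis.
        cl_sign S S * (\<tau> (cl_basis S) b \<bullet> b) * (C (\<rho> (cl_basis S) c) \<bullet> c))"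
      by (rule sum.swap)
    also have "\<dots> = (\<Sum>b\<in>Basis. \<Sum>c\<in>Basis. \<Sum>S\<in>even_sets r.
        cl_sign S S * (\<tau> (cl_basis S) b \<bullet> b) * (C (\<rho> (cl_basis S) c) \<bullet> c))"
      by (intro sum.cong refl sum.swap)
    also have "\<dots> = 0" by (simp add: z)
    finally show False using nz by simp
  qed
  then show thesis using that by blast
qed

end

section \<open>Orthogonal representations\<close>

locale orthogonal_rep = cl0_rep +
  assumes skew: "spin_skew r \<rho>"
begin

text \<open>The generators \<open>e\<^sub>i e\<^sub>j\<close> act by skew operators with square \<open>-1\<close>, and these are isometries.\<close>

lemma basis_isometry: "S \<in> even_sets r \<Longrightarrow> \<rho> (cl_basis S) u \<bullet> \<rho> (cl_basis S) v = u \<bullet> v"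
proof (induction arbitrary: u v rule: even_set_induct)
  case empty
  show ?case by (simp add: cl_basis_empty)
next
  case (pair S i j)
  have "cl_sign {i, j} {i, j} = -1"
    using cl_sign_insert_self[of "{j}" i] cl_sign_insert_self[of "{}" j] pair.hyps by simp
  then have "\<rho> (cl_basis {i, j}) (\<rho> (cl_basis {i, j}) v) = - v" for v
    using basis_square[OF pair.hyps(7)] by simp
  moreover have "\<rho> (cl_basis {i, j}) u \<bullet> v = - (u \<bullet> \<rho> (cl_basis {i, j}) v)" for u v
    using skew pair.hyps unfolding spin_skew_def skew_def by (metis cl_basis_pair)
  ultimately have "\<rho> (cl_basis {i, j}) u \<bullet> \<rho> (cl_basis {i, j}) v = u \<bullet> v" for u v by simp
  then show ?case using pair.IH by (simp add: basis_step[OF pair.hyps(1,7,8)])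
qed

lemma basis_adjoint:
  assumes "S \<in> even_sets r"
  shows "\<rho> (cl_basis S) u \<bullet> v = cl_sign S S * (u \<bullet> \<rho> (cl_basis S) v)"
proof -
  have "\<rho> (cl_basis S) u \<bullet> v = cl_sign S S * (\<rho> (cl_basis S) u \<bullet> \<rho> (cl_basis S) (\<rho> (cl_basis S) v))"
    by (simp add: basis_square[OF assms])
  then show ?thesis by (simp add: basis_isometry[OF assms])
qed

text \<open>For \<open>r \<equiv> 2\<close> modulo \<open>4\<close> the volume element has square \<open>-1\<close> and is therefore skew.\<close>

lemma trace_vol_eq_0:
  assumes "r mod 4 = 2" shows "op_trace (\<rho> (vol r)) = 0"
proof (rule op_trace_skew)
  have "even r" using assms by presburger
  then show "\<rho> (vol r) u \<bullet> v = - (u \<bullet> \<rho> (vol r) v)" for u v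
    unfolding vol_eq using basis_adjoint[OF full_even_set] cl_sign_vol_2[OF assms] by simp
qed

end

text \<open>Only the monomials \<open>1\<close> and \<open>vol\<close> have a nonzero trace, so the pairing of the characters is
  \<open>dim W\<close> times \<open>tr C\<close>, to which \<open>vol\<close> adds a summand of the same sign if \<open>4\<close> divides \<open>r\<close>.  The operator
  \<open>C\<close> serves to prescribe where the values of the intertwiner should lie.\<close>

lemma exists_intertwiner:
  fixes \<tau> :: "clifford \<Rightarrow> 'w::euclidean_space \<Rightarrow> 'w" and \<rho> :: "clifford \<Rightarrow> 'v::euclidean_space \<Rightarrow> 'v"
  assumes W: "orthogonal_rep r \<tau>" and V: "cl0_rep r \<rho>" and C: "linear C" "op_trace C \<noteq> 0"
    and r: "r > 0"
    and vol: "r mod 4 = 0 \<Longrightarrow> (\<forall>w. \<tau> (vol r) w = \<epsilon> *\<^sub>R w) \<and> (\<forall>v. C (\<rho> (vol r) v) = \<epsilon> *\<^sub>R C v) \<and> \<epsilon> \<noteq> 0"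
  obtains f w where "intertwines r \<tau> \<rho> f" "C (f w) \<noteq> 0"
proof -
  interpret W: orthogonal_rep r \<tau> by (rule W)
  interpret cl0_rep_pair r \<tau> \<rho> by (intro cl0_rep_pair.intro W.cl0_rep_axioms V)
  let ?t = "\<lambda>S. cl_sign S S * op_trace (\<tau> (cl_basis S)) * op_trace (\<lambda>v. C (\<rho> (cl_basis S) v))"
  have t0: "?t {} = DIM('w) * op_trace C"
  proof -
    have "\<tau> 1 = (\<lambda>w. w)" by auto
    then show ?thesis by (simp add: cl_basis_empty op_trace_id)
  qed
  have "(\<Sum>S\<in>even_sets r. ?t S) \<noteq> 0"
  proof (cases "r mod 4 = 0")
    case False
    have "(\<Sum>S\<in>even_sets r. ?t S) = (\<Sum>S\<in>{{}}. ?t S)"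
    proof (rule sum.mono_neutral_right)
      show "\<forall>S\<in>even_sets r - {{}}. ?t S = 0"
      proof
        fix S assume S: "S \<in> even_sets r - {{}}"
        show "?t S = 0"
        proof (cases "S = {1..r}")
          case True
          then have "even r" using S unfolding even_sets_def by simp
          then have "r mod 4 = 2" using False by presburger
          then show ?thesis using W.trace_vol_eq_0 True unfolding vol_eq by simp
        next
          case False
          then show ?thesis using S by (simp add: W.trace_basis_eq_0)
        qed
      qed
    qed auto
    then show ?thesis using t0 C by simp
  next
    case True
    then have ev: "even r" by presburger
    have tv: "\<tau> (vol r) = (\<lambda>w. \<epsilon> *\<^sub>R w)" using vol[OF True] by blast
    have t1: "?t {1..r} = \<epsilon> ^ 2 * (DIM('w) * op_trace C)"
      using vol[OF True] cl_sign_vol_0[OF True]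
      unfolding vol_eq[symmetric] tv by (simp add: op_trace_scaleR op_trace_id power2_eq_square)
    have "(\<Sum>S\<in>even_sets r. ?t S) = (\<Sum>S\<in>{{}, {1..r}}. ?t S)"
      using W.trace_basis_eq_0 by (intro sum.mono_neutral_right) (use full_even_set[OF ev] in auto)
    also have "\<dots> = ?t {} + ?t {1..r}" using r by simp
    also note t1
    also have "?t {} + \<epsilon> ^ 2 * (DIM('w) * op_trace C) = (1 + \<epsilon> ^ 2) * (DIM('w) * op_trace C)"
      unfolding t0 by (simp add: algebra_simps)
    also have "\<dots> \<noteq> 0" using C by (simp add: add_nonneg_eq_0_iff)
    finally show ?thesis .
  qed
  then show thesis using exists_intertwiner_trace[OF C(1)] that by blast
qed

section \<open>Schur's lemma\<close>

text \<open>Monomials are selfadjoint or skew, with the same sign on both sides.\<close>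

lemma adjoint_intertwines:
  assumes W: "orthogonal_rep r \<tau>" and V: "orthogonal_rep r \<rho>" and f: "intertwines r \<tau> \<rho> f"
  shows "intertwines r \<rho> \<tau> (adjoint f)"
proof -
  interpret W: orthogonal_rep r \<tau> by (rule W)
  interpret V: orthogonal_rep r \<rho> by (rule V)
  interpret cl0_rep_pair r \<rho> \<tau> by (intro cl0_rep_pair.intro W.cl0_rep_axioms V.cl0_rep_axioms)
  note lf = intertwinesD(1)[OF f]
  show ?thesis
  proof (rule intertwines_basisI[OF adjoint_linear[OF lf]])
    fix S v assume S: "S \<in> even_sets r"
    show "adjoint f (\<rho> (cl_basis S) v) = \<tau> (cl_basis S) (adjoint f v)"
    proof (rule vector_eq_rdot[THEN iffD1], rule allI)
      fix w
      have "adjoint f (\<rho> (cl_basis S) v) \<bullet> w = cl_sign S S * (v \<bullet> \<rho> (cl_basis S) (f w))"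
        by (simp add: adjoint_clauses[OF lf] V.basis_adjoint[OF S])
      also have "\<dots> = cl_sign S S * (v \<bullet> f (\<tau> (cl_basis S) w))"
        by (simp add: intertwinesD(2)[OF f cl_basis_in_Cl0[OF S]])
      also have "\<dots> = \<tau> (cl_basis S) (adjoint f v) \<bullet> w"
        by (simp add: adjoint_clauses[OF lf] W.basis_adjoint[OF S])
      finally show "adjoint f (\<rho> (cl_basis S) v) \<bullet> w = \<tau> (cl_basis S) (adjoint f v) \<bullet> w" .
    qed
  qed
qed

text \<open>A nonnegative quadratic function that vanishes at \<open>0\<close> has a critical point there.\<close>

lemma nonneg_quadratic_linear_term:
  fixes \<beta> \<gamma> :: real
  assumes "\<And>t. 0 \<le> 2 * t * \<beta> + t\<^sup>2 * \<gamma>"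
  shows "\<beta> = 0"
proof (rule ccontr)
  assume b: "\<beta> \<noteq> 0"
  have g: "\<gamma> \<ge> 0" using assms[of 1] assms[of "-1"] by simp
  \<comment> \<open>A step against the sign of \<open>\<beta>\<close>, short enough for the linear term to dominate.\<close>
  define s where "s = 1 / (\<gamma> + 1)"
  have s: "s > 0" "s * \<gamma> < 2" unfolding s_def using g by (simp_all add: field_simps)
  have "2 * (- \<beta> * s) * \<beta> + (- \<beta> * s)\<^sup>2 * \<gamma> = \<beta>\<^sup>2 * s * (s * \<gamma> - 2)"
    by (simp add: algebra_simps power2_eq_square)
  also have "\<dots> < 0" using b s by (intro mult_pos_neg) simp_all
  finally show False using assms[of "- \<beta> * s"] by simp
qed

text \<open>A maximiser \<open>u\<close> of the Rayleigh quotient, with value \<open>c\<close>, is a zero of the positive semidefinite form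
  of \<open>c - h\<close>, and so lies in its kernel.\<close>

lemma symmetric_has_eigenvector:
  fixes h :: "'w::euclidean_space \<Rightarrow> 'w"
  assumes h: "linear h" and sym: "\<And>u v. h u \<bullet> v = u \<bullet> h v"
  obtains u c where "u \<noteq> 0" "h u = c *\<^sub>R u"
proof -
  have "continuous_on (sphere 0 1) (\<lambda>u. h u \<bullet> u)"
    by (intro continuous_intros linear_continuous_on_compose[OF _ h])
  then obtain u where u: "norm u = 1" and max: "\<And>v. norm v = 1 \<Longrightarrow> h v \<bullet> v \<le> h u \<bullet> u"
    using continuous_attains_sup[of "sphere (0::'w) 1" "\<lambda>u. h u \<bullet> u"] by force
  define c where "c = h u \<bullet> u"
  have pos: "0 \<le> c * (v \<bullet> v) - h v \<bullet> v" for v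
  proof (cases "v = 0")
    case False
    have "h (v /\<^sub>R norm v) \<bullet> (v /\<^sub>R norm v) \<le> c" unfolding c_def by (rule max) (simp add: False)
    then have "(h v \<bullet> v) / (norm v * norm v) \<le> c" by (simp add: linear_cmul[OF h] field_simps)
    then show ?thesis using False by (simp add: pos_divide_le_eq dot_square_norm power2_eq_square)
  qed (simp add: linear_0[OF h])
  have "(c *\<^sub>R u - h u) \<bullet> v = 0" for v
  proof (rule nonneg_quadratic_linear_term[where \<gamma> = "c * (v \<bullet> v) - h v \<bullet> v"])
    fix t
    have uu: "u \<bullet> u = 1" using u by (simp add: dot_square_norm)
    have "h v \<bullet> u = h u \<bullet> v" using sym[of u v] by (simp add: inner_commute)
    then have "c * ((u + t *\<^sub>R v) \<bullet> (u + t *\<^sub>R v)) - h (u + t *\<^sub>R v) \<bullet> (u + t *\<^sub>R v) =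
        2 * t * ((c *\<^sub>R u - h u) \<bullet> v) + t\<^sup>2 * (c * (v \<bullet> v) - h v \<bullet> v)"
      using uu by (simp add: linear_add[OF h] linear_cmul[OF h] algebra_simps power2_eq_square
          c_def inner_commute)
    then show "0 \<le> 2 * t * ((c *\<^sub>R u - h u) \<bullet> v) + t\<^sup>2 * (c * (v \<bullet> v) - h v \<bullet> v)"
      using pos[of "u + t *\<^sub>R v"] by simp
  qed
  then have "h u = c *\<^sub>R u" using inner_eq_zero_iff[of "c *\<^sub>R u - h u"] by simp
  moreover have "u \<noteq> 0" using u by auto
  ultimately show thesis using that by blast
qed

locale irreducible_rep = orthogonal_rep r \<tau>
  for r and \<tau> :: "clifford \<Rightarrow> 'w::euclidean_space \<Rightarrow> 'w" +
  assumes irreducible: "subspace U \<Longrightarrow> (\<And>a. a \<in> Cl0 r \<Longrightarrow> \<tau> a ` U \<subseteq> U) \<Longrightarrow> U = {0} \<or> U = UNIV"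
begin

text \<open>The kernel is an invariant subspace.\<close>

lemma intertwiner_inj:
  assumes f: "intertwines r \<tau> \<rho> f" and nz: "f w \<noteq> 0"
    and lin: "\<And>a. a \<in> Cl0 r \<Longrightarrow> linear (\<rho> a)"
  shows "inj f"
proof -
  note lf = intertwinesD(1)[OF f]
  have "{w. f w = 0} = {0} \<or> {w. f w = 0} = UNIV"
    by (rule irreducible)
      (auto simp: linear_subspace_kernel[OF lf] intertwinesD(2)[OF f] linear_0[OF lin])
  then have "{w. f w = 0} = {0}" using nz by auto
  then show ?thesis using linear_injective_0[OF lf] by auto
qed

text \<open>Every eigenspace is invariant, and there is one.\<close>

lemma schur_symmetric:
  assumes h: "intertwines r \<tau> \<tau> h" and sym: "\<And>u v. h u \<bullet> v = u \<bullet> h v"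
  obtains c where "\<And>w. h w = c *\<^sub>R w"
proof -
  note lh = intertwinesD(1)[OF h]
  obtain u c where u: "u \<noteq> 0" "h u = c *\<^sub>R u"
    by (rule symmetric_has_eigenvector[OF lh sym]) blast
  have "{w. h w = c *\<^sub>R w} = {0} \<or> {w. h w = c *\<^sub>R w} = UNIV"
  proof (rule irreducible)
    show "subspace {w. h w = c *\<^sub>R w}"
      by (rule subspaceI) (auto simp: linear_0[OF lh] linear_add[OF lh] linear_cmul[OF lh] scaleR_add_right)
    show "\<tau> a ` {w. h w = c *\<^sub>R w} \<subseteq> {w. h w = c *\<^sub>R w}" if "a \<in> Cl0 r" for a
      using intertwinesD(2)[OF h that] linear_cmul[OF rep_linear[OF that]] by auto
  qed
  then have "{w. h w = c *\<^sub>R w} = UNIV" using u by auto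
  then show thesis using that by auto
qed

section \<open>The commutant of an irreducible representation\<close>

definition skew_comm :: "('w \<Rightarrow> 'w) \<Rightarrow> bool" where
  "skew_comm T \<longleftrightarrow> intertwines r \<tau> \<tau> T \<and> (\<forall>u v. T u \<bullet> v = - (u \<bullet> T v))"

lemma skew_commD:
  assumes "skew_comm T"
  shows "intertwines r \<tau> \<tau> T" "linear T" "T u \<bullet> v = - (u \<bullet> T v)" "T (u + v) = T u + T v"
    "T (u - v) = T u - T v" "T (- u) = - T u" "T (c *\<^sub>R u) = c *\<^sub>R T u" "T 0 = 0"
  using assms linear_add[of T u v] linear_cmul[of T c u] linear_diff[of T u v] linear_neg[of T u] linear_0[of T]
  unfolding skew_comm_def intertwines_def by auto

lemma skew_comm_scale: "skew_comm T \<Longrightarrow> skew_comm (\<lambda>w. c *\<^sub>R T w)"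
  unfolding skew_comm_def by (auto intro: intertwines_scale)

lemma skew_comm_add: "skew_comm S \<Longrightarrow> skew_comm T \<Longrightarrow> skew_comm (\<lambda>w. S w + T w)"
  unfolding skew_comm_def by (auto intro: intertwines_add simp: inner_add_left inner_add_right)

text \<open>The symmetric part \<open>(T + T\<^sup>*)/2\<close> is a scalar by Schur's lemma.\<close>

lemma commutant_decompose:
  assumes T: "intertwines r \<tau> \<tau> T"
  obtains a T' where "skew_comm T'" "\<And>w. T w = a *\<^sub>R w + T' w"
proof -
  note lT = intertwinesD(1)[OF T]
  have adj: "intertwines r \<tau> \<tau> (adjoint T)"
    by (rule adjoint_intertwines[OF orthogonal_rep_axioms orthogonal_rep_axioms T])
  obtain c where c: "\<And>w. T w + adjoint T w = c *\<^sub>R w"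
    by (rule schur_symmetric[OF intertwines_add[OF T adj]])
      (auto simp: inner_add_left inner_add_right adjoint_clauses[OF lT])
  let ?T = "\<lambda>w. (1 / 2) *\<^sub>R (T w + (- 1) *\<^sub>R adjoint T w)"
  have "intertwines r \<tau> \<tau> ?T"
    by (intro intertwines_scale intertwines_add T adj)
  moreover have "?T u \<bullet> v = - (u \<bullet> ?T v)" for u v
    by (simp add: inner_diff_left inner_diff_right adjoint_clauses[OF lT] field_simps)
  ultimately have "skew_comm ?T" unfolding skew_comm_def by blast
  moreover have "T w = (c / 2) *\<^sub>R w + ?T w" for w
  proof -
    have "(c / 2) *\<^sub>R w = (1 / 2) *\<^sub>R (T w + adjoint T w)" unfolding c by simp
    then have "(c / 2) *\<^sub>R w + ?T w = (1 / 2) *\<^sub>R (T w + T w)"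
      by (simp add: algebra_simps)
    also have "\<dots> = T w" by (simp add: scaleR_2[symmetric])
    finally show ?thesis by simp
  qed
  ultimately show thesis using that by blast
qed

lemma skew_comm_anticommutator:
  assumes S: "skew_comm S" and T: "skew_comm T"
  obtains c where "\<And>w. S (T w) + T (S w) = c *\<^sub>R w"
proof (rule schur_symmetric)
  show "intertwines r \<tau> \<tau> (\<lambda>w. S (T w) + T (S w))"
    by (intro intertwines_add intertwines_comp[OF skew_commD(1)[OF T] skew_commD(1)[OF S]]
        intertwines_comp[OF skew_commD(1)[OF S] skew_commD(1)[OF T]])
  show "(S (T u) + T (S u)) \<bullet> v = u \<bullet> (S (T v) + T (S v))" for u v
    by (simp add: inner_add_left inner_add_right skew_commD(3)[OF S] skew_commD(3)[OF T])
qed (use that in blast)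

definition unit_comm :: "('w \<Rightarrow> 'w) \<Rightarrow> bool" where
  "unit_comm I \<longleftrightarrow> skew_comm I \<and> (\<forall>w. I (I w) = - w)"

lemma unit_commD: "unit_comm I \<Longrightarrow> skew_comm I" "unit_comm I \<Longrightarrow> I (I w) = - w"
  unfolding unit_comm_def by auto

text \<open>The square of a skew element of the commutant is symmetric, hence a nonpositive scalar.\<close>

lemma skew_comm_normalize:
  assumes T: "skew_comm T" and nz: "T w0 \<noteq> 0"
  obtains c where "unit_comm (\<lambda>w. c *\<^sub>R T w)" "c \<noteq> 0"
proof -
  note D = skew_commD[OF T]
  obtain c where c: "\<And>w. T (T w) = c *\<^sub>R w"
  proof (rule skew_comm_anticommutator[OF T T])
    fix c assume *: "\<And>w. T (T w) + T (T w) = c *\<^sub>R w"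
    have "T (T w) = (c / 2) *\<^sub>R w" for w
    proof -
      have "2 *\<^sub>R T (T w) = c *\<^sub>R w" using * by (simp add: scaleR_2)
      then have "(1/2) *\<^sub>R (2 *\<^sub>R T (T w)) = (1/2) *\<^sub>R (c *\<^sub>R w)" by simp
      then show ?thesis by simp
    qed
    then show thesis by (rule that)
  qed
  have "c * (w0 \<bullet> w0) = T (T w0) \<bullet> w0" by (simp add: c)
  also have "\<dots> = - (T w0 \<bullet> T w0)" using D(3)[of "T w0" w0] by simp
  also have "\<dots> < 0" using nz by simp
  finally have neg: "c < 0" by (smt (verit) inner_ge_zero mult_nonneg_nonneg)
  define k where "k = 1 / sqrt (- c)"
  have k: "k * k * c = - 1" "k \<noteq> 0"
  proof -
    have "sqrt (- c) * sqrt (- c) = - c" using neg by simp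
    then show "k * k * c = - 1" unfolding k_def using neg by (simp add: field_simps)
    show "k \<noteq> 0" unfolding k_def using neg by simp
  qed
  have "unit_comm (\<lambda>w. k *\<^sub>R T w)"
    unfolding unit_comm_def using skew_comm_scale[OF T] k(1)[unfolded mult.assoc] by (simp add: D c)
  then show thesis using that k(2) by blast
qed

definition quaternion_comm :: "('w \<Rightarrow> 'w) \<Rightarrow> ('w \<Rightarrow> 'w) \<Rightarrow> ('w \<Rightarrow> 'w) \<Rightarrow> bool" where
  "quaternion_comm I J K \<longleftrightarrow> unit_comm I \<and> unit_comm J \<and> unit_comm K \<and>
     (\<forall>w. I (J w) = K w \<and> J (K w) = I w \<and> K (I w) = J w)"

lemma quaternion_commD:
  assumes "quaternion_comm I J K"
  shows "skew_comm I" "skew_comm J" "skew_comm K"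
    "I (I w) = - w" "J (J w) = - w" "K (K w) = - w"
    "I (J w) = K w" "J (K w) = I w" "K (I w) = J w"
    "J (I w) = - K w" "K (J w) = - I w" "I (K w) = - J w"
proof -
  note D = assms[unfolded quaternion_comm_def unit_comm_def]
  show I: "skew_comm I" "skew_comm J" "skew_comm K"
    and s: "I (I w) = - w" "J (J w) = - w" "K (K w) = - w"
    and p: "I (J w) = K w" "J (K w) = I w" "K (I w) = J w" for w
    using D by auto
  have "J (I w) = J (J (K w))" using D by simp
  then show "J (I w) = - K w" using s by simp
  have "K (J w) = K (K (I w))" using D by simp
  then show "K (J w) = - I w" using s by simp
  have "I (K w) = I (I (J w))" using D by simp
  then show "I (K w) = - J w" using s by simp
qed

text \<open>Anticommutators of skew elements are scalars, so a suitable combination of \<open>I\<close>, \<open>J\<close>, \<open>K\<close> can be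
  subtracted from \<open>T\<close> to leave an \<open>R\<close> anticommuting with all three.  But then \<open>R\<close> also commutes with
  \<open>K = I J\<close>, hence \<open>R K = 0\<close> and \<open>R = 0\<close>.\<close>

lemma quaternion_comm_span:
  assumes Q: "quaternion_comm I J K" and T: "skew_comm T"
  obtains a b c where "\<And>w. T w = a *\<^sub>R I w + b *\<^sub>R J w + c *\<^sub>R K w"
proof -
  note q = quaternion_commD[OF Q]
  note lin = skew_commD(4-8)[OF q(1)] skew_commD(4-8)[OF q(2)] skew_commD(4-8)[OF q(3)]
  obtain a where a: "\<And>w. T (I w) + I (T w) = a *\<^sub>R w" by (rule skew_comm_anticommutator[OF T q(1)]) blast
  obtain b where b: "\<And>w. T (J w) + J (T w) = b *\<^sub>R w" by (rule skew_comm_anticommutator[OF T q(2)]) blast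
  obtain c where c: "\<And>w. T (K w) + K (T w) = c *\<^sub>R w" by (rule skew_comm_anticommutator[OF T q(3)]) blast
  define R where "R w = T w + (a / 2) *\<^sub>R I w + (b / 2) *\<^sub>R J w + (c / 2) *\<^sub>R K w" for w
  have R: "skew_comm R" unfolding R_def
    by (intro skew_comm_add skew_comm_scale T q)
  have half: "(x / 2) *\<^sub>R w + (x / 2) *\<^sub>R w = x *\<^sub>R w" for x and w :: 'w
    by (simp add: scaleR_add_left[symmetric])
  have RI: "R (I w) = - I (R w)" for w
  proof -
    have "R (I w) + I (R w) = (T (I w) + I (T w)) - ((a / 2) *\<^sub>R w + (a / 2) *\<^sub>R w)"
      unfolding R_def by (simp add: lin q)
    then have "R (I w) + I (R w) = 0" by (simp add: a half)
    then show ?thesis by (simp add: eq_neg_iff_add_eq_0)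
  qed
  have RJ: "R (J w) = - J (R w)" for w
  proof -
    have "R (J w) + J (R w) = (T (J w) + J (T w)) - ((b / 2) *\<^sub>R w + (b / 2) *\<^sub>R w)"
      unfolding R_def by (simp add: lin q)
    then have "R (J w) + J (R w) = 0" by (simp add: b half)
    then show ?thesis by (simp add: eq_neg_iff_add_eq_0)
  qed
  have RK: "R (K w) = - K (R w)" for w
  proof -
    have "R (K w) + K (R w) = (T (K w) + K (T w)) - ((c / 2) *\<^sub>R w + (c / 2) *\<^sub>R w)"
      unfolding R_def by (simp add: lin q)
    then have "R (K w) + K (R w) = 0" by (simp add: c half)
    then show ?thesis by (simp add: eq_neg_iff_add_eq_0)
  qed
  have R0: "R w = 0" for w
  proof -
    have "R (K w) = R (I (J w))" by (simp add: q)
    also have "\<dots> = - I (R (J w))" by (rule RI)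
    also have "\<dots> = I (J (R w))" by (simp only: RJ lin minus_minus)
    also have "\<dots> = K (R w)" by (rule q)
    finally have "K (R w) = - K (R w)" using RK by simp
    then have "2 *\<^sub>R K (R w) = 0" by (simp add: scaleR_2 eq_neg_iff_add_eq_0)
    then have "K (R w) = 0" by simp
    then have "K (K (R w)) = 0" by (simp add: lin)
    then show ?thesis by (simp add: q)
  qed
  have "T w = (- a / 2) *\<^sub>R I w + (- b / 2) *\<^sub>R J w + (- c / 2) *\<^sub>R K w" for w
    using R0[of w] unfolding R_def by (simp add: algebra_simps eq_neg_iff_add_eq_0)
  then show thesis by (rule that)
qed

text \<open>
  Frobenius' theorem.  If \<open>I\<close> does not span the skew elements, then some skew \<open>T\<close> can be corrected by a
  multiple of \<open>I\<close> to anticommute with \<open>I\<close>; normalised, it is a \<open>J\<close>, and \<open>K = I J\<close> completes the quaternions.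
\<close>

lemma commutant_trichotomy:
  obtains (real) "\<And>T w. skew_comm T \<Longrightarrow> T w = 0"
  | (complex) I where "unit_comm I" "\<And>T. skew_comm T \<Longrightarrow> \<exists>c. \<forall>w. T w = c *\<^sub>R I w"
  | (quaternionic) I J K where "quaternion_comm I J K"
proof (cases "\<forall>T. skew_comm T \<longrightarrow> (\<forall>w. T w = 0)")
  case True
  then show thesis using that(1) by auto
next
  case False
  then obtain T0 w0 where "skew_comm T0" "T0 w0 \<noteq> 0" by auto
  then obtain I where I: "unit_comm I" using skew_comm_normalize by blast
  note sI = unit_commD(1)[OF I] and II = unit_commD(2)[OF I]
  note linI = skew_commD(4-8)[OF sI]
  show thesis
  proof (cases "\<forall>T. skew_comm T \<longrightarrow> (\<exists>c. \<forall>w. T w = c *\<^sub>R I w)")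
    case True
    then show thesis using that(2) I by auto
  next
    case False
    then obtain T where T: "skew_comm T" "\<And>c. \<exists>w. T w \<noteq> c *\<^sub>R I w" by auto
    obtain c where c: "\<And>w. I (T w) + T (I w) = c *\<^sub>R w" by (rule skew_comm_anticommutator[OF sI T(1)]) blast
    define R where "R w = T w + (c / 2) *\<^sub>R I w" for w
    have R: "skew_comm R" unfolding R_def by (intro skew_comm_add skew_comm_scale T sI)
    obtain w1 where "T w1 \<noteq> (- c / 2) *\<^sub>R I w1" using T(2) by blast
    then have nz: "R w1 \<noteq> 0" unfolding R_def by (simp add: eq_neg_iff_add_eq_0)
    have anti: "R (I w) = - I (R w)" for w
    proof -
      have "R (I w) + I (R w) = (I (T w) + T (I w)) - ((c / 2) *\<^sub>R w + (c / 2) *\<^sub>R w)"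
        unfolding R_def by (simp add: linI II)
      then have "R (I w) + I (R w) = 0" by (simp add: c scaleR_add_left[symmetric])
      then show ?thesis by (simp add: eq_neg_iff_add_eq_0)
    qed
    obtain k where k: "unit_comm (\<lambda>w. k *\<^sub>R R w)" "k \<noteq> 0"
      by (rule skew_comm_normalize[OF R nz])
    define J where "J w = k *\<^sub>R R w" for w
    have J: "unit_comm J" using k(1) unfolding J_def .
    note sJ = unit_commD(1)[OF J] and JJ = unit_commD(2)[OF J]
    note linJ = skew_commD(4-8)[OF sJ]
    have JI: "J (I w) = - I (J w)" for w unfolding J_def by (simp add: anti linI)
    define K where "K w = I (J w)" for w
    have "intertwines r \<tau> \<tau> K" unfolding K_def
      by (rule intertwines_comp[OF skew_commD(1)[OF sJ] skew_commD(1)[OF sI]])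
    moreover have "K u \<bullet> v = - (u \<bullet> K v)" for u v
      unfolding K_def using JI[of v] by (simp add: skew_commD(3)[OF sI] skew_commD(3)[OF sJ])
    ultimately have sK: "skew_comm K" unfolding skew_comm_def by blast
    have "quaternion_comm I J K"
      unfolding quaternion_comm_def unit_comm_def using sI sJ sK
      by (simp add: K_def II JJ JI linI linJ)
    then show thesis by (rule that(3))
  qed
qed

end

lemma spin_lie_subset_Cl0: "lcarrier (spin_lie r) \<subseteq> Cl0 r"
proof -
  have "cl_gen i * cl_gen j \<in> Cl0 r" if "1 \<le> i" "i < j" "j \<le> r" for i j
    using that cl_basis_in_Cl0[of "{i, j}" r] by (simp add: cl_basis_pair even_sets_def)
  then show ?thesis
    unfolding spin_lie_def lie_algebra.simps by (intro span_minimal[OF _ subspace_Cl0]) auto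
qed

section \<open>The Frobenius-Schur indicator\<close>

lemma cl_sign_self: "finite S \<Longrightarrow> cl_sign S S = (-1) ^ (card S * (card S + 1) div 2)"
proof (induction S rule: finite_induct)
  case (insert x S)
  have "Suc (card S) * (Suc (card S) + 1) = card S * (card S + 1) + 2 * Suc (card S)" by simp
  then have "Suc (card S) * (Suc (card S) + 1) div 2 = card S * (card S + 1) div 2 + Suc (card S)"
    by presburger
  then show ?case using insert by (simp add: cl_sign_insert_self power_add)
qed simp

text \<open>The binomial expansion of \<open>(1 + \<i>)\<^sup>r\<close> runs over all subsets \<open>S\<close>, with summands \<open>\<i>\<^bsup>|S|\<^esup>\<close>.  The real part
  retains the even subsets, for which \<open>\<i>\<^bsup>|S|\<^esup> = (-1)\<^bsup>|S|/2\<^esup> = e\<^sub>S\<^sup>2\<close>.\<close>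

lemma sum_cl_sign: "(\<Sum>S\<in>even_sets r. cl_sign S S) = Re ((1 + \<i>) ^ r)"
proof -
  have "(1 + \<i>) ^ r = (\<Prod>x\<in>{1..r}. \<i> + 1)" by (simp add: add.commute)
  also have "\<dots> = (\<Sum>S\<in>Pow {1..r}. \<i> ^ card S)" by (subst prod_add) simp_all
  finally have "Re ((1 + \<i>) ^ r) = (\<Sum>S\<in>Pow {1..r}. Re (\<i> ^ card S))" by simp
  also have "\<dots> = (\<Sum>S\<in>even_sets r. Re (\<i> ^ card S))"
  proof (rule sum.mono_neutral_right)
    show "\<forall>S\<in>Pow {1..r} - even_sets r. Re (\<i> ^ card S) = 0"
    proof
      fix S assume "S \<in> Pow {1..r} - even_sets r"
      then obtain k where "card S = 2 * k + 1" unfolding even_sets_def by (auto elim: oddE)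
      then show "Re (\<i> ^ card S) = 0" by (simp add: power_mult uminus_power_if)
    qed
  qed (auto simp: even_sets_def)
  also have "\<dots> = (\<Sum>S\<in>even_sets r. cl_sign S S)"
  proof (rule sum.cong[OF refl])
    fix S assume S: "S \<in> even_sets r"
    then obtain k where k: "card S = 2 * k" unfolding even_sets_def by (auto elim: evenE)
    have "2 * k * (2 * k + 1) div 2 = k * (2 * k + 1)" by simp
    then have "cl_sign S S = (-1) ^ k"
      unfolding cl_sign_self[OF even_sets_finite[OF S]] k by (simp add: uminus_power_if)
    then show "Re (\<i> ^ card S) = cl_sign S S" unfolding k by (simp add: power_mult uminus_power_if)
  qed
  finally show ?thesis ..
qed

text \<open>Reduce the exponent by \<open>(1 + \<i>)\<^sup>8 = 16\<close>.\<close>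

lemma sum_cl_sign_mod_8:
  "r mod 8 \<in> {0, 1, 7} \<Longrightarrow> (\<Sum>S\<in>even_sets r. cl_sign S S) > 0"
  "r mod 8 \<in> {2, 6} \<Longrightarrow> (\<Sum>S\<in>even_sets r. cl_sign S S) = 0"
  "r mod 8 \<in> {3, 4, 5} \<Longrightarrow> (\<Sum>S\<in>even_sets r. cl_sign S S) < 0"
proof -
  have p2: "(1 + \<i>) ^ 2 = 2 * \<i>" by (simp add: power2_eq_square algebra_simps)
  have p4: "(1 + \<i>) ^ 4 = - 4"
  proof -
    have "(1 + \<i>) ^ 4 = ((1 + \<i>) ^ 2) ^ 2" by simp
    also have "\<dots> = - 4" unfolding p2 by (simp add: power2_eq_square)
    finally show ?thesis .
  qed
  have p8: "(1 + \<i>) ^ 8 = 16"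
  proof -
    have "(1 + \<i>) ^ 8 = ((1 + \<i>) ^ 4) ^ 2" by simp
    also have "\<dots> = 16" unfolding p4 by simp
    finally show ?thesis .
  qed
  have "(1 + \<i>) ^ r = (1 + \<i>) ^ (8 * (r div 8) + r mod 8)" by simp
  also have "\<dots> = of_real (16 ^ (r div 8)) * (1 + \<i>) ^ (r mod 8)" by (simp only: power_add power_mult p8) simp
  finally have e: "(\<Sum>S\<in>even_sets r. cl_sign S S) = 16 ^ (r div 8) * Re ((1 + \<i>) ^ (r mod 8))"
    unfolding sum_cl_sign by simp
  have p3: "(1 + \<i>) ^ 3 = - 2 + 2 * \<i>"
    using p2 by (simp add: power3_eq_cube power2_eq_square algebra_simps)
  have p5: "(1 + \<i>) ^ 5 = - 4 - 4 * \<i>"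
  proof -
    have "(1 + \<i>) ^ 5 = (1 + \<i>) ^ (4 + 1)" by simp
    then show ?thesis by (simp only: power_add p4) (simp add: algebra_simps)
  qed
  have p6: "(1 + \<i>) ^ 6 = - 8 * \<i>"
  proof -
    have "(1 + \<i>) ^ 6 = (1 + \<i>) ^ (4 + 2)" by simp
    then show ?thesis by (simp only: power_add p4 p2) simp
  qed
  have p7: "(1 + \<i>) ^ 7 = 8 - 8 * \<i>"
  proof -
    have "(1 + \<i>) ^ 7 = (1 + \<i>) ^ (4 + 3)" by simp
    then show ?thesis by (simp only: power_add p4 p3) (simp add: algebra_simps)
  qed
  show "r mod 8 \<in> {0, 1, 7} \<Longrightarrow> (\<Sum>S\<in>even_sets r. cl_sign S S) > 0" unfolding e by (auto simp: p7)
  show "r mod 8 \<in> {2, 6} \<Longrightarrow> (\<Sum>S\<in>even_sets r. cl_sign S S) = 0" unfolding e by (auto simp: p2 p6)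
  show "r mod 8 \<in> {3, 4, 5} \<Longrightarrow> (\<Sum>S\<in>even_sets r. cl_sign S S) < 0"
    unfolding e by (auto simp: p3 p4 p5 mult_less_0_iff)
qed

context irreducible_rep
begin

text \<open>The trace inner product of operators is invariant under right multiplication by an isometry.\<close>

lemma sum_basis_isometry_invariant:
  fixes g h :: "'w \<Rightarrow> 'w"
  assumes S: "S \<in> even_sets r" and g: "linear g" and h: "linear h"
  shows "(\<Sum>b\<in>Basis. g (\<tau> (cl_basis S) b) \<bullet> h (\<tau> (cl_basis S) b)) = (\<Sum>b\<in>Basis. g b \<bullet> h b)"
    (is "?l = ?r")
proof -
  let ?A = "\<lambda>w. adjoint h (g w)" and ?t = "\<tau> (cl_basis S)"
  have lA: "linear ?A" using linear_compose[OF g adjoint_linear[OF h]] by (simp add: o_def)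
  have lt: "linear ?t" by (rule basis_linear[OF S])
  have "?l = op_trace (\<lambda>w. cl_sign S S *\<^sub>R ?t (?A (?t w)))"
    unfolding op_trace_def
    by (intro sum.cong refl) (simp add: basis_adjoint[OF S] adjoint_clauses[OF h])
  also have "\<dots> = cl_sign S S * op_trace (\<lambda>w. ?A (?t (?t w)))"
    using op_trace_commute[OF lt, of "\<lambda>w. ?A (?t w)"] linear_compose[OF lt lA]
    by (simp add: op_trace_scaleR o_def)
  also have "\<dots> = op_trace ?A"
    by (simp add: basis_square[OF S] linear_cmul[OF lA] op_trace_scaleR)
  also have "\<dots> = ?r" unfolding op_trace_def by (simp add: adjoint_clauses[OF h])
  finally show ?thesis .
qed

text \<open>Averaging is, up to the factor \<open>card (even_sets r)\<close>, the orthogonal projection of \<open>End W\<close> onto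
  the commutant; computing the trace of its composition with transposition in two ways gives
  the indicator formula.  The \<open>Is k\<close> are an orthogonal basis of the commutant, each of squared
  norm \<open>dim W\<close>; in the applications these are the identity, with \<open>\<epsilon> 0 = 1\<close>, and skew elements, with
  \<open>\<epsilon> k = -1\<close>.\<close>

lemma frobenius_schur:
  fixes Is :: "nat \<Rightarrow> 'w \<Rightarrow> 'w" and \<epsilon> :: "nat \<Rightarrow> real"
  assumes com: "\<And>k. k < n \<Longrightarrow> intertwines r \<tau> \<tau> (Is k)"
    and sq: "\<And>k w. k < n \<Longrightarrow> Is k (Is k w) = \<epsilon> k *\<^sub>R w"
    and orth: "\<And>k l. k < n \<Longrightarrow> l < n \<Longrightarrow>
      (\<Sum>b\<in>Basis. Is k b \<bullet> Is l b) = (if k = l then real DIM('w) else 0)"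
    and gen: "\<And>T. intertwines r \<tau> \<tau> T \<Longrightarrow> \<exists>c. \<forall>w. T w = (\<Sum>k<n. c k *\<^sub>R Is k w)"
  shows "DIM('w) * (\<Sum>S\<in>even_sets r. cl_sign S S) = card (even_sets r) * (\<Sum>k<n. \<epsilon> k)"
proof -
  interpret P: cl0_rep_pair r \<tau> \<tau> by (intro cl0_rep_pair.intro cl0_rep_axioms)
  let ?d = "real DIM('w)" and ?N = "real (card (even_sets r))"
  \<comment> \<open>The projection of the rank one operator given by \<open>a\<close> and \<open>b\<close>, expanded in the basis \<open>Is\<close>.\<close>
  have key: "?d * (P.average (\<lambda>w. (w \<bullet> b) *\<^sub>R a) x \<bullet> y) =
      (\<Sum>k<n. ?N * (a \<bullet> Is k b) * (Is k x \<bullet> y))" for a b x y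
  proof -
    let ?T = "\<lambda>w. (w \<bullet> b) *\<^sub>R a"
    have T: "linear ?T" by (intro linearI) (simp_all add: inner_add_left scaleR_add_left)
    obtain c where c: "\<And>w. P.average ?T w = (\<Sum>k<n. c k *\<^sub>R Is k w)"
      using gen[OF P.average_intertwines[OF T]] by blast
    have ck: "c k * ?d = ?N * (a \<bullet> Is k b)" if k: "k < n" for k
    proof -
      note lk = intertwinesD(1)[OF com[OF k]]
      have "c k * ?d = (\<Sum>l<n. c l * (\<Sum>w\<in>Basis. Is l w \<bullet> Is k w))"
        using k by (simp add: orth if_distrib cong: if_cong)
      also have "\<dots> = (\<Sum>w\<in>Basis. P.average ?T w \<bullet> Is k w)"
        unfolding c inner_sum_left sum_distrib_left by (subst sum.swap) simp
      also have "\<dots> = (\<Sum>S\<in>even_sets r. \<Sum>w\<in>Basis.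
          cl_sign S S * (\<tau> (cl_basis S) (?T (\<tau> (cl_basis S) w)) \<bullet> Is k w))"
        unfolding P.average_def inner_sum_left by (subst sum.swap) simp
      also have "\<dots> = (\<Sum>S\<in>even_sets r. \<Sum>w\<in>Basis. ?T (\<tau> (cl_basis S) w) \<bullet> Is k (\<tau> (cl_basis S) w))"
        by (intro sum.cong refl)
          (simp add: basis_adjoint intertwinesD(2)[OF com[OF k]] cl_basis_in_Cl0 del: inner_scaleR_left)
      also have "\<dots> = (\<Sum>S\<in>even_sets r. \<Sum>w\<in>Basis. ?T w \<bullet> Is k w)"
        by (intro sum.cong refl sum_basis_isometry_invariant T lk)
      also have "\<dots> = ?N * (\<Sum>w\<in>Basis. ?T w \<bullet> Is k w)" by simp
      also have "(\<Sum>w\<in>Basis. ?T w \<bullet> Is k w) = a \<bullet> Is k b"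
        using linear_inner_expand[OF lk, of b a] by (simp add: inner_commute)
      finally show ?thesis .
    qed
    have "?d * (P.average ?T x \<bullet> y) = (\<Sum>k<n. (c k * ?d) * (Is k x \<bullet> y))"
      unfolding c inner_sum_left sum_distrib_left by (simp add: mult_ac)
    also have "\<dots> = (\<Sum>k<n. ?N * (a \<bullet> Is k b) * (Is k x \<bullet> y))"
      by (intro sum.cong refl) (simp add: ck)
    finally show ?thesis .
  qed
  \<comment> \<open>The trace in question; directly it is the sum of all \<open>tr(e\<^sub>S\<^sup>T e\<^sub>S)\<close> with the signs \<open>e\<^sub>S\<^sup>2\<close>.\<close>
  have "(\<Sum>x\<in>Basis. \<Sum>y\<in>Basis. P.average (\<lambda>w. (w \<bullet> y) *\<^sub>R x) x \<bullet> y) =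
      (\<Sum>x\<in>Basis. \<Sum>y\<in>Basis. \<Sum>S\<in>even_sets r. cl_sign S S * (\<tau> (cl_basis S) x \<bullet> y) * (\<tau> (cl_basis S) x \<bullet> y))"
    unfolding P.average_def inner_sum_left
    by (intro sum.cong refl) (simp add: linear_cmul[OF basis_linear])
  also have "\<dots> = (\<Sum>x\<in>Basis. \<Sum>S\<in>even_sets r. \<Sum>y\<in>Basis. cl_sign S S * ((\<tau> (cl_basis S) x \<bullet> y) * (y \<bullet> \<tau> (cl_basis S) x)))"
    by (intro sum.cong refl, subst sum.swap) (simp add: inner_commute mult.assoc)
  also have "\<dots> = (\<Sum>x\<in>(Basis::'w set). \<Sum>S\<in>even_sets r. cl_sign S S)"
    by (simp add: sum_distrib_left[symmetric] inner_expand[symmetric] basis_isometry inner_Basis)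
  finally have "?d * (?d * (\<Sum>S\<in>even_sets r. cl_sign S S)) =
      (\<Sum>x\<in>Basis. \<Sum>y\<in>Basis. ?d * (P.average (\<lambda>w. (w \<bullet> y) *\<^sub>R x) x \<bullet> y))"
    by (simp add: sum_distrib_left[symmetric])
  also have "\<dots> = (\<Sum>x\<in>Basis. \<Sum>y\<in>Basis. \<Sum>k<n. ?N * ((Is k x \<bullet> y) * (Is k y \<bullet> x)))"
    unfolding key by (simp add: inner_commute mult_ac)
  also have "\<dots> = (\<Sum>x\<in>Basis. \<Sum>k<n. ?N * (\<Sum>y\<in>Basis. (Is k x \<bullet> y) * (Is k y \<bullet> x)))"
    by (intro sum.cong refl, subst sum.swap) (simp add: sum_distrib_left)
  also have "\<dots> = (\<Sum>x\<in>(Basis::'w set). \<Sum>k<n. ?N * \<epsilon> k)"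
  proof (intro sum.cong refl)
    fix x :: 'w and k assume x: "x \<in> Basis" and "k \<in> {..<n}"
    then have k: "k < n" by simp
    show "?N * (\<Sum>y\<in>Basis. (Is k x \<bullet> y) * (Is k y \<bullet> x)) = ?N * \<epsilon> k"
      unfolding linear_inner_expand[OF intertwinesD(1)[OF com[OF k]], symmetric] sq[OF k]
      using x by (simp add: inner_Basis)
  qed
  also have "\<dots> = ?d * (?N * (\<Sum>k<n. \<epsilon> k))" by (simp add: sum_distrib_left)
  finally show ?thesis by simp
qed

lemma card_even_sets_pos: "card (even_sets r) > 0"
  using even_sets_empty[of r] by (auto simp: card_gt_0_iff simp del: even_sets_empty)

lemma unit_comm_isometry: "unit_comm I \<Longrightarrow> I u \<bullet> I v = u \<bullet> v"
  using skew_commD(3)[of I u "I v"] unit_commD[of I] by simp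

lemma skew_comm_trace: 
  "skew_comm T \<Longrightarrow> (\<Sum>b\<in>Basis. T b \<bullet> b) = 0 \<and> (\<Sum>b\<in>Basis. b \<bullet> T b) = 0"
proof -
  assume T: "skew_comm T"
  have "(\<Sum>b\<in>Basis. T b \<bullet> b) = 0"
    using op_trace_skew[of T, OF skew_commD(3)[OF T]] unfolding op_trace_def .
  then show ?thesis by (simp add: inner_commute)
qed

lemma sum_Basis_inner: "(\<Sum>b\<in>(Basis::'w set). b \<bullet> b) = DIM('w)"
  by (simp add: inner_Basis)

lemma indicator_real:
  assumes "\<And>T w. skew_comm T \<Longrightarrow> T w = 0"
  shows "(\<Sum>S\<in>even_sets r. cl_sign S S) > 0"
proof -
  have "DIM('w) * (\<Sum>S\<in>even_sets r. cl_sign S S) = real (card (even_sets r)) * (\<Sum>k<1. (\<lambda>_::nat. 1) k)"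
  proof (rule frobenius_schur[where Is = "\<lambda>k w. w" and n = 1])
    fix T assume "intertwines r \<tau> \<tau> T"
    then obtain a T' where "skew_comm T'" "\<And>w. T w = a *\<^sub>R w + T' w" using commutant_decompose by blast
    then show "\<exists>c. \<forall>w. T w = (\<Sum>k<(1::nat). c k *\<^sub>R w)"
      using assms by (intro exI[of _ "\<lambda>_. a"]) simp
  qed (auto simp: intertwines_id sum_Basis_inner)
  also have "\<dots> > 0" using card_even_sets_pos by simp
  finally show ?thesis by (simp add: zero_less_mult_iff)
qed

lemma indicator_complex:
  assumes I: "unit_comm I" and gen: "\<And>T. skew_comm T \<Longrightarrow> \<exists>c. \<forall>w. T w = c *\<^sub>R I w"
  shows "(\<Sum>S\<in>even_sets r. cl_sign S S) = 0"
proof -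
  note sI = unit_commD(1)[OF I]
  have two: "k < 2 \<longleftrightarrow> k = 0 \<or> k = (1::nat)" for k by auto
  have "DIM('w) * (\<Sum>S\<in>even_sets r. cl_sign S S) = card (even_sets r) * (\<Sum>k<2. (\<lambda>k. if k = 0 then 1 else - 1 :: real) (k::nat))"
  proof (rule frobenius_schur[where Is = "\<lambda>k w. if k = 0 then w else I w" and n = 2])
    fix T assume "intertwines r \<tau> \<tau> T"
    then obtain a T' where T': "skew_comm T'" "\<And>w. T w = a *\<^sub>R w + T' w" using commutant_decompose by blast
    then obtain c where "\<And>w. T' w = c *\<^sub>R I w" using gen by blast
    then show "\<exists>c. \<forall>w. T w = (\<Sum>k<(2::nat). c k *\<^sub>R (if k = 0 then w else I w))"
      using T'(2) by (intro exI[of _ "\<lambda>k. if k = 0 then a else c"]) (simp add: numeral_2_eq_2)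
  qed (auto simp: two intertwines_id skew_commD(1)[OF sI] sum_Basis_inner unit_commD(2)[OF I]
        unit_comm_isometry[OF I] skew_comm_trace[OF sI])
  then show ?thesis by (simp add: numeral_2_eq_2)
qed

lemma indicator_quaternionic:
  assumes Q: "quaternion_comm I J K"
  shows "(\<Sum>S\<in>even_sets r. cl_sign S S) < 0"
proof -
  note q = quaternion_commD[OF Q]
  have u: "unit_comm I" "unit_comm J" "unit_comm K" using Q unfolding quaternion_comm_def by auto
  have four: "k < 4 \<longleftrightarrow> k = 0 \<or> k = 1 \<or> k = 2 \<or> k = (3::nat)" for k by auto
  have cross: "(\<Sum>b\<in>Basis. I b \<bullet> J b) = 0" "(\<Sum>b\<in>Basis. J b \<bullet> I b) = 0" "(\<Sum>b\<in>Basis. I b \<bullet> K b) = 0"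
    "(\<Sum>b\<in>Basis. K b \<bullet> I b) = 0" "(\<Sum>b\<in>Basis. J b \<bullet> K b) = 0" "(\<Sum>b\<in>Basis. K b \<bullet> J b) = 0"
    by (simp_all add: skew_commD(3)[OF q(1)] skew_commD(3)[OF q(2)] skew_commD(3)[OF q(3)] q
        sum_negf skew_comm_trace[OF q(1)] skew_comm_trace[OF q(2)] skew_comm_trace[OF q(3)])
  have "DIM('w) * (\<Sum>S\<in>even_sets r. cl_sign S S) = card (even_sets r) * (\<Sum>k<4. (\<lambda>k. if k = 0 then 1 else - 1 :: real) (k::nat))"
  proof (rule frobenius_schur[where n = 4 and
        Is = "\<lambda>k w. if k = 0 then w else if k = 1 then I w else if k = 2 then J w else K w"])
    fix T assume "intertwines r \<tau> \<tau> T"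
    then obtain a T' where T': "skew_comm T'" "\<And>w. T w = a *\<^sub>R w + T' w" using commutant_decompose by blast
    obtain b c d where "\<And>w. T' w = b *\<^sub>R I w + c *\<^sub>R J w + d *\<^sub>R K w"
      using quaternion_comm_span[OF Q T'(1)] by blast
    then show "\<exists>c. \<forall>w. T w = (\<Sum>k<(4::nat). c k *\<^sub>R
        (if k = 0 then w else if k = 1 then I w else if k = 2 then J w else K w))"
      using T'(2) by (intro exI[of _ "\<lambda>k. if k = 0 then a else if k = 1 then b else if k = 2 then c else d"])
        (simp add: eval_nat_numeral add.assoc)
  next
    show "\<And>k l :: nat. k < 4 \<Longrightarrow> l < 4 \<Longrightarrow>
       (\<Sum>ba\<in>Basis. (if k = 0 then ba else if k = 1 then I ba else if k = 2 then J ba else K ba) \<bullet>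
           (if l = 0 then ba else if l = 1 then I ba else if l = 2 then J ba else K ba)) =
       (if k = l then real DIM('w) else 0)"
      unfolding four
      by (elim disjE; simp add: cross sum_Basis_inner unit_comm_isometry[OF u(1)] unit_comm_isometry[OF u(2)]
          unit_comm_isometry[OF u(3)] skew_comm_trace[OF q(1)] skew_comm_trace[OF q(2)] skew_comm_trace[OF q(3)])
  qed (auto simp: four intertwines_id skew_commD(1)[OF q(1)] skew_commD(1)[OF q(2)] skew_commD(1)[OF q(3)] q)
  also have "\<dots> < 0" using card_even_sets_pos by (simp add: eval_nat_numeral)
  finally show ?thesis by (simp add: mult_less_0_iff)
qed

theorem commutant_real: "r mod 8 \<in> {0, 1, 7} \<Longrightarrow> skew_comm T \<Longrightarrow> T w = 0"
  using indicator_complex indicator_quaternionic sum_cl_sign_mod_8(1)[of r]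
  by (rule_tac commutant_trichotomy) force+

text \<open>The indicator vanishes, so the commutant is complex; it contains \<open>vol\<close>, which is skew with square \<open>-1\<close>.\<close>

theorem commutant_complex:
  assumes r: "r mod 8 \<in> {2, 6}"
  shows "unit_comm (\<tau> (vol r))" and "skew_comm T \<Longrightarrow> \<exists>c. \<forall>w. T w = c *\<^sub>R \<tau> (vol r) w"
proof -
  interpret P: cl0_rep_pair r \<tau> \<tau> by (intro cl0_rep_pair.intro cl0_rep_axioms)
  have "r mod 8 = 2 \<or> r mod 8 = 6" using r by simp
  then have r2: "r mod 4 = 2" by presburger
  then have r2: "r mod 4 = 2" "even r" by presburger+
  note F = full_even_set[OF r2(2)]
  have "intertwines r \<tau> \<tau> (\<tau> (vol r))"
    by (rule P.intertwines_basisI) (simp_all add: rep_linear vol_in_Cl0 r2 vol_commutes)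
  moreover have "\<tau> (vol r) u \<bullet> v = - (u \<bullet> \<tau> (vol r) v)" for u v
    unfolding vol_eq using basis_adjoint[OF F] cl_sign_vol_2[OF r2(1)] by simp
  moreover have "\<tau> (vol r) (\<tau> (vol r) w) = - w" for w
    unfolding vol_eq using basis_square[OF F] cl_sign_vol_2[OF r2(1)] by simp
  ultimately show vol: "unit_comm (\<tau> (vol r))" unfolding unit_comm_def skew_comm_def by blast
  assume T: "skew_comm T"
  show "\<exists>c. \<forall>w. T w = c *\<^sub>R \<tau> (vol r) w"
  proof (cases rule: commutant_trichotomy)
    case real
    then show ?thesis using indicator_real sum_cl_sign_mod_8(2)[OF r] by auto
  next
    case (complex I)
    obtain c where c: "\<And>w. T w = c *\<^sub>R I w" using complex(2)[OF T] by blast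
    obtain e where e: "\<And>w. \<tau> (vol r) w = e *\<^sub>R I w" using complex(2)[OF unit_commD(1)[OF vol]] by blast
    have "e \<noteq> 0"
    proof
      assume "e = 0"
      then have "\<tau> (vol r) w = 0" for w by (simp add: e)
      then have "w = 0" for w :: 'w using unit_commD(2)[OF vol, of w] by simp
      then show False using nonempty_Basis nonzero_Basis by blast
    qed
    then have "T w = (c / e) *\<^sub>R \<tau> (vol r) w" for w by (simp add: c e)
    then show ?thesis by blast
  next
    case (quaternionic I J K)
    then show ?thesis using indicator_quaternionic sum_cl_sign_mod_8(2)[OF r] by force
  qed
qed

theorem commutant_quaternionic:
  assumes r: "r mod 8 \<in> {3, 4, 5}"
  obtains I J K where "quaternion_comm I J K"
  using indicator_real indicator_complex sum_cl_sign_mod_8(3)[OF r]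
  by (rule_tac commutant_trichotomy) force+

text \<open>
  Commuting operators with square \<open>-1\<close> are automatically skew.  Write \<open>T = a + T'\<close> with \<open>T'\<close> skew; the inner
  product of \<open>T\<^sup>2 w = -w\<close> with \<open>T' w\<close> reads \<open>2 a |T' w|\<^sup>2 = 0\<close>, and \<open>T' = 0\<close> would give \<open>a\<^sup>2 = -1\<close>.
\<close>

lemma quaternionic_structure_iff:
  "quaternionic_structure r \<tau> I J K \<longleftrightarrow> quaternion_comm I J K"
proof
  assume Q: "quaternion_comm I J K"
  note q = quaternion_commD[OF Q]
  note sub = spin_lie_subset_Cl0[of r]
  show "quaternionic_structure r \<tau> I J K"
    unfolding quaternionic_structure_def
    using skew_commD(2)[OF q(1)] skew_commD(2)[OF q(2)] skew_commD(2)[OF q(3)] q(4-9)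
      intertwinesD(2)[OF skew_commD(1)[OF q(1)]] intertwinesD(2)[OF skew_commD(1)[OF q(2)]]
      intertwinesD(2)[OF skew_commD(1)[OF q(3)]] sub
    by auto
next
  assume Q: "quaternionic_structure r \<tau> I J K"
  interpret P: cl0_rep_pair r \<tau> \<tau> by (intro cl0_rep_pair.intro cl0_rep_axioms)
  have "unit_comm T" if T: "T \<in> {I, J, K}" for T
  proof -
    have lin: "linear T" and sq: "\<And>w. T (T w) = - w"
      and com: "\<And>\<xi> w. \<xi> \<in> lcarrier (spin_lie r) \<Longrightarrow> T (\<tau> \<xi> w) = \<tau> \<xi> (T w)"
      using Q T unfolding quaternionic_structure_def by auto
    have "intertwines r \<tau> \<tau> T"
    proof (rule P.intertwines_pairI[OF lin])
      fix i j w assume "1 \<le> i" "i < j" "j \<le> r"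
      then have "cl_gen i * cl_gen j \<in> lcarrier (spin_lie r)"
        unfolding spin_lie_def lie_algebra.simps by (intro span_base) blast
      then show "T (\<tau> (cl_gen i * cl_gen j) w) = \<tau> (cl_gen i * cl_gen j) (T w)" by (rule com)
    qed
    then obtain a T' where T': "skew_comm T'" "\<And>w. T w = a *\<^sub>R w + T' w"
      using commutant_decompose by blast
    have "a = 0"
    proof (rule ccontr)
      assume a: "a \<noteq> 0"
      have perp: "T' w \<bullet> w = 0" for w using skew_commD(3)[OF T'(1), of w w] by (simp add: inner_commute)
      have "T' w = 0" for w
      proof -
        have "T (T w) = a *\<^sub>R T w + T' (T w)" by (rule T'(2))
        also have "T' (T w) = a *\<^sub>R T' w + T' (T' w)"
          by (simp only: T'(2)[of w] skew_commD(4,7)[OF T'(1)])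
        also have "a *\<^sub>R T w = (a * a) *\<^sub>R w + a *\<^sub>R T' w"
          by (simp only: T'(2)[of w] scaleR_add_right scaleR_scaleR)
        finally have "T (T w) \<bullet> T' w = 2 * a * (T' w \<bullet> T' w)"
          using perp[of w] perp[of "T' w"] by (simp add: inner_add_left inner_add_right inner_commute)
        then show ?thesis using a perp[of w] by (simp add: sq inner_commute)
      qed
      then have "(a * a) *\<^sub>R w = - w" for w :: 'w using sq[of w] unfolding T'(2) by simp
      then have "(a * a + 1) *\<^sub>R w = 0" for w :: 'w by (simp add: scaleR_add_left)
      moreover have "a * a + 1 \<noteq> 0" by (smt (verit) zero_le_square)
      ultimately have "w = 0" for w :: 'w by simp
      then show False using nonempty_Basis nonzero_Basis by blast
    qed
    then have "T = T'" using T'(2) by auto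
    then show ?thesis using T'(1) sq unfolding unit_comm_def by simp
  qed
  then show "quaternion_comm I J K"
    using Q unfolding quaternion_comm_def quaternionic_structure_def by auto
qed

end

lemma real_spinor_rep_irreducible:
  "real_spinor_rep r \<tau> \<Longrightarrow> irreducible_rep r \<tau>"
  unfolding real_spinor_rep_def
  by (intro irreducible_rep.intro orthogonal_rep.intro cl0_rep.intro orthogonal_rep_axioms.intro
      irreducible_rep_axioms.intro) auto

section \<open>Isotypic decomposition\<close>

definition orthonormal_copies ::
  "nat \<Rightarrow> (clifford \<Rightarrow> 'w::euclidean_space \<Rightarrow> 'w) \<Rightarrow> (clifford \<Rightarrow> 'v::euclidean_space \<Rightarrow> 'v) \<Rightarrow>
    nat \<Rightarrow> (nat \<Rightarrow> 'w \<Rightarrow> 'v) \<Rightarrow> bool" where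
  "orthonormal_copies r \<tau> \<rho> m f \<longleftrightarrow> (\<forall>i<m. intertwines r \<tau> \<rho> (f i)) \<and>
     (\<forall>i<m. \<forall>j<m. \<forall>w w'. f i w \<bullet> f j w' = (if i = j then w \<bullet> w' else 0))"

text \<open>Isometric copies of \<open>W\<close> with orthogonal images, the orthogonal projection to whose span is \<open>C\<close>.\<close>

definition frame ::
  "nat \<Rightarrow> (clifford \<Rightarrow> 'w::euclidean_space \<Rightarrow> 'w) \<Rightarrow> (clifford \<Rightarrow> 'v::euclidean_space \<Rightarrow> 'v) \<Rightarrow>
    ('v \<Rightarrow> 'v) \<Rightarrow> nat \<Rightarrow> (nat \<Rightarrow> 'w \<Rightarrow> 'v) \<Rightarrow> bool" where
  "frame r \<tau> \<rho> C m f \<longleftrightarrow> orthonormal_copies r \<tau> \<rho> m f \<and> (\<forall>v. C v = (\<Sum>i<m. f i (adjoint (f i) v)))"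

lemma copiesD:
  assumes "orthonormal_copies r \<tau> \<rho> m f"
  shows "i < m \<Longrightarrow> intertwines r \<tau> \<rho> (f i)" "i < m \<Longrightarrow> linear (f i)"
    and "i < m \<Longrightarrow> j < m \<Longrightarrow> f i w \<bullet> f j w' = (if i = j then w \<bullet> w' else 0)"
  using assms unfolding orthonormal_copies_def by (auto intro: intertwinesD(1))

lemma copies_adjoint_linear: "orthonormal_copies r \<tau> \<rho> m f \<Longrightarrow> i < m \<Longrightarrow> linear (adjoint (f i))"
  by (intro adjoint_linear copiesD)

lemma copies_adjoint:
  assumes F: "orthonormal_copies r \<tau> \<rho> m f" and i: "i < m" "j < m"
  shows "adjoint (f i) (f j w) = (if i = j then w else 0)"
proof (rule vector_eq_rdot[THEN iffD1], rule allI)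
  show "adjoint (f i) (f j w) \<bullet> u = (if i = j then w else 0) \<bullet> u" for u
    using copiesD(3)[OF F i, of u w] by (simp add: adjoint_clauses[OF copiesD(2)[OF F i(1)]] inner_commute)
qed

lemma copies_coordinate:
  assumes F: "orthonormal_copies r \<tau> \<rho> m f" and i: "i < m"
  shows "adjoint (f i) (\<Sum>j<m. f j (x j)) = x i"
proof -
  have "adjoint (f i) (\<Sum>j<m. f j (x j)) = (\<Sum>j<m. if j = i then x i else 0)"
    unfolding linear_sum[OF copies_adjoint_linear[OF F i]]
    by (intro sum.cong refl) (auto simp: copies_adjoint[OF F i])
  then show ?thesis using i by simp
qed

lemma frameD:
  assumes "frame r \<tau> \<rho> C m f"
  shows "i < m \<Longrightarrow> intertwines r \<tau> \<rho> (f i)" "i < m \<Longrightarrow> linear (f i)"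
    and "orthonormal_copies r \<tau> \<rho> m f"
    and "C v = (\<Sum>i<m. f i (adjoint (f i) v))"
  using assms unfolding frame_def by (auto intro: copiesD)

lemmas frame_adjoint = copies_adjoint[OF frameD(3)]
lemmas frame_adjoint_linear = copies_adjoint_linear[OF frameD(3)]
lemmas frame_coordinate = copies_coordinate[OF frameD(3)]

lemma frame_range: "frame r \<tau> \<rho> C m f \<Longrightarrow> i < m \<Longrightarrow> C (f i w) = f i w"
proof -
  assume F: "frame r \<tau> \<rho> C m f" and i: "i < m"
  have "C (f i w) = (\<Sum>j<m. f j (if j = i then w else 0))"
    unfolding frameD(4)[OF F] by (intro sum.cong refl) (simp add: frame_adjoint[OF F _ i])
  also have "\<dots> = (\<Sum>j<m. if j = i then f i w else 0)"
    by (intro sum.cong refl) (auto simp: linear_0[OF frameD(2)[OF F]])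
  finally show ?thesis using i by simp
qed

lemma frame_adjoint_C: "frame r \<tau> \<rho> C m f \<Longrightarrow> i < m \<Longrightarrow> adjoint (f i) (C v) = adjoint (f i) v"
  by (subst frameD(4)) (assumption, rule frame_coordinate)

text \<open>Start from a family of mutually orthogonal isometric copies of \<open>W\<close> of maximal length.  If it did not
  fill the image of \<open>C\<close>, then averaging would produce an equivariant map to the complement there, which is
  a multiple of an isometry by Schur's lemma.\<close>

lemma frame_exists:
  fixes \<tau> :: "clifford \<Rightarrow> 'w::euclidean_space \<Rightarrow> 'w" and \<rho> :: "clifford \<Rightarrow> 'v::euclidean_space \<Rightarrow> 'v"
  assumes W: "irreducible_rep r \<tau>" and V: "orthogonal_rep r \<rho>" and r: "r > 0"
    and C: "intertwines r \<rho> \<rho> C" "\<And>v. C (C v) = C v" "\<And>u v. C u \<bullet> v = u \<bullet> C v"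
    and vol: "r mod 4 = 0 \<Longrightarrow> (\<forall>w. \<tau> (vol r) w = \<epsilon> *\<^sub>R w) \<and> (\<forall>v. C (\<rho> (vol r) v) = \<epsilon> *\<^sub>R C v) \<and> \<epsilon> \<noteq> 0"
  obtains m f where "frame r \<tau> \<rho> C m f"
proof -
  interpret W: irreducible_rep r \<tau> by (rule W)
  interpret V: orthogonal_rep r \<rho> by (rule V)
  define P where "P m f \<longleftrightarrow> orthonormal_copies r \<tau> \<rho> m f \<and> (\<forall>i<m. \<forall>w. C (f i w) = f i w)"
    for m :: nat and f :: "nat \<Rightarrow> 'w \<Rightarrow> 'v"
  have bound: "m \<le> DIM('v)" if "P m f" for m f
  proof -
    obtain b :: 'w where b: "b \<in> Basis" using nonempty_Basis by blast
    have o: "f i b \<bullet> f j b = (if i = j then 1 else 0)" if "i < m" "j < m" for i j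
      using \<open>P m f\<close> that b unfolding P_def orthonormal_copies_def by simp
    have inj: "inj_on (\<lambda>i. f i b) {..<m}"
    proof (rule inj_onI)
      fix i j assume "i \<in> {..<m}" "j \<in> {..<m}" "f i b = f j b"
      then have "f i b \<bullet> f j b = 1" using o[of i i] by simp
      then show "i = j" using o[of i j] \<open>i \<in> {..<m}\<close> \<open>j \<in> {..<m}\<close> by (simp split: if_splits)
    qed
    have "pairwise real_inner_class.orthogonal ((\<lambda>i. f i b) ` {..<m})"
      unfolding pairwise_def real_inner_class.orthogonal_def using o by auto
    moreover have "0 \<notin> (\<lambda>i. f i b) ` {..<m}"
    proof
      assume "0 \<in> (\<lambda>i. f i b) ` {..<m}"
      then obtain i where "i < m" "f i b = 0" by auto
      then show False using o[of i i] by simp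
    qed
    ultimately have "independent ((\<lambda>i. f i b) ` {..<m})" by (rule pairwise_orthogonal_independent)
    then have "card ((\<lambda>i. f i b) ` {..<m}) \<le> DIM('v)" by (rule independent_bound[THEN conjunct2])
    then show ?thesis by (simp add: card_image[OF inj])
  qed
  have "P 0 (\<lambda>_ _. 0)" unfolding P_def orthonormal_copies_def by simp
  then have "\<exists>m. (\<exists>f. P m f) \<and> (\<forall>n. (\<exists>f. P n f) \<longrightarrow> n \<le> m)"
    using Nat.ex_has_greatest_nat[of "\<lambda>m. \<exists>f. P m f" 0 "DIM('v)"] bound by blast
  then obtain m f where Pm: "P m f" and max: "\<And>n g. P n g \<Longrightarrow> n \<le> m" by blast
  have copies: "orthonormal_copies r \<tau> \<rho> m f" using Pm unfolding P_def by blast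
  have f: "intertwines r \<tau> \<rho> (f i)" "linear (f i)" "C (f i w) = f i w" if "i < m" for i w
    using Pm that unfolding P_def by (auto intro: copiesD)
  have f_adj_C: "adjoint (f i) (C v) = adjoint (f i) v" if "i < m" for i v
  proof (rule vector_eq_rdot[THEN iffD1], rule allI)
    show "adjoint (f i) (C v) \<bullet> u = adjoint (f i) v \<bullet> u" for u
      by (simp add: adjoint_clauses[OF f(2)[OF that]] C(3) f(3)[OF that])
  qed
  note lC = intertwinesD(1)[OF C(1)]
  \<comment> \<open>The orthogonal projection to the complement.\<close>
  define R where "R v = C v - (\<Sum>i<m. f i (adjoint (f i) v))" for v
  have R_int: "intertwines r \<rho> \<rho> R" unfolding R_def
    by (intro V.intertwines_diff C V.intertwines_sum
        intertwines_comp[OF adjoint_intertwines[OF W.orthogonal_rep_axioms V]] f) auto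
  note lR = intertwinesD(1)[OF R_int]
  have adj_R: "adjoint (f i) (R v) = 0" if "i < m" for i v
    unfolding R_def by (simp add: linear_diff[OF adjoint_linear[OF f(2)[OF that]]] copies_coordinate[OF copies that] f_adj_C[OF that])
  have CR: "C (R v) = R v" for v
    unfolding R_def by (simp add: linear_diff[OF lC] linear_sum[OF lC] C(2) f(3))
  have RC: "R (C v) = R v" for v unfolding R_def by (simp add: C(2) f_adj_C)
  have RR: "R (R v) = R v" for v
  proof -
    have "R (R v) = C (R v) - (\<Sum>i<m. f i (adjoint (f i) (R v)))" by (rule R_def)
    also have "(\<Sum>i<m. f i (adjoint (f i) (R v))) = 0"
      by (intro sum.neutral ballI) (simp add: adj_R linear_0[OF f(2)])
    finally show ?thesis by (simp add: CR)
  qed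
  have "f i (adjoint (f i) u) \<bullet> v = u \<bullet> f i (adjoint (f i) v)" if "i < m" for i u v
    by (metis adjoint_clauses[OF f(2)[OF that]])
  then have Rsym: "R u \<bullet> v = u \<bullet> R v" for u v
    unfolding R_def inner_diff_left inner_diff_right inner_sum_left inner_sum_right C(3) by simp
  have R0: "R v = 0" for v
  proof (rule ccontr)
    assume Rv: "R v \<noteq> 0"
    have "op_trace R = (\<Sum>b\<in>Basis. R b \<bullet> R b)"
      unfolding op_trace_def by (intro sum.cong refl) (metis RR Rsym)
    moreover have "(\<Sum>b\<in>Basis. R b \<bullet> R b) \<noteq> 0"
    proof
      assume "(\<Sum>b\<in>Basis. R b \<bullet> R b) = 0"
      then have "\<forall>b\<in>Basis. R b = 0" by (subst (asm) sum_nonneg_eq_0_iff) auto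
      then have "R v \<bullet> u = 0" for u by (subst linear_inner_expand[OF lR]) simp
      then show False using Rv inner_eq_zero_iff by blast
    qed
    ultimately have tr: "op_trace R \<noteq> 0" by simp
    have volR: "(\<forall>w. \<tau> (vol r) w = \<epsilon> *\<^sub>R w) \<and> (\<forall>v. R (\<rho> (vol r) v) = \<epsilon> *\<^sub>R R v) \<and> \<epsilon> \<noteq> 0" if "r mod 4 = 0"
    proof -
      have "R (\<rho> (vol r) v) = R (C (\<rho> (vol r) v))" for v by (simp add: RC)
      then show ?thesis using vol[OF that] by (simp add: linear_cmul[OF lR] RC)
    qed
    obtain g w0 where g: "intertwines r \<tau> \<rho> g" "R (g w0) \<noteq> 0"
      by (rule exists_intertwiner[OF W.orthogonal_rep_axioms V.cl0_rep_axioms lR tr r volR]) blast+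
    define h where "h w = R (g w)" for w
    have h: "intertwines r \<tau> \<rho> h" unfolding h_def by (rule intertwines_comp[OF g(1) R_int])
    note lh = intertwinesD(1)[OF h]
    obtain c where c: "\<And>w. adjoint h (h w) = c *\<^sub>R w"
    proof (rule W.schur_symmetric)
      show "intertwines r \<tau> \<tau> (\<lambda>w. adjoint h (h w))"
        by (rule intertwines_comp[OF h adjoint_intertwines[OF W.orthogonal_rep_axioms V h]])
      show "adjoint h (h u) \<bullet> v = u \<bullet> adjoint h (h v)" for u v by (simp add: adjoint_clauses[OF lh])
    qed blast
    have hh: "h u \<bullet> h w = c * (u \<bullet> w)" for u w
      using adjoint_clauses(1)[OF lh, of u "h w"] by (simp add: c)
    have "h w0 \<bullet> h w0 > 0" using g(2) unfolding h_def by simp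
    then have cpos: "c > 0" unfolding hh by (smt (verit) inner_ge_zero mult_nonneg_nonneg mult_nonpos_nonneg zero_less_mult_iff)
    \<comment> \<open>Append the new copy, scaled to an isometry.\<close>
    define f' where "f' i = (if i = m then (\<lambda>w. (1 / sqrt c) *\<^sub>R h w) else f i)" for i
    have hf: "f i w \<bullet> h w' = 0" "h w' \<bullet> f i w = 0" if "i < m" for i w w'
      using adjoint_clauses(1)[OF f(2)[OF that], of w "h w'"] adj_R[OF that, of "g w'"]
      unfolding h_def by (simp_all add: inner_commute)
    have "P (Suc m) f'" unfolding P_def orthonormal_copies_def
    proof (intro conjI allI impI)
      fix i assume "i < Suc m"
      then show "intertwines r \<tau> \<rho> (f' i)" unfolding f'_def using f h by (auto intro: V.intertwines_scale)
    next
      fix i j w w' assume "i < Suc m" "j < Suc m"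
      then show "f' i w \<bullet> f' j w' = (if i = j then w \<bullet> w' else 0)"
        unfolding f'_def using cpos by (auto simp: copiesD(3)[OF copies] hf hh less_Suc_eq)
    next
      fix i w assume "i < Suc m"
      then show "C (f' i w) = f' i w"
        unfolding f'_def using f(3) CR by (auto simp: linear_cmul[OF lC] h_def)
    qed
    then show False using max by fastforce
  qed
  have "frame r \<tau> \<rho> C m f"
    unfolding frame_def using copies R0 unfolding R_def by auto
  then show thesis by (rule that)
qed

definition coordinates :: "nat \<Rightarrow> (nat \<Rightarrow> 'w::real_inner \<Rightarrow> 'v::real_inner) \<Rightarrow> 'v \<Rightarrow> nat \<Rightarrow> 'w" where
  "coordinates m f v = (\<lambda>i. if i < m then adjoint (f i) v else 0)"

lemma coordinates_in_tensor_space: "coordinates m f v \<in> tensor_space m UNIV"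
  unfolding coordinates_def tensor_space_def by simp

lemma frame_coordinates:
  assumes "frame r \<tau> \<rho> C m f" "x \<in> tensor_space m UNIV"
  shows "coordinates m f (\<Sum>i<m. f i (x i)) = x"
  using assms(2) unfolding coordinates_def tensor_space_def by (auto simp: frame_coordinate[OF assms(1)])

lemma frame_inner_sum:
  assumes F: "frame r \<tau> \<rho> C m f"
  shows "(\<Sum>i<m. f i (x i)) \<bullet> (\<Sum>i<m. f i (y i)) = (\<Sum>i<m. x i \<bullet> y i)"
proof -
  have "f i (x i) \<bullet> (\<Sum>j<m. f j (y j)) = x i \<bullet> y i" if "i < m" for i
    using adjoint_clauses(1)[OF frameD(2)[OF F that], of "x i" "\<Sum>j<m. f j (y j)"]
    by (simp add: frame_coordinate[OF F that])
  then show ?thesis unfolding inner_sum_left by simp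
qed

lemma frame_decomposition:
  assumes F: "frame r \<tau> \<rho> (\<lambda>v. v) m f" and V: "cl0_rep r \<rho>"
  shows "decomposition r \<tau> \<rho> m (\<lambda>x. \<Sum>i<m. f i (x i))"
proof -
  interpret V: cl0_rep r \<rho> by (rule V)
  have inv: "(\<Sum>i<m. f i (coordinates m f v i)) = v" for v
    using frameD(4)[OF F, of v] unfolding coordinates_def by simp
  have bij: "bij_betw (\<lambda>x. \<Sum>i<m. f i (x i)) (tensor_space m UNIV) UNIV"
    by (rule bij_betwI[where g = "coordinates m f"])
      (auto simp: coordinates_in_tensor_space frame_coordinates[OF F] inv)
  show ?thesis
    unfolding decomposition_def Let_def
    using bij frame_inner_sum[OF F]
    by (auto simp: linear_add[OF frameD(2)[OF F]] linear_cmul[OF frameD(2)[OF F]] sum.distrib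
        scaleR_sum_right linear_sum[OF V.rep_linear] intertwinesD(2)[OF frameD(1)[OF F]])
qed

definition single :: "nat \<Rightarrow> 'w::zero \<Rightarrow> nat \<Rightarrow> 'w" where
  "single i w = (\<lambda>j. if j = i then w else 0)"

lemma single_simps:
  "i < m \<Longrightarrow> single i w \<in> tensor_space m UNIV"
  "single i (u + v) = single i u + single i (v :: 'w::real_vector)"
  "single i (c *\<^sub>R v) = (\<lambda>j. c *\<^sub>R single i v j)"
  unfolding single_def tensor_space_def by (auto simp: fun_eq_iff)

lemma half_add_half: "(1 / 2) *\<^sub>R v + (1 / 2) *\<^sub>R v = (v :: 'a::real_vector)"
  by (simp add: scaleR_add_left[symmetric])

lemma single_linear: "linear T \<Longrightarrow> single i (T w) = (\<lambda>j. T (single i w j))"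
  unfolding single_def by (auto simp: fun_eq_iff linear_0)

lemma tensor_space_zero: "(\<lambda>_. 0) \<in> tensor_space m UNIV" "0 \<in> tensor_space m UNIV"
  unfolding tensor_space_def by auto

lemma sum_single_inner:
  "i < m \<Longrightarrow> j < m \<Longrightarrow> (\<Sum>k<m. single i w k \<bullet> single j w' k) = (if i = j then w \<bullet> (w'::'w::real_inner) else 0)"
proof -
  assume "i < m" "j < m"
  have "(\<Sum>k<m. single i w k \<bullet> single j w' k) = (\<Sum>k<m. if k = i then (if i = j then w \<bullet> w' else 0) else 0)"
    by (intro sum.cong refl) (auto simp: single_def)
  then show ?thesis using \<open>i < m\<close> by simp
qed

lemma additive_tensor_expand:
  fixes \<phi> :: "(nat \<Rightarrow> 'w::real_vector) \<Rightarrow> 'v::real_vector"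
  assumes add: "\<And>x y. x \<in> tensor_space m UNIV \<Longrightarrow> y \<in> tensor_space m UNIV \<Longrightarrow> \<phi> (x + y) = \<phi> x + \<phi> y"
    and x: "x \<in> tensor_space m UNIV"
  shows "\<phi> x = (\<Sum>i<m. \<phi> (single i (x i)))"
proof -
  have "\<phi> (0 + 0) = \<phi> 0 + \<phi> 0" by (intro add tensor_space_zero)
  then have z: "\<phi> 0 = 0" by simp
  have "\<phi> (\<lambda>j. if j < k then x j else 0) = (\<Sum>i<k. \<phi> (single i (x i)))" if "k \<le> m" for k
    using that
  proof (induction k)
    case 0
    have "(\<lambda>j. if j < 0 then x j else 0) = 0" by auto
    then show ?case using z by simp
  next
    case (Suc k)
    have e: "(\<lambda>j. if j < Suc k then x j else 0) = (\<lambda>j. if j < k then x j else 0) + single k (x k)"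
      by (auto simp: fun_eq_iff single_def less_Suc_eq)
    show ?case unfolding e
      using Suc by (subst add) (auto simp: tensor_space_def single_def)
  qed
  moreover have "(\<lambda>j. if j < m then x j else 0) = x" using x unfolding tensor_space_def by auto
  ultimately show ?thesis by (metis order_refl)
qed

text \<open>This applies to a decomposition as well as to its restrictions to the summands of either type.\<close>

lemma isometric_copies:
  assumes W: "cl0_rep r \<tau>"
    and add: "\<And>x y. x \<in> tensor_space m UNIV \<Longrightarrow> y \<in> tensor_space m UNIV \<Longrightarrow> \<phi> (x + y) = \<phi> x + \<phi> y"
    and scale: "\<And>t x. x \<in> tensor_space m UNIV \<Longrightarrow> \<phi> (\<lambda>i. t *\<^sub>R x i) = t *\<^sub>R \<phi> x"
    and inner: "\<And>x y. x \<in> tensor_space m UNIV \<Longrightarrow> y \<in> tensor_space m UNIV \<Longrightarrow> \<phi> x \<bullet> \<phi> y = (\<Sum>i<m. x i \<bullet> y i)"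
    and act: "\<And>a x. a \<in> Cl0 r \<Longrightarrow> x \<in> tensor_space m UNIV \<Longrightarrow> \<phi> (\<lambda>i. \<tau> a (x i)) = \<rho> a (\<phi> x)"
  defines "f \<equiv> \<lambda>i w. \<phi> (single i w)"
  shows "orthonormal_copies r \<tau> \<rho> m f" "x \<in> tensor_space m UNIV \<Longrightarrow> \<phi> x = (\<Sum>i<m. f i (x i))"
proof -
  interpret W: cl0_rep r \<tau> by (rule W)
  show "x \<in> tensor_space m UNIV \<Longrightarrow> \<phi> x = (\<Sum>i<m. f i (x i))"
    unfolding f_def by (rule additive_tensor_expand[OF add])
  have "linear (f i)" if "i < m" for i
    unfolding f_def by (rule linearI) (simp_all add: single_simps that add scale)
  moreover have "f i (\<tau> a w) = \<rho> a (f i w)" if "i < m" "a \<in> Cl0 r" for i a w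
    unfolding f_def using that by (simp add: single_linear[OF W.rep_linear] act single_simps)
  moreover have "f i w \<bullet> f j w' = (if i = j then w \<bullet> w' else 0)" if "i < m" "j < m" for i j w w'
    unfolding f_def using that by (subst inner) (auto simp: single_simps sum_single_inner)
  ultimately show "orthonormal_copies r \<tau> \<rho> m f" unfolding orthonormal_copies_def intertwines_def by blast
qed

lemma decomposition_frame:
  assumes D: "decomposition r \<tau> \<rho> m \<phi>" and W: "cl0_rep r \<tau>"
  obtains f where "frame r \<tau> \<rho> (\<lambda>v. v) m f" "\<And>x. x \<in> tensor_space m UNIV \<Longrightarrow> \<phi> x = (\<Sum>i<m. f i (x i))"
proof -
  have bij: "bij_betw \<phi> (tensor_space m UNIV) UNIV"
    and add: "\<And>x y. x \<in> tensor_space m UNIV \<Longrightarrow> y \<in> tensor_space m UNIV \<Longrightarrow> \<phi> (x + y) = \<phi> x + \<phi> y"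
    and scale: "\<And>t x. x \<in> tensor_space m UNIV \<Longrightarrow> \<phi> (\<lambda>i. t *\<^sub>R x i) = t *\<^sub>R \<phi> x"
    and inner: "\<And>x y. x \<in> tensor_space m UNIV \<Longrightarrow> y \<in> tensor_space m UNIV \<Longrightarrow> \<phi> x \<bullet> \<phi> y = (\<Sum>i<m. x i \<bullet> y i)"
    and act: "\<And>a x. a \<in> Cl0 r \<Longrightarrow> x \<in> tensor_space m UNIV \<Longrightarrow> \<phi> (\<lambda>i. \<tau> a (x i)) = \<rho> a (\<phi> x)"
    using D unfolding decomposition_def Let_def by blast+
  define f where "f = (\<lambda>i w. \<phi> (single i w))"
  have copies: "orthonormal_copies r \<tau> \<rho> m f" "\<And>x. x \<in> tensor_space m UNIV \<Longrightarrow> \<phi> x = (\<Sum>i<m. f i (x i))"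
    unfolding f_def by (rule isometric_copies[OF W add scale inner act]; assumption)+
  have "v = (\<Sum>i<m. f i (adjoint (f i) v))" for v
  proof -
    obtain x where x: "x \<in> tensor_space m UNIV" "v = \<phi> x" using bij unfolding bij_betw_def by blast
    show ?thesis unfolding x(2) copies(2)[OF x(1)] by (simp add: copies_coordinate[OF copies(1)])
  qed
  then have "frame r \<tau> \<rho> (\<lambda>v. v) m f" unfolding frame_def using copies(1) by blast
  then show thesis using copies(2) by (rule that)
qed

subsection \<open>The two eigenspaces of the volume element\<close>

definition vol_proj :: "nat \<Rightarrow> (clifford \<Rightarrow> 'v::real_vector \<Rightarrow> 'v) \<Rightarrow> real \<Rightarrow> 'v \<Rightarrow> 'v" where
  "vol_proj r \<rho> \<epsilon> v = (1 / 2) *\<^sub>R (v + \<epsilon> *\<^sub>R \<rho> (vol r) v)"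

context orthogonal_rep
begin

lemma vol_intertwines: "even r \<Longrightarrow> intertwines r \<rho> \<rho> (\<rho> (vol r))"
proof -
  assume r: "even r"
  interpret P: cl0_rep_pair r \<rho> \<rho> by (intro cl0_rep_pair.intro cl0_rep_axioms)
  show ?thesis
    by (rule P.intertwines_basisI) (simp_all add: rep_linear vol_in_Cl0 r vol_commutes)
qed

lemma vol_square_symmetric:
  assumes "r mod 4 = 0"
  shows "\<rho> (vol r) (\<rho> (vol r) v) = v" "\<rho> (vol r) u \<bullet> v = u \<bullet> \<rho> (vol r) v"
proof -
  have "even r" using assms by presburger
  note F = full_even_set[OF this]
  show "\<rho> (vol r) (\<rho> (vol r) v) = v" "\<rho> (vol r) u \<bullet> v = u \<bullet> \<rho> (vol r) v"
    unfolding vol_eq using basis_square[OF F] basis_adjoint[OF F] cl_sign_vol_0[OF assms] by simp_all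
qed

lemma vol_proj:
  assumes r: "r mod 4 = 0" and e: "\<epsilon> = 1 \<or> \<epsilon> = - 1"
  shows "intertwines r \<rho> \<rho> (vol_proj r \<rho> \<epsilon>)"
    "vol_proj r \<rho> \<epsilon> (vol_proj r \<rho> \<epsilon> v) = vol_proj r \<rho> \<epsilon> v"
    "vol_proj r \<rho> \<epsilon> (vol_proj r \<rho> (- \<epsilon>) v) = 0"
    "vol_proj r \<rho> \<epsilon> u \<bullet> v = u \<bullet> vol_proj r \<rho> \<epsilon> v"
    "vol_proj r \<rho> \<epsilon> (\<rho> (vol r) v) = \<epsilon> *\<^sub>R vol_proj r \<rho> \<epsilon> v"
    "vol_proj r \<rho> \<epsilon> v + vol_proj r \<rho> (- \<epsilon>) v = v"
    "\<rho> (vol r) v = \<epsilon> *\<^sub>R v \<Longrightarrow> vol_proj r \<rho> \<epsilon> v = v"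
    "\<rho> (vol r) v = \<epsilon> *\<^sub>R v \<Longrightarrow> vol_proj r \<rho> (- \<epsilon>) v = 0"
proof -
  have ev: "even r" using r by presburger
  have ee: "\<epsilon> * \<epsilon> = 1" "\<epsilon> * (\<epsilon> * x) = x" for x using e by auto
  note vi = vol_intertwines[OF ev] note lin = intertwinesD(1)[OF vi]
  show "intertwines r \<rho> \<rho> (vol_proj r \<rho> \<epsilon>)"
    unfolding vol_proj_def by (intro intertwines_scale intertwines_add intertwines_id vi)
  have vp: "\<rho> (vol r) (vol_proj r \<rho> e v) = (1/2) *\<^sub>R (\<rho> (vol r) v + e *\<^sub>R v)" for e v
    unfolding vol_proj_def by (simp add: linear_cmul[OF lin] linear_add[OF lin] vol_square_symmetric[OF r])
  show pv: "vol_proj r \<rho> \<epsilon> (\<rho> (vol r) v) = \<epsilon> *\<^sub>R vol_proj r \<rho> \<epsilon> v" for v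
    unfolding vol_proj_def by (simp add: vol_square_symmetric[OF r] scaleR_add_right ee add.commute)
  have ev1: "\<rho> (vol r) (vol_proj r \<rho> \<epsilon> v) = \<epsilon> *\<^sub>R vol_proj r \<rho> \<epsilon> v" for v
    unfolding vp unfolding vol_proj_def by (simp add: scaleR_add_right ee add.commute)
  show fix1: "\<rho> (vol r) v = \<epsilon> *\<^sub>R v \<Longrightarrow> vol_proj r \<rho> \<epsilon> v = v" for v
    unfolding vol_proj_def by (simp add: ee scaleR_add_right half_add_half)
  show fix0: "\<rho> (vol r) v = \<epsilon> *\<^sub>R v \<Longrightarrow> vol_proj r \<rho> (- \<epsilon>) v = 0" for v
    unfolding vol_proj_def by (simp add: ee)
  show "vol_proj r \<rho> \<epsilon> (vol_proj r \<rho> \<epsilon> v) = vol_proj r \<rho> \<epsilon> v" by (rule fix1[OF ev1])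
  have "\<rho> (vol r) (vol_proj r \<rho> (- \<epsilon>) v) = (- \<epsilon>) *\<^sub>R vol_proj r \<rho> (- \<epsilon>) v"
    unfolding vp unfolding vol_proj_def by (simp add: scaleR_add_right scaleR_diff_right ee)
  then show "vol_proj r \<rho> \<epsilon> (vol_proj r \<rho> (- \<epsilon>) v) = 0"
    by (simp add: vol_proj_def[of r \<rho> \<epsilon>] ee)
  show "vol_proj r \<rho> \<epsilon> u \<bullet> v = u \<bullet> vol_proj r \<rho> \<epsilon> v"
    unfolding vol_proj_def by (simp add: inner_add_left inner_add_right vol_square_symmetric[OF r])
  show "vol_proj r \<rho> \<epsilon> v + vol_proj r \<rho> (- \<epsilon>) v = v"
    unfolding vol_proj_def by (simp add: scaleR_add_right scaleR_diff_right half_add_half)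
qed

end

text \<open>The images lie in those of the complementary projections \<open>C\<close> and \<open>C'\<close>.\<close>

lemma frames_orthogonal:
  assumes F: "frame r \<tau> \<rho> C m f" and G: "frame r \<sigma> \<rho> C' n g"
    and sym: "\<And>u v. C u \<bullet> v = u \<bullet> C v" and CC: "\<And>v. C (C' v) = 0" and i: "i < m" and j: "j < n"
  shows "f i w \<bullet> g j w' = 0" "adjoint (f i) (g j w') = 0" "adjoint (g j) (f i w) = 0"
proof -
  have *: "f i w \<bullet> g j w' = 0" for w w'
  proof -
    have "f i w \<bullet> g j w' = C (f i w) \<bullet> C' (g j w')" by (simp add: frame_range[OF F i] frame_range[OF G j])
    then show ?thesis by (simp add: sym CC)
  qed
  show "f i w \<bullet> g j w' = 0" by (rule *)
  have "adjoint (f i) (g j w') \<bullet> u = 0" for u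
    using * by (simp add: adjoint_clauses[OF frameD(2)[OF F i]] inner_commute)
  then show "adjoint (f i) (g j w') = 0" using inner_eq_zero_iff by blast
  have "adjoint (g j) (f i w) \<bullet> u = 0" for u
    using * by (simp add: adjoint_clauses[OF frameD(2)[OF G j]])
  then show "adjoint (g j) (f i w) = 0" using inner_eq_zero_iff by blast
qed

lemma frames_decomposition2:
  assumes F: "frame r \<tau> \<rho> C m f" and G: "frame r \<sigma> \<rho> C' n g" and V: "cl0_rep r \<rho>"
    and sym: "\<And>u v. C u \<bullet> v = u \<bullet> C v" and CC: "\<And>v. C (C' v) = 0" and id: "\<And>v. C v + C' v = v"
  shows "decomposition2 r \<tau> \<sigma> \<rho> m n (\<lambda>(x, y). (\<Sum>i<m. f i (x i)) + (\<Sum>i<n. g i (y i)))"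
proof -
  interpret V: cl0_rep r \<rho> by (rule V)
  note O = frames_orthogonal[OF F G sym CC]
  let ?\<phi> = "\<lambda>(x, y). (\<Sum>i<m. f i (x i)) + (\<Sum>i<n. g i (y i))"
  have inv: "(\<Sum>i<m. f i (coordinates m f v i)) + (\<Sum>i<n. g i (coordinates n g v i)) = v" for v
    using frameD(4)[OF F, of v] frameD(4)[OF G, of v] id[of v] unfolding coordinates_def by simp
  have cf: "coordinates m f (\<Sum>i<n. g i (y i)) = 0" for y
    unfolding coordinates_def
    by (auto simp: fun_eq_iff linear_sum[OF frame_adjoint_linear[OF F]] O)
  have cg: "coordinates n g (\<Sum>i<m. f i (x i)) = 0" for x
    unfolding coordinates_def
    by (auto simp: fun_eq_iff linear_sum[OF frame_adjoint_linear[OF G]] O)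
  have addf: "coordinates m f (u + v) = coordinates m f u + coordinates m f v" for u v
    unfolding coordinates_def by (auto simp: fun_eq_iff linear_add[OF frame_adjoint_linear[OF F]])
  have addg: "coordinates n g (u + v) = coordinates n g u + coordinates n g v" for u v
    unfolding coordinates_def by (auto simp: fun_eq_iff linear_add[OF frame_adjoint_linear[OF G]])
  have bij: "bij_betw ?\<phi> (tensor_space m UNIV \<times> tensor_space n UNIV) UNIV"
    by (rule bij_betwI[where g = "\<lambda>v. (coordinates m f v, coordinates n g v)"])
      (auto simp: coordinates_in_tensor_space frame_coordinates[OF F] frame_coordinates[OF G] inv addf addg cf cg)
  have inner: "((\<Sum>i<m. f i (x i)) + (\<Sum>i<n. g i (y i))) \<bullet> ((\<Sum>i<m. f i (x' i)) + (\<Sum>i<n. g i (y' i))) =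
      (\<Sum>i<m. x i \<bullet> x' i) + (\<Sum>i<n. y i \<bullet> y' i)" for x y x' y'
  proof -
    have "(\<Sum>i<m. f i (x i)) \<bullet> (\<Sum>i<n. g i (y i)) = 0" for x y
      unfolding inner_sum_left inner_sum_right by (simp add: O)
    then show ?thesis
      by (simp add: inner_add_left inner_add_right frame_inner_sum[OF F] frame_inner_sum[OF G] inner_commute)
  qed
  show ?thesis
    unfolding decomposition2_def Let_def
    using bij inner
    by (auto simp: linear_add[OF frameD(2)[OF F]] linear_cmul[OF frameD(2)[OF F]] sum.distrib
        linear_add[OF frameD(2)[OF G]] linear_cmul[OF frameD(2)[OF G]] scaleR_add_right
        scaleR_sum_right linear_sum[OF V.rep_linear] linear_add[OF V.rep_linear]
        intertwinesD(2)[OF frameD(1)[OF F]] intertwinesD(2)[OF frameD(1)[OF G]] algebra_simps)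
qed

text \<open>The volume element acts as \<open>1\<close> on the copies of the first module and as \<open>-1\<close> on those of the second,
  so the projections to their spans are the two spectral projections of \<open>vol\<close>.\<close>

lemma decomposition2_frames:
  assumes D: "decomposition2 r \<tau> \<sigma> \<rho> m n \<phi>" and W: "cl0_rep r \<tau>" "cl0_rep r \<sigma>"
    and V: "orthogonal_rep r \<rho>"
    and r: "r mod 4 = 0" and vol: "\<And>w. \<tau> (vol r) w = w" "\<And>w. \<sigma> (vol r) w = - w"
  obtains f g where "frame r \<tau> \<rho> (vol_proj r \<rho> 1) m f" "frame r \<sigma> \<rho> (vol_proj r \<rho> (- 1)) n g"
    "\<And>x y. x \<in> tensor_space m UNIV \<Longrightarrow> y \<in> tensor_space n UNIV \<Longrightarrow>
      \<phi> (x, y) = (\<Sum>i<m. f i (x i)) + (\<Sum>i<n. g i (y i))"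
proof -
  interpret W: cl0_rep r \<tau> by (rule W)
  interpret W': cl0_rep r \<sigma> by (rule W)
  interpret V: orthogonal_rep r \<rho> by (rule V)
  let ?D = "tensor_space m UNIV" and ?E = "tensor_space n UNIV"
  have bij: "bij_betw \<phi> (?D \<times> ?E) UNIV"
    and add: "\<And>x y. x \<in> ?D \<times> ?E \<Longrightarrow> y \<in> ?D \<times> ?E \<Longrightarrow> \<phi> (x + y) = \<phi> x + \<phi> y"
    and scale: "\<And>t x y. x \<in> ?D \<Longrightarrow> y \<in> ?E \<Longrightarrow> \<phi> (\<lambda>i. t *\<^sub>R x i, \<lambda>i. t *\<^sub>R y i) = t *\<^sub>R \<phi> (x, y)"
    and inner: "\<And>x y x' y'. x \<in> ?D \<Longrightarrow> y \<in> ?E \<Longrightarrow> x' \<in> ?D \<Longrightarrow> y' \<in> ?E \<Longrightarrow>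
      \<phi> (x, y) \<bullet> \<phi> (x', y') = (\<Sum>i<m. x i \<bullet> x' i) + (\<Sum>i<n. y i \<bullet> y' i)"
    and act: "\<And>a x y. a \<in> Cl0 r \<Longrightarrow> x \<in> ?D \<Longrightarrow> y \<in> ?E \<Longrightarrow>
      \<phi> (\<lambda>i. \<tau> a (x i), \<lambda>i. \<sigma> a (y i)) = \<rho> a (\<phi> (x, y))"
    using D unfolding decomposition2_def Let_def by blast+
  note z = tensor_space_zero(2)
  define f where "f = (\<lambda>i w. \<phi> (single i w, 0))"
  define g where "g = (\<lambda>i w. \<phi> (0, single i w))"
  have f: "orthonormal_copies r \<tau> \<rho> m f" "\<And>x. x \<in> ?D \<Longrightarrow> \<phi> (x, 0) = (\<Sum>i<m. f i (x i))"
  proof -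
    have *: "x \<in> ?D \<Longrightarrow> y \<in> ?D \<Longrightarrow> \<phi> (x + y, 0) = \<phi> (x, 0) + \<phi> (y, 0)"
      "x \<in> ?D \<Longrightarrow> \<phi> (\<lambda>i. t *\<^sub>R x i, 0) = t *\<^sub>R \<phi> (x, 0)"
      "x \<in> ?D \<Longrightarrow> y \<in> ?D \<Longrightarrow> \<phi> (x, 0) \<bullet> \<phi> (y, 0) = (\<Sum>i<m. x i \<bullet> y i)"
      "a \<in> Cl0 r \<Longrightarrow> x \<in> ?D \<Longrightarrow> \<phi> (\<lambda>i. \<tau> a (x i), 0) = \<rho> a (\<phi> (x, 0))" for x y t a
      using add[of "(x, 0)" "(y, 0)"] scale[of x 0 t] inner[of x 0 y 0] act[of a x 0] z
      by (simp_all add: z zero_fun_def[symmetric] linear_0[OF W'.rep_linear])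
    show "orthonormal_copies r \<tau> \<rho> m f" "\<And>x. x \<in> ?D \<Longrightarrow> \<phi> (x, 0) = (\<Sum>i<m. f i (x i))"
      unfolding f_def by (rule isometric_copies[where \<phi> = "\<lambda>x. \<phi> (x, 0)", OF W(1) *]; assumption)+
  qed
  have g: "orthonormal_copies r \<sigma> \<rho> n g" "\<And>x. x \<in> ?E \<Longrightarrow> \<phi> (0, x) = (\<Sum>i<n. g i (x i))"
  proof -
    have *: "x \<in> ?E \<Longrightarrow> y \<in> ?E \<Longrightarrow> \<phi> (0, x + y) = \<phi> (0, x) + \<phi> (0, y)"
      "x \<in> ?E \<Longrightarrow> \<phi> (0, \<lambda>i. t *\<^sub>R x i) = t *\<^sub>R \<phi> (0, x)"
      "x \<in> ?E \<Longrightarrow> y \<in> ?E \<Longrightarrow> \<phi> (0, x) \<bullet> \<phi> (0, y) = (\<Sum>i<n. x i \<bullet> y i)"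
      "a \<in> Cl0 r \<Longrightarrow> x \<in> ?E \<Longrightarrow> \<phi> (0, \<lambda>i. \<sigma> a (x i)) = \<rho> a (\<phi> (0, x))" for x y t a
      using add[of "(0, x)" "(0, y)"] scale[of 0 x t] inner[of 0 x 0 y] act[of a 0 x] z
      by (simp_all add: z zero_fun_def[symmetric] linear_0[OF W.rep_linear])
    show "orthonormal_copies r \<sigma> \<rho> n g" "\<And>x. x \<in> ?E \<Longrightarrow> \<phi> (0, x) = (\<Sum>i<n. g i (x i))"
      unfolding g_def by (rule isometric_copies[where \<phi> = "\<lambda>x. \<phi> (0, x)", OF W(2) *]; assumption)+
  qed
  have exp: "\<phi> (x, y) = (\<Sum>i<m. f i (x i)) + (\<Sum>i<n. g i (y i))" if "x \<in> ?D" "y \<in> ?E" for x y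
  proof -
    have "\<phi> (x, y) = \<phi> (x, 0) + \<phi> (0, y)" using add[of "(x, 0)" "(0, y)"] that by (simp add: z)
    then show ?thesis by (simp add: f(2) g(2) that)
  qed
  have ev: "even r" using r by presburger
  note vC = vol_in_Cl0[OF ev]
  have vf: "vol_proj r \<rho> 1 (f i w) = f i w" "vol_proj r \<rho> (-1) (f i w) = 0" if "i < m" for i w
    using V.vol_proj(7,8)[OF r, of 1 "f i w"] intertwinesD(2)[OF copiesD(1)[OF f(1) that] vC, of w] vol by simp_all
  have vg: "vol_proj r \<rho> (-1) (g i w) = g i w" "vol_proj r \<rho> 1 (g i w) = 0" if "i < n" for i w
    using V.vol_proj(7,8)[OF r, of "-1" "g i w"] intertwinesD(2)[OF copiesD(1)[OF g(1) that] vC, of w] vol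
      linear_neg[OF copiesD(2)[OF g(1) that], of w] by simp_all
  have l: "linear (vol_proj r \<rho> 1)" "linear (vol_proj r \<rho> (-1))"
    using intertwinesD(1)[OF V.vol_proj(1)[OF r]] by auto
  have c: "vol_proj r \<rho> 1 v = (\<Sum>i<m. f i (adjoint (f i) v)) \<and>
      vol_proj r \<rho> (-1) v = (\<Sum>i<n. g i (adjoint (g i) v))" for v
  proof -
    obtain x y where x: "x \<in> ?D" "y \<in> ?E" and "v = \<phi> (x, y)" using bij unfolding bij_betw_def by blast
    then have v: "v = (\<Sum>i<m. f i (x i)) + (\<Sum>i<n. g i (y i))" using exp by simp
    have p: "vol_proj r \<rho> 1 v = (\<Sum>i<m. f i (x i))" "vol_proj r \<rho> (-1) v = (\<Sum>i<n. g i (y i))"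
      unfolding v by (simp_all add: linear_add[OF l(1)] linear_add[OF l(2)] linear_sum[OF l(1)]
          linear_sum[OF l(2)] vf vg)
    have "adjoint (f i) v = x i" if "i < m" for i
    proof -
      have "adjoint (f i) v \<bullet> u = adjoint (f i) (vol_proj r \<rho> 1 v) \<bullet> u" for u
        by (simp add: adjoint_clauses[OF copiesD(2)[OF f(1) that]] V.vol_proj(4)[OF r] vf that)
      then have "adjoint (f i) v = adjoint (f i) (vol_proj r \<rho> 1 v)" using vector_eq_rdot by blast
      then show ?thesis unfolding p by (simp add: copies_coordinate[OF f(1) that])
    qed
    moreover have "adjoint (g i) v = y i" if "i < n" for i
    proof -
      have "adjoint (g i) v \<bullet> u = adjoint (g i) (vol_proj r \<rho> (-1) v) \<bullet> u" for u
        by (simp add: adjoint_clauses[OF copiesD(2)[OF g(1) that]] V.vol_proj(4)[OF r] vg that)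
      then have "adjoint (g i) v = adjoint (g i) (vol_proj r \<rho> (-1) v)" using vector_eq_rdot by blast
      then show ?thesis unfolding p by (simp add: copies_coordinate[OF g(1) that])
    qed
    ultimately show ?thesis unfolding p by simp
  qed
  have "frame r \<tau> \<rho> (vol_proj r \<rho> 1) m f" "frame r \<sigma> \<rho> (vol_proj r \<rho> (- 1)) n g"
    unfolding frame_def using f(1) g(1) c by blast+
  then show thesis using exp by (rule that)
qed

section \<open>The centralizer as a Lie algebra of matrices over the commutant\<close>

lemma centralizer_iff:
  assumes V: "cl0_rep r \<rho>"
  shows "X \<in> lcarrier (centralizer r \<rho>) \<longleftrightarrow> intertwines r \<rho> \<rho> X \<and> (\<forall>u v. X u \<bullet> v = - (u \<bullet> X v))"
    (is "?l \<longleftrightarrow> ?r")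
proof
  interpret V: cl0_rep r \<rho> by (rule V)
  interpret P: cl0_rep_pair r \<rho> \<rho> by (intro cl0_rep_pair.intro V)
  show ?r if l: ?l
  proof
    have X: "linear X" "\<And>u v. X u \<bullet> v = - (u \<bullet> X v)"
      and com: "\<And>\<xi> v. \<xi> \<in> lcarrier (spin_lie r) \<Longrightarrow> X (\<rho> \<xi> v) = \<rho> \<xi> (X v)"
      using l unfolding centralizer_def end_lie_def skew_def by auto
    show "intertwines r \<rho> \<rho> X"
    proof (rule P.intertwines_pairI[OF X(1)])
      fix i j v assume "1 \<le> i" "i < j" "j \<le> r"
      then have "cl_gen i * cl_gen j \<in> lcarrier (spin_lie r)"
        unfolding spin_lie_def lie_algebra.simps by (intro span_base) blast
      then show "X (\<rho> (cl_gen i * cl_gen j) v) = \<rho> (cl_gen i * cl_gen j) (X v)" by (rule com)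
    qed
    show "\<forall>u v. X u \<bullet> v = - (u \<bullet> X v)" using X(2) by blast
  qed
  show ?l if ?r
    using that spin_lie_subset_Cl0[of r]
    unfolding centralizer_def end_lie_def skew_def intertwines_def by auto
qed

text \<open>Matrices over the commutant which are anti-selfadjoint for the conjugate transpose.\<close>

definition skew_matrix ::
  "nat \<Rightarrow> (clifford \<Rightarrow> 'w::euclidean_space \<Rightarrow> 'w) \<Rightarrow> nat \<Rightarrow> (nat \<Rightarrow> nat \<Rightarrow> 'w \<Rightarrow> 'w) \<Rightarrow> bool" where
  "skew_matrix r \<tau> m M \<longleftrightarrow> (\<forall>i<m. \<forall>j<m. intertwines r \<tau> \<tau> (M i j) \<and>
     (\<forall>w w'. M i j w \<bullet> w' = - (w \<bullet> M j i w')))"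

text \<open>The operator \<open>\<Sum> f\<^sub>i M\<^sub>i\<^sub>j f\<^sub>j\<^sup>*\<close>, which has matrix \<open>M\<close> with respect to the copies \<open>f\<^sub>i\<close>.\<close>

definition block_op ::
  "nat \<Rightarrow> (nat \<Rightarrow> 'w::euclidean_space \<Rightarrow> 'v::euclidean_space) \<Rightarrow> (nat \<Rightarrow> nat \<Rightarrow> 'w \<Rightarrow> 'w) \<Rightarrow> 'v \<Rightarrow> 'v" where
  "block_op m f M v = (\<Sum>i<m. f i (\<Sum>j<m. M i j (adjoint (f j) v)))"

text \<open>\<open>M\<close> identifies the Lie algebra \<open>L\<close> with that of the anti-selfadjoint \<open>m \<times> m\<close> matrices over the commutant.\<close>

definition skew_matrix_iso ::
  "nat \<Rightarrow> (clifford \<Rightarrow> 'w::euclidean_space \<Rightarrow> 'w) \<Rightarrow> nat \<Rightarrow> 'l lie_algebra \<Rightarrow>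
    ('l \<Rightarrow> nat \<Rightarrow> nat \<Rightarrow> 'w \<Rightarrow> 'w) \<Rightarrow> bool" where
  "skew_matrix_iso r \<tau> m L M \<longleftrightarrow>
     (\<forall>Z\<in>lcarrier L. skew_matrix r \<tau> m (M Z)) \<and>
     (\<forall>Z\<in>lcarrier L. \<forall>Z'\<in>lcarrier L. ladd L Z Z' \<in> lcarrier L \<and> lbracket L Z Z' \<in> lcarrier L \<and>
        (\<forall>i<m. \<forall>j<m. \<forall>w. M (ladd L Z Z') i j w = M Z i j w + M Z' i j w \<and>
          M (lbracket L Z Z') i j w = (\<Sum>k<m. M Z i k (M Z' k j w)) - (\<Sum>k<m. M Z' i k (M Z k j w)))) \<and>
     (\<forall>t. \<forall>Z\<in>lcarrier L. lscale L t Z \<in> lcarrier L \<and>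
        (\<forall>i<m. \<forall>j<m. \<forall>w. M (lscale L t Z) i j w = t *\<^sub>R M Z i j w)) \<and>
     (\<forall>Z\<in>lcarrier L. \<forall>Z'\<in>lcarrier L. (\<forall>i<m. \<forall>j<m. \<forall>w. M Z i j w = M Z' i j w) \<longrightarrow> Z = Z') \<and>
     (\<forall>N. skew_matrix r \<tau> m N \<longrightarrow> (\<exists>Z\<in>lcarrier L. \<forall>i<m. \<forall>j<m. \<forall>w. M Z i j w = N i j w))"

lemma skew_matrix_isoD:
  assumes "skew_matrix_iso r \<tau> m L M"
  shows "Z \<in> lcarrier L \<Longrightarrow> skew_matrix r \<tau> m (M Z)"
    and "Z \<in> lcarrier L \<Longrightarrow> Z' \<in> lcarrier L \<Longrightarrow> ladd L Z Z' \<in> lcarrier L"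
    and "Z \<in> lcarrier L \<Longrightarrow> lscale L t Z \<in> lcarrier L"
    and "Z \<in> lcarrier L \<Longrightarrow> Z' \<in> lcarrier L \<Longrightarrow> lbracket L Z Z' \<in> lcarrier L"
    and "Z \<in> lcarrier L \<Longrightarrow> Z' \<in> lcarrier L \<Longrightarrow> (\<And>i j w. i < m \<Longrightarrow> j < m \<Longrightarrow> M Z i j w = M Z' i j w) \<Longrightarrow> Z = Z'"
    and "skew_matrix r \<tau> m N \<Longrightarrow> \<exists>Z\<in>lcarrier L. \<forall>i<m. \<forall>j<m. \<forall>w. M Z i j w = N i j w"
    and "Z \<in> lcarrier L \<Longrightarrow> Z' \<in> lcarrier L \<Longrightarrow> i < m \<Longrightarrow> j < m \<Longrightarrow>
      M (ladd L Z Z') i j w = M Z i j w + M Z' i j w"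
    and "Z \<in> lcarrier L \<Longrightarrow> i < m \<Longrightarrow> j < m \<Longrightarrow> M (lscale L t Z) i j w = t *\<^sub>R M Z i j w"
    and "Z \<in> lcarrier L \<Longrightarrow> Z' \<in> lcarrier L \<Longrightarrow> i < m \<Longrightarrow> j < m \<Longrightarrow>
      M (lbracket L Z Z') i j w = (\<Sum>k<m. M Z i k (M Z' k j w)) - (\<Sum>k<m. M Z' i k (M Z k j w))"
proof -
  note A = assms[unfolded skew_matrix_iso_def]
  note A1 = conjunct1[OF A] and B = conjunct2[OF A]
  note A2 = conjunct1[OF B] and C = conjunct2[OF B]
  note A3 = conjunct1[OF C] and D = conjunct2[OF C]
  note A4 = conjunct1[OF D] and A5 = conjunct2[OF D]
  show "Z \<in> lcarrier L \<Longrightarrow> skew_matrix r \<tau> m (M Z)" using A1 by blast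
  show "skew_matrix r \<tau> m N \<Longrightarrow> \<exists>Z\<in>lcarrier L. \<forall>i<m. \<forall>j<m. \<forall>w. M Z i j w = N i j w" using A5 by blast
  show "Z \<in> lcarrier L \<Longrightarrow> Z' \<in> lcarrier L \<Longrightarrow> (\<And>i j w. i < m \<Longrightarrow> j < m \<Longrightarrow> M Z i j w = M Z' i j w) \<Longrightarrow> Z = Z'"
    using A4 by simp
  show "Z \<in> lcarrier L \<Longrightarrow> lscale L t Z \<in> lcarrier L" using A3 by simp
  show "Z \<in> lcarrier L \<Longrightarrow> i < m \<Longrightarrow> j < m \<Longrightarrow> M (lscale L t Z) i j w = t *\<^sub>R M Z i j w" using A3 by simp
  show "Z \<in> lcarrier L \<Longrightarrow> Z' \<in> lcarrier L \<Longrightarrow> ladd L Z Z' \<in> lcarrier L"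
    and "Z \<in> lcarrier L \<Longrightarrow> Z' \<in> lcarrier L \<Longrightarrow> lbracket L Z Z' \<in> lcarrier L"
    and "Z \<in> lcarrier L \<Longrightarrow> Z' \<in> lcarrier L \<Longrightarrow> i < m \<Longrightarrow> j < m \<Longrightarrow>
      M (ladd L Z Z') i j w = M Z i j w + M Z' i j w"
    and "Z \<in> lcarrier L \<Longrightarrow> Z' \<in> lcarrier L \<Longrightarrow> i < m \<Longrightarrow> j < m \<Longrightarrow>
      M (lbracket L Z Z') i j w = (\<Sum>k<m. M Z i k (M Z' k j w)) - (\<Sum>k<m. M Z' i k (M Z k j w))"
    using A2 by simp_all
qed

lemma skew_matrix_linear: "skew_matrix r \<tau> m M \<Longrightarrow> i < m \<Longrightarrow> j < m \<Longrightarrow> linear (M i j)"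
  unfolding skew_matrix_def by (auto intro: intertwinesD(1))

lemma block_op_cong:
  "(\<And>i j w. i < m \<Longrightarrow> j < m \<Longrightarrow> M i j w = N i j w) \<Longrightarrow> block_op m f M = block_op m f N"
  unfolding block_op_def by (auto simp: fun_eq_iff intro!: sum.cong arg_cong[of _ _ "f _"])

context
  fixes r :: nat and \<tau> :: "clifford \<Rightarrow> 'w::euclidean_space \<Rightarrow> 'w" and \<rho> :: "clifford \<Rightarrow> 'v::euclidean_space \<Rightarrow> 'v"
    and C :: "'v \<Rightarrow> 'v" and m f
  assumes W: "orthogonal_rep r \<tau>" and V: "orthogonal_rep r \<rho>" and F: "frame r \<tau> \<rho> C m f"
begin

interpretation W: orthogonal_rep r \<tau> by (rule W)
interpretation V: orthogonal_rep r \<rho> by (rule V)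

lemma frame_adjoint_intertwines: "i < m \<Longrightarrow> intertwines r \<rho> \<tau> (adjoint (f i))"
  by (rule adjoint_intertwines[OF W V frameD(1)[OF F]])

lemma block_op_coordinate: "i < m \<Longrightarrow> adjoint (f i) (block_op m f M v) = (\<Sum>j<m. M i j (adjoint (f j) v))"
  unfolding block_op_def by (rule frame_coordinate[OF F])

lemma block_op_intertwines: "skew_matrix r \<tau> m M \<Longrightarrow> intertwines r \<rho> \<rho> (block_op m f M)"
proof -
  assume M: "skew_matrix r \<tau> m M"
  have row: "intertwines r \<rho> \<tau> (\<lambda>v. \<Sum>j<m. M i j (adjoint (f j) v))" if "i < m" for i
  proof (rule W.intertwines_sum)
    fix j assume "j \<in> {..<m}"
    then show "intertwines r \<rho> \<tau> (\<lambda>v. M i j (adjoint (f j) v))"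
      using M that frame_adjoint_intertwines[of j] unfolding skew_matrix_def
      by (rule_tac intertwines_comp[where f = "adjoint (f j)" and g = "M i j"]) auto
  qed
  show ?thesis unfolding block_op_def
  proof (rule V.intertwines_sum)
    fix i assume "i \<in> {..<m}"
    then show "intertwines r \<rho> \<rho> (\<lambda>v. f i (\<Sum>j<m. M i j (adjoint (f j) v)))"
      using row[of i] frameD(1)[OF F, of i] by (rule_tac intertwines_comp[where g = "f i"]) auto
  qed
qed

lemma block_op_skew:
  assumes M: "skew_matrix r \<tau> m M" shows "block_op m f M u \<bullet> v = - (u \<bullet> block_op m f M v)"
proof -
  have a: "f i x \<bullet> v = x \<bullet> adjoint (f i) v" "v \<bullet> f i x = adjoint (f i) v \<bullet> x" if "i < m" for i x v
    by (simp_all add: adjoint_clauses[OF frameD(2)[OF F that]])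
  have "block_op m f M u \<bullet> v = (\<Sum>i<m. \<Sum>j<m. M i j (adjoint (f j) u) \<bullet> adjoint (f i) v)"
    unfolding block_op_def inner_sum_left by (intro sum.cong refl) (simp add: a inner_sum_left)
  also have "\<dots> = (\<Sum>i<m. \<Sum>j<m. - (adjoint (f j) u \<bullet> M j i (adjoint (f i) v)))"
    using M unfolding skew_matrix_def by (intro sum.cong refl) auto
  also have "\<dots> = (\<Sum>j<m. \<Sum>i<m. - (adjoint (f j) u \<bullet> M j i (adjoint (f i) v)))" by (rule sum.swap)
  also have "\<dots> = - (u \<bullet> block_op m f M v)"
    unfolding block_op_def inner_sum_right sum_negf[symmetric]
    by (intro sum.cong refl) (simp add: a inner_sum_right sum_negf)
  finally show ?thesis .
qed

lemma block_op_in_centralizer: "skew_matrix r \<tau> m M \<Longrightarrow> block_op m f M \<in> lcarrier (centralizer r \<rho>)"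
  unfolding centralizer_iff[OF V.cl0_rep_axioms] using block_op_intertwines block_op_skew by blast

lemma block_op_entry:
  assumes "i < m" "j < m" and lin: "\<And>k. k < m \<Longrightarrow> linear (M i k)"
  shows "adjoint (f i) (block_op m f M (f j w)) = M i j w"
proof -
  have "adjoint (f i) (block_op m f M (f j w)) = (\<Sum>k<m. if k = j then M i j w else 0)"
    unfolding block_op_coordinate[OF assms(1)]
    by (intro sum.cong refl) (auto simp: frame_adjoint[OF F _ assms(2)] linear_0[OF lin])
  then show ?thesis using assms(2) by simp
qed

lemma block_op_inj:
  assumes "skew_matrix r \<tau> m M" "skew_matrix r \<tau> m N" "block_op m f M = block_op m f N" "i < m" "j < m"
  shows "M i j w = N i j w"
  using block_op_entry[OF assms(4,5), where M = M and w = w] block_op_entry[OF assms(4,5), where M = N and w = w]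
    skew_matrix_linear[OF assms(1,4)] skew_matrix_linear[OF assms(2,4)] assms(3,5) by simp

lemma block_op_absorb: "block_op m f M (C v) = block_op m f M v" "C (block_op m f M v) = block_op m f M v"
proof -
  show "block_op m f M (C v) = block_op m f M v"
    unfolding block_op_def by (simp add: frame_adjoint_C[OF F])
  show "C (block_op m f M v) = block_op m f M v"
    unfolding frameD(4)[OF F, of "block_op m f M v"]
    by (simp add: block_op_coordinate) (simp add: block_op_def)
qed

text \<open>The entries \<open>f\<^sub>i\<^sup>* X f\<^sub>j\<close> of an equivariant operator are equivariant.\<close>

lemma block_op_of_centralizer:
  assumes X: "X \<in> lcarrier (centralizer r \<rho>)"
  defines "N \<equiv> \<lambda>i j w. adjoint (f i) (X (f j w))"
  shows "skew_matrix r \<tau> m N" "block_op m f N v = C (X (C v))"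
proof -
  have Xi: "intertwines r \<rho> \<rho> X" "\<And>u v. X u \<bullet> v = - (u \<bullet> X v)"
    using X unfolding centralizer_iff[OF V.cl0_rep_axioms] by auto
  have "N i j w \<bullet> w' = - (w \<bullet> N j i w')" if "i < m" "j < m" for i j w w'
    unfolding N_def using that
    by (simp add: adjoint_clauses[OF frameD(2)[OF F]] Xi(2))
  moreover have "intertwines r \<tau> \<tau> (N i j)" if "i < m" "j < m" for i j
    unfolding N_def
    by (rule intertwines_comp[OF intertwines_comp[OF frameD(1)[OF F that(2)] Xi(1)]
          frame_adjoint_intertwines[OF that(1)]])
  ultimately show "skew_matrix r \<tau> m N" unfolding skew_matrix_def by blast
  show "block_op m f N v = C (X (C v))"
    unfolding frameD(4)[OF F, of "X (C v)"] unfolding frameD(4)[OF F, of v] block_op_def N_def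
      linear_sum[OF intertwinesD(1)[OF Xi(1)]]
    by (intro sum.cong refl) (simp add: linear_sum[OF frame_adjoint_linear[OF F]])
qed

lemma block_op_lie:
  assumes I: "skew_matrix_iso r \<tau> m L M" and Z: "Z \<in> lcarrier L" "Z' \<in> lcarrier L"
  shows "block_op m f (M (ladd L Z Z')) v = block_op m f (M Z) v + block_op m f (M Z') v"
    "block_op m f (M (lscale L t Z)) v = t *\<^sub>R block_op m f (M Z) v"
    "block_op m f (M (lbracket L Z Z')) v =
      block_op m f (M Z) (block_op m f (M Z') v) - block_op m f (M Z') (block_op m f (M Z) v)"
proof -
  note lin = frameD(2)[OF F]
  note sk = skew_matrix_isoD(1)[OF I Z(1)] skew_matrix_isoD(1)[OF I Z(2)]
  note ops = skew_matrix_isoD(7)[OF I Z] skew_matrix_isoD(8)[OF I Z(1)] skew_matrix_isoD(9)[OF I Z]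
  show "block_op m f (M (ladd L Z Z')) v = block_op m f (M Z) v + block_op m f (M Z') v"
    unfolding block_op_def sum.distrib[symmetric]
    by (intro sum.cong refl) (simp add: ops sum.distrib linear_add[OF lin])
  show "block_op m f (M (lscale L t Z)) v = t *\<^sub>R block_op m f (M Z) v"
    unfolding block_op_def scaleR_sum_right
    by (intro sum.cong refl) (simp add: ops scaleR_sum_right[symmetric] linear_cmul[OF lin])
  have comp: "block_op m f A (block_op m f B v) =
      (\<Sum>i<m. f i (\<Sum>j<m. \<Sum>k<m. A i k (B k j (adjoint (f j) v))))" if A: "skew_matrix r \<tau> m A" for A B
  proof -
    have "(\<Sum>k<m. A i k (adjoint (f k) (block_op m f B v))) =
        (\<Sum>j<m. \<Sum>k<m. A i k (B k j (adjoint (f j) v)))" if "i < m" for i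
    proof -
      have "(\<Sum>k<m. A i k (adjoint (f k) (block_op m f B v))) =
          (\<Sum>k<m. \<Sum>j<m. A i k (B k j (adjoint (f j) v)))"
        by (intro sum.cong refl)
          (simp add: block_op_coordinate linear_sum[OF skew_matrix_linear[OF A that]])
      also have "\<dots> = (\<Sum>j<m. \<Sum>k<m. A i k (B k j (adjoint (f j) v)))" by (rule sum.swap)
      finally show ?thesis .
    qed
    then show ?thesis unfolding block_op_def[of m f A] by simp
  qed
  show "block_op m f (M (lbracket L Z Z')) v =
      block_op m f (M Z) (block_op m f (M Z') v) - block_op m f (M Z') (block_op m f (M Z) v)"
    unfolding comp[OF sk(1)] comp[OF sk(2)] block_op_def[of m f "M (lbracket L Z Z')"] sum_subtractf[symmetric]
    by (intro sum.cong refl) (simp add: ops linear_diff[OF lin, symmetric] sum_subtractf[symmetric])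
qed

end

lemma centralizer_ops:
  "ladd (centralizer r \<rho>) = (\<lambda>X Y v. X v + Y v)"
  "lscale (centralizer r \<rho>) = (\<lambda>t X v. t *\<^sub>R X v)"
  "lbracket (centralizer r \<rho>) = (\<lambda>X Y v. X (Y v) - Y (X v))"
  unfolding centralizer_def end_lie_def by simp_all

text \<open>An element of the centralizer is determined by its matrix, and every anti-selfadjoint matrix occurs.\<close>

lemma lie_iso_single:
  assumes W: "orthogonal_rep r \<tau>" and V: "orthogonal_rep r \<rho>" and F: "frame r \<tau> \<rho> (\<lambda>v. v) m f"
    and I: "skew_matrix_iso r \<tau> m L M"
    and \<iota>: "\<And>Z. Z \<in> lcarrier L \<Longrightarrow> \<iota> Z = block_op m f (M Z)"
  shows "lie_iso L (centralizer r \<rho>) \<iota>"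
proof -
  note D = skew_matrix_isoD[OF I]
  have inj: "inj_on \<iota> (lcarrier L)"
  proof (rule inj_onI)
    fix Z Z' assume Z: "Z \<in> lcarrier L" "Z' \<in> lcarrier L" "\<iota> Z = \<iota> Z'"
    then have "block_op m f (M Z) = block_op m f (M Z')" by (simp add: \<iota>)
    then show "Z = Z'"
      by (intro D(5)[OF Z(1,2)] block_op_inj[OF W V F D(1)[OF Z(1)] D(1)[OF Z(2)]])
  qed
  have surj: "\<exists>Z\<in>lcarrier L. \<iota> Z = X" if X: "X \<in> lcarrier (centralizer r \<rho>)" for X
  proof -
    let ?N = "\<lambda>i j w. adjoint (f i) (X (f j w))"
    obtain Z where Z: "Z \<in> lcarrier L" "\<And>i j w. i < m \<Longrightarrow> j < m \<Longrightarrow> M Z i j w = ?N i j w"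
      using D(6)[OF block_op_of_centralizer(1)[OF W V F X]] by blast
    have "\<iota> Z = block_op m f ?N" unfolding \<iota>[OF Z(1)] using Z(2) by (rule block_op_cong)
    also have "\<dots> = X" using block_op_of_centralizer(2)[OF W V F X] by auto
    finally show ?thesis using Z(1) by blast
  qed
  have im: "\<iota> ` lcarrier L = lcarrier (centralizer r \<rho>)"
    using surj block_op_in_centralizer[OF W V F D(1)] \<iota> by (auto simp: image_iff)
  show ?thesis
    unfolding lie_iso_def centralizer_ops bij_betw_def
    using inj im D(2-4) by (auto simp: \<iota> fun_eq_iff block_op_lie[OF W V F I])
qed

text \<open>An element of the centralizer commutes with the projection \<open>C\<close>, so it has no entries between copies of
  different type.\<close>

lemma lie_iso_double:
  assumes W: "orthogonal_rep r \<tau>" "orthogonal_rep r \<sigma>" and V: "orthogonal_rep r \<rho>"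
    and F: "frame r \<tau> \<rho> C m f" and G: "frame r \<sigma> \<rho> C' n g"
    and C: "intertwines r \<rho> \<rho> C" "\<And>u v. C u \<bullet> v = u \<bullet> C v" "\<And>v. C (C' v) = 0" "\<And>v. C v + C' v = v"
    and C': "\<And>X v. intertwines r \<rho> \<rho> X \<Longrightarrow> C (X v) = X (C v)"
    and I: "skew_matrix_iso r \<tau> m L M" and J: "skew_matrix_iso r \<sigma> n L' M'"
    and \<iota>: "\<And>Z Z'. Z \<in> lcarrier L \<Longrightarrow> Z' \<in> lcarrier L' \<Longrightarrow>
      \<iota> (Z, Z') = (\<lambda>v. block_op m f (M Z) v + block_op n g (M' Z') v)"
  shows "lie_iso (lie_sum L L') (centralizer r \<rho>) \<iota>"
proof -
  interpret V: orthogonal_rep r \<rho> by (rule V)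
  note D = skew_matrix_isoD[OF I] and E = skew_matrix_isoD[OF J]
  note lC = intertwinesD(1)[OF C(1)]
  have C'eq: "C' v = v - C v" for v using C(4)[of v] by (simp add: algebra_simps)
  have CC: "C (C v) = C v" for v using C(3)[of v] unfolding C'eq by (simp add: linear_diff[OF lC])
  have C'C: "C' (C v) = 0" for v unfolding C'eq by (simp add: CC)
  have cross: "block_op m f A (block_op n g B v) = 0" "block_op n g B (block_op m f A v) = 0"
    if "skew_matrix r \<tau> m A" "skew_matrix r \<sigma> n B" for A B v
  proof -
    have "block_op m f A (block_op n g B v) = block_op m f A (C (C' (block_op n g B v)))"
      by (simp add: block_op_absorb[OF W(1) V F] block_op_absorb[OF W(2) V G])
    also have "\<dots> = 0" by (simp add: C(3) linear_0[OF intertwinesD(1)[OF block_op_intertwines[OF W(1) V F that(1)]]])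
    finally show "block_op m f A (block_op n g B v) = 0" .
    have "block_op n g B (block_op m f A v) = block_op n g B (C' (C (block_op m f A v)))"
      by (simp add: block_op_absorb[OF W(1) V F] block_op_absorb[OF W(2) V G])
    also have "\<dots> = 0" by (simp add: C'C linear_0[OF intertwinesD(1)[OF block_op_intertwines[OF W(2) V G that(2)]]])
    finally show "block_op n g B (block_op m f A v) = 0" .
  qed
  have lin: "linear (block_op m f (M Z))" if "Z \<in> lcarrier L" for Z
    by (rule intertwinesD(1)[OF block_op_intertwines[OF W(1) V F D(1)[OF that]]])
  have lin': "linear (block_op n g (M' Z))" if "Z \<in> lcarrier L'" for Z
    by (rule intertwinesD(1)[OF block_op_intertwines[OF W(2) V G E(1)[OF that]]])
  have inj: "inj_on \<iota> (lcarrier L \<times> lcarrier L')"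
  proof (rule inj_onI)
    fix p q assume pq: "p \<in> lcarrier L \<times> lcarrier L'" "q \<in> lcarrier L \<times> lcarrier L'" "\<iota> p = \<iota> q"
    obtain Z Z' where p: "p = (Z, Z')" "Z \<in> lcarrier L" "Z' \<in> lcarrier L'" using pq by auto
    obtain Y Y' where q: "q = (Y, Y')" "Y \<in> lcarrier L" "Y' \<in> lcarrier L'" using pq by auto
    have e: "block_op m f (M Z) v + block_op n g (M' Z') v = block_op m f (M Y) v + block_op n g (M' Y') v" for v
      using pq(3) unfolding p(1) q(1) \<iota>[OF p(2,3)] \<iota>[OF q(2,3)] by meson
    have "block_op m f (M Z) v = block_op m f (M Y) v" for v
    proof -
      have z: "block_op n g (M' T) (C v) = 0" if "T \<in> lcarrier L'" for T
        using block_op_absorb(1)[OF W(2) V G, of "M' T" "C v"] by (simp add: C'C linear_0[OF lin'[OF that]])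
      show ?thesis using e[of "C v"] by (simp add: z p q block_op_absorb[OF W(1) V F])
    qed
    moreover have "block_op n g (M' Z') v = block_op n g (M' Y') v" for v
      using e[of v] calculation by simp
    ultimately have e1: "block_op m f (M Z) = block_op m f (M Y)" and e2: "block_op n g (M' Z') = block_op n g (M' Y')"
      by auto
    have "Z = Y" by (intro D(5) p q block_op_inj[OF W(1) V F D(1)[OF p(2)] D(1)[OF q(2)] e1])
    moreover have "Z' = Y'" by (intro E(5) p q block_op_inj[OF W(2) V G E(1)[OF p(3)] E(1)[OF q(3)] e2])
    ultimately show "p = q" using p q by simp
  qed
  have surj: "\<exists>p\<in>lcarrier L \<times> lcarrier L'. \<iota> p = X" if X: "X \<in> lcarrier (centralizer r \<rho>)" for X
  proof -
    have Xi: "intertwines r \<rho> \<rho> X" using X unfolding centralizer_iff[OF V.cl0_rep_axioms] by auto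
    note lX = intertwinesD(1)[OF Xi]
    let ?N = "\<lambda>i j w. adjoint (f i) (X (f j w))" and ?N' = "\<lambda>i j w. adjoint (g i) (X (g j w))"
    obtain Z where Z: "Z \<in> lcarrier L" "\<And>i j w. i < m \<Longrightarrow> j < m \<Longrightarrow> M Z i j w = ?N i j w"
      using D(6)[OF block_op_of_centralizer(1)[OF W(1) V F X]] by blast
    obtain Z' where Z': "Z' \<in> lcarrier L'" "\<And>i j w. i < n \<Longrightarrow> j < n \<Longrightarrow> M' Z' i j w = ?N' i j w"
      using E(6)[OF block_op_of_centralizer(1)[OF W(2) V G X]] by blast
    have "\<iota> (Z, Z') v = X v" for v
    proof -
      have "\<iota> (Z, Z') v = block_op m f ?N v + block_op n g ?N' v"
        using block_op_cong[of m "M Z" ?N f, OF Z(2)] block_op_cong[of n "M' Z'" ?N' g, OF Z'(2)]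
        unfolding \<iota>[OF Z(1) Z'(1)] by simp
      also have "\<dots> = C (X (C v)) + C' (X (C' v))"
        using block_op_of_centralizer(2)[OF W(1) V F X] block_op_of_centralizer(2)[OF W(2) V G X] by simp
      also have "\<dots> = X v"
        unfolding C'eq C'[OF Xi] by (simp add: linear_diff[OF lX] linear_diff[OF lC] linear_0[OF lX] CC C'[OF Xi])
      finally show ?thesis .
    qed
    then show ?thesis using Z(1) Z'(1) by blast
  qed
  have "\<iota> (Z, Z') \<in> lcarrier (centralizer r \<rho>)" if "Z \<in> lcarrier L" "Z' \<in> lcarrier L'" for Z Z'
    using block_op_in_centralizer[OF W(1) V F D(1)[OF that(1)]] block_op_in_centralizer[OF W(2) V G E(1)[OF that(2)]]
    unfolding \<iota>[OF that] centralizer_iff[OF V.cl0_rep_axioms]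
    by (auto intro: V.intertwines_add simp: inner_add_left inner_add_right)
  then have im: "\<iota> ` (lcarrier L \<times> lcarrier L') = lcarrier (centralizer r \<rho>)"
    using surj by (auto simp: image_iff) metis+
  show ?thesis
    unfolding lie_iso_def centralizer_ops bij_betw_def lie_sum_def lie_algebra.simps
    using inj im D(2-4) E(2-4)
    by (auto simp: \<iota> fun_eq_iff block_op_lie[OF W(1) V F I] block_op_lie[OF W(2) V G J] scaleR_add_right
        linear_add[OF lin] linear_add[OF lin'] cross[OF D(1) E(1)])
qed

section \<open>The three matrix Lie algebras\<close>

lemma mat_lie_simps:
  "lcarrier (mat_lie E) = E" "ladd (mat_lie E) = (+)" "lscale (mat_lie E) = (\<lambda>t A. of_real t \<cdot>\<^sub>m A)"
  "lbracket (mat_lie E) = (\<lambda>A B. A * B - B * A)"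
  unfolding mat_lie_def by simp_all

lemma mat_mult_entry:
  assumes "A \<in> carrier_mat n n" "B \<in> carrier_mat n n" "i < n" "j < n"
  shows "(A * B) $$ (i, j) = (\<Sum>k<n. A $$ (i, k) * (B $$ (k, j) :: 'a::semiring_0))"
  using assms by (simp add: scalar_prod_def lessThan_atLeast0)

lemma skew_hermitian_iff:
  assumes "A \<in> carrier_mat m m"
  shows "transpose_mat (map_mat star A) = - A \<longleftrightarrow> (\<forall>i<m. \<forall>j<m. star (A $$ (j, i)) = - A $$ (i, j))"
  using assms by (auto simp: mat_eq_iff)

lemma skew_hermitian_bracket:
  fixes A B :: "'k::comm_ring_1 mat" and star :: "'k \<Rightarrow> 'k"
  assumes star: "\<And>a b. star (a + b) = star a + star b" "\<And>a b. star (a * b) = star a * star b"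
    and c: "A \<in> carrier_mat m m" "B \<in> carrier_mat m m"
    and A: "\<And>i j. i < m \<Longrightarrow> j < m \<Longrightarrow> star (A $$ (j, i)) = - A $$ (i, j)"
    and B: "\<And>i j. i < m \<Longrightarrow> j < m \<Longrightarrow> star (B $$ (j, i)) = - B $$ (i, j)"
    and ij: "i < m" "j < m"
  shows "star ((A * B - B * A) $$ (j, i)) = - (A * B - B * A) $$ (i, j)"
proof -
  have "star (0 + 0) = star 0 + star 0" by (rule star)
  then have star0: "star 0 = 0" by simp
  have starm: "star (- a) = - star a" for a using star(1)[of a "- a"] star0 by (simp add: eq_neg_iff_add_eq_0 add.commute)
  have starsum: "star (sum h A) = (\<Sum>x\<in>A. star (h x))" for h :: "nat \<Rightarrow> 'k" and A
    by (induction A rule: infinite_finite_induct) (simp_all add: star star0)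
  have "star ((A * B - B * A) $$ (j, i)) =
      star ((\<Sum>k<m. A $$ (j, k) * B $$ (k, i)) + - (\<Sum>k<m. B $$ (j, k) * A $$ (k, i)))"
    using c ij by (simp add: mat_mult_entry[OF _ _ ij(2,1)] del: index_mult_mat(1))
  also have "\<dots> = (\<Sum>k<m. star (A $$ (j, k)) * star (B $$ (k, i))) - (\<Sum>k<m. star (B $$ (j, k)) * star (A $$ (k, i)))"
    by (simp only: star starm starsum) simp
  also have "\<dots> = (\<Sum>k<m. A $$ (k, j) * B $$ (i, k)) - (\<Sum>k<m. B $$ (k, j) * A $$ (i, k))"
    using A B ij by simp
  also have "\<dots> = - (A * B - B * A) $$ (i, j)"
    using c ij by (simp add: mat_mult_entry[OF _ _ ij] mult.commute del: index_mult_mat(1))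
  finally show ?thesis .
qed

text \<open>The cases of \<open>so(m)\<close> and \<open>u(m)\<close> in common: the commutant is a field \<open>'k\<close>, acting through \<open>op\<close>, with the
  involution \<open>star\<close> corresponding to the adjoint.\<close>

lemma skew_matrix_iso_field:
  fixes op :: "'k::real_field \<Rightarrow> 'w::euclidean_space \<Rightarrow> 'w" and star :: "'k \<Rightarrow> 'k"
  assumes W: "cl0_rep r \<tau>"
    and star: "\<And>a b. star (a + b) = star a + star b" "\<And>a b. star (a * b) = star a * star b"
      "\<And>t. star (of_real t) = of_real t"
    and op: "\<And>a b w. op (a + b) w = op a w + op b w" "\<And>t a w. op (of_real t * a) w = t *\<^sub>R op a w"
      "\<And>a b w. op (a * b) w = op a (op b w)" "\<And>a w w'. op a w \<bullet> w' = w \<bullet> op (star a) w'"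
    and int: "\<And>a. intertwines r \<tau> \<tau> (op a)" and inj: "\<And>a b. (\<And>w. op a w = op b w) \<Longrightarrow> a = b"
    and surj: "\<And>T. intertwines r \<tau> \<tau> T \<Longrightarrow> \<exists>a. \<forall>w. T w = op a w"
    and L: "L = mat_lie {A \<in> carrier_mat m m. transpose_mat (map_mat star A) = - A}"
  shows "skew_matrix_iso r \<tau> m L (\<lambda>A i j. op (A $$ (i, j)))"
proof -
  let ?E = "{A \<in> carrier_mat m m. transpose_mat (map_mat star A) = - A}"
  have E: "A \<in> ?E \<longleftrightarrow> A \<in> carrier_mat m m \<and> (\<forall>i<m. \<forall>j<m. star (A $$ (j, i)) = - A $$ (i, j))" for A
    using skew_hermitian_iff[of A m star] by blast
  have "star (0 + 0) = star 0 + star 0" by (rule star)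
  then have star0: "star 0 = 0" by simp
  have op0: "op 0 w = 0" for w using op(2)[of 0 0 w] by simp
  have opm: "op (- a) w = - op a w" for a w using op(1)[of a "- a" w] op0 by (simp add: eq_neg_iff_add_eq_0 add.commute)
  have opd: "op (a - b) w = op a w - op b w" for a b w using op(1)[of a "- b" w] opm by simp
  have opsum: "op (sum h A) w = (\<Sum>x\<in>A. op (h x) w)" for h :: "nat \<Rightarrow> 'k" and A w
    by (induction A rule: infinite_finite_induct) (simp_all add: op op0)
  have bracket: "A * B - B * A \<in> ?E" if "A \<in> ?E" "B \<in> ?E" for A B
    using that skew_hermitian_bracket[where star = star and A = A and B = B, OF star(1,2)] unfolding E by auto
  show ?thesis
    unfolding skew_matrix_iso_def L mat_lie_simps
  proof (intro conjI ballI allI impI)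
    fix A assume A: "A \<in> ?E"
    show "skew_matrix r \<tau> m (\<lambda>i j. op (A $$ (i, j)))"
      unfolding skew_matrix_def
    proof (intro allI impI conjI int)
      fix i j w w' assume "i < m" "j < m"
      then have "star (A $$ (i, j)) = - A $$ (j, i)" using E[THEN iffD1, OF A] by blast
      then show "op (A $$ (i, j)) w \<bullet> w' = - (w \<bullet> op (A $$ (j, i)) w')" by (simp add: op(4) opm)
    qed
    fix t :: real
    show "of_real t \<cdot>\<^sub>m A \<in> ?E" using A unfolding E by (auto simp: star)
    show "op ((of_real t \<cdot>\<^sub>m A) $$ (i, j)) w = t *\<^sub>R op (A $$ (i, j)) w" if "i < m" "j < m" for i j w
      using A that op(2)[of t "A $$ (i, j)" w] by auto
  next
    fix A B assume A: "A \<in> ?E" and B: "B \<in> ?E"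
    then have c: "A \<in> carrier_mat m m" "B \<in> carrier_mat m m" by auto
    show "A + B \<in> ?E" using A B unfolding E by (auto simp: star)
    show "A * B - B * A \<in> ?E" by (rule bracket[OF A B])
    fix i j w assume ij: "i < m" "j < m"
    show "op ((A + B) $$ (i, j)) w = op (A $$ (i, j)) w + op (B $$ (i, j)) w" using c ij by (simp add: op)
    show "op ((A * B - B * A) $$ (i, j)) w =
        (\<Sum>k<m. op (A $$ (i, k)) (op (B $$ (k, j)) w)) - (\<Sum>k<m. op (B $$ (i, k)) (op (A $$ (k, j)) w))"
      using c ij by (simp add: mat_mult_entry[OF _ _ ij] opd opsum op(3) del: index_mult_mat(1))
  next
    fix A B assume "A \<in> ?E" "B \<in> ?E" and eq: "\<forall>i<m. \<forall>j<m. \<forall>w. op (A $$ (i, j)) w = op (B $$ (i, j)) w"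
    then show "A = B" using inj by (intro eq_matI) auto
  next
    fix N assume N: "skew_matrix r \<tau> m N"
    \<comment> \<open>Coefficients of the entries, which satisfy the conjugate symmetry because \<open>op\<close> is injective.\<close>
    define a where "a i j = (SOME c. \<forall>w. N i j w = op c w)" for i j
    have a: "N i j w = op (a i j) w" if "i < m" "j < m" for i j w
    proof -
      have "\<exists>c. \<forall>w. N i j w = op c w" using N that surj[of "N i j"] unfolding skew_matrix_def by blast
      then have "\<forall>w. N i j w = op (a i j) w" unfolding a_def by (rule someI_ex)
      then show ?thesis by blast
    qed
    have "star (a j i) = - a i j" if "i < m" "j < m" for i j
    proof (rule inj, rule vector_eq_ldot[THEN iffD1], rule allI)
      fix w u
      have "u \<bullet> op (star (a j i)) w = N j i u \<bullet> w" by (simp add: a that op(4))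
      also have "\<dots> = - (u \<bullet> N i j w)" using N that unfolding skew_matrix_def by blast
      finally show "u \<bullet> op (star (a j i)) w = u \<bullet> op (- a i j) w" by (simp add: a that opm)
    qed
    then show "\<exists>A\<in>?E. \<forall>i<m. \<forall>j<m. \<forall>w. op (A $$ (i, j)) w = N i j w"
      by (intro bexI[of _ "mat m m (\<lambda>(i, j). a i j)"]) (auto simp: a E)
  qed
qed

context irreducible_rep
begin

lemma skew_matrix_iso_so:
  assumes "r mod 8 \<in> {0, 1, 7}"
  shows "skew_matrix_iso r \<tau> m (so_lie m) (\<lambda>A i j w. (A $$ (i, j)) *\<^sub>R w)"
proof (rule skew_matrix_iso_field[OF cl0_rep_axioms, where star = "\<lambda>a. a"])
  have "map_mat (\<lambda>a. a) A = A" for A :: "real mat" by (rule eq_matI) auto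
  then show "so_lie m = mat_lie {A \<in> carrier_mat m m. transpose_mat (map_mat (\<lambda>a. a) A) = - A}"
    unfolding so_lie_def by simp
  show "intertwines r \<tau> \<tau> ((*\<^sub>R) a)" for a by (rule intertwines_scale[OF intertwines_id])
  show "a = b" if "\<And>w::'w. a *\<^sub>R w = b *\<^sub>R w" for a b :: real
  proof -
    obtain w :: 'w where "w \<in> Basis" using nonempty_Basis by blast
    then show ?thesis using that[of w] nonzero_Basis by auto
  qed
  show "\<exists>a. \<forall>w. T w = a *\<^sub>R w" if "intertwines r \<tau> \<tau> T" for T
    using commutant_decompose[OF that] commutant_real[OF assms] by (metis add.right_neutral)
qed (simp_all add: scaleR_add_left)

lemma skew_matrix_iso_u:
  assumes r: "r mod 8 \<in> {2, 6}"
  shows "skew_matrix_iso r \<tau> m (u_lie m) (\<lambda>Z i j w. Re (Z $$ (i, j)) *\<^sub>R w + Im (Z $$ (i, j)) *\<^sub>R \<tau> (vol r) w)"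
proof -
  let ?J = "\<tau> (vol r)"
  note U = commutant_complex(1)[OF r]
  note s = unit_commD(1)[OF U] and sq = unit_commD(2)[OF U]
  note lin = skew_commD(4-8)[OF s]
  have wJ: "?J w \<bullet> w = 0" for w using skew_commD(3)[OF s, of w w] by (simp add: inner_commute)
  show ?thesis
  proof (rule skew_matrix_iso_field[OF cl0_rep_axioms, where star = cnj and
        op = "\<lambda>z w. Re z *\<^sub>R w + Im z *\<^sub>R ?J w"])
    show "u_lie m = mat_lie {A \<in> carrier_mat m m. transpose_mat (map_mat cnj A) = - A}"
      unfolding u_lie_def ..
    show "intertwines r \<tau> \<tau> (\<lambda>w. Re z *\<^sub>R w + Im z *\<^sub>R ?J w)" for z
      by (intro intertwines_add intertwines_scale intertwines_id skew_commD(1)[OF s])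
    show "a = b" if "\<And>w. Re a *\<^sub>R w + Im a *\<^sub>R ?J w = Re b *\<^sub>R w + Im b *\<^sub>R ?J w" for a b
    proof -
      obtain w :: 'w where w: "w \<in> Basis" using nonempty_Basis by blast
      have "(Re a *\<^sub>R w + Im a *\<^sub>R ?J w) \<bullet> w = (Re b *\<^sub>R w + Im b *\<^sub>R ?J w) \<bullet> w" by (simp only: that)
      then have re: "Re a = Re b" using w by (simp add: inner_add_left wJ)
      then have "Im a *\<^sub>R ?J w = Im b *\<^sub>R ?J w" using that[of w] by simp
      moreover have "?J w \<noteq> 0" using sq[of w] w nonzero_Basis lin(5) by force
      ultimately show ?thesis using re by (simp add: complex_eq_iff)
    qed
    show "\<exists>a. \<forall>w. T w = Re a *\<^sub>R w + Im a *\<^sub>R ?J w" if T: "intertwines r \<tau> \<tau> T" for T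
    proof -
      obtain a T' where T': "skew_comm T'" "\<And>w. T w = a *\<^sub>R w + T' w" by (rule commutant_decompose[OF T]) blast
      obtain c where "\<And>w. T' w = c *\<^sub>R ?J w" using commutant_complex(2)[OF r T'(1)] by blast
      then show ?thesis using T'(2) by (intro exI[of _ "Complex a c"]) simp
    qed
    show "(Re a *\<^sub>R w + Im a *\<^sub>R ?J w) \<bullet> w' = w \<bullet> (Re (cnj a) *\<^sub>R w' + Im (cnj a) *\<^sub>R ?J w')" for a w w'
      by (simp add: inner_add_left inner_diff_right inner_add_right skew_commD(3)[OF s])
    show "Re (a * b) *\<^sub>R w + Im (a * b) *\<^sub>R ?J w =
       Re a *\<^sub>R (Re b *\<^sub>R w + Im b *\<^sub>R ?J w) + Im a *\<^sub>R ?J (Re b *\<^sub>R w + Im b *\<^sub>R ?J w)" for a b w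
      by (simp add: lin sq algebra_simps)
  qed (simp_all add: algebra_simps)
qed

end

lemma sum_lessThan_double: "(\<Sum>k<2 * m. h k) = (\<Sum>k<m. h k) + (\<Sum>k<m. h (k + m :: nat) :: 'a::comm_monoid_add)"
proof -
  have "(\<Sum>k<2 * m. h k) = (\<Sum>k<m. h k) + (\<Sum>k=m..<m + m. h k)"
    using sum.atLeastLessThan_concat[of 0 m "m + m" h] by (simp add: lessThan_atLeast0 mult_2)
  also have "(\<Sum>k=m..<m + m. h k) = (\<Sum>k<m. h (k + m))"
    using sum.shift_bounds_nat_ivl[of h 0 m m] by (simp add: lessThan_atLeast0)
  finally show ?thesis .
qed

text \<open>Block form \<open>(P, Q; -\<bar>Q, \<bar>P)\<close>, as in the description of \<open>sp(m)\<close>.\<close>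

definition quaternionic_shape :: "nat \<Rightarrow> complex mat \<Rightarrow> bool" where
  "quaternionic_shape m X \<longleftrightarrow> (\<forall>i<m. \<forall>j<m. X $$ (i + m, j) = - cnj (X $$ (i, j + m)) \<and>
     X $$ (i + m, j + m) = cnj (X $$ (i, j)))"

lemma symplectic_form_entry:
  "i < 2 * m \<Longrightarrow> j < 2 * m \<Longrightarrow> symplectic_form m $$ (i, j) =
    (if i < m then (if j = i + m then 1 else 0) else (if i = j + m then - 1 else 0))"
  unfolding symplectic_form_def by (auto simp: index_mat_four_block)

lemma symplectic_form_carrier [simp]: "symplectic_form m \<in> carrier_mat (2 * m) (2 * m)"
  unfolding symplectic_form_def by (auto simp: mult_2)

lemma symplectic_form_dim [simp]:
  "dim_row (symplectic_form m) = 2 * m" "dim_col (symplectic_form m) = 2 * m"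
  using carrier_matD[OF symplectic_form_carrier[of m]] .

lemma symplectic_condition_entry:
  assumes X: "X \<in> carrier_mat (2 * m) (2 * m)" and ab: "a < 2 * m" "b < 2 * m"
  shows "(transpose_mat X * symplectic_form m + symplectic_form m * X) $$ (a, b) =
    (if b < m then - X $$ (b + m, a) else X $$ (b - m, a)) +
    (if a < m then X $$ (a + m, b) else - X $$ (a - m, b))"
proof -
  have "(transpose_mat X * symplectic_form m) $$ (a, b) = (\<Sum>k<2 * m. X $$ (k, a) * symplectic_form m $$ (k, b))"
    using X ab by (subst mat_mult_entry[of _ "2 * m"]) auto
  also have "\<dots> = (\<Sum>k<2 * m. if k = (if b < m then b + m else b - m) then
      (if b < m then - X $$ (b + m, a) else X $$ (b - m, a)) else 0)"
    using ab by (intro sum.cong refl) (auto simp: symplectic_form_entry)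
  also have "\<dots> = (if b < m then - X $$ (b + m, a) else X $$ (b - m, a))"
    using ab by (subst sum.delta) auto
  finally have 1: "(transpose_mat X * symplectic_form m) $$ (a, b) =
    (if b < m then - X $$ (b + m, a) else X $$ (b - m, a))" .
  have "(symplectic_form m * X) $$ (a, b) = (\<Sum>k<2 * m. symplectic_form m $$ (a, k) * X $$ (k, b))"
    using X ab by (subst mat_mult_entry[of _ "2 * m"]) auto
  also have "\<dots> = (\<Sum>k<2 * m. if k = (if a < m then a + m else a - m) then
      (if a < m then X $$ (a + m, b) else - X $$ (a - m, b)) else 0)"
    using ab by (intro sum.cong refl) (auto simp: symplectic_form_entry)
  also have "\<dots> = (if a < m then X $$ (a + m, b) else - X $$ (a - m, b))"
    using ab by (subst sum.delta) auto
  finally have 2: "(symplectic_form m * X) $$ (a, b) =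
    (if a < m then X $$ (a + m, b) else - X $$ (a - m, b))" .
  have "(transpose_mat X * symplectic_form m + symplectic_form m * X) $$ (a, b) =
      (transpose_mat X * symplectic_form m) $$ (a, b) + (symplectic_form m * X) $$ (a, b)"
    using X ab symplectic_form_carrier[of m] by (intro index_add_mat(1)) auto
  then show ?thesis unfolding 1 2 .
qed

text \<open>For a skew-Hermitian \<open>X\<close> the symplectic condition says that \<open>X\<close> is quaternionic.  This makes the
  first \<open>m\<close> rows of \<open>X\<close> a full set of coordinates.\<close>

lemma sp_lie_iff:
  "X \<in> lcarrier (sp_lie m) \<longleftrightarrow> X \<in> carrier_mat (2 * m) (2 * m) \<and>
    (\<forall>i<2 * m. \<forall>j<2 * m. cnj (X $$ (j, i)) = - X $$ (i, j)) \<and> quaternionic_shape m X"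
proof (cases "X \<in> carrier_mat (2 * m) (2 * m)")
  case c: True
  let ?c = "\<lambda>a b. (if b < m then - X $$ (b + m, a) else X $$ (b - m, a)) +
    (if a < m then X $$ (a + m, b) else - X $$ (a - m, b))"
  have s: "transpose_mat X * symplectic_form m + symplectic_form m * X = 0\<^sub>m (2 * m) (2 * m) \<longleftrightarrow>
      (\<forall>a<2 * m. \<forall>b<2 * m. ?c a b = 0)" (is "?L = ?R")
  proof
    assume ?L
    then show ?R using symplectic_condition_entry[OF c] by (metis index_zero_mat(1))
  next
    assume ?R
    then show ?L
      using c symplectic_form_carrier[of m] symplectic_condition_entry[OF c]
      by (intro eq_matI) (auto simp del: index_mult_mat(1) index_add_mat(1))
  qed
  have "(\<forall>a<2 * m. \<forall>b<2 * m. ?c a b = 0) \<longleftrightarrow> quaternionic_shape m X"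
    if h: "\<And>i j. i < 2 * m \<Longrightarrow> j < 2 * m \<Longrightarrow> cnj (X $$ (j, i)) = - X $$ (i, j)"
  proof
    assume z: "\<forall>a<2 * m. \<forall>b<2 * m. ?c a b = 0"
    show "quaternionic_shape m X" unfolding quaternionic_shape_def
    proof (intro allI impI conjI)
      fix i j assume ij: "i < m" "j < m"
      have "?c i (j + m) = 0" "?c (i + m) (j + m) = 0"
        using ij z[rule_format, of i "j + m"] z[rule_format, of "i + m" "j + m"] by simp_all
      then have e: "X $$ (j, i) + X $$ (i + m, j + m) = 0" "X $$ (j, i + m) = X $$ (i, j + m)"
        using ij by auto
      show "X $$ (i + m, j + m) = cnj (X $$ (i, j))"
      proof -
        have "X $$ (j, i) + cnj (X $$ (i, j)) = 0" using h[of j i] ij by simp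
        then show ?thesis using e(1) by (metis add_left_cancel)
      qed
      show "X $$ (i + m, j) = - cnj (X $$ (i, j + m))"
        using e(2) h[of j "i + m"] ij by (metis (no_types, lifting) add_less_cancel_right complex_cnj_minus
            complex_cnj_cnj mult_2 trans_less_add1 minus_minus)
    qed
  next
    assume "quaternionic_shape m X"
    then have q: "X $$ (i + m, j) = - cnj (X $$ (i, j + m))" "X $$ (i + m, j + m) = cnj (X $$ (i, j))"
      if "i < m" "j < m" for i j using that unfolding quaternionic_shape_def by auto
    have sym: "X $$ (j, i + m) = X $$ (i, j + m)" if "i < m" "j < m" for i j
      using h[of "i + m" j] q(1)[OF that] that by simp
    show "\<forall>a<2 * m. \<forall>b<2 * m. ?c a b = 0"
    proof (intro allI impI)
      fix a b assume ab: "a < 2 * m" "b < 2 * m"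
      define a' b' where "a' = (if a < m then a else a - m)" and "b' = (if b < m then b else b - m)"
      have l: "a' < m" "b' < m" using ab unfolding a'_def b'_def by auto
      have "a = a' \<or> a = a' + m" "b = b' \<or> b = b' + m" unfolding a'_def b'_def by auto
      moreover have "X $$ (b', a') = - cnj (X $$ (a', b'))" using h[of b' a'] l by simp
      ultimately show "?c a b = 0"
        using l q[OF l] q[OF l(2,1)] sym[OF l] by auto
    qed
  qed
  then show ?thesis
    unfolding sp_lie_def mat_lie_simps using c s skew_hermitian_iff[OF c, of cnj] by blast
qed (auto simp: sp_lie_def mat_lie_simps)

lemma sp_lieD:
  assumes "X \<in> lcarrier (sp_lie m)"
  shows "X \<in> carrier_mat (2 * m) (2 * m)" "quaternionic_shape m X"
    "i < 2 * m \<Longrightarrow> j < 2 * m \<Longrightarrow> cnj (X $$ (j, i)) = - X $$ (i, j)"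
    "i < m \<Longrightarrow> j < m \<Longrightarrow> X $$ (i + m, j) = - cnj (X $$ (i, j + m))"
    "i < m \<Longrightarrow> j < m \<Longrightarrow> X $$ (i + m, j + m) = cnj (X $$ (i, j))"
  using assms[unfolded sp_lie_iff] unfolding quaternionic_shape_def by blast+

lemma sp_lieI:
  assumes "X \<in> carrier_mat (2 * m) (2 * m)"
    and "\<And>i j. i < 2 * m \<Longrightarrow> j < 2 * m \<Longrightarrow> cnj (X $$ (j, i)) = - X $$ (i, j)"
    and "\<And>i j. i < m \<Longrightarrow> j < m \<Longrightarrow> X $$ (i + m, j) = - cnj (X $$ (i, j + m))"
    and "\<And>i j. i < m \<Longrightarrow> j < m \<Longrightarrow> X $$ (i + m, j + m) = cnj (X $$ (i, j))"
  shows "X \<in> lcarrier (sp_lie m)"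
  unfolding sp_lie_iff quaternionic_shape_def using assms by blast

text \<open>The product rule \<open>(P, Q) (P', Q') = (P P' - Q \<bar>Q', P Q' + Q \<bar>P')\<close> for the upper blocks.\<close>

lemma quaternionic_mult_entry:
  assumes c: "X \<in> carrier_mat (2 * m) (2 * m)" "Y \<in> carrier_mat (2 * m) (2 * m)"
    and q: "quaternionic_shape m X" "quaternionic_shape m Y" and ij: "i < m" "j < m"
  shows "(X * Y) $$ (i, j) = (\<Sum>k<m. X $$ (i, k) * Y $$ (k, j) - X $$ (i, k + m) * cnj (Y $$ (k, j + m)))"
    "(X * Y) $$ (i, j + m) = (\<Sum>k<m. X $$ (i, k) * Y $$ (k, j + m) + X $$ (i, k + m) * cnj (Y $$ (k, j)))"
    "(X * Y) $$ (i + m, j) = - cnj ((X * Y) $$ (i, j + m))"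
    "(X * Y) $$ (i + m, j + m) = cnj ((X * Y) $$ (i, j))"
proof -
  have q: "X $$ (i + m, j) = - cnj (X $$ (i, j + m))" "X $$ (i + m, j + m) = cnj (X $$ (i, j))"
    "Y $$ (i + m, j) = - cnj (Y $$ (i, j + m))" "Y $$ (i + m, j + m) = cnj (Y $$ (i, j))"
    if "i < m" "j < m" for i j using that q unfolding quaternionic_shape_def by auto
  have l: "i < 2 * m" "i + m < 2 * m" "j < 2 * m" "j + m < 2 * m" using ij by auto
  show 1: "(X * Y) $$ (i, j) = (\<Sum>k<m. X $$ (i, k) * Y $$ (k, j) - X $$ (i, k + m) * cnj (Y $$ (k, j + m)))"
    using ij by (simp add: mat_mult_entry[OF c l(1,3)] sum_lessThan_double q sum_subtractf sum_negf
        del: index_mult_mat(1))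
  show 2: "(X * Y) $$ (i, j + m) = (\<Sum>k<m. X $$ (i, k) * Y $$ (k, j + m) + X $$ (i, k + m) * cnj (Y $$ (k, j)))"
    using ij by (simp add: mat_mult_entry[OF c l(1,4)] sum_lessThan_double q sum.distrib
        del: index_mult_mat(1))
  show "(X * Y) $$ (i + m, j) = - cnj ((X * Y) $$ (i, j + m))"
    unfolding 2 using ij by (simp add: mat_mult_entry[OF c l(2,3)] sum_lessThan_double q sum.distrib sum_negf
        del: index_mult_mat(1))
  show "(X * Y) $$ (i + m, j + m) = cnj ((X * Y) $$ (i, j))"
    unfolding 1 using ij by (simp add: mat_mult_entry[OF c l(2,4)] sum_lessThan_double q sum_subtractf sum_negf
        del: index_mult_mat(1))
qed

lemma sp_lie_simps:
  "ladd (sp_lie m) = (+)" "lscale (sp_lie m) = (\<lambda>t A. of_real t \<cdot>\<^sub>m A)"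
  "lbracket (sp_lie m) = (\<lambda>A B. A * B - B * A)"
  unfolding sp_lie_def mat_lie_simps by simp_all

text \<open>The action of the quaternion \<open>p + q j\<close>, since \<open>K = I J\<close>.\<close>

definition quat_op :: "('w \<Rightarrow> 'w) \<Rightarrow> ('w \<Rightarrow> 'w) \<Rightarrow> ('w \<Rightarrow> 'w) \<Rightarrow> complex \<Rightarrow> complex \<Rightarrow> 'w \<Rightarrow> 'w::real_vector" where
  "quat_op I J K p q w = Re p *\<^sub>R w + Im p *\<^sub>R I w + Re q *\<^sub>R J w + Im q *\<^sub>R K w"

context irreducible_rep
begin

lemma quat_op:
  assumes Q: "quaternion_comm I J K"
  shows "intertwines r \<tau> \<tau> (quat_op I J K p q)"
    "quat_op I J K (p + p') (q + q') w = quat_op I J K p q w + quat_op I J K p' q' w"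
    "quat_op I J K (of_real t * p) (of_real t * q) w = t *\<^sub>R quat_op I J K p q w"
    "quat_op I J K p q (quat_op I J K p' q' w) = quat_op I J K (p * p' - q * cnj q') (p * q' + q * cnj p') w"
    "quat_op I J K p q w \<bullet> w' = w \<bullet> quat_op I J K (cnj p) (- q) w'"
    "(\<And>w. quat_op I J K p q w = quat_op I J K p' q' w) \<Longrightarrow> p = p' \<and> q = q'"
    "intertwines r \<tau> \<tau> T \<Longrightarrow> \<exists>p q. \<forall>w. T w = quat_op I J K p q w"
proof -
  note q = quaternion_commD[OF Q]
  note lin = skew_commD(4-8)[OF q(1)] skew_commD(4-8)[OF q(2)] skew_commD(4-8)[OF q(3)]
  let ?o = "quat_op I J K"
  show "intertwines r \<tau> \<tau> (?o p q)" for p q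
    unfolding quat_op_def
    by (intro intertwines_add intertwines_scale intertwines_id skew_commD(1)[OF q(1)] skew_commD(1)[OF q(2)]
        skew_commD(1)[OF q(3)])
  show add: "?o (p + p') (q + q') w = ?o p q w + ?o p' q' w" for p q p' q' w
    unfolding quat_op_def by (simp add: algebra_simps)
  show "?o (of_real t * p) (of_real t * q) w = t *\<^sub>R ?o p q w"
    unfolding quat_op_def by (simp add: algebra_simps)
  show mult: "?o p q (?o p' q' w) = ?o (p * p' - q * cnj q') (p * q' + q * cnj p') w" for p q p' q' w
    unfolding quat_op_def lin q by (simp add: lin q algebra_simps)
  show adj: "?o p q w \<bullet> w' = w \<bullet> ?o (cnj p) (- q) w'" for p q w w'
    unfolding quat_op_def
    by (simp add: inner_add_left inner_add_right inner_diff_right skew_commD(3)[OF q(1)] skew_commD(3)[OF q(2)]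
        skew_commD(3)[OF q(3)])
  show "p = p' \<and> q = q'" if eq: "\<And>w. ?o p q w = ?o p' q' w"
  proof -
    obtain w :: 'w where w: "w \<in> Basis" using nonempty_Basis by blast
    define a b where "a = p - p'" and "b = q - q'"
    have "?o (p' + a) (q' + b) w = ?o p' q' w" unfolding a_def b_def by (simp add: eq)
    then have z: "?o a b w = 0" unfolding add by simp
    have "?o (cnj a) (- b) (?o a b w) = ?o (cnj a * a + b * cnj b) 0 w"
      unfolding mult by (simp add: mult.commute)
    also have "\<dots> = (cmod a ^ 2 + cmod b ^ 2) *\<^sub>R w"
      unfolding quat_op_def by (simp add: complex_mult_cnj mult.commute[of "cnj a"] cmod_power2)
    finally have "(cmod a ^ 2 + cmod b ^ 2) *\<^sub>R w = 0" unfolding z by (simp add: quat_op_def lin)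
    then have "cmod a ^ 2 + cmod b ^ 2 = 0" using w nonzero_Basis by auto
    then have "a = 0" "b = 0" by (simp_all add: add_nonneg_eq_0_iff)
    then show ?thesis unfolding a_def b_def by simp
  qed
  show "\<exists>p q. \<forall>w. T w = ?o p q w" if T: "intertwines r \<tau> \<tau> T" for T
  proof -
    obtain a T' where T': "skew_comm T'" "\<And>w. T w = a *\<^sub>R w + T' w" by (rule commutant_decompose[OF T]) blast
    obtain b c d where "\<And>w. T' w = b *\<^sub>R I w + c *\<^sub>R J w + d *\<^sub>R K w"
      by (rule quaternion_comm_span[OF Q T'(1)]) blast
    then show ?thesis using T'(2)
      by (intro exI[of _ "Complex a b"] exI[of _ "Complex c d"]) (simp add: quat_op_def add.assoc)
  qed
qed

text \<open>Skewness of \<open>p + q j\<close> pairs \<open>(p, q)\<close> with \<open>(\<bar>p, -q)\<close>, so an anti-selfadjoint matrix has \<open>P\<close>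
  skew-Hermitian and \<open>Q\<close> symmetric.\<close>

lemma skew_matrix_iso_sp:
  assumes Q: "quaternion_comm I J K"
  shows "skew_matrix_iso r \<tau> m (sp_lie m) (\<lambda>X i j. quat_op I J K (X $$ (i, j)) (X $$ (i, j + m)))"
proof -
  note o = quat_op[OF Q]
  let ?o = "quat_op I J K"
  have sum: "(\<Sum>k\<in>A. ?o (p k) (q k) w) = ?o (\<Sum>k\<in>A. p k) (\<Sum>k\<in>A. q k) w" for p q :: "nat \<Rightarrow> complex" and A w
  proof (induction A rule: infinite_finite_induct)
    case (insert x F)
    then show ?case by (simp add: o(2))
  qed (simp_all add: quat_op_def)
  have om: "?o (- p) (- q) w = - ?o p q w" for p q w unfolding quat_op_def by (simp add: algebra_simps)
  have od: "?o (p - p') (q - q') w = ?o p q w - ?o p' q' w" for p q p' q' w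
    unfolding quat_op_def by (simp add: algebra_simps)
  have sym: "X $$ (i, j + m) = X $$ (j, i + m)" if X: "X \<in> lcarrier (sp_lie m)" and ij: "i < m" "j < m" for X i j
  proof -
    have "cnj (X $$ (j + m, i)) = - X $$ (i, j + m)" using ij by (intro sp_lieD(3)[OF X]) auto
    then show ?thesis unfolding sp_lieD(4)[OF X ij(2,1)] by simp
  qed
  show ?thesis
    unfolding skew_matrix_iso_def sp_lie_simps
  proof (intro conjI ballI allI impI)
    fix X assume X: "X \<in> lcarrier (sp_lie m)"
    show "skew_matrix r \<tau> m (\<lambda>i j. ?o (X $$ (i, j)) (X $$ (i, j + m)))"
      unfolding skew_matrix_def
    proof (intro allI impI conjI o(1))
      fix i j w w' assume ij: "i < m" "j < m"
      have "cnj (X $$ (i, j)) = - X $$ (j, i)" using ij by (intro sp_lieD(3)[OF X]) auto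
      then show "?o (X $$ (i, j)) (X $$ (i, j + m)) w \<bullet> w' = - (w \<bullet> ?o (X $$ (j, i)) (X $$ (j, i + m)) w')"
        by (simp add: o(5) om sym[OF X ij])
    qed
    fix t :: real
    note c = sp_lieD(1)[OF X]
    show "of_real t \<cdot>\<^sub>m X \<in> lcarrier (sp_lie m)"
    proof (rule sp_lieI)
      show "of_real t \<cdot>\<^sub>m X \<in> carrier_mat (2 * m) (2 * m)" using c by simp
      show "cnj ((of_real t \<cdot>\<^sub>m X) $$ (j, i)) = - (of_real t \<cdot>\<^sub>m X) $$ (i, j)" if "i < 2 * m" "j < 2 * m" for i j
        using c that sp_lieD(3)[OF X that] by simp
      show "(of_real t \<cdot>\<^sub>m X) $$ (i + m, j) = - cnj ((of_real t \<cdot>\<^sub>m X) $$ (i, j + m))"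
        "(of_real t \<cdot>\<^sub>m X) $$ (i + m, j + m) = cnj ((of_real t \<cdot>\<^sub>m X) $$ (i, j))" if "i < m" "j < m" for i j
        using c that sp_lieD(4,5)[OF X that] by simp_all
    qed
    show "?o ((of_real t \<cdot>\<^sub>m X) $$ (i, j)) ((of_real t \<cdot>\<^sub>m X) $$ (i, j + m)) w =
        t *\<^sub>R ?o (X $$ (i, j)) (X $$ (i, j + m)) w" if "i < m" "j < m" for i j w
      using c that o(3)[of t "X $$ (i, j)" "X $$ (i, j + m)" w] by simp
  next
    fix X Y assume X: "X \<in> lcarrier (sp_lie m)" and Y: "Y \<in> lcarrier (sp_lie m)"
    note c = sp_lieD(1)[OF X] sp_lieD(1)[OF Y] and q = sp_lieD(2)[OF X] sp_lieD(2)[OF Y]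
      and h = sp_lieD(3)[OF X] sp_lieD(3)[OF Y]
    show "X + Y \<in> lcarrier (sp_lie m)"
    proof (rule sp_lieI)
      show "X + Y \<in> carrier_mat (2 * m) (2 * m)" using c by simp
      show "cnj ((X + Y) $$ (j, i)) = - (X + Y) $$ (i, j)" if "i < 2 * m" "j < 2 * m" for i j
        using c that by (simp add: h)
      show "(X + Y) $$ (i + m, j) = - cnj ((X + Y) $$ (i, j + m))"
        "(X + Y) $$ (i + m, j + m) = cnj ((X + Y) $$ (i, j))" if "i < m" "j < m" for i j
        using c that sp_lieD(4,5)[OF X that] sp_lieD(4,5)[OF Y that] by simp_all
    qed
    have e: "(X * Y - Y * X) $$ (i, j) = (X * Y) $$ (i, j) - (Y * X) $$ (i, j)"
      if "i < 2 * m" "j < 2 * m" for i j using that c by simp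
    have "quaternionic_shape m (X * Y - Y * X)"
      unfolding quaternionic_shape_def
      by (simp add: e quaternionic_mult_entry(3,4)[OF c q] quaternionic_mult_entry(3,4)[OF c(2,1) q(2,1)]
          del: index_mult_mat(1) index_minus_mat(1))
    moreover have "cnj ((X * Y - Y * X) $$ (j, i)) = - (X * Y - Y * X) $$ (i, j)" if "i < 2 * m" "j < 2 * m" for i j
      using skew_hermitian_bracket[where star = cnj, OF _ _ c h that] by simp
    moreover have "X * Y - Y * X \<in> carrier_mat (2 * m) (2 * m)" by (rule minus_carrier_mat[OF mult_carrier_mat[OF c(2,1)]])
    ultimately show "X * Y - Y * X \<in> lcarrier (sp_lie m)"
      unfolding sp_lie_iff by blast
    fix i j w assume ij: "i < m" "j < m"
    show "?o ((X + Y) $$ (i, j)) ((X + Y) $$ (i, j + m)) w =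
        ?o (X $$ (i, j)) (X $$ (i, j + m)) w + ?o (Y $$ (i, j)) (Y $$ (i, j + m)) w"
      using c ij by (simp add: o(2))
    show "?o ((X * Y - Y * X) $$ (i, j)) ((X * Y - Y * X) $$ (i, j + m)) w =
        (\<Sum>k<m. ?o (X $$ (i, k)) (X $$ (i, k + m)) (?o (Y $$ (k, j)) (Y $$ (k, j + m)) w)) -
        (\<Sum>k<m. ?o (Y $$ (i, k)) (Y $$ (i, k + m)) (?o (X $$ (k, j)) (X $$ (k, j + m)) w))"
      using ij by (simp add: e od o(4) sum quaternionic_mult_entry(1,2)[OF c q ij]
          quaternionic_mult_entry(1,2)[OF c(2,1) q(2,1) ij] del: index_mult_mat(1) index_minus_mat(1))
  next
    fix X Y assume X: "X \<in> lcarrier (sp_lie m)" and Y: "Y \<in> lcarrier (sp_lie m)"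
      and eq: "\<forall>i<m. \<forall>j<m. \<forall>w. ?o (X $$ (i, j)) (X $$ (i, j + m)) w = ?o (Y $$ (i, j)) (Y $$ (i, j + m)) w"
    have e: "X $$ (i, j) = Y $$ (i, j)" "X $$ (i, j + m) = Y $$ (i, j + m)" if "i < m" "j < m" for i j
      using eq that o(6)[of "X $$ (i, j)" "X $$ (i, j + m)" "Y $$ (i, j)" "Y $$ (i, j + m)"] by auto
    show "X = Y"
    proof (rule eq_matI)
      note c = sp_lieD(1)[OF X] sp_lieD(1)[OF Y]
      then show "dim_row X = dim_row Y" "dim_col X = dim_col Y" by auto
      fix a b assume "a < dim_row Y" "b < dim_col Y"
      then have ab: "a < 2 * m" "b < 2 * m" using c by auto
      define a' b' where "a' = (if a < m then a else a - m)" and "b' = (if b < m then b else b - m)"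
      have l: "a' < m" "b' < m" using ab unfolding a'_def b'_def by auto
      have "a = a' \<or> a = a' + m" "b = b' \<or> b = b' + m" unfolding a'_def b'_def by auto
      then show "X $$ (a, b) = Y $$ (a, b)"
        using e[OF l] sp_lieD(4,5)[OF X l] sp_lieD(4,5)[OF Y l] by auto
    qed
  next
    fix N assume N: "skew_matrix r \<tau> m N"
    define pq where "pq i j = (SOME c. \<forall>w. N i j w = ?o (fst c) (snd c) w)" for i j
    define p q where "p i j = fst (pq i j)" and "q i j = snd (pq i j)" for i j
    have pq: "N i j w = ?o (p i j) (q i j) w" if "i < m" "j < m" for i j w
    proof -
      have "intertwines r \<tau> \<tau> (N i j)" using N that unfolding skew_matrix_def by blast
      then obtain x y where "\<forall>w. N i j w = ?o x y w" using o(7) by blast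
      then have "\<exists>c. \<forall>w. N i j w = ?o (fst c) (snd c) w" by (intro exI[of _ "(x, y)"]) simp
      then have "\<forall>w. N i j w = ?o (fst (pq i j)) (snd (pq i j)) w" unfolding pq_def by (rule someI_ex)
      then show ?thesis unfolding p_def q_def by blast
    qed
    have h: "cnj (p j i) = - p i j" "q j i = q i j" if "i < m" "j < m" for i j
    proof -
      have "cnj (p j i) = - p i j \<and> - q j i = - q i j"
      proof (rule o(6), rule vector_eq_ldot[THEN iffD1], rule allI)
        fix w u
        have "u \<bullet> ?o (cnj (p j i)) (- q j i) w = N j i u \<bullet> w" by (simp add: pq that o(5))
        also have "\<dots> = - (u \<bullet> N i j w)" using N that unfolding skew_matrix_def by blast
        finally show "u \<bullet> ?o (cnj (p j i)) (- q j i) w = u \<bullet> ?o (- p i j) (- q i j) w" by (simp add: pq that om)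
      qed
      then show "cnj (p j i) = - p i j" "q j i = q i j" by auto
    qed
    define X where "X = mat (2 * m) (2 * m) (\<lambda>(i, j). if i < m then (if j < m then p i j else q i (j - m))
      else (if j < m then - cnj (q (i - m) j) else cnj (p (i - m) (j - m))))"
    have X: "X $$ (i, j) = p i j" "X $$ (i, j + m) = q i j" "X $$ (i + m, j) = - cnj (q i j)"
      "X $$ (i + m, j + m) = cnj (p i j)" if "i < m" "j < m" for i j
      unfolding X_def using that by auto
    have "cnj (X $$ (b, a)) = - X $$ (a, b)" if ab: "a < 2 * m" "b < 2 * m" for a b
    proof -
      define a' b' where "a' = (if a < m then a else a - m)" and "b' = (if b < m then b else b - m)"
      have l: "a' < m" "b' < m" using ab unfolding a'_def b'_def by auto
      have "cnj (cnj (p b' a')) = - cnj (p a' b')" unfolding h(1)[OF l] by simp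
      moreover have "a = a' \<or> a = a' + m" "b = b' \<or> b = b' + m" unfolding a'_def b'_def by auto
      ultimately show ?thesis using X[OF l] X[OF l(2,1)] h[OF l] by auto
    qed
    moreover have "X \<in> carrier_mat (2 * m) (2 * m)" unfolding X_def by simp
    moreover have "quaternionic_shape m X" unfolding quaternionic_shape_def by (simp add: X)
    ultimately have "X \<in> lcarrier (sp_lie m)" unfolding sp_lie_iff by blast
    then show "\<exists>X\<in>lcarrier (sp_lie m). \<forall>i<m. \<forall>j<m. \<forall>w. ?o (X $$ (i, j)) (X $$ (i, j + m)) w = N i j w"
      by (intro bexI[of _ X]) (simp_all add: X pq)
  qed
qed

end

section \<open>The identifications as block operators\<close>

definition matrix_op :: "nat \<Rightarrow> (nat \<Rightarrow> nat \<Rightarrow> 'w \<Rightarrow> 'w) \<Rightarrow> (nat \<Rightarrow> 'w) \<Rightarrow> nat \<Rightarrow> 'w::comm_monoid_add" where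
  "matrix_op m M x = (\<lambda>i. if i < m then \<Sum>j<m. M i j (x j) else 0)"

lemma matrix_op_in_tensor_space: "matrix_op m M x \<in> tensor_space m UNIV"
  unfolding matrix_op_def tensor_space_def by simp

lemma so_op_eq: "A \<in> carrier_mat m m \<Longrightarrow> so_op A = matrix_op m (\<lambda>i j w. (A $$ (i, j)) *\<^sub>R w)"
  unfolding so_op_def mat_tensor_def matrix_op_def by (auto simp: fun_eq_iff)

lemma u_op_eq:
  "Z \<in> carrier_mat m m \<Longrightarrow>
    u_op J Z = matrix_op m (\<lambda>i j w. Re (Z $$ (i, j)) *\<^sub>R w + Im (Z $$ (i, j)) *\<^sub>R J w)"
  unfolding u_op_def mat_tensor_def matrix_op_def by (auto simp: fun_eq_iff sum.distrib)

lemma sp_op_eq: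
  "sp_op I J K m X = matrix_op m (\<lambda>i j. quat_op I J K (X $$ (i, j)) (X $$ (i, j + m)))"
  unfolding sp_op_def mat_tensor_def matrix_op_def quat_op_def Let_def
  by (auto simp: fun_eq_iff sum.distrib)

lemma transport_single:
  assumes F: "frame r \<tau> \<rho> (\<lambda>v. v) m f"
    and \<phi>: "\<And>x. x \<in> tensor_space m UNIV \<Longrightarrow> \<phi> x = (\<Sum>i<m. f i (x i))"
    and inj: "inj_on \<phi> (tensor_space m UNIV)"
  shows "transport \<phi> (tensor_space m UNIV) (matrix_op m M) = block_op m f M"
proof
  fix v
  have "\<phi> (coordinates m f v) = v"
    using frameD(4)[OF F, of v] by (simp add: \<phi> coordinates_in_tensor_space) (simp add: coordinates_def)
  then have "inv_into (tensor_space m UNIV) \<phi> v = coordinates m f v"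
    using inv_into_f_eq[OF inj coordinates_in_tensor_space] by blast
  then show "transport \<phi> (tensor_space m UNIV) (matrix_op m M) v = block_op m f M v"
    unfolding transport_def by (simp add: \<phi> matrix_op_in_tensor_space)
      (simp add: matrix_op_def block_op_def coordinates_def)
qed

lemma transport_double:
  assumes F: "frame r \<tau> \<rho> C m f" and G: "frame r \<sigma> \<rho> C' n g" and id: "\<And>v. C v + C' v = v"
    and \<phi>: "\<And>x y. x \<in> tensor_space m UNIV \<Longrightarrow> y \<in> tensor_space n UNIV \<Longrightarrow>
      \<phi> (x, y) = (\<Sum>i<m. f i (x i)) + (\<Sum>i<n. g i (y i))"
    and inj: "inj_on \<phi> (tensor_space m UNIV \<times> tensor_space n UNIV)"
  shows "transport \<phi> (tensor_space m UNIV \<times> tensor_space n UNIV) (map_prod (matrix_op m M) (matrix_op n N)) =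
    (\<lambda>v. block_op m f M v + block_op n g N v)"
proof
  fix v
  have "\<phi> (coordinates m f v, coordinates n g v) = v"
    using frameD(4)[OF F, of v] frameD(4)[OF G, of v] id[of v]
    by (simp add: \<phi> coordinates_in_tensor_space) (simp add: coordinates_def)
  then have "inv_into (tensor_space m UNIV \<times> tensor_space n UNIV) \<phi> v = (coordinates m f v, coordinates n g v)"
    using inv_into_f_eq[OF inj, of "(coordinates m f v, coordinates n g v)" v]
    by (simp add: coordinates_in_tensor_space)
  then show "transport \<phi> (tensor_space m UNIV \<times> tensor_space n UNIV) (map_prod (matrix_op m M) (matrix_op n N)) v =
      block_op m f M v + block_op n g N v"
    unfolding transport_def by (simp add: \<phi> matrix_op_in_tensor_space)
      (simp add: matrix_op_def block_op_def coordinates_def)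
qed

section \<open>Complex spinors\<close>

lemma of_real_smult: "complex_of_real t *s x = t *\<^sub>R x"
  by (simp add: Finite_Cartesian_Product.vec_eq_iff) (simp add: scaleR_conv_of_real)

lemma smult_simps:
  "z *s (x + y) = z *s x + z *s (y :: complex^'s)" "z *s (x - y) = z *s x - z *s y" "z *s (- x) = - (z *s x)"
  "(a + z) *s x = a *s x + z *s x" "z *s (t *\<^sub>R x) = t *\<^sub>R (z *s x)" "a *s (z *s x) = (a * z) *s x"
  "z *s (\<Sum>i\<in>A. f i) = (\<Sum>i\<in>A. z *s f i)" "(t *\<^sub>R z) *s x = t *\<^sub>R (z *s x)" "(- z) *s x = - (z *s x)"
proof -
  show "z *s (\<Sum>i\<in>A. f i) = (\<Sum>i\<in>A. z *s f i)" by (simp add: Finite_Cartesian_Product.vec_eq_iff sum_distrib_left)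
qed (simp_all add: Finite_Cartesian_Product.vec_eq_iff algebra_simps)

lemma complex_smult: "z *s x = Re z *\<^sub>R x + Im z *\<^sub>R (\<i> *s (x :: complex^'s))"
proof -
  have "z = of_real (Re z) + of_real (Im z) * \<i>" by (simp add: complex_eq mult.commute)
  then have "z *s x = (of_real (Re z) + of_real (Im z) * \<i>) *s x" by simp
  also have "\<dots> = of_real (Re z) *s x + of_real (Im z) *s (\<i> *s x)" by (simp only: smult_simps)
  finally show ?thesis unfolding of_real_smult .
qed

lemma vec_subspaceI:
  fixes U :: "(complex^'s) set"
  assumes "subspace U" "\<And>x. x \<in> U \<Longrightarrow> \<i> *s x \<in> U"
  shows "vec.subspace U"
proof (rule vec.subspaceI)
  show "0 \<in> U" by (rule subspace_0[OF assms(1)])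
  show "x + y \<in> U" if "x \<in> U" "y \<in> U" for x y using that by (rule subspace_add[OF assms(1)])
  show "z *s x \<in> U" if "x \<in> U" for z x
    unfolding complex_smult[of z x]
    using that by (intro subspace_add[OF assms(1)] subspace_scale[OF assms(1)] assms(2))
qed

lemma vec_subspaceD:
  fixes U :: "(complex^'s) set"
  assumes "vec.subspace U"
  shows "x \<in> U \<Longrightarrow> z *s x \<in> U" "x \<in> U \<Longrightarrow> y \<in> U \<Longrightarrow> x + y \<in> U" "0 \<in> U" "x \<in> U \<Longrightarrow> t *\<^sub>R x \<in> U" "subspace U"
proof -
  show z: "x \<in> U \<Longrightarrow> z *s x \<in> U" for z x by (rule vec.subspace_scale[OF assms])
  show a: "x \<in> U \<Longrightarrow> y \<in> U \<Longrightarrow> x + y \<in> U" for x y by (rule vec.subspace_add[OF assms])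
  show 0: "0 \<in> U" by (rule vec.subspace_0[OF assms])
  show t: "x \<in> U \<Longrightarrow> t *\<^sub>R x \<in> U" for t x using z[of x "of_real t"] unfolding of_real_smult .
  show "subspace U" by (rule subspaceI) (use 0 a t in auto)
qed

text \<open>An irreducible complex module of the even Clifford algebra: \<open>\<Delta>\<^sub>r\<close> for odd \<open>r\<close>, a half spinor space for even \<open>r\<close>.\<close>

definition spinor_space ::
  "nat \<Rightarrow> (clifford \<Rightarrow> complex^'s \<Rightarrow> complex^'s) \<Rightarrow> (complex^'s) set \<Rightarrow> bool" where
  "spinor_space r \<kappa> H \<longleftrightarrow> cl0_rep r \<kappa> \<and> vec.subspace H \<and>
     (\<forall>a\<in>Cl0 r. Vector_Spaces.linear (*s) (*s) (\<kappa> a) \<and> \<kappa> a ` H \<subseteq> H) \<and>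
     (\<forall>U. vec.subspace U \<and> U \<subseteq> H \<and> (\<forall>a\<in>Cl0 r. \<kappa> a ` U \<subseteq> U) \<longrightarrow> U = {0} \<or> U = H)"

lemma complex_linear_smult: "Vector_Spaces.linear (*s) (*s) f \<Longrightarrow> f (z *s x) = z *s f (x :: complex^'s)"
  by (rule module_hom.scale[OF Vector_Spaces.linear.axioms(3)])

lemma Cl0_subset_Cl: "Cl0 r \<subseteq> Cl r"
  unfolding Cl0_eq Cl_eq by auto

locale even_spinor =
  fixes r :: nat and \<kappa> :: "clifford \<Rightarrow> complex^'s \<Rightarrow> complex^'s"
  assumes spinor: "complex_spinor_rep r \<kappa>" and even: "even r" and r2: "r \<ge> 2"
begin

lemma rep_Cl: "algebra_rep (Cl r) \<kappa>" and clin: "a \<in> Cl r \<Longrightarrow> Vector_Spaces.linear (*s) (*s) (\<kappa> a)"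
  and one: "\<kappa> 1 x = x"
  and irr: "vec.subspace U \<Longrightarrow> (\<And>a. a \<in> Cl r \<Longrightarrow> \<kappa> a ` U \<subseteq> U) \<Longrightarrow> U = {0} \<or> U = UNIV"
  using spinor even unfolding complex_spinor_rep_def Let_def by auto

sublocale cl0_rep r \<kappa>
  using rep_Cl one Cl0_subset_Cl[of r] unfolding algebra_rep_def
  by unfold_locales (auto simp: algebra_rep_def subset_iff)

definition E where "E = \<kappa> (cl_basis {1})"

lemma basis_in_Cl: "S \<subseteq> {1..r} \<Longrightarrow> cl_basis S \<in> Cl r"
  unfolding Cl_eq using finite_subset[of S "{1..r}"] by (auto simp: cl_coeff_basis split: if_splits)

lemma basis_mult_Cl:
  assumes "S \<subseteq> {1..r}" "T \<subseteq> {1..r}"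
  shows "\<kappa> (cl_basis S) (\<kappa> (cl_basis T) x) = cl_sign S T *\<^sub>R \<kappa> (cl_basis (sym_diff S T)) x"
proof -
  have f: "finite S" "finite T" using assms finite_subset by auto
  have s: "sym_diff S T \<subseteq> {1..r}" using assms by auto
  have "\<kappa> (cl_basis S) (\<kappa> (cl_basis T) x) = \<kappa> (cl_basis S * cl_basis T) x"
    using rep_Cl basis_in_Cl assms unfolding algebra_rep_def by simp
  also have "\<dots> = cl_sign S T *\<^sub>R \<kappa> (cl_basis (sym_diff S T)) x"
    unfolding cl_basis_times[OF f] using rep_Cl basis_in_Cl[OF s] unfolding algebra_rep_def by simp
  finally show ?thesis .
qed

lemma one_subset: "{1} \<subseteq> {1..r}" using r2 by auto

lemma E_square: "E (E x) = - x"
proof -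
  have "cl_sign {1} {1} = - 1" using cl_sign_insert_self[of "{}" 1] by simp
  then show ?thesis using basis_mult_Cl[OF one_subset one_subset, of x] by (simp add: E_def cl_basis_empty one)
qed

lemma E_linear: "linear E" "Vector_Spaces.linear (*s) (*s) E"
  using rep_Cl clin basis_in_Cl[OF one_subset] unfolding algebra_rep_def E_def by auto

lemma basis_E:
  assumes "S \<in> even_sets r"
  shows "\<kappa> (cl_basis S) (E x) = (- 1) ^ card (S \<inter> {1}) *\<^sub>R E (\<kappa> (cl_basis S) x)"
proof -
  have s: "S \<subseteq> {1..r}" "even (card S)" using assms unfolding even_sets_def by auto
  have c: "sym_diff S {1} = sym_diff {1} S" by auto
  have "cl_sign S {1} = (-1) ^ card (S \<inter> {1}) * cl_sign {1} S"
    using s by (intro cl_sign_commute_even even_sets_finite[OF assms]) auto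
  then show ?thesis
    unfolding E_def basis_mult_Cl[OF s(1) one_subset] basis_mult_Cl[OF one_subset s(1)] c by simp
qed

definition \<omega> where "\<omega> x = (- \<i>) ^ (r div 2) *s \<kappa> (vol r) x"

text \<open>The half spinor space \<open>\<Delta>\<^sub>r\<^sup>\<plusminus>\<close> for \<open>e = \<plusminus>1\<close>.\<close>

definition half where "half e = {x. \<omega> x = e *\<^sub>R x}"

definition half_proj where "half_proj e x = (1 / 2) *\<^sub>R (x + e *\<^sub>R \<omega> x)"

lemma vol_clin: "Vector_Spaces.linear (*s) (*s) (\<kappa> (vol r))"
  using clin Cl0_subset_Cl vol_in_Cl0[OF even] by blast

lemma Cl0_clin: "a \<in> Cl0 r \<Longrightarrow> Vector_Spaces.linear (*s) (*s) (\<kappa> a)"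
  using clin Cl0_subset_Cl by blast

lemma omega_linear: "linear \<omega>" "\<omega> (z *s x) = z *s \<omega> x"
proof -
  show z: "\<omega> (z *s x) = z *s \<omega> x" for z x
    unfolding \<omega>_def by (simp add: complex_linear_smult[OF vol_clin] smult_simps mult.commute)
  show "linear \<omega>"
    using z[of "of_real _", unfolded of_real_smult] unfolding \<omega>_def
    by (intro linearI) (auto simp: linear_add[OF rep_linear[OF vol_in_Cl0[OF even]]] smult_simps)
qed

lemma omega_E: "\<omega> (E x) = - E (\<omega> x)"
proof -
  have i: "{1..r} \<inter> {1} = {1}" using r2 by auto
  show ?thesis
    using basis_E[OF full_even_set[OF even], of x, unfolded i vol_eq[symmetric]] unfolding \<omega>_def
    by (simp add: complex_linear_smult[OF E_linear(2)] smult_simps)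
qed

lemma mod_4_cases: "r mod 4 = 0 \<or> r mod 4 = 2"
  using even by presburger

lemma omega_square: "\<omega> (\<omega> x) = x"
proof -
  define k where "k = r div 2"
  have k: "r = 2 * k" unfolding k_def using even by simp
  have "\<omega> (\<omega> x) = ((- \<i>) ^ k * (- \<i>) ^ k) *s \<kappa> (vol r) (\<kappa> (vol r) x)"
    unfolding \<omega>_def k_def by (simp add: complex_linear_smult[OF vol_clin] smult_simps)
  also have "\<kappa> (vol r) (\<kappa> (vol r) x) = cl_sign {1..r} {1..r} *\<^sub>R x"
    unfolding vol_eq by (rule basis_square[OF full_even_set[OF even]])
  also have "(- \<i>) ^ k * (- \<i>) ^ k = of_real ((-1) ^ k)"
    by (simp flip: power_mult_distrib)
  also have "of_real ((-1) ^ k) *s (cl_sign {1..r} {1..r} *\<^sub>R x) = ((-1) ^ k * cl_sign {1..r} {1..r}) *\<^sub>R x"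
    unfolding of_real_smult by simp
  also have "(-1) ^ k * cl_sign {1..r} {1..r} = 1"
  proof (cases "r mod 4 = 0")
    case True
    then have "even k" unfolding k by presburger
    then show ?thesis using cl_sign_vol_0[OF True] by simp
  next
    case False
    then have 2: "r mod 4 = 2" using mod_4_cases by simp
    then have "odd k" unfolding k by presburger
    then show ?thesis using cl_sign_vol_2[OF 2] by simp
  qed
  finally show ?thesis by simp
qed

lemma omega_basis: "S \<in> even_sets r \<Longrightarrow> \<omega> (\<kappa> (cl_basis S) x) = \<kappa> (cl_basis S) (\<omega> x)"
  unfolding \<omega>_def using vol_commutes[OF even]
  by (simp add: complex_linear_smult[OF Cl0_clin[OF cl_basis_in_Cl0]])

lemma omega_intertwines: "intertwines r \<kappa> \<kappa> \<omega>"
proof -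
  interpret P: cl0_rep_pair r \<kappa> \<kappa> by (intro cl0_rep_pair.intro cl0_rep_axioms)
  show ?thesis by (rule P.intertwines_basisI[OF omega_linear(1)]) (rule omega_basis)
qed

lemma half_proj_intertwines: "intertwines r \<kappa> \<kappa> (half_proj e)"
  unfolding half_proj_def
  by (intro intertwines_scale intertwines_add intertwines_id omega_intertwines)

lemma half_proj_in: "e = 1 \<or> e = - 1 \<Longrightarrow> half_proj e x \<in> half e"
  unfolding half_proj_def half_def
  by (auto simp: linear_cmul[OF omega_linear(1)] linear_add[OF omega_linear(1)] linear_diff[OF omega_linear(1)]
      omega_square algebra_simps)

text \<open>The operator \<open>\<omega>\<close> anticommutes with \<open>e\<^sub>1\<close>, so its trace is \<open>0\<close>.\<close>

lemma half_proj_trace: "op_trace (half_proj e) \<noteq> 0"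
proof -
  have z: "op_trace \<omega> = 0"
    by (rule op_trace_anticommute[OF omega_linear(1) E_linear(1), where c = "- 1"])
      (simp_all add: E_square omega_E)
  have "op_trace (half_proj e) = (1 / 2) * (op_trace (\<lambda>x::complex^'s. x) + e * op_trace \<omega>)"
    unfolding half_proj_def by (simp only: op_trace_scaleR op_trace_add)
  then show ?thesis unfolding z by (simp add: op_trace_id)
qed

text \<open>If \<open>U\<close> is an invariant subspace of a half spinor space, then \<open>U + e\<^sub>1 U\<close> is invariant under the
  whole Clifford algebra, hence \<open>0\<close> or everything; and \<open>U\<close> can be recovered from it because \<open>e\<^sub>1\<close>
  exchanges the half spinor spaces.\<close>

lemma half_spinor_space:
  assumes e: "e = 1 \<or> e = - 1"
  shows "spinor_space r \<kappa> (half e)"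
  unfolding spinor_space_def
proof (intro conjI ballI allI impI)
  show "cl0_rep r \<kappa>" by (rule cl0_rep_axioms)
  show "vec.subspace (half e)"
    unfolding half_def
    by (rule vec.subspaceI)
      (auto simp: linear_0[OF omega_linear(1)] linear_add[OF omega_linear(1)] omega_linear(2) smult_simps algebra_simps)
  fix a assume a: "a \<in> Cl0 r"
  show "Vector_Spaces.linear (*s) (*s) (\<kappa> a)" by (rule Cl0_clin[OF a])
  show "\<kappa> a ` half e \<subseteq> half e"
    unfolding half_def using intertwinesD(2)[OF omega_intertwines a] linear_cmul[OF rep_linear[OF a]] by auto
next
  fix U assume U: "vec.subspace U \<and> U \<subseteq> half e \<and> (\<forall>a\<in>Cl0 r. \<kappa> a ` U \<subseteq> U)"
  note D = vec_subspaceD[OF conjunct1[OF U]]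
  have inv: "\<kappa> (cl_basis S) u \<in> U" if "S \<in> even_sets r" "u \<in> U" for S u
    using U cl_basis_in_Cl0[OF that(1)] that(2) by blast
  let ?U = "{u + E u' | u u'. u \<in> U \<and> u' \<in> U}"
  have Uadd: "x + y \<in> ?U" if x: "x \<in> ?U" and y: "y \<in> ?U" for x y
  proof -
    obtain u u' where 1: "x = u + E u'" "u \<in> U" "u' \<in> U" using x by blast
    obtain v v' where 2: "y = v + E v'" "v \<in> U" "v' \<in> U" using y by blast
    have "x + y = (u + v) + E (u' + v')" unfolding 1 2 by (simp add: linear_add[OF E_linear(1)])
    then show ?thesis using 1 2 D(2) by blast
  qed
  have Uscale: "z *s x \<in> ?U" if x: "x \<in> ?U" for z x
  proof -
    obtain u u' where 1: "x = u + E u'" "u \<in> U" "u' \<in> U" using x by blast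
    have "z *s x = z *s u + E (z *s u')" unfolding 1 by (simp add: complex_linear_smult[OF E_linear(2)] smult_simps)
    then show ?thesis using 1 D(1) by blast
  qed
  have Uzero: "0 \<in> ?U"
    using D(3) linear_0[OF E_linear(1)] by (intro CollectI exI[of _ 0]) simp
  have sub: "vec.subspace ?U" using Uadd Uscale Uzero by (intro vec.subspaceI) auto
  have inv_even: "\<kappa> (cl_basis S) x \<in> ?U" if S: "S \<in> even_sets r" and x: "x \<in> ?U" for S x
  proof -
    obtain u u' where 1: "x = u + E u'" "u \<in> U" "u' \<in> U" using x by blast
    have "\<kappa> (cl_basis S) x = \<kappa> (cl_basis S) u + E ((- 1) ^ card (S \<inter> {1}) *\<^sub>R \<kappa> (cl_basis S) u')"
      unfolding 1 by (simp add: linear_add[OF basis_linear[OF S]] basis_E[OF S] linear_cmul[OF E_linear(1)])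
    then show ?thesis using inv[OF S] 1 D(4) by blast
  qed
  have inv_E: "E x \<in> ?U" if x: "x \<in> ?U" for x
  proof -
    obtain u u' where 1: "x = u + E u'" "u \<in> U" "u' \<in> U" using x by blast
    have "E x = (- 1) *\<^sub>R u' + E u" unfolding 1 by (simp add: linear_add[OF E_linear(1)] E_square)
    then show ?thesis using 1 D(4) by blast
  qed
  have inv_basis: "\<kappa> (cl_basis S) x \<in> ?U" if S: "S \<subseteq> {1..r}" and x: "x \<in> ?U" for S x
  proof (cases "even (card S)")
    case True
    then show ?thesis using S x inv_even unfolding even_sets_def by blast
  next
    case False
    have f: "finite S" using S finite_subset by auto
    define T where "T = sym_diff {1} S"
    have T: "T \<in> even_sets r" "T \<subseteq> {1..r}"
      using False S one_subset even_card_sym_diff[OF _ f, of "{1}"] unfolding even_sets_def T_def by auto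
    have s: "sym_diff {1} T = S" unfolding T_def by auto
    have "E (\<kappa> (cl_basis T) x) = cl_sign {1} T *\<^sub>R \<kappa> (cl_basis S) x"
      using basis_mult_Cl[OF one_subset T(2), of x] unfolding s E_def .
    then have "\<kappa> (cl_basis S) x = of_real (cl_sign {1} T) *s E (\<kappa> (cl_basis T) x)"
      unfolding of_real_smult by simp
    then show ?thesis using Uscale[OF inv_E[OF inv_even[OF T(1) x]]] by simp
  qed
  have "\<kappa> a ` ?U \<subseteq> ?U" if a: "a \<in> Cl r" for a
  proof
    fix y assume "y \<in> \<kappa> a ` ?U"
    then obtain x where x: "x \<in> ?U" "y = \<kappa> a x" by blast
    have "(\<Sum>S\<in>F. cl_coeff a S *\<^sub>R cl_basis S) \<in> Cl r \<and> \<kappa> (\<Sum>S\<in>F. cl_coeff a S *\<^sub>R cl_basis S) x \<in> ?U"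
      if "finite F" "F \<subseteq> {S. cl_coeff a S \<noteq> 0}" for F
      using that
    proof (induction F)
      case empty
      have "\<kappa> (0 *\<^sub>R 1) x = 0 *\<^sub>R \<kappa> 1 x" using rep_scale[OF one_in_Cl0] by blast
      then show ?case using Uzero unfolding Cl_def by (simp add: span_zero)
    next
      case (insert S F)
      have S: "S \<subseteq> {1..r}" using insert.prems a unfolding Cl_eq by auto
      have 1: "cl_coeff a S *\<^sub>R cl_basis S \<in> Cl r"
        using basis_in_Cl[OF S] unfolding Cl_def by (rule span_scale)
      have "\<kappa> (cl_coeff a S *\<^sub>R cl_basis S) x = of_real (cl_coeff a S) *s \<kappa> (cl_basis S) x"
        using rep_Cl basis_in_Cl[OF S] unfolding algebra_rep_def of_real_smult by blast
      then have 2: "\<kappa> (cl_coeff a S *\<^sub>R cl_basis S) x \<in> ?U"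
        using Uscale[OF inv_basis[OF S x(1)]] by simp
      have IH: "(\<Sum>S\<in>F. cl_coeff a S *\<^sub>R cl_basis S) \<in> Cl r" "\<kappa> (\<Sum>S\<in>F. cl_coeff a S *\<^sub>R cl_basis S) x \<in> ?U"
        using insert by auto
      have "\<kappa> (cl_coeff a S *\<^sub>R cl_basis S + (\<Sum>S\<in>F. cl_coeff a S *\<^sub>R cl_basis S)) x =
          \<kappa> (cl_coeff a S *\<^sub>R cl_basis S) x + \<kappa> (\<Sum>S\<in>F. cl_coeff a S *\<^sub>R cl_basis S) x"
        using rep_Cl 1 IH(1) unfolding algebra_rep_def by blast
      moreover have "cl_coeff a S *\<^sub>R cl_basis S + (\<Sum>S\<in>F. cl_coeff a S *\<^sub>R cl_basis S) \<in> Cl r"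
        using 1 IH(1) unfolding Cl_def by (rule span_add)
      ultimately show ?case using Uadd[OF 2 IH(2)] insert.hyps by simp
    qed
    from this[OF finite_cl_coeff subset_refl] show "y \<in> ?U"
      unfolding x(2) cl_expansion[of a, symmetric] by blast
  qed
  then have "?U = {0} \<or> ?U = UNIV" by (rule irr[OF sub])
  then show "U = {0} \<or> U = half e"
  proof
    assume z: "?U = {0}"
    have "u = 0" if "u \<in> U" for u
    proof -
      have "u = u + E 0" using linear_0[OF E_linear(1)] by simp
      then have "u \<in> ?U" using that D(3) by blast
      then show ?thesis unfolding z by simp
    qed
    then show ?thesis using D(3) by blast
  next
    assume all: "?U = UNIV"
    have "h \<in> U" if h: "h \<in> half e" for h
    proof -
      have "h \<in> ?U" unfolding all by simp
      then obtain u u' where 1: "h = u + E u'" "u \<in> U" "u' \<in> U" by blast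
      have o: "\<omega> h = e *\<^sub>R h" "\<omega> u = e *\<^sub>R u" "\<omega> u' = e *\<^sub>R u'" using h 1 U unfolding half_def by auto
      have "\<omega> h = e *\<^sub>R u - e *\<^sub>R E u'"
        unfolding 1 by (simp add: linear_add[OF omega_linear(1)] omega_E o linear_cmul[OF E_linear(1)])
      then have "e *\<^sub>R E u' + e *\<^sub>R E u' = 0" unfolding o(1) unfolding 1 by (simp add: algebra_simps eq_neg_iff_add_eq_0)
      then have "(2 * e) *\<^sub>R E u' = 0" by (simp add: scaleR_add_left[symmetric])
      then have "E u' = 0" using e by auto
      then show ?thesis using 1 by simp
    qed
    then show ?thesis using U by blast
  qed
qed

text \<open>If \<open>r = 4 k\<close>, then \<open>\<omega> = (-1)\<^sup>k vol\<close>, so that \<open>vol\<close> acts on \<open>\<Delta>\<^sub>r\<^sup>\<plusminus>\<close> as \<open>\<plusminus>(-1)\<^sup>k\<close>; the module \<open>W\<close> has to match.\<close>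

lemma half_intertwiner_exists:
  fixes \<tau> :: "clifford \<Rightarrow> 'w::euclidean_space \<Rightarrow> 'w"
  assumes W: "irreducible_rep r \<tau>" and e: "e = 1 \<or> e = - 1"
    and vol: "r mod 4 = 0 \<Longrightarrow> \<forall>w. \<tau> (vol r) w = ((-1) ^ (r div 4) * e) *\<^sub>R w"
  obtains g w where "intertwines r \<tau> \<kappa> g" "range g \<subseteq> half e" "g w \<noteq> 0"
proof -
  interpret W: irreducible_rep r \<tau> by (rule W)
  have vol': "(\<forall>w. \<tau> (vol r) w = ((-1) ^ (r div 4) * e) *\<^sub>R w) \<and>
      (\<forall>x. half_proj e (\<kappa> (vol r) x) = ((-1) ^ (r div 4) * e) *\<^sub>R half_proj e x) \<and> (-1) ^ (r div 4) * e \<noteq> 0"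
    if r0: "r mod 4 = 0"
  proof -
    define k where "k = r div 4"
    have k: "r = 4 * k" using r0 unfolding k_def by auto
    define s :: real where "s = (-1) ^ k"
    have s: "s * s = 1" unfolding s_def by (simp flip: power_mult_distrib)
    have "(- \<i>) ^ (r div 2) = ((- \<i>) ^ 2) ^ k" unfolding k by (simp flip: power_mult)
    then have i: "(- \<i>) ^ (r div 2) = of_real s" unfolding s_def by simp
    have o: "\<omega> x = s *\<^sub>R \<kappa> (vol r) x" for x unfolding \<omega>_def i of_real_smult ..
    have v: "\<kappa> (vol r) x = s *\<^sub>R \<omega> x" for x unfolding o by (simp add: s)
    have ee: "e * e = 1" using e by auto
    have "half_proj e (\<omega> x) = e *\<^sub>R half_proj e x" for x
      unfolding half_proj_def by (simp add: omega_square scaleR_add_right ee add.commute)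
    then have "half_proj e (\<kappa> (vol r) x) = (s * e) *\<^sub>R half_proj e x" for x
      unfolding v linear_cmul[OF intertwinesD(1)[OF half_proj_intertwines]] by simp
    moreover have "s * e \<noteq> 0" using e s by auto
    ultimately show ?thesis using vol[OF r0] unfolding s_def k_def by blast
  qed
  have "r > 0" using r2 by simp
  obtain f w where f: "intertwines r \<tau> \<kappa> f" "half_proj e (f w) \<noteq> 0"
    by (rule exists_intertwiner[OF W.orthogonal_rep_axioms cl0_rep_axioms
          intertwinesD(1)[OF half_proj_intertwines] half_proj_trace \<open>r > 0\<close> vol']) blast+
  have "intertwines r \<tau> \<kappa> (\<lambda>w. half_proj e (f w))" by (rule intertwines_comp[OF f(1) half_proj_intertwines])
  moreover have "range (\<lambda>w. half_proj e (f w)) \<subseteq> half e" using half_proj_in[OF e] by blast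
  ultimately show thesis using f(2) that by blast
qed

lemma vol_on_half: "x \<in> half e \<Longrightarrow> e = 1 \<or> e = - 1 \<Longrightarrow> \<kappa> (vol r) x = e *\<^sub>R (\<i> ^ (r div 2) *s x)"
proof -
  assume x: "x \<in> half e" and e: "e = 1 \<or> e = - 1"
  have "\<i> ^ (r div 2) *s \<omega> x = (\<i> * - \<i>) ^ (r div 2) *s \<kappa> (vol r) x"
    unfolding \<omega>_def smult_simps by (simp only: power_mult_distrib)
  then have "\<i> ^ (r div 2) *s \<omega> x = \<kappa> (vol r) x" by simp
  then show ?thesis using x unfolding half_def by (simp add: smult_simps)
qed

end

lemma odd_spinor_space:
  assumes s: "complex_spinor_rep r \<kappa>" and odd: "odd r"
  shows "spinor_space r \<kappa> UNIV"
  using s odd unfolding complex_spinor_rep_def spinor_space_def Let_def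
  by (auto intro!: cl0_rep.intro)

lemma odd_intertwiner_exists:
  fixes \<tau> :: "clifford \<Rightarrow> 'w::euclidean_space \<Rightarrow> 'w" and \<kappa> :: "clifford \<Rightarrow> complex^'s \<Rightarrow> complex^'s"
  assumes W: "irreducible_rep r \<tau>" and s: "spinor_space r \<kappa> H" and odd: "odd r"
  obtains g w where "intertwines r \<tau> \<kappa> g" "g w \<noteq> 0"
proof -
  interpret W: irreducible_rep r \<tau> by (rule W)
  have V: "cl0_rep r \<kappa>" using s unfolding spinor_space_def by blast
  show thesis
  proof (rule exists_intertwiner[OF W.orthogonal_rep_axioms V linear_id[unfolded id_def]])
    show "op_trace (\<lambda>x::complex^'s. x) \<noteq> 0" by (simp add: op_trace_id)
    show "r > 0" using odd by (cases r) auto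
    show "(\<forall>w. \<tau> (vol r) w = 1 *\<^sub>R w) \<and> (\<forall>v. \<kappa> (vol r) v = 1 *\<^sub>R v) \<and> (1::real) \<noteq> 0" if "r mod 4 = 0"
      using that odd by presburger
  qed (use that in blast)
qed

section \<open>Complexification\<close>

context irreducible_rep
begin

context
  fixes \<kappa> :: "clifford \<Rightarrow> complex^'s \<Rightarrow> complex^'s" and H and g :: "'w \<Rightarrow> complex^'s" and w0
  assumes S: "spinor_space r \<kappa> H" and g: "intertwines r \<tau> \<kappa> g" "range g \<subseteq> H" "g w0 \<noteq> 0"
begin

lemma spinor_intertwiner_inj: "inj g"
proof -
  have "cl0_rep r \<kappa>" using S unfolding spinor_space_def by blast
  then show ?thesis using intertwiner_inj[OF g(1,3)] cl0_rep.rep_linear[of r \<kappa>] by blast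
qed

lemma spinor_clin: "a \<in> Cl0 r \<Longrightarrow> \<kappa> a (z *s x) = z *s \<kappa> a x"
  using S unfolding spinor_space_def by (intro complex_linear_smult) blast

text \<open>The sums \<open>g u + \<i> g v\<close> form a nonzero invariant complex subspace.\<close>

lemma spinor_cover:
  assumes x: "x \<in> H" obtains u v where "x = g u + \<i> *s g v"
proof -
  have rep: "cl0_rep r \<kappa>" and H: "vec.subspace H"
    and irr: "\<And>U. vec.subspace U \<Longrightarrow> U \<subseteq> H \<Longrightarrow> (\<And>a. a \<in> Cl0 r \<Longrightarrow> \<kappa> a ` U \<subseteq> U) \<Longrightarrow> U = {0} \<or> U = H"
    using S unfolding spinor_space_def by auto
  interpret K: cl0_rep r \<kappa> by (rule rep)
  note lg = intertwinesD(1)[OF g(1)]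
  let ?U = "{g u + \<i> *s g v | u v. True}"
  have "vec.subspace ?U"
  proof (rule vec_subspaceI)
    show "subspace ?U"
    proof (rule subspaceI)
      show "0 \<in> ?U" using linear_0[OF lg] by (intro CollectI exI[of _ 0]) simp
      fix x y assume "x \<in> ?U" "y \<in> ?U"
      then obtain u v u' v' where "x = g u + \<i> *s g v" "y = g u' + \<i> *s g v'" by blast
      then have "x + y = g (u + u') + \<i> *s g (v + v')" by (simp add: linear_add[OF lg] smult_simps)
      then show "x + y \<in> ?U" by blast
    next
      fix t :: real and x assume "x \<in> ?U"
      then obtain u v where "x = g u + \<i> *s g v" by blast
      then have "t *\<^sub>R x = g (t *\<^sub>R u) + \<i> *s g (t *\<^sub>R v)"
        by (simp add: linear_cmul[OF lg] smult_simps scaleR_add_right)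
      then show "t *\<^sub>R x \<in> ?U" by blast
    qed
    fix x assume "x \<in> ?U"
    then obtain u v where "x = g u + \<i> *s g v" by blast
    then have "\<i> *s x = g (- v) + \<i> *s g u" by (simp add: linear_neg[OF lg] smult_simps)
    then show "\<i> *s x \<in> ?U" by blast
  qed
  moreover have "?U \<subseteq> H"
    using g(2) vec_subspaceD(1,2)[OF H] by (auto simp: image_subset_iff)
  moreover have "\<kappa> a ` ?U \<subseteq> ?U" if a: "a \<in> Cl0 r" for a
  proof
    fix y assume "y \<in> \<kappa> a ` ?U"
    then obtain u v where "y = \<kappa> a (g u + \<i> *s g v)" by blast
    then have "y = g (\<tau> a u) + \<i> *s g (\<tau> a v)"
      by (simp add: linear_add[OF K.rep_linear[OF a]] spinor_clin[OF a] intertwinesD(2)[OF g(1) a])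
    then show "y \<in> ?U" by blast
  qed
  ultimately have "?U = {0} \<or> ?U = H" by (rule irr)
  moreover have "g w0 \<in> ?U" using linear_0[OF lg] by (intro CollectI exI[of _ w0] exI[of _ 0]) simp
  ultimately have "?U = H" using g(3) by blast
  then show thesis using x that by blast
qed

text \<open>
  The \<open>v\<close> with \<open>\<i> g v \<in> g(W)\<close> form an invariant subspace.  If it were all of \<open>W\<close>, then multiplication by \<open>-\<i>\<close> on
  \<open>g(W)\<close> would induce a complex structure \<open>j\<close> in the commutant, which consists of scalars.
\<close>

lemma spinor_real_inj:
  assumes real: "\<And>T w. skew_comm T \<Longrightarrow> T w = 0" and z: "g u + \<i> *s g v = 0"
  shows "u = 0 \<and> v = 0"
proof -
  have rep: "cl0_rep r \<kappa>" using S unfolding spinor_space_def by auto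
  interpret K: cl0_rep r \<kappa> by (rule rep)
  note lg = intertwinesD(1)[OF g(1)]
  note inj = spinor_intertwiner_inj
  let ?N = "{v. \<exists>u. g u + \<i> *s g v = 0}"
  have "?N = {0} \<or> ?N = UNIV"
  proof (rule irreducible)
    show "subspace ?N"
    proof (rule subspaceI)
      show "0 \<in> ?N" using linear_0[OF lg] by (intro CollectI exI[of _ 0]) simp
      fix x y assume "x \<in> ?N" "y \<in> ?N"
      then obtain u u' where "g u + \<i> *s g x = 0" "g u' + \<i> *s g y = 0" by blast
      then have "(g u + \<i> *s g x) + (g u' + \<i> *s g y) = 0" by simp
      then have "g (u + u') + \<i> *s g (x + y) = 0" by (simp add: linear_add[OF lg] smult_simps algebra_simps)
      then show "x + y \<in> ?N" by blast
    next
      fix t :: real and x assume "x \<in> ?N"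
      then obtain u where "g u + \<i> *s g x = 0" by blast
      then have "t *\<^sub>R (g u + \<i> *s g x) = 0" by simp
      then have "g (t *\<^sub>R u) + \<i> *s g (t *\<^sub>R x) = 0"
        by (simp add: linear_cmul[OF lg] smult_simps scaleR_add_right)
      then show "t *\<^sub>R x \<in> ?N" by blast
    qed
    show "\<tau> a ` ?N \<subseteq> ?N" if a: "a \<in> Cl0 r" for a
    proof
      fix y assume "y \<in> \<tau> a ` ?N"
      then obtain x u where x: "y = \<tau> a x" "g u + \<i> *s g x = 0" by blast
      then have "\<kappa> a (g u + \<i> *s g x) = 0" by (simp add: linear_0[OF K.rep_linear[OF a]])
      then have "g (\<tau> a u) + \<i> *s g y = 0" unfolding x(1)
        by (simp add: linear_add[OF K.rep_linear[OF a]] spinor_clin[OF a] intertwinesD(2)[OF g(1) a])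
      then show "y \<in> ?N" by blast
    qed
  qed
  moreover have "?N \<noteq> UNIV"
  proof
    assume all: "?N = UNIV"
    define j where "j v = (SOME u. g u + \<i> *s g v = 0)" for v
    have "\<exists>u. g u + \<i> *s g v = 0" for v using all by blast
    then have "g (j v) + \<i> *s g v = 0" for v unfolding j_def by (rule someI_ex)
    then have j: "g (j v) = - (\<i> *s g v)" for v by (simp add: eq_neg_iff_add_eq_0)
    have "linear j"
      by (rule linearI; rule injD[OF inj])
        (simp_all add: j linear_add[OF lg] linear_cmul[OF lg] smult_simps)
    then have ji: "intertwines r \<tau> \<tau> j"
      unfolding intertwines_def
      by (intro conjI ballI allI injD[OF inj])
        (simp_all add: j intertwinesD(2)[OF g(1)] spinor_clin[symmetric] linear_neg[OF K.rep_linear, symmetric]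
          del: linear_neg)
    have jj: "j (j v) = - v" for v
      by (rule injD[OF inj]) (simp add: j linear_neg[OF lg] smult_simps)
    obtain a T' where T': "skew_comm T'" "\<And>w. j w = a *\<^sub>R w + T' w" using commutant_decompose[OF ji] by blast
    have "j w = a *\<^sub>R w" for w using T' real by simp
    then have "(a * a) *\<^sub>R w = - w" for w :: 'w using jj[of w] by simp
    then have "(a * a + 1) *\<^sub>R w0 = 0" by (simp add: scaleR_add_left)
    moreover have "a * a + 1 \<noteq> 0" by (smt (verit) zero_le_square)
    ultimately have "w0 = 0" by simp
    then show False using g(3) linear_0[OF lg] by simp
  qed
  ultimately have "v = 0" using z by blast
  moreover have "u = 0" using z \<open>v = 0\<close> linear_0[OF lg] injD[OF inj, of u 0] by simp
  ultimately show ?thesis by blast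
qed

text \<open>Either \<open>g - \<i> g I\<close> or, if that vanishes, \<open>g J\<close> is complex linear for the structure \<open>I\<close>.\<close>

lemma spinor_quaternionic_linear:
  assumes Q: "quaternion_comm I J K"
  obtains g' w where "intertwines r \<tau> \<kappa> g'" "range g' \<subseteq> H" "g' w \<noteq> 0" "\<And>w. g' (I w) = \<i> *s g' w"
proof -
  have rep: "cl0_rep r \<kappa>" and H: "vec.subspace H" using S unfolding spinor_space_def by auto
  interpret K: cl0_rep r \<kappa> by (rule rep)
  note q = quaternion_commD[OF Q]
  note lg = intertwinesD(1)[OF g(1)]
  have gI: "intertwines r \<tau> \<kappa> (\<lambda>w. g (I w))" by (rule intertwines_comp[OF skew_commD(1)[OF q(1)] g(1)])
  note lgI = intertwinesD(1)[OF gI]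
  have i: "intertwines r \<tau> \<kappa> (\<lambda>w. \<i> *s g (I w))"
    unfolding intertwines_def
  proof (intro conjI ballI allI)
    show "linear (\<lambda>w. \<i> *s g (I w))"
      by (rule linearI) (simp_all add: linear_add[OF lgI] linear_cmul[OF lgI] smult_simps)
    show "\<i> *s g (I (\<tau> a w)) = \<kappa> a (\<i> *s g (I w))" if "a \<in> Cl0 r" for a w
      by (simp add: spinor_clin[OF that] intertwinesD(2)[OF gI that])
  qed
  have gH: "g w \<in> H" for w using g(2) by blast
  show thesis
  proof (cases "\<forall>w. g w = \<i> *s g (I w)")
    case False
    then obtain w where "g w - \<i> *s g (I w) \<noteq> 0" by auto
    moreover have "range (\<lambda>w. g w - \<i> *s g (I w)) \<subseteq> H"
      using gH vec_subspaceD(1)[OF H gH, of \<i>] subspace_diff[OF vec_subspaceD(5)[OF H]] by blast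
    moreover have "g (I w) - \<i> *s g (I (I w)) = \<i> *s (g w - \<i> *s g (I w))" for w
      by (simp add: q linear_neg[OF lg] smult_simps)
    ultimately show thesis using that[OF K.intertwines_diff[OF g(1) i]] by blast
  next
    case True
    have "g (J (I w)) = \<i> *s g (J w)" for w
    proof -
      have "g (J (I w)) = - g (I (J w))" by (simp add: q linear_neg[OF lg])
      also have "\<dots> = \<i> *s (\<i> *s g (I (J w)))" by (simp add: smult_simps)
      also have "\<dots> = \<i> *s g (J w)" by (simp only: True[rule_format, of "J w", symmetric])
      finally show ?thesis .
    qed
    moreover have "g (J (- J w0)) \<noteq> 0" using g(3) by (simp add: q skew_commD(6)[OF q(2)])
    moreover have "range (\<lambda>w. g (J w)) \<subseteq> H" using gH by blast
    ultimately show thesis using that[OF intertwines_comp[OF skew_commD(1)[OF q(2)] g(1)]] by blast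
  qed
qed

end

end

subsection \<open>Complexified frames\<close>

definition complexify :: "('v \<Rightarrow> nat \<Rightarrow> complex^'s) \<Rightarrow> 'v \<Rightarrow> 'v \<Rightarrow> nat \<Rightarrow> complex^'s" where
  "complexify h u v = (\<lambda>i. h u i + \<i> *s h v i)"

definition pointwise_linear :: "('v::real_vector \<Rightarrow> nat \<Rightarrow> complex^'s) \<Rightarrow> bool" where
  "pointwise_linear h \<longleftrightarrow> (\<forall>i. linear (\<lambda>v. h v i))"

text \<open>\<open>h\<close> factors through the projection \<open>C\<close> and identifies the complexification of its image with \<open>\<complex>\<^sup>s \<otimes> H\<close>.\<close>

definition complex_form ::
  "('v::real_vector \<Rightarrow> 'v) \<Rightarrow> ('v \<Rightarrow> nat \<Rightarrow> complex^'s) \<Rightarrow> nat \<Rightarrow> (complex^'s) set \<Rightarrow> bool" where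
  "complex_form C h s H \<longleftrightarrow> pointwise_linear h \<and> (\<forall>v. h (C v) = h v) \<and>
     (\<forall>u v. complexify h u v \<in> tensor_space s H) \<and>
     (\<forall>x\<in>tensor_space s H. \<exists>u v. complexify h u v = x) \<and>
     (\<forall>u v. complexify h u v = (\<lambda>_. 0) \<longrightarrow> C u = 0 \<and> C v = 0)"

lemma pointwise_linearD:
  assumes "pointwise_linear h"
  shows "h (u + v) i = h u i + h v i" "h (u - v) i = h u i - h v i" "h (t *\<^sub>R v) i = t *\<^sub>R h v i" "h 0 i = 0"
  using assms linear_add[of "\<lambda>v. h v i" u v] linear_diff[of "\<lambda>v. h v i" u v] linear_cmul[of "\<lambda>v. h v i" t v]
    linear_0[of "\<lambda>v. h v i"] unfolding pointwise_linear_def by auto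

lemma complexify_simps:
  assumes "pointwise_linear h"
  shows "complexify h (u + u') (v + v') = (\<lambda>i. complexify h u v i + complexify h u' v' i)"
    "complexify h (u - u') (v - v') = (\<lambda>i. complexify h u v i - complexify h u' v' i)"
    "complexify h (Re z *\<^sub>R u - Im z *\<^sub>R v) (Re z *\<^sub>R v + Im z *\<^sub>R u) = (\<lambda>i. z *s complexify h u v i)"
  unfolding complexify_def complex_smult[of z]
  by (auto simp: fun_eq_iff pointwise_linearD[OF assms] smult_simps algebra_simps)

lemma complex_form_bij_single:
  assumes "complex_form (\<lambda>v. v) h s H"
  shows "bij_betw (\<lambda>(u, v). complexify h u v) UNIV (tensor_space s H)"
proof -
  have lin: "pointwise_linear h" and into: "\<And>u v. complexify h u v \<in> tensor_space s H"
    and onto: "\<And>x. x \<in> tensor_space s H \<Longrightarrow> \<exists>u v. complexify h u v = x"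
    and ker: "\<And>u v. complexify h u v = (\<lambda>_. 0) \<Longrightarrow> u = 0 \<and> v = 0"
    using assms unfolding complex_form_def by blast+
  have "inj (\<lambda>(u, v). complexify h u v)"
  proof (rule injI, clarify)
    fix u v u' v' assume "complexify h u v = complexify h u' v'"
    then have "complexify h (u - u') (v - v') = (\<lambda>_. 0)" unfolding complexify_simps(2)[OF lin] by simp
    then show "u = u' \<and> v = v'" using ker by fastforce
  qed
  moreover have "range (\<lambda>(u, v). complexify h u v) = tensor_space s H"
    using into onto by (auto simp: image_iff) (metis case_prod_conv)
  ultimately show ?thesis unfolding bij_betw_def by simp
qed

text \<open>The complementary projections split the complexification into two summands, on each of which one of
  the two maps is bijective and the other one zero.\<close>

lemma complex_form_bij_double:
  assumes h: "complex_form C h s H" and h': "complex_form C' h' s' H'"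
    and lin: "linear C" "linear C'" and CC: "\<And>v. C (C' v) = 0" "\<And>v. C' (C v) = 0" and id: "\<And>v. C v + C' v = v"
  shows "bij_betw (\<lambda>(u, v). (complexify h u v, complexify h' u v)) UNIV (tensor_space s H \<times> tensor_space s' H')"
proof -
  have l: "pointwise_linear h" and hC: "\<And>v. h (C v) = h v" and into: "\<And>u v. complexify h u v \<in> tensor_space s H"
    and onto: "\<And>x. x \<in> tensor_space s H \<Longrightarrow> \<exists>u v. complexify h u v = x"
    and ker: "\<And>u v. complexify h u v = (\<lambda>_. 0) \<Longrightarrow> C u = 0 \<and> C v = 0"
    using h unfolding complex_form_def by blast+
  have l': "pointwise_linear h'" and hC': "\<And>v. h' (C' v) = h' v" and into': "\<And>u v. complexify h' u v \<in> tensor_space s' H'"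
    and onto': "\<And>x. x \<in> tensor_space s' H' \<Longrightarrow> \<exists>u v. complexify h' u v = x"
    and ker': "\<And>u v. complexify h' u v = (\<lambda>_. 0) \<Longrightarrow> C' u = 0 \<and> C' v = 0"
    using h' unfolding complex_form_def by blast+
  have z: "h (C' v) i = 0" "h' (C v) i = 0" for v i
    using hC[of "C' v"] hC'[of "C v"] CC pointwise_linearD(4)[OF l] pointwise_linearD(4)[OF l'] by metis+
  have inj: "inj (\<lambda>(u, v). (complexify h u v, complexify h' u v))"
  proof (rule injI, clarify)
    fix u v u' v' assume "complexify h u v = complexify h u' v'" "complexify h' u v = complexify h' u' v'"
    then have "complexify h (u - u') (v - v') = (\<lambda>_. 0)" "complexify h' (u - u') (v - v') = (\<lambda>_. 0)"
      unfolding complexify_simps(2)[OF l] complexify_simps(2)[OF l'] by simp_all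
    then have "C (u - u') = 0" "C (v - v') = 0" "C' (u - u') = 0" "C' (v - v') = 0"
      using ker ker' by blast+
    then have "u - u' = 0" "v - v' = 0" using id[of "u - u'"] id[of "v - v'"] by simp_all
    then show "u = u' \<and> v = v'" by simp
  qed
  have "\<exists>u v. complexify h u v = x \<and> complexify h' u v = y" if xy: "x \<in> tensor_space s H" "y \<in> tensor_space s' H'" for x y
  proof -
    obtain u v u' v' where 1: "complexify h u v = x" "complexify h' u' v' = y" using onto[OF xy(1)] onto'[OF xy(2)] by blast
    have "h (C u + C' u') = h u" "h' (C u + C' u') = h' u'" for u u'
      by (auto simp: fun_eq_iff pointwise_linearD[OF l] pointwise_linearD[OF l'] z hC hC')
    then have "complexify h (C u + C' u') (C v + C' v') = x" "complexify h' (C u + C' u') (C v + C' v') = y"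
      using 1 unfolding complexify_def by simp_all
    then show ?thesis by blast
  qed
  then have "range (\<lambda>(u, v). (complexify h u v, complexify h' u v)) = tensor_space s H \<times> tensor_space s' H'"
    using into into' by (auto simp: image_iff) (metis case_prod_conv)
  then show ?thesis using inj unfolding bij_betw_def by simp
qed

lemma complex_form_kernel:
  assumes "complex_form C h s H" "C v = 0" shows "h v i = 0"
proof -
  have "h v = h (C v)" "pointwise_linear h" using assms(1) unfolding complex_form_def by auto
  then show ?thesis using pointwise_linearD(4)[of h i] assms(2) by simp
qed

lemma mat_tensor_complexify:
  "mat_tensor (*s) A id (complexify h u v) = (\<lambda>i. mat_tensor (*s) A id (h u) i + \<i> *s mat_tensor (*s) A id (h v) i)"
  unfolding mat_tensor_def complexify_def
  by (auto simp: fun_eq_iff smult_simps sum.distrib mult.commute)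

lemma lie_iso_inverse:
  assumes "lie_iso L c \<iota>" "X \<in> lcarrier c"
  shows "inv_into (lcarrier L) \<iota> X \<in> lcarrier L" "\<iota> (inv_into (lcarrier L) \<iota> X) = X"
proof -
  have "\<iota> ` lcarrier L = lcarrier c" using assms(1) unfolding lie_iso_def bij_betw_def by blast
  then show "inv_into (lcarrier L) \<iota> X \<in> lcarrier L" "\<iota> (inv_into (lcarrier L) \<iota> X) = X"
    using assms(2) by (auto intro: inv_into_into f_inv_into_f)
qed

text \<open>The action of \<open>\<cc> \<oplus> spin(r)\<close> is real, so it suffices to compare it on \<open>V\<close>.\<close>

lemma complexify_action:
  assumes h: "pointwise_linear h" and iso: "lie_iso L (centralizer r \<rho>) \<iota>"
    and act: "\<And>Z v. Z \<in> lcarrier L \<Longrightarrow> h (\<iota> Z v) = mat_tensor (*s) (\<pi> Z) id (h v)"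
    and spin: "\<And>a v i. a \<in> Cl0 r \<Longrightarrow> h (\<rho> a v) i = \<kappa> a (h v i)"
    and K: "spinor_space r \<kappa> H" and X: "X \<in> lcarrier (centralizer r \<rho>)" and \<xi>: "\<xi> \<in> lcarrier (spin_lie r)"
  shows "complexify h (X u) (X v) i = mat_tensor (*s) (\<pi> (inv_into (lcarrier L) \<iota> X)) id (complexify h u v) i"
    "complexify h (\<rho> \<xi> u) (\<rho> \<xi> v) i = \<kappa> \<xi> (complexify h u v i)"
proof -
  note inv = lie_iso_inverse[OF iso X]
  have a: "\<xi> \<in> Cl0 r" using \<xi> spin_lie_subset_Cl0 by blast
  have cl: "Vector_Spaces.linear (*s) (*s) (\<kappa> \<xi>)" and rep: "cl0_rep r \<kappa>"
    using K a unfolding spinor_space_def by auto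
  have lin: "\<kappa> \<xi> (x + \<i> *s y) = \<kappa> \<xi> x + \<i> *s \<kappa> \<xi> y" for x y
    using linear_add[OF cl0_rep.rep_linear[OF rep a], of x "\<i> *s y"] complex_linear_smult[OF cl, of \<i> y] by simp
  have hX: "h (X w) i = mat_tensor (*s) (\<pi> (inv_into (lcarrier L) \<iota> X)) id (h w) i" for w i
    using act[OF inv(1), of w] unfolding inv(2) by simp
  show "complexify h (X u) (X v) i = mat_tensor (*s) (\<pi> (inv_into (lcarrier L) \<iota> X)) id (complexify h u v) i"
    unfolding mat_tensor_complexify by (simp add: complexify_def hX)
  show "complexify h (\<rho> \<xi> u) (\<rho> \<xi> v) i = \<kappa> \<xi> (complexify h u v i)"
    by (simp add: complexify_def spin[OF a] lin)
qed

lemma crep_iso_single: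
  assumes bij: "bij_betw (\<lambda>(u, v). complexify h u v) UNIV (tensor_space s H)" and h: "pointwise_linear h"
    and iso: "lie_iso L (centralizer r \<rho>) \<iota>"
    and act: "\<And>Z v. Z \<in> lcarrier L \<Longrightarrow> h (\<iota> Z v) = mat_tensor (*s) (\<pi> Z) id (h v)"
    and spin: "\<And>a v i. a \<in> Cl0 r \<Longrightarrow> h (\<rho> a v) i = \<kappa> a (h v i)" and K: "spinor_space r \<kappa> H"
    and S: "S = \<lparr>rspace = H, rscale = (*s), ract = \<kappa>\<rparr>"
  shows "crep_iso (lie_sum (centralizer r \<rho>) (spin_lie r)) (complexified \<rho>)
    (std_tensor s (\<lambda>X. \<pi> (inv_into (lcarrier L) \<iota> X)) S)"
  unfolding crep_iso_def S std_tensor_def complexified_def lie_sum_def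
  using bij
  by (intro exI[of _ "\<lambda>(u, v). complexify h u v"])
    (auto simp: complexify_simps[OF h] complexify_action[OF h iso act spin K] fun_eq_iff)

lemma crep_iso_double:
  assumes bij: "bij_betw (\<lambda>(u, v). (complexify h u v, complexify h' u v)) UNIV (tensor_space s H \<times> tensor_space s' H')"
    and h: "pointwise_linear h" "pointwise_linear h'"
    and iso: "lie_iso L (centralizer r \<rho>) \<iota>"
    and act: "\<And>Z v. Z \<in> lcarrier L \<Longrightarrow> h (\<iota> Z v) = mat_tensor (*s) (\<pi> Z) id (h v)"
      "\<And>Z v. Z \<in> lcarrier L \<Longrightarrow> h' (\<iota> Z v) = mat_tensor (*s) (\<pi>' Z) id (h' v)"
    and spin: "\<And>a v i. a \<in> Cl0 r \<Longrightarrow> h (\<rho> a v) i = \<kappa> a (h v i)"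
      "\<And>a v i. a \<in> Cl0 r \<Longrightarrow> h' (\<rho> a v) i = \<kappa> a (h' v i)"
    and K: "spinor_space r \<kappa> H" "spinor_space r \<kappa> H'"
    and S: "S = \<lparr>rspace = H, rscale = (*s), ract = \<kappa>\<rparr>" "S' = \<lparr>rspace = H', rscale = (*s), ract = \<kappa>\<rparr>"
  shows "crep_iso (lie_sum (centralizer r \<rho>) (spin_lie r)) (complexified \<rho>)
    (crep_sum (std_tensor s (\<lambda>X. \<pi> (inv_into (lcarrier L) \<iota> X)) S)
      (std_tensor s' (\<lambda>X. \<pi>' (inv_into (lcarrier L) \<iota> X)) S'))"
  unfolding crep_iso_def crep_sum_def S std_tensor_def complexified_def lie_sum_def
  using bij
  by (intro exI[of _ "\<lambda>(u, v). (complexify h u v, complexify h' u v)"])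
    (auto simp: complexify_simps[OF h(1)] complexify_simps[OF h(2)] complexify_action[OF h(1) iso act(1) spin(1) K(1)]
      complexify_action[OF h(2) iso act(2) spin(2) K(2)] fun_eq_iff)

subsection \<open>The standard modules\<close>

context irreducible_rep
begin

context
  fixes \<rho> :: "clifford \<Rightarrow> 'v::euclidean_space \<Rightarrow> 'v" and C m f
    and \<kappa> :: "clifford \<Rightarrow> complex^'s \<Rightarrow> complex^'s" and H and g :: "'w \<Rightarrow> complex^'s" and w0
  assumes V: "orthogonal_rep r \<rho>" and F: "frame r \<tau> \<rho> C m f"
    and S: "spinor_space r \<kappa> H" and g: "intertwines r \<tau> \<kappa> g" "range g \<subseteq> H" "g w0 \<noteq> 0"
begin

interpretation V: orthogonal_rep r \<rho> by (rule V)

lemma adj_linear: "i < m \<Longrightarrow> linear (adjoint (f i))"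
  by (rule frame_adjoint_linear[OF F])

lemma adj_act: "i < m \<Longrightarrow> a \<in> Cl0 r \<Longrightarrow> adjoint (f i) (\<rho> a v) = \<tau> a (adjoint (f i) v)"
  using frame_adjoint_intertwines[OF orthogonal_rep_axioms V F] by (intro intertwinesD(2))

lemma linear_g: "linear g" by (rule intertwinesD(1)[OF g(1)])

definition simple_form :: "'v \<Rightarrow> nat \<Rightarrow> complex^'s" where
  "simple_form v i = (if i < m then g (adjoint (f i) v) else 0)"

lemma simple_form_linear: "pointwise_linear simple_form"
  unfolding pointwise_linear_def
proof
  fix i
  show "linear (\<lambda>v. simple_form v i)"
  proof (cases "i < m")
    case True
    show ?thesis unfolding simple_form_def
      using linear_compose[OF adj_linear[OF True] linear_g] True by (simp add: o_def)
  qed (simp add: simple_form_def linear_iff)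
qed

lemma simple_form_spin:
  assumes "a \<in> Cl0 r" shows "simple_form (\<rho> a v) i = \<kappa> a (simple_form v i)"
proof -
  have "cl0_rep r \<kappa>" using S unfolding spinor_space_def by blast
  then show ?thesis
    unfolding simple_form_def using assms
    by (simp add: adj_act intertwinesD(2)[OF g(1)] linear_0[OF cl0_rep.rep_linear])
qed

lemma simple_form_block:
  assumes "A \<in> carrier_mat m m" "\<And>i j w. i < m \<Longrightarrow> j < m \<Longrightarrow> g (M i j w) = A $$ (i, j) *s g w"
  shows "simple_form (block_op m f M v) = mat_tensor (*s) A id (simple_form v)"
proof
  fix i
  show "simple_form (block_op m f M v) i = mat_tensor (*s) A id (simple_form v) i"
  proof (cases "i < m")
    case True
    then show ?thesis
      using assms unfolding mat_tensor_def simple_form_def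
      by (simp add: block_op_coordinate[OF orthogonal_rep_axioms V F] linear_sum[OF linear_g])
  next
    case False
    then show ?thesis using assms(1) unfolding mat_tensor_def simple_form_def by simp
  qed
qed

lemma simple_form_C: "simple_form (C v) = simple_form v"
  unfolding simple_form_def by (auto simp: fun_eq_iff frame_adjoint_C[OF F])

lemma simple_form_into: "complexify simple_form u v \<in> tensor_space m H"
proof -
  have "vec.subspace H" using S unfolding spinor_space_def by blast
  note D = vec_subspaceD[OF this]
  have "g w \<in> H" for w using g(2) by blast
  then show ?thesis
    unfolding tensor_space_def complexify_def simple_form_def by (auto intro!: D)
qed

lemma simple_form_real:
  assumes r8: "r mod 8 \<in> {0, 1, 7}"
  shows "complex_form C simple_form m H"
  unfolding complex_form_def
proof (intro conjI allI ballI impI simple_form_linear simple_form_C simple_form_into)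
  fix x assume x: "x \<in> tensor_space m H"
  define c where "c i = (SOME c. x i = g (fst c) + \<i> *s g (snd c))" for i
  define a b where "a i = fst (c i)" and "b i = snd (c i)" for i
  have ab: "x i = g (a i) + \<i> *s g (b i)" if "i < m" for i
  proof -
    have "x i \<in> H" using x that unfolding tensor_space_def by blast
    then obtain u v where "x i = g u + \<i> *s g v" by (rule spinor_cover[OF S g])
    then have "\<exists>c. x i = g (fst c) + \<i> *s g (snd c)" by (intro exI[of _ "(u, v)"]) simp
    then show ?thesis unfolding a_def b_def c_def by (rule someI_ex)
  qed
  have "complexify simple_form (\<Sum>i<m. f i (a i)) (\<Sum>i<m. f i (b i)) = x"
    using x ab unfolding complexify_def simple_form_def tensor_space_def
    by (auto simp: fun_eq_iff frame_coordinate[OF F])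
  then show "\<exists>u v. complexify simple_form u v = x" by blast
next
  fix u v assume z: "complexify simple_form u v = (\<lambda>_. 0)"
  have "adjoint (f i) u = 0 \<and> adjoint (f i) v = 0" if "i < m" for i
  proof (rule spinor_real_inj[OF S g])
    show "T w = 0" if "skew_comm T" for T w using r8 that by (rule commutant_real)
    show "g (adjoint (f i) u) + \<i> *s g (adjoint (f i) v) = 0"
      using fun_cong[OF z, of i] that unfolding complexify_def simple_form_def by simp
  qed
  then show "C u = 0" "C v = 0" unfolding frameD(4)[OF F] by (simp_all add: linear_0[OF frameD(2)[OF F]])
qed

text \<open>A quaternionic entry \<open>p + q J\<close> mixes \<open>g\<close> and \<open>g J\<close>, so both components are recorded.\<close>

definition double_form :: "('w \<Rightarrow> 'w) \<Rightarrow> 'v \<Rightarrow> nat \<Rightarrow> complex^'s" where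
  "double_form J v i = (if i < m then g (adjoint (f i) v)
     else if i < 2 * m then g (J (adjoint (f (i - m)) v)) else 0)"

context
  fixes I J K :: "'w \<Rightarrow> 'w"
  assumes Q: "quaternion_comm I J K" and gI: "\<And>w. g (I w) = \<i> *s g w"
begin

lemma double_form_linear: "pointwise_linear (double_form J)"
  unfolding pointwise_linear_def
proof
  note J = skew_commD(2)[OF quaternion_commD(2)[OF Q]]
  fix i
  consider "i < m" | "\<not> i < m" "i < 2 * m" | "\<not> i < 2 * m" by linarith
  then show "linear (\<lambda>v. double_form J v i)"
  proof cases
    case 1
    then show ?thesis unfolding double_form_def
      using linear_compose[OF adj_linear[OF 1] linear_g] by (simp add: o_def)
  next
    case 2
    then have "i - m < m" by simp
    then show ?thesis unfolding double_form_def
      using 2 linear_compose[OF linear_compose[OF adj_linear[of "i - m"] J] linear_g] by (simp add: o_def)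
  qed (simp add: double_form_def linear_iff)
qed

lemma double_form_spin:
  assumes "a \<in> Cl0 r" shows "double_form J (\<rho> a v) i = \<kappa> a (double_form J v i)"
proof -
  have "cl0_rep r \<kappa>" using S unfolding spinor_space_def by blast
  then show ?thesis
    unfolding double_form_def using assms
    by (simp add: adj_act intertwinesD(2)[OF g(1)] linear_0[OF cl0_rep.rep_linear]
        intertwinesD(2)[OF skew_commD(1)[OF quaternion_commD(2)[OF Q]]])
qed

lemma g_quat_op: "g (quat_op I J K p q w) = p *s g w + q *s g (J w)"
proof -
  have "g (K w) = \<i> *s g (J w)" using gI[of "J w"] by (simp add: quaternion_commD(7)[OF Q])
  then show ?thesis
    unfolding quat_op_def complex_smult[of p] complex_smult[of q]
    by (simp add: linear_add[OF linear_g] linear_cmul[OF linear_g] gI)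
qed

lemma g_J_quat_op: "g (J (quat_op I J K p q w)) = (- cnj q) *s g w + cnj p *s g (J w)"
proof -
  have "J w = quat_op I J K 0 1 w" for w unfolding quat_op_def by simp
  then have "J (quat_op I J K p q w) = quat_op I J K (- cnj q) (cnj p) w"
    by (simp add: quat_op(4)[OF Q])
  then show ?thesis by (simp add: g_quat_op)
qed

text \<open>Since \<open>J (p + q J) = -\<bar>q + \<bar>p J\<close>, the second component of \<open>(p + q J) w\<close> is given by the lower rows of the
  quaternionic matrix.\<close>

lemma double_form_block:
  assumes X: "X \<in> lcarrier (sp_lie m)"
  shows "double_form J (block_op m f (\<lambda>i j. quat_op I J K (X $$ (i, j)) (X $$ (i, j + m))) v) =
    mat_tensor (*s) X id (double_form J v)"
proof
  note c = sp_lieD(1)[OF X] and J = skew_commD(2)[OF quaternion_commD(2)[OF Q]]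
  let ?b = "block_op m f (\<lambda>i j. quat_op I J K (X $$ (i, j)) (X $$ (i, j + m)))"
  note bc = block_op_coordinate[OF orthogonal_rep_axioms V F]
  fix i
  consider "i < m" | "\<not> i < m" "i < 2 * m" | "\<not> i < 2 * m" by linarith
  then show "double_form J (?b v) i = mat_tensor (*s) X id (double_form J v) i"
  proof cases
    case 1
    then have "mat_tensor (*s) X id (double_form J v) i =
        (\<Sum>j<m. X $$ (i, j) *s g (adjoint (f j) v) + X $$ (i, j + m) *s g (J (adjoint (f j) v)))"
      using c unfolding mat_tensor_def by (simp add: sum_lessThan_double sum.distrib double_form_def)
    then show ?thesis using 1 unfolding double_form_def
      by (simp add: bc linear_sum[OF linear_g] g_quat_op)
  next
    case 2
    define k where "k = i - m"
    have k: "i = k + m" "k < m" using 2 unfolding k_def by auto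
    have "mat_tensor (*s) X id (double_form J v) i =
        (\<Sum>j<m. X $$ (k + m, j) *s g (adjoint (f j) v) + X $$ (k + m, j + m) *s g (J (adjoint (f j) v)))"
      using c k unfolding mat_tensor_def by (simp add: sum_lessThan_double sum.distrib double_form_def)
    also have "\<dots> = (\<Sum>j<m. (- cnj (X $$ (k, j + m))) *s g (adjoint (f j) v) +
        cnj (X $$ (k, j)) *s g (J (adjoint (f j) v)))"
      using k(2) by (intro sum.cong refl) (simp add: sp_lieD(4,5)[OF X])
    finally show ?thesis using k unfolding double_form_def
      by (simp add: bc linear_sum[OF J] linear_sum[OF linear_g] g_J_quat_op)
  next
    case 3
    then show ?thesis using c unfolding mat_tensor_def double_form_def by simp
  qed
qed

lemma g_surj: "x \<in> H \<Longrightarrow> \<exists>w. g w = x"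
proof -
  assume "x \<in> H"
  then obtain u v where "x = g u + \<i> *s g v" by (rule spinor_cover[OF S g])
  then have "g (u + I v) = x" by (simp add: linear_add[OF linear_g] gI)
  then show ?thesis ..
qed

lemma double_form_quaternionic: "complex_form C (double_form J) (2 * m) H"
  unfolding complex_form_def
proof (intro conjI allI ballI impI double_form_linear)
  note q = quaternion_commD[OF Q]
  note lI = skew_commD(4-8)[OF q(1)] and lJ = skew_commD(4-8)[OF q(2)]
  have "vec.subspace H" using S unfolding spinor_space_def by blast
  note D = vec_subspaceD[OF this]
  have gH: "g w \<in> H" for w using g(2) by blast
  have first: "g u + \<i> *s g v = g (u + I v)" for u v by (simp add: linear_add[OF linear_g] gI)
  have second: "g (J u) + \<i> *s g (J v) = g (J (u - I v))" for u v
    by (simp add: lJ q linear_add[OF linear_g] linear_diff[OF linear_g] linear_neg[OF linear_g])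
      (simp add: q(7)[symmetric] gI)
  show "double_form J (C v) = double_form J v" for v
    unfolding double_form_def by (auto simp: fun_eq_iff frame_adjoint_C[OF F])
  show "complexify (double_form J) u v \<in> tensor_space (2 * m) H" for u v
    unfolding tensor_space_def complexify_def double_form_def using gH by (auto intro!: D)
  fix x assume x: "x \<in> tensor_space (2 * m) H"
  define a where "a i = (SOME w. g w = x i)" for i
  have a: "g (a i) = x i" if "i < 2 * m" for i
    unfolding a_def using g_surj[of "x i"] x that unfolding tensor_space_def by (auto intro: someI_ex)
  \<comment> \<open>Solution of \<open>p + I s = a\<^sub>i\<close> and \<open>J (p - I s) = a\<^bsub>i + m\<^esub>\<close>, the equations read off from \<open>first\<close> and \<open>second\<close>.\<close>
  define p where "p i = (1 / 2) *\<^sub>R (a i - J (a (i + m)))" for i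
  define s where "s i = (1 / 2) *\<^sub>R (- I (a i) - I (J (a (i + m))))" for i
  have p: "p i + I (s i) = a i" "p i - I (s i) = - J (a (i + m))" for i
  proof -
    have "I (s i) = (1 / 2) *\<^sub>R (a i + J (a (i + m)))"
      unfolding s_def lI q(4) by (simp add: lI q(4))
    moreover have "p i + (1 / 2) *\<^sub>R (a i + J (a (i + m))) = (1 / 2) *\<^sub>R a i + (1 / 2) *\<^sub>R a i"
      "p i - (1 / 2) *\<^sub>R (a i + J (a (i + m))) = - ((1 / 2) *\<^sub>R J (a (i + m)) + (1 / 2) *\<^sub>R J (a (i + m)))"
      unfolding p_def by (simp_all add: scaleR_add_right scaleR_diff_right)
    ultimately show "p i + I (s i) = a i" "p i - I (s i) = - J (a (i + m))"
      unfolding half_add_half by simp_all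
  qed
  have "complexify (double_form J) (\<Sum>i<m. f i (p i)) (\<Sum>i<m. f i (s i)) = x"
  proof
    fix i
    consider "i < m" | "\<not> i < m" "i < 2 * m" | "\<not> i < 2 * m" by linarith
    then show "complexify (double_form J) (\<Sum>i<m. f i (p i)) (\<Sum>i<m. f i (s i)) i = x i"
    proof cases
      case 1
      then show ?thesis unfolding complexify_def double_form_def
        by (simp add: frame_coordinate[OF F] first p a)
    next
      case 2
      then have "i - m < m" "i - m + m = i" by auto
      then show ?thesis using 2 unfolding complexify_def double_form_def
        by (simp add: frame_coordinate[OF F] second p a lJ q)
    next
      case 3
      then show ?thesis using x unfolding complexify_def double_form_def tensor_space_def by simp
    qed
  qed
  then show "\<exists>u v. complexify (double_form J) u v = x" by blast
next
  note q = quaternion_commD[OF Q]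
  note lI = skew_commD(4-8)[OF q(1)] and lJ = skew_commD(4-8)[OF q(2)]
  fix u v assume z: "complexify (double_form J) u v = (\<lambda>_. 0)"
  have "adjoint (f i) u = 0 \<and> adjoint (f i) v = 0" if i: "i < m" for i
  proof -
    let ?a = "adjoint (f i) u" and ?b = "adjoint (f i) v"
    have "g ?a + \<i> *s g ?b = 0" "g (J ?a) + \<i> *s g (J ?b) = 0"
      using fun_cong[OF z, of i] fun_cong[OF z, of "i + m"] i unfolding complexify_def double_form_def by simp_all
    moreover have "g (J ?a) + \<i> *s g (J ?b) = g (J (?a - I ?b))"
      by (simp add: lJ q linear_add[OF linear_g] linear_diff[OF linear_g] linear_neg[OF linear_g])
        (simp add: q(7)[symmetric] gI)
    moreover have "g ?a + \<i> *s g ?b = g (?a + I ?b)" by (simp add: linear_add[OF linear_g] gI)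
    ultimately have "g (?a + I ?b) = g 0" "g (J (?a - I ?b)) = g 0" by (simp_all add: linear_0[OF linear_g])
    then have 1: "?a + I ?b = 0" and "J (?a - I ?b) = 0"
      using injD[OF spinor_intertwiner_inj[OF S g]] by blast+
    then have "J (J (?a - I ?b)) = 0" by (simp only: lJ)
    then have "- (?a - I ?b) = 0" unfolding q(5) .
    then have 2: "?a = I ?b" by simp
    then have "2 *\<^sub>R ?a = 0" using 1 by (simp add: scaleR_2)
    then have a: "?a = 0" by simp
    then have "I (I ?b) = 0" using 2 lI by simp
    then show ?thesis using a unfolding q(4) by simp
  qed
  then show "C u = 0" "C v = 0" unfolding frameD(4)[OF F] by (simp_all add: linear_0[OF frameD(2)[OF F]])
qed

end

end

end

section \<open>Assembling the decompositions\<close>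

text \<open>The relation \<open>(e\<^sub>1 e\<^sub>2)\<^sup>2 = -1\<close> holds in the algebra and for the action, so \<open>1\<close> acts as the identity.\<close>

lemma orthogonal_repI:
  assumes r: "r \<ge> 2" and rep: "algebra_rep (Cl0 r) \<rho>" and "no_trivial_summands r \<rho>" and skew: "spin_skew r \<rho>"
  shows "orthogonal_rep r \<rho>"
proof -
  have P: "{1, 2} \<in> even_sets r" using r unfolding even_sets_def by auto
  note e = cl_basis_in_Cl0[OF P]
  have "cl_sign {1, 2} {1, 2} = - 1"
    using cl_sign_insert_self[of "{2}" 1] cl_sign_insert_self[of "{}" 2] by simp
  then have s: "cl_basis {1, 2} * cl_basis {1, 2} = (- 1) *\<^sub>R 1"
    using cl_basis_times[of "{1, 2}" "{1, 2}"] by (simp add: cl_basis_empty)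
  have "\<rho> 1 v = v" for v
  proof -
    have "- v = \<rho> (cl_basis {1, 2}) (\<rho> (cl_basis {1, 2}) v)"
      using assms(3) r cl_basis_pair[of 1 2] unfolding no_trivial_summands_def by (metis one_less_numeral_iff order_refl semiring_norm(76))
    also have "\<dots> = \<rho> (cl_basis {1, 2} * cl_basis {1, 2}) v"
      using rep e unfolding algebra_rep_def by simp
    also have "\<dots> = - \<rho> 1 v"
    proof -
      have "\<rho> ((- 1) *\<^sub>R 1) v = (- 1) *\<^sub>R \<rho> 1 v" using rep one_in_Cl0[of r] unfolding algebra_rep_def by blast
      then show ?thesis unfolding s by simp
    qed
    finally show ?thesis by simp
  qed
  then show ?thesis
    by (intro orthogonal_rep.intro cl0_rep.intro orthogonal_rep_axioms.intro rep skew)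
qed

lemma decomposition_exists:
  assumes W: "irreducible_rep r \<tau>" and V: "orthogonal_rep r \<rho>" and r: "r mod 4 \<noteq> 0"
  shows "\<exists>m \<phi>. decomposition r \<tau> \<rho> m \<phi>"
proof -
  interpret V: orthogonal_rep r \<rho> by (rule V)
  have "r > 0" using r by (cases r) auto
  then obtain m f where "frame r \<tau> \<rho> (\<lambda>v. v) m f"
    by (rule frame_exists[OF W V _ V.intertwines_id, of 1]) (use r in auto)
  then show ?thesis using frame_decomposition V.cl0_rep_axioms by blast
qed

lemma decomposition2_exists:
  assumes W: "irreducible_rep r \<tau>" "irreducible_rep r \<sigma>" and V: "orthogonal_rep r \<rho>"
    and r: "r mod 4 = 0" "r > 0" and vol: "\<And>w. \<tau> (vol r) w = w" "\<And>w. \<sigma> (vol r) w = - w"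
  shows "\<exists>m n \<phi>. decomposition2 r \<tau> \<sigma> \<rho> m n \<phi>"
proof -
  interpret V: orthogonal_rep r \<rho> by (rule V)
  note P = V.vol_proj[OF r(1), of 1, simplified] and N = V.vol_proj[OF r(1), of "- 1", simplified]
  obtain m f where F: "frame r \<tau> \<rho> (vol_proj r \<rho> 1) m f"
    by (rule frame_exists[OF W(1) V r(2) P(1,2,4), of 1]) (use vol P(5) in auto)
  obtain n g where G: "frame r \<sigma> \<rho> (vol_proj r \<rho> (- 1)) n g"
    by (rule frame_exists[OF W(2) V r(2) N(1,2,4), of "- 1"]) (use vol N(5) in auto)
  show ?thesis
    using frames_decomposition2[OF F G V.cl0_rep_axioms P(4) P(3) P(6)] by blast
qed

context irreducible_rep
begin

text \<open>On \<open>W\<close>, viewed as a complex vector space through \<open>J\<close>, the map \<open>g\<close> is linear and \<open>g'\<close> is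
  conjugate linear, or the other way round, so \<open>(u, v)\<close> is mapped to \<open>(g (u + c J v), g' (u - c J v))\<close>.\<close>

lemma conjugate_forms_bij:
  fixes \<rho> :: "clifford \<Rightarrow> 'v::euclidean_space \<Rightarrow> 'v" and \<kappa> :: "clifford \<Rightarrow> complex^'s \<Rightarrow> complex^'s"
  assumes V: "orthogonal_rep r \<rho>" and F: "frame r \<tau> \<rho> (\<lambda>v. v) m f" and J: "unit_comm J" and c: "c = 1 \<or> c = (- 1 :: real)"
    and S: "spinor_space r \<kappa> H" "spinor_space r \<kappa> H'"
    and g: "intertwines r \<tau> \<kappa> g" "range g \<subseteq> H" "g w0 \<noteq> 0" "\<And>w. g (J w) = c *\<^sub>R (\<i> *s g w)"
    and g': "intertwines r \<tau> \<kappa> g'" "range g' \<subseteq> H'" "g' w1 \<noteq> 0" "\<And>w. g' (J w) = (- c) *\<^sub>R (\<i> *s g' w)"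
  shows "bij_betw (\<lambda>(u, v). (complexify (simple_form m f g) u v, complexify (simple_form m f g') u v)) UNIV
    (tensor_space m H \<times> tensor_space m H')"
proof -
  note lJ = skew_commD(4-8)[OF unit_commD(1)[OF J]] and JJ = unit_commD(2)[OF J]
  have cc: "c * c = 1" "c *\<^sub>R c *\<^sub>R x = x" for x :: "complex^'s" using c by auto
  note lg = intertwinesD(1)[OF g(1)] and lg' = intertwinesD(1)[OF g'(1)]
  have e: "g u + \<i> *s g v = g (u + c *\<^sub>R J v)" for u v
    by (simp add: linear_add[OF lg] linear_cmul[OF lg] g(4) cc)
  have e': "g' u + \<i> *s g' v = g' (u - c *\<^sub>R J v)" for u v
    by (simp add: linear_diff[OF lg'] linear_cmul[OF lg'] g'(4) cc)
  note inj = spinor_intertwiner_inj[OF S(1) g(1-3)] and inj' = spinor_intertwiner_inj[OF S(2) g'(1-3)]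
  have surj: "\<exists>w. g w = x" if x: "x \<in> H" for x
  proof -
    obtain u v where "x = g u + \<i> *s g v" by (rule spinor_cover[OF S(1) g(1-3) x])
    then show ?thesis unfolding e by blast
  qed
  have surj': "\<exists>w. g' w = x" if x: "x \<in> H'" for x
  proof -
    obtain u v where "x = g' u + \<i> *s g' v" by (rule spinor_cover[OF S(2) g'(1-3) x])
    then show ?thesis unfolding e' by blast
  qed
  let ?h = "simple_form m f g" and ?h' = "simple_form m f g'"
  note l = simple_form_linear[OF V F S(1) g(1-3)] and l' = simple_form_linear[OF V F S(2) g'(1-3)]
  have comp: "complexify ?h u v i = g (adjoint (f i) u + c *\<^sub>R J (adjoint (f i) v))"
    "complexify ?h' u v i = g' (adjoint (f i) u - c *\<^sub>R J (adjoint (f i) v))" if "i < m" for u v i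
    using that unfolding complexify_def
    by (simp_all add: simple_form_def[OF V F S(1) g(1-3)] simple_form_def[OF V F S(2) g'(1-3)] e e')
  have inj2: "inj (\<lambda>(u, v). (complexify ?h u v, complexify ?h' u v))"
  proof (rule injI, clarify)
    fix u v u' v' assume eq: "complexify ?h u v = complexify ?h u' v'" "complexify ?h' u v = complexify ?h' u' v'"
    define a where "a i = adjoint (f i) (u - u')" for i
    define b where "b i = adjoint (f i) (v - v')" for i
    have z: "complexify ?h (u - u') (v - v') = (\<lambda>_. 0)" "complexify ?h' (u - u') (v - v') = (\<lambda>_. 0)"
      using eq unfolding complexify_simps(2)[OF l] complexify_simps(2)[OF l'] by simp_all
    have "a i = 0 \<and> b i = 0" if i: "i < m" for i
    proof -
      have "g (a i + c *\<^sub>R J (b i)) = g 0" "g' (a i - c *\<^sub>R J (b i)) = g' 0"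
        using fun_cong[OF z(1), of i] fun_cong[OF z(2), of i] i
        by (simp_all add: comp a_def b_def linear_0[OF lg] linear_0[OF lg'])
      then have 1: "a i + c *\<^sub>R J (b i) = 0" "a i = c *\<^sub>R J (b i)" using injD[OF inj] injD[OF inj'] by fastforce+
      then have "a i + a i = 0" by metis
      then have "2 *\<^sub>R a i = 0" by (simp add: scaleR_2)
      then have a: "a i = 0" by simp
      then have "c *\<^sub>R J (b i) = 0" using 1(2) by simp
      then have "J (b i) = 0" using c by auto
      then have "J (J (b i)) = 0" using lJ(5) by simp
      then show ?thesis using a by (simp add: JJ)
    qed
    then have "u - u' = 0" "v - v' = 0"
      using frameD(4)[OF F, of "u - u'"] frameD(4)[OF F, of "v - v'"] unfolding a_def b_def
      by (simp_all add: linear_0[OF frameD(2)[OF F]])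
    then show "u = u' \<and> v = v'" by simp
  qed
  have "\<exists>u v. complexify ?h u v = x \<and> complexify ?h' u v = y" if xy: "x \<in> tensor_space m H" "y \<in> tensor_space m H'" for x y
  proof -
    define a b where "a i = (SOME w. g w = x i)" and "b i = (SOME w. g' w = y i)" for i
    have a: "g (a i) = x i" and b: "g' (b i) = y i" if "i < m" for i
      unfolding a_def b_def using surj[of "x i"] surj'[of "y i"] xy that unfolding tensor_space_def
      by (auto intro: someI_ex)
    \<comment> \<open>Solution of \<open>p + c J s = a\<^sub>i\<close> and \<open>p - c J s = b\<^sub>i\<close>.\<close>
    define p where "p i = (1 / 2) *\<^sub>R (a i + b i)" for i
    define s where "s i = (- c / 2) *\<^sub>R J (a i - b i)" for i
    have "c *\<^sub>R J (s i) = (1 / 2) *\<^sub>R (a i - b i)" for i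
      unfolding s_def using cc(1) by (simp add: lJ JJ algebra_simps)
    then have ps: "p i + c *\<^sub>R J (s i) = a i" "p i - c *\<^sub>R J (s i) = b i" for i
      unfolding p_def by (simp_all add: scaleR_add_right scaleR_diff_right half_add_half)
    have "complexify ?h (\<Sum>i<m. f i (p i)) (\<Sum>i<m. f i (s i)) = x \<and>
        complexify ?h' (\<Sum>i<m. f i (p i)) (\<Sum>i<m. f i (s i)) = y"
    proof (intro conjI ext)
      fix i
      show "complexify ?h (\<Sum>i<m. f i (p i)) (\<Sum>i<m. f i (s i)) i = x i"
      proof (cases "i < m")
        case False
        then show ?thesis using xy unfolding complexify_def tensor_space_def
          by (simp add: simple_form_def[OF V F S(1) g(1-3)])
      qed (simp add: comp frame_coordinate[OF F] ps a)
      show "complexify ?h' (\<Sum>i<m. f i (p i)) (\<Sum>i<m. f i (s i)) i = y i"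
      proof (cases "i < m")
        case False
        then show ?thesis using xy unfolding complexify_def tensor_space_def
          by (simp add: simple_form_def[OF V F S(2) g'(1-3)])
      qed (simp add: comp frame_coordinate[OF F] ps b)
    qed
    then show ?thesis by blast
  qed
  moreover have "complexify ?h u v \<in> tensor_space m H" "complexify ?h' u v \<in> tensor_space m H'" for u v
    using simple_form_into[OF V F S(1) g(1-3)] simple_form_into[OF V F S(2) g'(1-3)] by blast+
  ultimately have "range (\<lambda>(u, v). (complexify ?h u v, complexify ?h' u v)) = tensor_space m H \<times> tensor_space m H'"
    by (auto simp: image_iff) (metis case_prod_conv)
  then show ?thesis using inj2 unfolding bij_betw_def by simp
qed

end

lemma spinor_record: "spinor \<kappa> = \<lparr>rspace = UNIV, rscale = (*s), ract = \<kappa>\<rparr>"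
  unfolding spinor_def ..

lemma (in even_spinor) half_spinor_record:
  "half_spinor r \<kappa> 1 = \<lparr>rspace = half 1, rscale = (*s), ract = \<kappa>\<rparr>"
  "half_spinor r \<kappa> (- 1) = \<lparr>rspace = half (- 1), rscale = (*s), ract = \<kappa>\<rparr>"
  unfolding half_spinor_def spinor_def half_def \<omega>_def by (simp_all add: smult_simps)

lemma decomposition_inj: "decomposition r \<tau> \<rho> m \<phi> \<Longrightarrow> inj_on \<phi> (tensor_space m UNIV)"
  unfolding decomposition_def Let_def bij_betw_def by blast

lemma decomposition2_inj:
  "decomposition2 r \<tau> \<sigma> \<rho> m n \<phi> \<Longrightarrow> inj_on \<phi> (tensor_space m UNIV \<times> tensor_space n UNIV)"
  unfolding decomposition2_def Let_def bij_betw_def by blast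

lemma so_lie_carrier: "A \<in> lcarrier (so_lie m) \<Longrightarrow> A \<in> carrier_mat m m"
  unfolding so_lie_def mat_lie_def by simp

lemma u_lie_carrier: "Z \<in> lcarrier (u_lie m) \<Longrightarrow> Z \<in> carrier_mat m m"
  unfolding u_lie_def mat_lie_def by simp

text \<open>Real type: the coordinates are mapped to \<open>\<Delta>\<^sub>r\<close> by a single intertwiner, which commutes with the real
  entries of the matrices.\<close>

lemma complexification_1_7:
  assumes W: "irreducible_rep r \<tau>" and V: "orthogonal_rep r \<rho>" and K: "complex_spinor_rep r \<kappa>"
    and r: "r mod 8 \<in> {1, 7}" and D: "decomposition r \<tau> \<rho> m \<phi>"
  shows "let \<gg> = so_lie m;
            \<cc> = centralizer r \<rho>;
            \<iota> = (\<lambda>A. transport \<phi> (tensor_space m UNIV) (so_op A));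
            \<theta> = inv_into (lcarrier \<gg>) \<iota>
        in lie_iso \<gg> \<cc> \<iota> \<and>
           crep_iso (lie_sum \<cc> (spin_lie r)) (complexified \<rho>)
             (std_tensor m (\<lambda>X. map_mat complex_of_real (\<theta> X)) (spinor \<kappa>))"
proof -
  interpret W: irreducible_rep r \<tau> by (rule W)
  interpret V: orthogonal_rep r \<rho> by (rule V)
  have odd: "odd r" and r8: "r mod 8 \<in> {0, 1, 7}" using r by (auto, presburger+)
  note S = odd_spinor_space[OF K odd]
  obtain g w0 where g: "intertwines r \<tau> \<kappa> g" "range g \<subseteq> UNIV" "g w0 \<noteq> 0"
    using odd_intertwiner_exists[OF W S odd] by blast
  obtain f where F: "frame r \<tau> \<rho> (\<lambda>v. v) m f" and \<phi>: "\<And>x. x \<in> tensor_space m UNIV \<Longrightarrow> \<phi> x = (\<Sum>i<m. f i (x i))"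
    using decomposition_frame[OF D W.cl0_rep_axioms] by blast
  define \<iota> where "\<iota> A = transport \<phi> (tensor_space m UNIV) (so_op A)" for A :: "real mat"
  have \<iota>: "\<iota> A = block_op m f (\<lambda>i j w. (A $$ (i, j)) *\<^sub>R w)" if "A \<in> lcarrier (so_lie m)" for A
    unfolding \<iota>_def so_op_eq[OF so_lie_carrier[OF that]] by (rule transport_single[OF F \<phi> decomposition_inj[OF D]])
  have iso: "lie_iso (so_lie m) (centralizer r \<rho>) \<iota>"
    by (rule lie_iso_single[OF W.orthogonal_rep_axioms V F W.skew_matrix_iso_so[OF r8] \<iota>])
  note form = W.simple_form_real[OF V F S g r8]
  have "crep_iso (lie_sum (centralizer r \<rho>) (spin_lie r)) (complexified \<rho>)
     (std_tensor m (\<lambda>X. map_mat complex_of_real (inv_into (lcarrier (so_lie m)) \<iota> X)) (spinor \<kappa>))"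
  proof (rule crep_iso_single[OF complex_form_bij_single[OF form] W.simple_form_linear[OF V F S g] iso _ _ S
        spinor_record, where \<pi> = "map_mat complex_of_real"])
    fix A v assume A: "A \<in> lcarrier (so_lie m)"
    show "W.simple_form m f g (\<iota> A v) = mat_tensor (*s) (map_mat complex_of_real A) id (W.simple_form m f g v)"
      unfolding \<iota>[OF A] using so_lie_carrier[OF A]
      by (intro W.simple_form_block[OF V F S g]) (simp_all add: of_real_smult linear_cmul[OF intertwinesD(1)[OF g(1)]])
  qed (rule W.simple_form_spin[OF V F S g])
  then show ?thesis unfolding Let_def \<iota>_def[symmetric, abs_def] using iso unfolding \<iota>_def[abs_def] by blast
qed

text \<open>Quaternionic type: \<open>g\<close> is adapted to the given \<open>I\<close>.\<close>

lemma complexification_3_5: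
  assumes W: "irreducible_rep r \<tau>" and V: "orthogonal_rep r \<rho>" and K: "complex_spinor_rep r \<kappa>"
    and r: "r mod 8 \<in> {3, 5}" and D: "decomposition r \<tau> \<rho> m \<phi>" and Q: "quaternionic_structure r \<tau> I J K'"
  shows "let \<gg> = sp_lie m;
            \<cc> = centralizer r \<rho>;
            \<iota> = (\<lambda>X. transport \<phi> (tensor_space m UNIV) (sp_op I J K' m X));
            \<theta> = inv_into (lcarrier \<gg>) \<iota>
        in lie_iso \<gg> \<cc> \<iota> \<and>
           crep_iso (lie_sum \<cc> (spin_lie r)) (complexified \<rho>)
             (std_tensor (2 * m) \<theta> (spinor \<kappa>))"
proof -
  interpret W: irreducible_rep r \<tau> by (rule W)
  interpret V: orthogonal_rep r \<rho> by (rule V)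
  have odd: "odd r" using r by (auto, presburger+)
  have Q: "W.quaternion_comm I J K'" using Q unfolding W.quaternionic_structure_iff .
  note S = odd_spinor_space[OF K odd]
  obtain g0 w1 where g0: "intertwines r \<tau> \<kappa> g0" "range g0 \<subseteq> UNIV" "g0 w1 \<noteq> 0"
    using odd_intertwiner_exists[OF W S odd] by blast
  obtain g w0 where g: "intertwines r \<tau> \<kappa> g" "range g \<subseteq> UNIV" "g w0 \<noteq> 0" and gI: "\<And>w. g (I w) = \<i> *s g w"
    by (rule W.spinor_quaternionic_linear[OF S g0 Q]) blast
  obtain f where F: "frame r \<tau> \<rho> (\<lambda>v. v) m f" and \<phi>: "\<And>x. x \<in> tensor_space m UNIV \<Longrightarrow> \<phi> x = (\<Sum>i<m. f i (x i))"
    using decomposition_frame[OF D W.cl0_rep_axioms] by blast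
  define \<iota> where "\<iota> X = transport \<phi> (tensor_space m UNIV) (sp_op I J K' m X)" for X
  have \<iota>: "\<iota> X = block_op m f (\<lambda>i j. quat_op I J K' (X $$ (i, j)) (X $$ (i, j + m)))" for X
    unfolding \<iota>_def sp_op_eq by (rule transport_single[OF F \<phi> decomposition_inj[OF D]])
  have iso: "lie_iso (sp_lie m) (centralizer r \<rho>) \<iota>"
    by (rule lie_iso_single[OF W.orthogonal_rep_axioms V F W.skew_matrix_iso_sp[OF Q] \<iota>])
  have "crep_iso (lie_sum (centralizer r \<rho>) (spin_lie r)) (complexified \<rho>)
     (std_tensor (2 * m) (\<lambda>X. inv_into (lcarrier (sp_lie m)) \<iota> X) (spinor \<kappa>))"
    by (rule crep_iso_single[OF complex_form_bij_single[OF W.double_form_quaternionic[OF V F S g Q gI]]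
          W.double_form_linear[OF V F S g Q gI] iso _ _ S spinor_record, where \<pi> = "\<lambda>X. X"])
      (simp_all only: \<iota> W.double_form_block[OF V F S g Q gI] W.double_form_spin[OF V F S g Q gI])
  then show ?thesis unfolding Let_def using iso unfolding \<iota>_def[abs_def] by simp
qed

text \<open>Complex type: \<open>J = vol\<close> is carried to \<open>\<plusminus>\<i>\<^bsup>r/2\<^esup>\<close> by the intertwiner to \<open>\<Delta>\<^sub>r\<^sup>\<plusminus>\<close>, where \<open>\<i>\<^bsup>r/2\<^esup>\<close> is \<open>\<i>\<close> for
  \<open>r \<equiv> 2\<close> and \<open>-\<i>\<close> for \<open>r \<equiv> 6\<close>.  Accordingly the entries of a matrix act by themselves or by their conjugates.\<close>

lemma complexification_2_6:
  assumes W: "irreducible_rep r \<tau>" and V: "orthogonal_rep r \<rho>" and K: "complex_spinor_rep r \<kappa>"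
    and r: "r mod 8 \<in> {2, 6}" and D: "decomposition r \<tau> \<rho> m \<phi>"
  defines "\<iota> \<equiv> (\<lambda>Z. transport \<phi> (tensor_space m UNIV) (u_op (\<tau> (vol r)) Z))"
  defines "\<theta> \<equiv> inv_into (lcarrier (u_lie m)) \<iota>"
  shows "lie_iso (u_lie m) (centralizer r \<rho>) \<iota>"
    and "r mod 8 = 2 \<Longrightarrow> crep_iso (lie_sum (centralizer r \<rho>) (spin_lie r)) (complexified \<rho>)
      (crep_sum (std_tensor m \<theta> (half_spinor r \<kappa> 1))
        (std_tensor m (\<lambda>X. map_mat cnj (\<theta> X)) (half_spinor r \<kappa> (- 1))))"
    and "r mod 8 = 6 \<Longrightarrow> crep_iso (lie_sum (centralizer r \<rho>) (spin_lie r)) (complexified \<rho>)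
      (crep_sum (std_tensor m (\<lambda>X. map_mat cnj (\<theta> X)) (half_spinor r \<kappa> 1))
        (std_tensor m \<theta> (half_spinor r \<kappa> (- 1))))"
proof -
  interpret W: irreducible_rep r \<tau> by (rule W)
  interpret V: orthogonal_rep r \<rho> by (rule V)
  have "r mod 8 = 2 \<or> r mod 8 = 6" using r by auto
  then have ev: "even r" "r \<ge> 2" "r mod 4 = 2" by presburger+
  interpret K: even_spinor r \<kappa> by unfold_locales (use K ev in auto)
  let ?J = "\<tau> (vol r)"
  note J = W.commutant_complex(1)[OF r]
  obtain g w0 where g: "intertwines r \<tau> \<kappa> g" "range g \<subseteq> K.half 1" "g w0 \<noteq> 0"
    by (rule K.half_intertwiner_exists[OF W, of 1]) (use ev in auto)
  obtain g' w1 where g': "intertwines r \<tau> \<kappa> g'" "range g' \<subseteq> K.half (- 1)" "g' w1 \<noteq> 0"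
    by (rule K.half_intertwiner_exists[OF W, of "- 1"]) (use ev in auto)
  note S = K.half_spinor_space[of 1, simplified] K.half_spinor_space[of "- 1", simplified]
  obtain f where F: "frame r \<tau> \<rho> (\<lambda>v. v) m f" and \<phi>: "\<And>x. x \<in> tensor_space m UNIV \<Longrightarrow> \<phi> x = (\<Sum>i<m. f i (x i))"
    using decomposition_frame[OF D W.cl0_rep_axioms] by blast
  let ?M = "\<lambda>Z i j w. Re (Z $$ (i, j)) *\<^sub>R w + Im (Z $$ (i, j)) *\<^sub>R ?J w"
  have \<iota>: "\<iota> Z = block_op m f (?M Z)" if "Z \<in> lcarrier (u_lie m)" for Z
    unfolding \<iota>_def u_op_eq[OF u_lie_carrier[OF that]] by (rule transport_single[OF F \<phi> decomposition_inj[OF D]])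
  show iso: "lie_iso (u_lie m) (centralizer r \<rho>) \<iota>"
    by (rule lie_iso_single[OF W.orthogonal_rep_axioms V F W.skew_matrix_iso_u[OF r] \<iota>])
  have gJ: "g (?J w) = \<i> ^ (r div 2) *s g w" "g' (?J w) = - (\<i> ^ (r div 2) *s g' w)" for w
    using K.vol_on_half[of "g w" 1] K.vol_on_half[of "g' w" "- 1"] g(2) g'(2)
      intertwinesD(2)[OF g(1) vol_in_Cl0[OF ev(1)], of w] intertwinesD(2)[OF g'(1) vol_in_Cl0[OF ev(1)], of w]
    by auto
  note lin = intertwinesD(1)[OF g(1)] intertwinesD(1)[OF g'(1)]
  let ?h = "W.simple_form m f g" and ?h' = "W.simple_form m f g'"
  note h = W.simple_form_linear[OF V F S(1) g] W.simple_form_linear[OF V F S(2) g']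
  note spin = W.simple_form_spin[OF V F S(1) g] W.simple_form_spin[OF V F S(2) g']
  have cnj: "cnj z *s x = Re z *\<^sub>R x - Im z *\<^sub>R (\<i> *s x)" for z and x :: "complex^'c"
    unfolding complex_smult[of "cnj z"] by simp
  show "crep_iso (lie_sum (centralizer r \<rho>) (spin_lie r)) (complexified \<rho>)
      (crep_sum (std_tensor m \<theta> (half_spinor r \<kappa> 1))
        (std_tensor m (\<lambda>X. map_mat cnj (\<theta> X)) (half_spinor r \<kappa> (- 1))))" if r: "r mod 8 = 2"
  proof -
    define k where "k = r div 8"
    have "r div 2 = 4 * k + 1" using r unfolding k_def by presburger
    then have "\<i> ^ (r div 2) = \<i>" by (simp add: power_add power_mult)
    then have gi: "g (?J w) = 1 *\<^sub>R (\<i> *s g w)" "g' (?J w) = (- 1) *\<^sub>R (\<i> *s g' w)" for w using gJ by simp_all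
    show ?thesis
      unfolding \<theta>_def
    proof (rule crep_iso_double[OF W.conjugate_forms_bij[OF V F J _ S g gi(1) g' gi(2)] h iso _ _ spin S
          K.half_spinor_record, where \<pi> = "\<lambda>X. X" and \<pi>' = "map_mat cnj"])
      fix Z v assume Z: "Z \<in> lcarrier (u_lie m)"
      show "?h (\<iota> Z v) = mat_tensor (*s) Z id (?h v)"
        unfolding \<iota>[OF Z] using u_lie_carrier[OF Z]
        by (intro W.simple_form_block[OF V F S(1) g])
          (simp_all add: linear_add[OF lin(1)] linear_cmul[OF lin(1)] gi complex_smult[symmetric])
      show "?h' (\<iota> Z v) = mat_tensor (*s) (map_mat cnj Z) id (?h' v)"
        unfolding \<iota>[OF Z] using u_lie_carrier[OF Z]
        by (intro W.simple_form_block[OF V F S(2) g'])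
          (simp_all add: linear_add[OF lin(2)] linear_cmul[OF lin(2)] gi cnj)
    qed simp
  qed
  show "crep_iso (lie_sum (centralizer r \<rho>) (spin_lie r)) (complexified \<rho>)
      (crep_sum (std_tensor m (\<lambda>X. map_mat cnj (\<theta> X)) (half_spinor r \<kappa> 1))
        (std_tensor m \<theta> (half_spinor r \<kappa> (- 1))))" if r: "r mod 8 = 6"
  proof -
    define k where "k = r div 8"
    have "r div 2 = 4 * k + 3" using r unfolding k_def by presburger
    then have "\<i> ^ (r div 2) = - \<i>" by (simp add: power_add power_mult power3_eq_cube)
    then have gi: "g (?J w) = (- 1) *\<^sub>R (\<i> *s g w)" "g' (?J w) = (- (- 1)) *\<^sub>R (\<i> *s g' w)" for w
      using gJ by (simp_all add: smult_simps)
    show ?thesis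
      unfolding \<theta>_def
    proof (rule crep_iso_double[OF W.conjugate_forms_bij[OF V F J _ S g gi(1) g' gi(2)] h iso _ _ spin S
          K.half_spinor_record, where \<pi> = "map_mat cnj" and \<pi>' = "\<lambda>X. X"])
      fix Z v assume Z: "Z \<in> lcarrier (u_lie m)"
      show "?h (\<iota> Z v) = mat_tensor (*s) (map_mat cnj Z) id (?h v)"
        unfolding \<iota>[OF Z] using u_lie_carrier[OF Z]
        by (intro W.simple_form_block[OF V F S(1) g])
          (simp_all add: linear_add[OF lin(1)] linear_cmul[OF lin(1)] gi cnj)
      show "?h' (\<iota> Z v) = mat_tensor (*s) Z id (?h' v)"
        unfolding \<iota>[OF Z] using u_lie_carrier[OF Z]
        by (intro W.simple_form_block[OF V F S(2) g'])
          (simp_all add: linear_add[OF lin(2)] linear_cmul[OF lin(2)] gi complex_smult[symmetric])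
    qed simp
  qed
qed

lemma vol_proj_commutes:
  assumes V: "orthogonal_rep r \<rho>" and r: "r mod 4 = 0" and X: "intertwines r \<rho> \<rho> X"
  shows "vol_proj r \<rho> e (X v) = X (vol_proj r \<rho> e v)"
proof -
  have "even r" using r by presburger
  then show ?thesis unfolding vol_proj_def
    using intertwinesD(2)[OF X vol_in_Cl0, of v] intertwinesD(1)[OF X] by (simp add: linear_add linear_cmul)
qed

text \<open>Real type on each of the two eigenspaces of \<open>vol\<close>; as \<open>(-\<i>)\<^bsup>r/2\<^esup> = 1\<close>, the signs correspond.\<close>

lemma complexification_0:
  assumes W: "irreducible_rep r \<tau>" "irreducible_rep r \<sigma>" and V: "orthogonal_rep r \<rho>" and K: "complex_spinor_rep r \<kappa>"
    and r: "r mod 8 = 0" "r \<ge> 2" and vol: "\<And>w. \<tau> (vol r) w = w" "\<And>w. \<sigma> (vol r) w = - w"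
    and D: "decomposition2 r \<tau> \<sigma> \<rho> m1 m2 \<phi>"
  shows "let \<gg> = lie_sum (so_lie m1) (so_lie m2);
            \<cc> = centralizer r \<rho>;
            \<iota> = (\<lambda>(A, B). transport \<phi> (tensor_space m1 UNIV \<times> tensor_space m2 UNIV)
                   (map_prod (so_op A) (so_op B)));
            \<theta> = inv_into (lcarrier \<gg>) \<iota>
        in lie_iso \<gg> \<cc> \<iota> \<and>
           crep_iso (lie_sum \<cc> (spin_lie r)) (complexified \<rho>)
             (crep_sum
               (std_tensor m1 (\<lambda>X. map_mat complex_of_real (fst (\<theta> X))) (half_spinor r \<kappa> 1))
               (std_tensor m2 (\<lambda>X. map_mat complex_of_real (snd (\<theta> X))) (half_spinor r \<kappa> (-1))))"
proof -
  interpret W: irreducible_rep r \<tau> by (rule W)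
  interpret W': irreducible_rep r \<sigma> by (rule W)
  interpret V: orthogonal_rep r \<rho> by (rule V)
  have r4: "r mod 4 = 0" "even r" "even (r div 4)" and r8: "r mod 8 \<in> {0, 1, 7}" using r by (presburger | simp)+
  interpret K: even_spinor r \<kappa> by unfold_locales (use K r4 r in auto)
  note P = V.vol_proj[OF r4(1), of 1, simplified] and N = V.vol_proj[OF r4(1), of "- 1", simplified]
  obtain f f' where F: "frame r \<tau> \<rho> (vol_proj r \<rho> 1) m1 f" "frame r \<sigma> \<rho> (vol_proj r \<rho> (- 1)) m2 f'"
    and \<phi>: "\<And>x y. x \<in> tensor_space m1 UNIV \<Longrightarrow> y \<in> tensor_space m2 UNIV \<Longrightarrow>
      \<phi> (x, y) = (\<Sum>i<m1. f i (x i)) + (\<Sum>i<m2. f' i (y i))"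
    using decomposition2_frames[OF D W.cl0_rep_axioms W'.cl0_rep_axioms V r4(1) vol] by blast
  obtain g w0 where g: "intertwines r \<tau> \<kappa> g" "range g \<subseteq> K.half 1" "g w0 \<noteq> 0"
    by (rule K.half_intertwiner_exists[OF W(1), of 1]) (use r4 vol in auto)
  obtain g' w1 where g': "intertwines r \<sigma> \<kappa> g'" "range g' \<subseteq> K.half (- 1)" "g' w1 \<noteq> 0"
    by (rule K.half_intertwiner_exists[OF W(2), of "- 1"]) (use r4 vol in auto)
  note S = K.half_spinor_space[of 1, simplified] K.half_spinor_space[of "- 1", simplified]
  define \<iota> where "\<iota> = (\<lambda>(A, B). transport \<phi> (tensor_space m1 UNIV \<times> tensor_space m2 UNIV)
    (map_prod (so_op A) (so_op B)))"
  have \<iota>: "\<iota> (A, B) = (\<lambda>v. block_op m1 f (\<lambda>i j w. (A $$ (i, j)) *\<^sub>R w) v + block_op m2 f' (\<lambda>i j w. (B $$ (i, j)) *\<^sub>R w) v)"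
    if "A \<in> lcarrier (so_lie m1)" "B \<in> lcarrier (so_lie m2)" for A B
    unfolding \<iota>_def prod.case so_op_eq[OF so_lie_carrier[OF that(1)]] so_op_eq[OF so_lie_carrier[OF that(2)]]
    by (rule transport_double[OF F P(6) \<phi> decomposition2_inj[OF D]])
  have iso: "lie_iso (lie_sum (so_lie m1) (so_lie m2)) (centralizer r \<rho>) \<iota>"
    by (rule lie_iso_double[OF W.orthogonal_rep_axioms W'.orthogonal_rep_axioms V F P(1,4,3,6)
          vol_proj_commutes[OF V r4(1)] W.skew_matrix_iso_so[OF r8] W'.skew_matrix_iso_so[OF r8] \<iota>])
  note form = W.simple_form_real[OF V F(1) S(1) g r8]
    W'.simple_form_real[OF V F(2) S(2) g' r8]
  note lin = intertwinesD(1)[OF g(1)] intertwinesD(1)[OF g'(1)]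
  let ?h = "W.simple_form m1 f g" and ?h' = "W'.simple_form m2 f' g'"
  note h = W.simple_form_linear[OF V F(1) S(1) g] W'.simple_form_linear[OF V F(2) S(2) g']
  have cross: "?h (block_op m2 f' M v) i = 0" "?h' (block_op m1 f M' v) i = 0" for M M' v i
    using block_op_absorb(2)[OF W'.orthogonal_rep_axioms V F(2), of M v]
      block_op_absorb(2)[OF W.orthogonal_rep_axioms V F(1), of M' v] P(3) N(3)
    by (metis complex_form_kernel[OF form(1)], metis complex_form_kernel[OF form(2)])
  have "crep_iso (lie_sum (centralizer r \<rho>) (spin_lie r)) (complexified \<rho>)
     (crep_sum
       (std_tensor m1 (\<lambda>X. map_mat complex_of_real (fst (inv_into (lcarrier (lie_sum (so_lie m1) (so_lie m2))) \<iota> X))) (half_spinor r \<kappa> 1))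
       (std_tensor m2 (\<lambda>X. map_mat complex_of_real (snd (inv_into (lcarrier (lie_sum (so_lie m1) (so_lie m2))) \<iota> X))) (half_spinor r \<kappa> (-1))))"
  proof (rule crep_iso_double[OF complex_form_bij_double[OF form intertwinesD(1)[OF P(1)] intertwinesD(1)[OF N(1)]
          P(3) N(3) P(6)] h iso _ _ W.simple_form_spin[OF V F(1) S(1) g] W'.simple_form_spin[OF V F(2) S(2) g'] S
        K.half_spinor_record, where \<pi> = "\<lambda>Z. map_mat complex_of_real (fst Z)" and \<pi>' = "\<lambda>Z. map_mat complex_of_real (snd Z)"])
    fix Z v assume "Z \<in> lcarrier (lie_sum (so_lie m1) (so_lie m2))"
    then obtain A B where Z: "Z = (A, B)" "A \<in> lcarrier (so_lie m1)" "B \<in> lcarrier (so_lie m2)"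
      unfolding lie_sum_def by auto
    have "?h (\<iota> Z v) = ?h (block_op m1 f (\<lambda>i j w. (A $$ (i, j)) *\<^sub>R w) v)"
      unfolding Z(1) \<iota>[OF Z(2,3)] by (auto simp: fun_eq_iff pointwise_linearD[OF h(1)] cross)
    also have "\<dots> = mat_tensor (*s) (map_mat complex_of_real A) id (?h v)"
      using so_lie_carrier[OF Z(2)]
      by (intro W.simple_form_block[OF V F(1) S(1) g]) (simp_all add: of_real_smult linear_cmul[OF lin(1)])
    finally show "?h (\<iota> Z v) = mat_tensor (*s) (map_mat complex_of_real (fst Z)) id (?h v)" by (simp add: Z)
    have "?h' (\<iota> Z v) = ?h' (block_op m2 f' (\<lambda>i j w. (B $$ (i, j)) *\<^sub>R w) v)"
      unfolding Z(1) \<iota>[OF Z(2,3)] by (auto simp: fun_eq_iff pointwise_linearD[OF h(2)] cross)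
    also have "\<dots> = mat_tensor (*s) (map_mat complex_of_real B) id (?h' v)"
      using so_lie_carrier[OF Z(3)]
      by (intro W'.simple_form_block[OF V F(2) S(2) g']) (simp_all add: of_real_smult linear_cmul[OF lin(2)])
    finally show "?h' (\<iota> Z v) = mat_tensor (*s) (map_mat complex_of_real (snd Z)) id (?h' v)" by (simp add: Z)
  qed
  then show ?thesis unfolding Let_def using iso unfolding \<iota>_def by blast
qed

text \<open>Quaternionic type on each of the two eigenspaces of \<open>vol\<close>; as \<open>(-\<i>)\<^bsup>r/2\<^esup> = -1\<close>, the signs are opposite.\<close>

lemma complexification_4:
  assumes W: "irreducible_rep r \<tau>" "irreducible_rep r \<sigma>" and V: "orthogonal_rep r \<rho>" and K: "complex_spinor_rep r \<kappa>"
    and r: "r mod 8 = 4" "r \<ge> 2" and vol: "\<And>w. \<tau> (vol r) w = w" "\<And>w. \<sigma> (vol r) w = - w"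
    and D: "decomposition2 r \<tau> \<sigma> \<rho> m1 m2 \<phi>"
    and Q: "quaternionic_structure r \<tau> I J K0" and Q': "quaternionic_structure r \<sigma> I' J' K0'"
  shows "let \<gg> = lie_sum (sp_lie m1) (sp_lie m2);
            \<cc> = centralizer r \<rho>;
            \<iota> = (\<lambda>(X, Y). transport \<phi> (tensor_space m1 UNIV \<times> tensor_space m2 UNIV)
                   (map_prod (sp_op I J K0 m1 X) (sp_op I' J' K0' m2 Y)));
            \<theta> = inv_into (lcarrier \<gg>) \<iota>
        in lie_iso \<gg> \<cc> \<iota> \<and>
           crep_iso (lie_sum \<cc> (spin_lie r)) (complexified \<rho>)
             (crep_sum
               (std_tensor (2 * m2) (\<lambda>X. snd (\<theta> X)) (half_spinor r \<kappa> 1))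
               (std_tensor (2 * m1) (\<lambda>X. fst (\<theta> X)) (half_spinor r \<kappa> (-1))))"
proof -
  interpret W: irreducible_rep r \<tau> by (rule W)
  interpret W': irreducible_rep r \<sigma> by (rule W)
  interpret V: orthogonal_rep r \<rho> by (rule V)
  have r4: "r mod 4 = 0" "even r" "odd (r div 4)" using r by presburger+
  interpret K: even_spinor r \<kappa> by unfold_locales (use K r4 r in auto)
  have Q: "W.quaternion_comm I J K0" using Q unfolding W.quaternionic_structure_iff .
  have Q': "W'.quaternion_comm I' J' K0'" using Q' unfolding W'.quaternionic_structure_iff .
  note P = V.vol_proj[OF r4(1), of 1, simplified] and N = V.vol_proj[OF r4(1), of "- 1", simplified]
  obtain f f' where F: "frame r \<tau> \<rho> (vol_proj r \<rho> 1) m1 f" "frame r \<sigma> \<rho> (vol_proj r \<rho> (- 1)) m2 f'"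
    and \<phi>: "\<And>x y. x \<in> tensor_space m1 UNIV \<Longrightarrow> y \<in> tensor_space m2 UNIV \<Longrightarrow>
      \<phi> (x, y) = (\<Sum>i<m1. f i (x i)) + (\<Sum>i<m2. f' i (y i))"
    using decomposition2_frames[OF D W.cl0_rep_axioms W'.cl0_rep_axioms V r4(1) vol] by blast
  note S = K.half_spinor_space[of 1, simplified] K.half_spinor_space[of "- 1", simplified]
  obtain g0 u0 where g0: "intertwines r \<tau> \<kappa> g0" "range g0 \<subseteq> K.half (- 1)" "g0 u0 \<noteq> 0"
    by (rule K.half_intertwiner_exists[OF W(1), of "- 1"]) (use r4 vol in auto)
  obtain g0' u1 where g0': "intertwines r \<sigma> \<kappa> g0'" "range g0' \<subseteq> K.half 1" "g0' u1 \<noteq> 0"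
    by (rule K.half_intertwiner_exists[OF W(2), of 1]) (use r4 vol in auto)
  obtain g w0 where g: "intertwines r \<tau> \<kappa> g" "range g \<subseteq> K.half (- 1)" "g w0 \<noteq> 0" and gI: "\<And>w. g (I w) = \<i> *s g w"
    by (rule W.spinor_quaternionic_linear[OF S(2) g0 Q]) blast
  obtain g' w1 where g': "intertwines r \<sigma> \<kappa> g'" "range g' \<subseteq> K.half 1" "g' w1 \<noteq> 0" and gI': "\<And>w. g' (I' w) = \<i> *s g' w"
    by (rule W'.spinor_quaternionic_linear[OF S(1) g0' Q']) blast
  define \<iota> where "\<iota> = (\<lambda>(X, Y). transport \<phi> (tensor_space m1 UNIV \<times> tensor_space m2 UNIV)
    (map_prod (sp_op I J K0 m1 X) (sp_op I' J' K0' m2 Y)))"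
  let ?M = "\<lambda>X i j. quat_op I J K0 (X $$ (i, j)) (X $$ (i, j + m1))"
  let ?M' = "\<lambda>X i j. quat_op I' J' K0' (X $$ (i, j)) (X $$ (i, j + m2))"
  have \<iota>: "\<iota> (X, Y) = (\<lambda>v. block_op m1 f (?M X) v + block_op m2 f' (?M' Y) v)" for X Y
    unfolding \<iota>_def prod.case sp_op_eq by (rule transport_double[OF F P(6) \<phi> decomposition2_inj[OF D]])
  have iso: "lie_iso (lie_sum (sp_lie m1) (sp_lie m2)) (centralizer r \<rho>) \<iota>"
    by (rule lie_iso_double[OF W.orthogonal_rep_axioms W'.orthogonal_rep_axioms V F P(1,4,3,6)
          vol_proj_commutes[OF V r4(1)] W.skew_matrix_iso_sp[OF Q] W'.skew_matrix_iso_sp[OF Q'] \<iota>])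
  note form = W.double_form_quaternionic[OF V F(1) S(2) g Q gI] W'.double_form_quaternionic[OF V F(2) S(1) g' Q' gI']
  let ?h = "W.double_form m1 f g J" and ?h' = "W'.double_form m2 f' g' J'"
  note h = W.double_form_linear[OF V F(1) S(2) g Q gI] W'.double_form_linear[OF V F(2) S(1) g' Q' gI']
  have cross: "?h (block_op m2 f' M v) i = 0" "?h' (block_op m1 f M' v) i = 0" for M M' v i
    using block_op_absorb(2)[OF W'.orthogonal_rep_axioms V F(2), of M v]
      block_op_absorb(2)[OF W.orthogonal_rep_axioms V F(1), of M' v] P(3) N(3)
    by (metis complex_form_kernel[OF form(1)], metis complex_form_kernel[OF form(2)])
  have "crep_iso (lie_sum (centralizer r \<rho>) (spin_lie r)) (complexified \<rho>)
     (crep_sum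
       (std_tensor (2 * m2) (\<lambda>X. snd (inv_into (lcarrier (lie_sum (sp_lie m1) (sp_lie m2))) \<iota> X)) (half_spinor r \<kappa> 1))
       (std_tensor (2 * m1) (\<lambda>X. fst (inv_into (lcarrier (lie_sum (sp_lie m1) (sp_lie m2))) \<iota> X)) (half_spinor r \<kappa> (-1))))"
  proof (rule crep_iso_double[OF complex_form_bij_double[OF form(2,1) intertwinesD(1)[OF N(1)] intertwinesD(1)[OF P(1)]
          N(3) P(3) N(6)] h(2,1) iso _ _ W'.double_form_spin[OF V F(2) S(1) g' Q' gI'] W.double_form_spin[OF V F(1) S(2) g Q gI] S
        K.half_spinor_record, where \<pi> = snd and \<pi>' = fst])
    fix Z v assume "Z \<in> lcarrier (lie_sum (sp_lie m1) (sp_lie m2))"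
    then obtain X Y where Z: "Z = (X, Y)" "X \<in> lcarrier (sp_lie m1)" "Y \<in> lcarrier (sp_lie m2)"
      unfolding lie_sum_def by auto
    have "?h (\<iota> Z v) = ?h (block_op m1 f (?M X) v)"
      unfolding Z(1) \<iota> by (auto simp: fun_eq_iff pointwise_linearD[OF h(1)] cross)
    then show "?h (\<iota> Z v) = mat_tensor (*s) (fst Z) id (?h v)"
      using W.double_form_block[OF V F(1) S(2) g Q gI Z(2)] by (simp add: Z)
    have "?h' (\<iota> Z v) = ?h' (block_op m2 f' (?M' Y) v)"
      unfolding Z(1) \<iota> by (auto simp: fun_eq_iff pointwise_linearD[OF h(2)] cross)
    then show "?h' (\<iota> Z v) = mat_tensor (*s) (snd Z) id (?h' v)"
      using W'.double_form_block[OF V F(2) S(1) g' Q' gI' Z(3)] by (simp add: Z)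
  qed
  then show ?thesis unfolding Let_def using iso unfolding \<iota>_def by blast
qed

theorem theorem3p1:
  fixes r :: nat
    and \<rho> :: "clifford \<Rightarrow> 'v::euclidean_space \<Rightarrow> 'v"
    and \<tau> :: "clifford \<Rightarrow> 'w::euclidean_space \<Rightarrow> 'w"
    and \<tau>p :: "clifford \<Rightarrow> 'p::euclidean_space \<Rightarrow> 'p"
    and \<tau>m :: "clifford \<Rightarrow> 'q::euclidean_space \<Rightarrow> 'q"
    and \<kappa> :: "clifford \<Rightarrow> complex^'s \<Rightarrow> complex^'s"
  assumes "r \<ge> 2"
    and "algebra_rep (Cl0 r) \<rho>" and "no_trivial_summands r \<rho>" and "spin_skew r \<rho>"
    and "complex_spinor_rep r \<kappa>"
    and "r mod 4 \<noteq> 0 \<Longrightarrow> real_spinor_rep r \<tau>"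
    and "r mod 4 = 0 \<Longrightarrow> real_spinor_rep r \<tau>p \<and> (\<forall>w. \<tau>p (vol r) w = w)"
    and "r mod 4 = 0 \<Longrightarrow> real_spinor_rep r \<tau>m \<and> (\<forall>w. \<tau>m (vol r) w = - w)"
  shows
    "(r mod 4 \<noteq> 0 \<longrightarrow> (\<exists>m \<phi>. decomposition r \<tau> \<rho> m \<phi>)) \<and>
     (r mod 4 = 0 \<longrightarrow> (\<exists>m1 m2 \<phi>. decomposition2 r \<tau>p \<tau>m \<rho> m1 m2 \<phi>)) \<and>
     (r mod 8 \<in> {3, 5} \<longrightarrow> (\<exists>I J K. quaternionic_structure r \<tau> I J K)) \<and>
     (r mod 8 = 4 \<longrightarrow> (\<exists>I J K. quaternionic_structure r \<tau>p I J K) \<and>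
        (\<exists>I J K. quaternionic_structure r \<tau>m I J K)) \<and>
     (r mod 8 = 0 \<longrightarrow> (\<forall>m1 m2 \<phi>. decomposition2 r \<tau>p \<tau>m \<rho> m1 m2 \<phi> \<longrightarrow>
       (let \<gg> = lie_sum (so_lie m1) (so_lie m2);
            \<cc> = centralizer r \<rho>;
            \<iota> = (\<lambda>(A, B). transport \<phi> (tensor_space m1 UNIV \<times> tensor_space m2 UNIV)
                   (map_prod (so_op A) (so_op B)));
            \<theta> = inv_into (lcarrier \<gg>) \<iota>
        in lie_iso \<gg> \<cc> \<iota> \<and>
           crep_iso (lie_sum \<cc> (spin_lie r)) (complexified \<rho>)
             (crep_sum
               (std_tensor m1 (\<lambda>X. map_mat complex_of_real (fst (\<theta> X))) (half_spinor r \<kappa> 1))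
               (std_tensor m2 (\<lambda>X. map_mat complex_of_real (snd (\<theta> X))) (half_spinor r \<kappa> (-1))))))) \<and>
     (r mod 8 \<in> {1, 7} \<longrightarrow> (\<forall>m \<phi>. decomposition r \<tau> \<rho> m \<phi> \<longrightarrow>
       (let \<gg> = so_lie m;
            \<cc> = centralizer r \<rho>;
            \<iota> = (\<lambda>A. transport \<phi> (tensor_space m UNIV) (so_op A));
            \<theta> = inv_into (lcarrier \<gg>) \<iota>
        in lie_iso \<gg> \<cc> \<iota> \<and>
           crep_iso (lie_sum \<cc> (spin_lie r)) (complexified \<rho>)
             (std_tensor m (\<lambda>X. map_mat complex_of_real (\<theta> X)) (spinor \<kappa>))))) \<and>
     (r mod 8 = 2 \<longrightarrow> (\<forall>m \<phi>. decomposition r \<tau> \<rho> m \<phi> \<longrightarrow>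
       (let \<gg> = u_lie m;
            \<cc> = centralizer r \<rho>;
            \<iota> = (\<lambda>Z. transport \<phi> (tensor_space m UNIV) (u_op (\<tau> (vol r)) Z));
            \<theta> = inv_into (lcarrier \<gg>) \<iota>
        in lie_iso \<gg> \<cc> \<iota> \<and>
           crep_iso (lie_sum \<cc> (spin_lie r)) (complexified \<rho>)
             (crep_sum
               (std_tensor m \<theta> (half_spinor r \<kappa> 1))
               (std_tensor m (\<lambda>X. map_mat cnj (\<theta> X)) (half_spinor r \<kappa> (-1))))))) \<and>
     (r mod 8 = 6 \<longrightarrow> (\<forall>m \<phi>. decomposition r \<tau> \<rho> m \<phi> \<longrightarrow>
       (let \<gg> = u_lie m;
            \<cc> = centralizer r \<rho>;
            \<iota> = (\<lambda>Z. transport \<phi> (tensor_space m UNIV) (u_op (\<tau> (vol r)) Z));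
            \<theta> = inv_into (lcarrier \<gg>) \<iota>
        in lie_iso \<gg> \<cc> \<iota> \<and>
           crep_iso (lie_sum \<cc> (spin_lie r)) (complexified \<rho>)
             (crep_sum
               (std_tensor m (\<lambda>X. map_mat cnj (\<theta> X)) (half_spinor r \<kappa> 1))
               (std_tensor m \<theta> (half_spinor r \<kappa> (-1))))))) \<and>
     (r mod 8 \<in> {3, 5} \<longrightarrow> (\<forall>m \<phi> I J K.
       decomposition r \<tau> \<rho> m \<phi> \<and> quaternionic_structure r \<tau> I J K \<longrightarrow>
       (let \<gg> = sp_lie m;
            \<cc> = centralizer r \<rho>;
            \<iota> = (\<lambda>X. transport \<phi> (tensor_space m UNIV) (sp_op I J K m X));
            \<theta> = inv_into (lcarrier \<gg>) \<iota>
        in lie_iso \<gg> \<cc> \<iota> \<and>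
           crep_iso (lie_sum \<cc> (spin_lie r)) (complexified \<rho>)
             (std_tensor (2 * m) \<theta> (spinor \<kappa>))))) \<and>
     (r mod 8 = 4 \<longrightarrow> (\<forall>m1 m2 \<phi> I J K I' J' K'.
       decomposition2 r \<tau>p \<tau>m \<rho> m1 m2 \<phi> \<and>
       quaternionic_structure r \<tau>p I J K \<and> quaternionic_structure r \<tau>m I' J' K' \<longrightarrow>
       (let \<gg> = lie_sum (sp_lie m1) (sp_lie m2);
            \<cc> = centralizer r \<rho>;
            \<iota> = (\<lambda>(X, Y). transport \<phi> (tensor_space m1 UNIV \<times> tensor_space m2 UNIV)
                   (map_prod (sp_op I J K m1 X) (sp_op I' J' K' m2 Y)));
            \<theta> = inv_into (lcarrier \<gg>) \<iota>
        in lie_iso \<gg> \<cc> \<iota> \<and>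
           crep_iso (lie_sum \<cc> (spin_lie r)) (complexified \<rho>)
             (crep_sum
               (std_tensor (2 * m2) (\<lambda>X. snd (\<theta> X)) (half_spinor r \<kappa> 1))
               (std_tensor (2 * m1) (\<lambda>X. fst (\<theta> X)) (half_spinor r \<kappa> (-1)))))))"
proof -
  have V: "orthogonal_rep r \<rho>" using assms(1-4) by (rule orthogonal_repI)
  have W: "irreducible_rep r \<tau>" if "r mod 4 \<noteq> 0"
    using assms(6)[OF that] by (rule real_spinor_rep_irreducible)
  have Wp: "irreducible_rep r \<tau>p" "\<And>w. \<tau>p (vol r) w = w"
    and Wm: "irreducible_rep r \<tau>m" "\<And>w. \<tau>m (vol r) w = - w" if "r mod 4 = 0"
    using assms(7)[OF that] assms(8)[OF that] by (auto intro: real_spinor_rep_irreducible)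
  have r0: "r > 0" using assms(1) by simp
  have q: "\<exists>I J K. quaternionic_structure r \<sigma> I J K"
    if "irreducible_rep r \<sigma>" "r mod 8 \<in> {3, 4, 5}" for \<sigma> :: "clifford \<Rightarrow> 'z::euclidean_space \<Rightarrow> 'z"
    using irreducible_rep.commutant_quaternionic[OF that] irreducible_rep.quaternionic_structure_iff[OF that(1)] by metis
  have m0: "r mod 8 = 0 \<Longrightarrow> r mod 4 = 0" "r mod 8 = 4 \<Longrightarrow> r mod 4 = 0" by presburger+
  have m1: "r mod 8 = 1 \<Longrightarrow> r mod 4 \<noteq> 0" "r mod 8 = 7 \<Longrightarrow> r mod 4 \<noteq> 0" "r mod 8 = 2 \<Longrightarrow> r mod 4 \<noteq> 0"
    "r mod 8 = 6 \<Longrightarrow> r mod 4 \<noteq> 0" "r mod 8 = 3 \<Longrightarrow> r mod 4 \<noteq> 0" "r mod 8 = 5 \<Longrightarrow> r mod 4 \<noteq> 0"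
    by presburger+
  then have m1': "r mod 8 \<in> {1, 7} \<Longrightarrow> r mod 4 \<noteq> 0" "r mod 8 \<in> {3, 5} \<Longrightarrow> r mod 4 \<noteq> 0" by blast+
  show ?thesis
    (is "?C1 \<and> ?C2 \<and> ?C3 \<and> ?C4 \<and> ?C5 \<and> ?C6 \<and> ?C7 \<and> ?C8 \<and> ?C9 \<and> ?C10")
  proof (intro conjI)
    show ?C1 using decomposition_exists[OF W V] by blast
    show ?C2
      by (rule impI, rule decomposition2_exists[OF Wp(1) Wm(1) V _ r0 Wp(2) Wm(2)])
    show ?C3 
    proof
      assume r: "r mod 8 \<in> {3, 5}"
      then show "\<exists>I J K. quaternionic_structure r \<tau> I J K" using m1'(2) by (intro q W) auto
    qed
    show ?C4
    proof
      assume r: "r mod 8 = 4"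
      then have "r mod 4 = 0" by (rule m0)
      then show "(\<exists>I J K. quaternionic_structure r \<tau>p I J K) \<and> (\<exists>I J K. quaternionic_structure r \<tau>m I J K)"
        using r by (intro conjI q Wp Wm) auto
    qed
    show ?C5
      by (intro impI allI, rule complexification_0[OF Wp(1)[OF m0(1)] Wm(1)[OF m0(1)] V assms(5) _ assms(1)
            Wp(2)[OF m0(1)] Wm(2)[OF m0(1)]])
    show ?C6
      by (intro impI allI, rule complexification_1_7[OF W[OF m1'(1)] V assms(5)])
    show ?C7
      unfolding Let_def
      by (intro impI allI conjI complexification_2_6(1,2)[OF W[OF m1(3)] V assms(5)]) simp_all
    show ?C8
      unfolding Let_def
      by (intro impI allI conjI complexification_2_6(1,3)[OF W[OF m1(4)] V assms(5)]) simp_all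
    show ?C9
      by (intro impI allI, elim conjE, rule complexification_3_5[OF W[OF m1'(2)] V assms(5)])
    show ?C10
      by (intro impI allI, elim conjE, rule complexification_4[OF Wp(1)[OF m0(2)] Wm(1)[OF m0(2)] V assms(5) _ assms(1)
            Wp(2)[OF m0(2)] Wm(2)[OF m0(2)]])
  qed
qed

end
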